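(* Let $\mathfrak g$ be a simple simply-laced Lie algebra of rank $r$. For all $\boldsymbol\ell\in\mathbb Z_+^r$ and all finitely supported $\mathbf n=(n_{\alpha,i})_{\alpha\in I_r,i\ge1}$ with entries in $\mathbb Z_+$ and $n_{\alpha,i}=0$ for $i>k$, $$M_{\boldsymbol\ell;\mathbf n}(q^{-1})=q^{-\frac1\delta\sum_{\alpha,\beta,i}n_{\alpha,i}\lambda_{\alpha,\beta}-\frac1{2\delta}\left(\sum_\alpha\ell_\alpha\lambda_{\alpha,\alpha}+\mathbf n\cdot(\lambda\otimes A)\mathbf n\right)}\;\langle0,\dots,0|\prod_{i=1}^k\prod_{\alpha=1}^r\widehat Q_{\alpha,i}^{\,n_{\alpha,i}}|\ell_1,\dots,\ell_r\rangle.$$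
   Context: $\mathbb Z_+=\{0,1,2,\dots\}$, $I_r=\{1,\dots,r\}$; $C$ is the Cartan matrix of $\mathfrak g$, $\delta=\det C$, $\lambda=\delta C^{-1}$, $A_{i,j}=\min(i,j)$, $q=t^{-\delta}$ ($t$ an indeterminate). For $a\in\mathbb Z_+$, $b\in\mathbb Z$, $\left[\begin{matrix}a+b\\ a\end{matrix}\right]_q$ is the coefficient of $x^a$ in $\prod_{i=0}^{b}(1-q^ix)^{-1}$ if $b\ge0$, and in $\prod_{i=0}^{-b-1}(1-q^{i+b+1}x)$ if $b<0$. For $K\ge1$, with indices $\alpha\in I_r$, $1\le i\le K$, put $\mathbf p=(I\otimes A)\mathbf n-(C\otimes A)\mathbf m$, $q_{\alpha,0}=\ell_\alpha-p_{\alpha,K}$, $Q(\mathbf m,\mathbf n)=-\frac12\mathbf m\cdot(\mathbf p+(I\otimes A)\mathbf n)$ and $$M^{(K)}_{\boldsymbol\ell;\mathbf n}(q^{-1})=\sum_{\substack{m_{\alpha,i}\in\mathbb Z_+\\ q_{\alpha,0}=0;\ p_{\alpha,i}\ge0}}q^{Q(\mathbf m,\mathbf n)}\prod_{\alpha=1}^r\prod_{i=1}^K\left[\begin{matrix}m_{\alpha,i}+p_{\alpha,i}\\ m_{\alpha,i}\end{matrix}\right]_q;$$ $M_{\boldsymbol\ell;\mathbf n}(q^{-1})$ is its value for $K$ sufficiently large with respect to $\mathbf n$ (where it does not depend on $K$). Quantum $Q$-system: $\widehat Q_{\alpha,0},\widehat Q_{\alpha,1}$ ($\alpha\in I_r$)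 are invertible variables with $\widehat Q_{\alpha,n}\widehat Q_{\beta,m}=t^{\lambda_{\alpha,\beta}(m-n)}\widehat Q_{\beta,m}\widehat Q_{\alpha,n}$ for $m,n\in\{0,1\}$, and $\widehat Q_{\alpha,n}$, $n\in\mathbb Z$, are defined by $t^{\lambda_{\alpha,\alpha}}\widehat Q_{\alpha,n+1}\widehat Q_{\alpha,n-1}=\widehat Q_{\alpha,n}^2-\prod_{\beta\ne\alpha}\widehat Q_{\beta,n}^{-C_{\alpha,\beta}}$; they lie in the quantum torus over $\mathbb Z[t^{\pm1}]$ generated by the $\widehat Q_{\alpha,0}^{\pm1},\widehat Q_{\alpha,1}^{\pm1}$. Let $\mathcal A_+$ be the $\mathbb Z[t^{\pm1}]$-algebra generated by all $\widehat Q_{\alpha,0}^{\pm1}$ and $\widehat Q_{\alpha,m}$, $m\ge1$, viewed inside this quantum torus. Products $\prod_i\prod_\alpha$ are ordered first by increasing $i$, then by increasing $\alpha$, from left to right. Consider the cyclic representation of $\mathcal A_+$ (acting from the right) with cyclic vector $\langle0,\dots,0|$ such that $$\langle0,\dots,0|\widehat Q_{\alpha,0}=t^{-\sum_\beta\lambda_{\alpha,\beta}}\langle0,\dots,0|\qquad(\alpha\in I_r),$$ and with $\mathbb Z[t^{\pm1}]$-basis $\langle p_1,\dots,p_r|$, $\mathbf p\in\mathbb Z_+^r$, determined by the following equations, one for each $(m_1,\dots,m_r)\in\mathbb Z_+^r$, with $\mathbf n=\mathbf n(m_1,\dots,m_r)$ given by $n_{\alpha,i}=\delta_{i,m_\alpha}$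 ($i\ge1$): $$\langle0,\dots,0|\prod_{i\ge1}\prod_{\alpha=1}^r\widehat Q_{\alpha,i}^{\,n_{\alpha,i}}=\sum_{\mathbf p\in\mathbb Z_+^r}t^{-\sum_{\alpha,\beta,i}n_{\alpha,i}\lambda_{\alpha,\beta}-\frac12\left(\sum_\alpha p_\alpha\lambda_{\alpha,\alpha}+\sum_{\alpha,\beta}\min(m_\alpha,m_\beta)\lambda_{\alpha,\beta}\right)}M_{\mathbf p;\mathbf n}(q^{-1})\,\langle p_1,\dots,p_r|.$$ $|\ell_1,\dots,\ell_r\rangle$ denotes the dual basis: $\langle m_1,\dots,m_r|\ell_1,\dots,\ell_r\rangle=\prod_\alpha\delta_{m_\alpha,\ell_\alpha}$. *)

theory Defs
  imports
    "HOL-Analysis.Analysis"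
    "HOL-Algebra.Generated_Rings"
    "HOL-Library.Poly_Mapping"
    "HOL-Computational_Algebra.Formal_Power_Series"
begin

type_synonym 'r sqmat = "int ^ 'r ^ 'r"

text \<open>
  Simple Lie algebras enter only through their Cartan matrix. The Cartan matrices of simple
  simply-laced Lie algebras are exactly the indecomposable symmetric generalized Cartan matrices of
  finite type (positive definite). The finite linear order \<^typ>\<open>'r\<close> plays the role of
  the index set \<open>{1, ..., r}\<close>.
\<close>

definition simply_laced_cartan_matrix :: "'r::finite sqmat \<Rightarrow> bool" where
  "simply_laced_cartan_matrix C \<longleftrightarrow>
     (\<forall>\<alpha>. C $ \<alpha> $ \<alpha> = 2) \<and>
     (\<forall>\<alpha> \<beta>. \<alpha> \<noteq> \<beta> \<longrightarrow> C $ \<alpha> $ \<beta> \<in> {0, -1}) \<and>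
     transpose C = C \<and>
     (\<forall>x :: real ^ 'r. x \<noteq> 0 \<longrightarrow>
        0 < (\<Sum>\<alpha>\<in>UNIV. \<Sum>\<beta>\<in>UNIV. of_int (C $ \<alpha> $ \<beta>) * x $ \<alpha> * x $ \<beta>)) \<and>
     (\<forall>S. S \<noteq> {} \<and> S \<noteq> UNIV \<longrightarrow> (\<exists>\<alpha>\<in>S. \<exists>\<beta>\<in>-S. C $ \<alpha> $ \<beta> \<noteq> 0))"

text \<open>\<open>\<lambda> = det C \<cdot> C\<^sup>-\<^sup>1\<close> is the adjugate of \<open>C\<close>, hence integral; the floor is only the
  coercion from \<^typ>\<open>rat\<close> to \<^typ>\<open>int\<close>.\<close>

definition lam :: "'r::finite sqmat \<Rightarrow> 'r \<Rightarrow> 'r \<Rightarrow> int" where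
  "lam C \<alpha> \<beta> =
     \<lfloor>of_int (det C) * matrix_inv (\<chi> i j. of_int (C $ i $ j) :: rat ^ 'r ^ 'r) $ \<alpha> $ \<beta>\<rfloor>"

text \<open>\<^typ>\<open>int \<Rightarrow>\<^sub>0 int\<close> with its convolution product is \<open>\<int>[t\<^sup>\<plusminus>\<^sup>1]\<close>. Fractional exponents
  of \<open>t\<close> and \<open>q\<close> live in the group ring \<^typ>\<open>rat \<Rightarrow>\<^sub>0 int\<close>, which contains
  \<open>\<int>[t\<^sup>\<plusminus>\<^sup>1]\<close> through the injective ring homomorphism \<open>emb\<close>.\<close>

type_synonym laurent = "int \<Rightarrow>\<^sub>0 int"
type_synonym puiseux = "rat \<Rightarrow>\<^sub>0 int"

definition tpow :: "'e \<Rightarrow> ('e \<Rightarrow>\<^sub>0 int)" where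
  "tpow e = Poly_Mapping.single e 1"

definition emb :: "laurent \<Rightarrow> puiseux" where
  "emb f = (\<Sum>e\<in>Poly_Mapping.keys f. Poly_Mapping.single (of_int e) (Poly_Mapping.lookup f e))"

definition qpow :: "'r::finite sqmat \<Rightarrow> rat \<Rightarrow> puiseux" where
  "qpow C x = tpow (- of_int (det C) * x)"

text \<open>Since \<^typ>\<open>puiseux\<close> is not a field, \<open>inverse\<close> is not available for its power series;
  \<^term>\<open>fps_left_inverse f 1\<close> is the inverse of a series \<open>f\<close> with constant coefficient 1.\<close>

definition qbinom :: "'r::finite sqmat \<Rightarrow> nat \<Rightarrow> int \<Rightarrow> puiseux" where
  "qbinom C a b =
     (if 0 \<le> b
      then fps_nth (fps_left_inverse (\<Prod>i\<in>{0..b}. 1 - fps_const (qpow C (of_int i)) * fps_X) 1) a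
      else fps_nth (\<Prod>i\<in>{0..-b-1}. 1 - fps_const (qpow C (of_int (i + b + 1))) * fps_X) a)"

definition An :: "nat \<Rightarrow> ('r \<Rightarrow> nat \<Rightarrow> nat) \<Rightarrow> 'r \<Rightarrow> nat \<Rightarrow> int" where
  "An K n \<alpha> i = (\<Sum>j=1..K. int (min i j) * int (n \<alpha> j))"

definition pvec ::
  "'r::finite sqmat \<Rightarrow> nat \<Rightarrow> ('r \<Rightarrow> nat \<Rightarrow> nat) \<Rightarrow> ('r \<Rightarrow> nat \<Rightarrow> nat) \<Rightarrow> 'r \<Rightarrow> nat \<Rightarrow> int" where
  "pvec C K m n \<alpha> i = An K n \<alpha> i - (\<Sum>\<beta>\<in>UNIV. C $ \<alpha> $ \<beta> * An K m \<beta> i)"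

definition Qform ::
  "'r::finite sqmat \<Rightarrow> nat \<Rightarrow> ('r \<Rightarrow> nat \<Rightarrow> nat) \<Rightarrow> ('r \<Rightarrow> nat \<Rightarrow> nat) \<Rightarrow> rat" where
  "Qform C K m n =
     - (1/2) * of_int (\<Sum>\<alpha>\<in>UNIV. \<Sum>i=1..K. int (m \<alpha> i) * (pvec C K m n \<alpha> i + An K n \<alpha> i))"

text \<open>The vectors \<open>m\<close> have entries \<open>m \<alpha> i\<close> with \<open>1 \<le> i \<le> K\<close> only; they are encoded as functions
  vanishing at all other \<open>i\<close>. The summation set is finite for every \<open>K \<ge> 1\<close>, because
  \<open>p \<alpha> K = l \<alpha>\<close> prescribes all sums \<open>\<Sum>i. i * m \<alpha> i\<close>.\<close>

definition Mset ::
  "'r::finite sqmat \<Rightarrow> nat \<Rightarrow> ('r \<Rightarrow> nat) \<Rightarrow> ('r \<Rightarrow> nat \<Rightarrow> nat) \<Rightarrow> ('r \<Rightarrow> nat \<Rightarrow> nat) set" where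
  "Mset C K l n =
     {m. (\<forall>\<alpha> i. i \<notin> {1..K} \<longrightarrow> m \<alpha> i = 0) \<and>
         (\<forall>\<alpha>. int (l \<alpha>) - pvec C K m n \<alpha> K = 0) \<and>
         (\<forall>\<alpha>. \<forall>i\<in>{1..K}. pvec C K m n \<alpha> i \<ge> 0)}"

definition MsumK ::
  "'r::finite sqmat \<Rightarrow> nat \<Rightarrow> ('r \<Rightarrow> nat) \<Rightarrow> ('r \<Rightarrow> nat \<Rightarrow> nat) \<Rightarrow> puiseux" where
  "MsumK C K l n =
     (\<Sum>m\<in>Mset C K l n. qpow C (Qform C K m n) *
        (\<Prod>\<alpha>\<in>UNIV. \<Prod>i=1..K. qbinom C (m \<alpha> i) (pvec C K m n \<alpha> i)))"

definition Msum :: "'r::finite sqmat \<Rightarrow> ('r \<Rightarrow> nat) \<Rightarrow> ('r \<Rightarrow> nat \<Rightarrow> nat) \<Rightarrow> puiseux" where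
  "Msum C l n = (THE M. \<forall>\<^sub>F K in sequentially. MsumK C K l n = M)"

text \<open>An element \<open>f\<close> represents the sum of
  \<open>f(a,b) \<Prod>\<^sub>\<alpha> Q\<^bsub>\<alpha>,0\<^esub>\<^bsup>a \<alpha>\<^esup> \<Prod>\<^sub>\<alpha> Q\<^bsub>\<alpha>,1\<^esub>\<^bsup>b \<alpha>\<^esup>\<close> over \<open>(a,b)\<close>. The power of \<open>t\<close> in the product comes from
  moving \<open>\<Prod>\<^sub>\<alpha> Q\<^bsub>\<alpha>,1\<^esub>\<^bsup>b \<alpha>\<^esup>\<close> to the right of \<open>\<Prod>\<^sub>\<alpha> Q\<^bsub>\<alpha>,0\<^esub>\<^bsup>a' \<alpha>\<^esup>\<close> by
  \<open>Q\<^bsub>\<alpha>,1\<^esub> Q\<^bsub>\<beta>,0\<^esub> = t\<^bsup>-\<lambda>(\<alpha>,\<beta>)\<^esup> Q\<^bsub>\<beta>,0\<^esub> Q\<^bsub>\<alpha>,1\<^esub>\<close>; variables with the same second index commute.\<close>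

type_synonym 'r qt = "((int ^ 'r) \<times> (int ^ 'r)) \<Rightarrow>\<^sub>0 laurent"

definition qt_mult :: "'r::finite sqmat \<Rightarrow> 'r qt \<Rightarrow> 'r qt \<Rightarrow> 'r qt" where
  "qt_mult C f g =
     (\<Sum>x\<in>Poly_Mapping.keys f. \<Sum>y\<in>Poly_Mapping.keys g.
        Poly_Mapping.single (x + y)
          (tpow (- (\<Sum>\<alpha>\<in>UNIV. \<Sum>\<beta>\<in>UNIV. snd x $ \<alpha> * lam C \<alpha> \<beta> * fst y $ \<beta>))
           * Poly_Mapping.lookup f x * Poly_Mapping.lookup g y))"

definition qtorus :: "'r::finite sqmat \<Rightarrow> 'r qt ring" where
  "qtorus C = \<lparr>carrier = UNIV, monoid.mult = qt_mult C, one = Poly_Mapping.single 0 1,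
                zero = 0, add = (+)\<rparr>"

definition qt_scalar :: "laurent \<Rightarrow> 'r::finite qt" where
  "qt_scalar c = Poly_Mapping.single 0 c"

definition qgen0 :: "'r::finite \<Rightarrow> 'r qt" where
  "qgen0 \<alpha> = Poly_Mapping.single (axis \<alpha> 1, 0) 1"

definition qgen1 :: "'r::finite \<Rightarrow> 'r qt" where
  "qgen1 \<alpha> = Poly_Mapping.single (0, axis \<alpha> 1) 1"

definition list_product :: "('a, 'b) monoid_scheme \<Rightarrow> 'a list \<Rightarrow> 'a" where
  "list_product G xs = foldr (\<lambda>x y. x \<otimes>\<^bsub>G\<^esub> y) xs \<one>\<^bsub>G\<^esub>"

definition indices :: "'r::{finite,linorder} list" where
  "indices = sorted_list_of_set UNIV"

text \<open>The quantum torus has no zero divisors, so the recursion determines every \<open>Q \<alpha> n\<close>; that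
  it has a solution in the quantum torus is the Laurent property.\<close>

definition quantum_Q_system ::
  "'r sqmat \<Rightarrow> ('r::{finite,linorder} \<Rightarrow> int \<Rightarrow> 'r qt) \<Rightarrow> bool" where
  "quantum_Q_system C Q \<longleftrightarrow>
     (\<forall>\<alpha>. Q \<alpha> 0 = qgen0 \<alpha>) \<and>
     (\<forall>\<alpha>. Q \<alpha> 1 = qgen1 \<alpha>) \<and>
     (\<forall>\<alpha> n. qt_scalar (tpow (lam C \<alpha> \<alpha>)) \<otimes>\<^bsub>qtorus C\<^esub> (Q \<alpha> (n + 1) \<otimes>\<^bsub>qtorus C\<^esub> Q \<alpha> (n - 1)) =
        Q \<alpha> n [^]\<^bsub>qtorus C\<^esub> (2::nat) \<ominus>\<^bsub>qtorus C\<^esub>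
        list_product (qtorus C)
          (map (\<lambda>\<beta>. Q \<beta> n [^]\<^bsub>qtorus C\<^esub> (- (C $ \<alpha> $ \<beta>))) (filter (\<lambda>\<beta>. \<beta> \<noteq> \<alpha>) indices)))"

definition A_plus ::
  "'r sqmat \<Rightarrow> ('r::{finite,linorder} \<Rightarrow> int \<Rightarrow> 'r qt) \<Rightarrow> 'r qt set" where
  "A_plus C Q =
     generate_ring (qtorus C)
       (range qt_scalar \<union> range (\<lambda>\<alpha>. Q \<alpha> 0) \<union> range (\<lambda>\<alpha>. inv\<^bsub>qtorus C\<^esub> (Q \<alpha> 0)) \<union>
        {Q \<alpha> m | \<alpha> m. m \<ge> 1})"

definition Q_product ::
  "'r sqmat \<Rightarrow> ('r::{finite,linorder} \<Rightarrow> int \<Rightarrow> 'r qt) \<Rightarrow> nat \<Rightarrow> ('r \<Rightarrow> nat \<Rightarrow> nat) \<Rightarrow> 'r qt" where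
  "Q_product C Q k n =
     list_product (qtorus C)
       (concat (map (\<lambda>i. map (\<lambda>\<alpha>. Q \<alpha> (int i) [^]\<^bsub>qtorus C\<^esub> n \<alpha> i) indices) [1..<Suc k]))"

definition right_representation ::
  "'r::finite sqmat \<Rightarrow> 'r qt set \<Rightarrow> (laurent \<Rightarrow> 'v \<Rightarrow> 'v::ab_group_add) \<Rightarrow> ('v \<Rightarrow> 'r qt \<Rightarrow> 'v) \<Rightarrow> bool" where
  "right_representation C A sc act \<longleftrightarrow>
     Modules.module sc \<and>
     (\<forall>v w. \<forall>a\<in>A. act (v + w) a = act v a + act w a) \<and>
     (\<forall>v. \<forall>a\<in>A. \<forall>b\<in>A. act v (a \<oplus>\<^bsub>qtorus C\<^esub> b) = act v a + act v b) \<and>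
     (\<forall>v. \<forall>a\<in>A. \<forall>b\<in>A. act v (a \<otimes>\<^bsub>qtorus C\<^esub> b) = act (act v a) b) \<and>
     (\<forall>v c. act v (qt_scalar c) = sc c v) \<and>
     (\<forall>v. act v \<one>\<^bsub>qtorus C\<^esub> = v)"

text \<open>\<open>ket sc bra l\<close> is the dual basis element \<open>|l\<rangle>\<close>, as a linear functional: the coordinate
  at \<open>\<langle>l|\<close> with respect to the basis \<open>bra\<close>.\<close>

definition ket ::
  "(laurent \<Rightarrow> 'v \<Rightarrow> 'v::ab_group_add) \<Rightarrow> (('r \<Rightarrow> nat) \<Rightarrow> 'v) \<Rightarrow> ('r \<Rightarrow> nat) \<Rightarrow> 'v \<Rightarrow> laurent" where
  "ket sc bra l v = module.representation sc (range bra) v (bra l)"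

definition unit_n :: "('r \<Rightarrow> nat) \<Rightarrow> 'r \<Rightarrow> nat \<Rightarrow> nat" where
  "unit_n m \<alpha> i = (if i \<ge> 1 \<and> i = m \<alpha> then 1 else 0)"

text \<open>The last conjunct is the expansion of \<open>\<langle>0,\<dots>,0| \<Prod>\<^sub>i\<^sub>\<ge>\<^sub>1 \<Prod>\<^sub>\<alpha> Q\<^bsub>\<alpha>,i\<^esub>\<^bsup>n(\<alpha>,i)\<^esup>\<close> in the basis \<open>bra\<close>,
  read off coordinate by coordinate; the factors with \<open>i > Max (range m)\<close> are trivial.\<close>

definition cyclic_Q_representation ::
  "'r sqmat \<Rightarrow> ('r::{finite,linorder} \<Rightarrow> int \<Rightarrow> 'r qt) \<Rightarrow>
   (laurent \<Rightarrow> 'v \<Rightarrow> 'v::ab_group_add) \<Rightarrow> ('v \<Rightarrow> 'r qt \<Rightarrow> 'v) \<Rightarrow> (('r \<Rightarrow> nat) \<Rightarrow> 'v) \<Rightarrow> bool" where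
  "cyclic_Q_representation C Q sc act bra \<longleftrightarrow>
     right_representation C (A_plus C Q) sc act \<and>
     (\<forall>v. \<exists>a\<in>A_plus C Q. v = act (bra (\<lambda>_. 0)) a) \<and>
     (\<forall>\<alpha>. act (bra (\<lambda>_. 0)) (Q \<alpha> 0) =
        sc (tpow (- (\<Sum>\<beta>\<in>UNIV. lam C \<alpha> \<beta>))) (bra (\<lambda>_. 0))) \<and>
     inj bra \<and> \<not> module.dependent sc (range bra) \<and> module.span sc (range bra) = UNIV \<and>
     (\<forall>m p. let n = unit_n m; k = Max (range m) in
        emb (ket sc bra p (act (bra (\<lambda>_. 0)) (Q_product C Q k n))) =
        tpow (- of_int (\<Sum>\<alpha>\<in>UNIV. \<Sum>\<beta>\<in>UNIV. \<Sum>i=1..k. int (n \<alpha> i) * lam C \<alpha> \<beta>)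
              - (1/2) * of_int ((\<Sum>\<alpha>\<in>UNIV. int (p \<alpha>) * lam C \<alpha> \<alpha>)
                  + (\<Sum>\<alpha>\<in>UNIV. \<Sum>\<beta>\<in>UNIV. int (min (m \<alpha>) (m \<beta>)) * lam C \<alpha> \<beta>)))
        * Msum C p n)"

end

theory Submission
  imports Defs
begin

text \<open>
  Both sides are matrix elements of the same module. The quantum torus acts from the right on functions on the
  weight lattice; the delta function at \<open>b\<close> plays the role of \<open>\<langle>0| y\<^bsup>b\<^esup>\<close> with \<open>y\<^bsub>\<alpha>\<^esub> = Q\<^bsub>\<alpha>,1\<^esub>\<close>, and
  \<open>x\<^bsub>\<alpha>\<^esub> = Q\<^bsub>\<alpha>,0\<^esub>\<close> acts by a scalar on it. Since \<open>Q\<^bsub>\<alpha>,i\<^esub>\<close> has an invertible leading term in \<open>y\<close>, it is bijective on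
  functions with support bounded above, and \<open>\<langle>0| \<Prod> Q\<^bsub>\<alpha>,i\<^esub>\<^bsup>n(\<alpha>,i)\<^esup>\<close> makes sense for all integers \<open>n(\<alpha>,i)\<close>.

  Drop the condition \<open>p \<ge> 0\<close> from the fermionic sum. By Pascal's rule the resulting \<open>N\<close> satisfies in \<open>n\<close> the relation that
  the \<open>Q\<close>-system yields for the coefficient at \<open>(-1, \<dots>, -1)\<close> of \<open>\<langle>0| \<Prod> Q\<^bsub>\<alpha>,i\<^esub>\<^bsup>n(\<alpha>,i)\<^esup>\<close>; this relation has at most one
  solution with the given values for \<open>i = 1\<close>, so \<open>N\<close> is such a coefficient up to a power of \<open>t\<close>. Polynomiality of the
  \<open>Q\<close>-system (the operators \<open>Q\<^bsub>\<alpha>,i\<^esub>\<close> preserve the functions supported on \<open>b \<ge> 0\<close>) then makes \<open>N\<close> vanish for negative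
  \<open>\<ell>\<close>, which implies \<open>M = N\<close>. Hence \<open>M\<close> is a linear functional of the vector \<open>\<langle>0| \<Prod> Q\<^bsub>\<alpha>,i\<^esub>\<^bsup>n(\<alpha>,i)\<^esup>\<close> in the function module.

  In the given representation the lowest terms of \<open>Q\<^bsub>\<alpha>,i\<^esub>\<close> after half a period act as lowering operators, so no
  \<open>\<langle>0, \<dots>, 0| y\<^bsup>b\<^esup>\<close> with \<open>b \<ge> 0\<close> vanishes and the annihilator of \<open>\<langle>0, \<dots>, 0|\<close> in \<open>\<A>\<^sub>+\<close> also annihilates the delta function
  at \<open>0\<close>. The functional above therefore descends to the representation; it is proportional to \<open>|\<ell>\<rangle>\<close> because both agree
  on the vectors by which the representation is defined, and these span.
\<close>

text \<open>The representation is prescribed only on products with at most one factor for each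
  \<alpha>, so the obstacle is to show that \<open>Msum\<close> depends on an arbitrary product only
  through the vector which it produces. Negative exponents are forced on the way: solving the
  Q-system relation for the highest level lowers exponents on the levels below it, so the recursion
  leaves the honest products and the honest fermionic sums. The target value -1 serves as base
  because the modified q-binomial vanishes at p = -1 for m > 0, which leaves a single term; a
  general \<open>l\<close> is reduced to it by adding \<open>l + 1\<close> on level \<open>K\<close>
  and subtracting it on level \<open>K + 1\<close>. Polynomiality comes from translating the index:
  \<open>Q \<alpha> n\<close> is the image of \<open>Q \<alpha> (n + 1)\<close> under a substitution
  into the operators \<open>Q \<alpha> (- 1)\<close>, which lower one coordinate by one and vanish
  where it is 0, hence cannot pass from nonnegative to negative coordinates. All leading terms are
  separated by the weight \<open>rho\<close>, because C maps it to the constant vector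
  \<open>d\<close>.\<close>

lemma tpow_0: "tpow 0 = (1::'e::monoid_add \<Rightarrow>\<^sub>0 int)"
  by (simp add: tpow_def single_one)

lemma tpow_mult: "tpow a * tpow b = tpow (a + b)"
  by (simp add: tpow_def mult_single)

lemma tpow_nonzero [simp]: "tpow e \<noteq> 0"
  by (simp add: tpow_def)

lemma tpow_inverse [simp]: "tpow e * tpow (- e) = 1" "tpow (- e) * tpow e = 1"
  for e :: "'e::group_add"
  by (simp_all add: tpow_mult tpow_0)

lemma tpow_inject [simp]: "tpow a = tpow b \<longleftrightarrow> a = b"
proof
  assume "tpow a = tpow b"
  then have "Poly_Mapping.keys (tpow a) = Poly_Mapping.keys (tpow b)" by simp
  then show "a = b" by (simp add: tpow_def)
qed simp

section \<open>The quantum torus as a noncommutative ring\<close>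

locale torus =
  fixes C :: "'r::finite sqmat"
begin

definition om :: "int ^ 'r \<Rightarrow> int ^ 'r \<Rightarrow> int" where
  "om b a = (\<Sum>\<alpha>\<in>UNIV. \<Sum>\<beta>\<in>UNIV. b $ \<alpha> * lam C \<alpha> \<beta> * a $ \<beta>)"

abbreviation tmult :: "'r qt \<Rightarrow> 'r qt \<Rightarrow> 'r qt" (infixl "\<star>" 70) where
  "f \<star> g \<equiv> qt_mult C f g"

lemma om_add_left: "om (b + b') a = om b a + om b' a"
  by (simp add: om_def algebra_simps sum.distrib)

lemma om_add_right: "om b (a + a') = om b a + om b a'"
  by (simp add: om_def algebra_simps sum.distrib)

lemma om_zero [simp]: "om 0 a = 0" "om b 0 = 0"
  by (simp_all add: om_def)

lemma om_uminus [simp]: "om (- b) a = - om b a" "om b (- a) = - om b a"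
  by (simp_all add: om_def sum_negf)

lemma om_diff_left: "om (b - b') a = om b a - om b' a"
  using om_add_left[of b "- b'" a] by simp

lemma om_diff_right: "om b (a - a') = om b a - om b a'"
  using om_add_right[of b a "- a'"] by simp

lemma qt_mult_superset:
  assumes "finite A" "finite B" "Poly_Mapping.keys f \<subseteq> A" "Poly_Mapping.keys g \<subseteq> B"
  shows "f \<star> g = (\<Sum>x\<in>A. \<Sum>y\<in>B. Poly_Mapping.single (x + y)
          (tpow (- om (snd x) (fst y)) * Poly_Mapping.lookup f x * Poly_Mapping.lookup g y))"
proof -
  have *: "(\<Sum>y\<in>B. Poly_Mapping.single (x + y)
          (tpow (- om (snd x) (fst y)) * Poly_Mapping.lookup f x * Poly_Mapping.lookup g y))
     = (\<Sum>y\<in>Poly_Mapping.keys g. Poly_Mapping.single (x + y)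
          (tpow (- om (snd x) (fst y)) * Poly_Mapping.lookup f x * Poly_Mapping.lookup g y))" for x
    by (rule sum.mono_neutral_right) (use assms in \<open>auto simp: in_keys_iff\<close>)
  have "f \<star> g = (\<Sum>x\<in>Poly_Mapping.keys f. \<Sum>y\<in>Poly_Mapping.keys g. Poly_Mapping.single (x + y)
          (tpow (- om (snd x) (fst y)) * Poly_Mapping.lookup f x * Poly_Mapping.lookup g y))"
    by (simp add: qt_mult_def om_def)
  also have "\<dots> = (\<Sum>x\<in>A. \<Sum>y\<in>Poly_Mapping.keys g. Poly_Mapping.single (x + y)
          (tpow (- om (snd x) (fst y)) * Poly_Mapping.lookup f x * Poly_Mapping.lookup g y))"
    by (rule sum.mono_neutral_left) (use assms in \<open>auto simp: in_keys_iff\<close>)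
  finally show ?thesis by (simp add: *)
qed

lemma qt_mult_single:
  "Poly_Mapping.single x c \<star> Poly_Mapping.single y d
     = Poly_Mapping.single (x + y) (tpow (- om (snd x) (fst y)) * c * d)"
  by (subst qt_mult_superset[of "{x}" "{y}"]) (auto simp: mult.assoc)

lemma qt_mult_add_left: "(f + g) \<star> h = f \<star> h + g \<star> h"
proof -
  let ?A = "Poly_Mapping.keys f \<union> Poly_Mapping.keys g"
  have "Poly_Mapping.keys (f + g) \<subseteq> ?A" by (rule keys_add)
  then show ?thesis
    by (simp add: qt_mult_superset[of ?A "Poly_Mapping.keys h"] lookup_add algebra_simps
        single_add sum.distrib)
qed

lemma qt_mult_add_right: "h \<star> (f + g) = h \<star> f + h \<star> g"
proof -
  let ?A = "Poly_Mapping.keys f \<union> Poly_Mapping.keys g"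
  have "Poly_Mapping.keys (f + g) \<subseteq> ?A" by (rule keys_add)
  then show ?thesis
    by (simp add: qt_mult_superset[of "Poly_Mapping.keys h" ?A] lookup_add algebra_simps
        single_add sum.distrib)
qed

lemma qt_mult_zero [simp]: "0 \<star> g = 0" "g \<star> 0 = 0"
  by (simp_all add: qt_mult_def)

lemma qt_mult_sum_left: "(\<Sum>i\<in>I. f i) \<star> g = (\<Sum>i\<in>I. f i \<star> g)"
  by (induction I rule: infinite_finite_induct) (simp_all add: qt_mult_add_left)

lemma qt_mult_sum_right: "g \<star> (\<Sum>i\<in>I. f i) = (\<Sum>i\<in>I. g \<star> f i)"
  by (induction I rule: infinite_finite_induct) (simp_all add: qt_mult_add_right)

lemma qt_additive_induct:
  assumes "\<And>x c. P (Poly_Mapping.single x c)" "\<And>f g. P f \<Longrightarrow> P g \<Longrightarrow> P (f + g)"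
  shows "P (f :: 'r qt)"
proof -
  have "P (\<Sum>x\<in>A. Poly_Mapping.single x (Poly_Mapping.lookup f x))" for A
  proof (induction A rule: infinite_finite_induct)
    case (infinite A)
    then show ?case using assms(1)[of 0 0] by simp
  next
    case empty
    then show ?case using assms(1)[of 0 0] by simp
  next
    case (insert x F)
    then show ?case using assms by simp
  qed
  moreover have "f = (\<Sum>x\<in>Poly_Mapping.keys f. Poly_Mapping.single x (Poly_Mapping.lookup f x))"
    by (rule poly_mapping_eqI) (simp add: lookup_sum lookup_single when_def in_keys_iff)
  ultimately show ?thesis by metis
qed

text \<open>On monomials both bracketings carry the same power of t because \<open>om\<close> is
  biadditive (the cocycle identity); the rest is additivity.\<close>

lemma qt_mult_assoc: "(f \<star> g) \<star> h = f \<star> (g \<star> h)"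
proof (induction f rule: qt_additive_induct)
  case (1 x c)
  show ?case
  proof (induction g rule: qt_additive_induct)
    case (1 y d)
    show ?case
    proof (induction h rule: qt_additive_induct)
      case (1 z e)
      have "tpow (- om (snd x) (fst y + fst z)) * (tpow (- om (snd y) (fst z)))
          = tpow (- om (snd x + snd y) (fst z)) * (tpow (- om (snd x) (fst y)))"
        by (simp add: tpow_mult om_add_left om_add_right algebra_simps)
      then have "(tpow (- om (snd x) (fst y + fst z)) * (tpow (- om (snd y) (fst z)))) * (c * d * e)
          = (tpow (- om (snd x + snd y) (fst z)) * (tpow (- om (snd x) (fst y)))) * (c * d * e)"
        by simp
      then have "tpow (- om (snd x) (fst y + fst z)) * c * (tpow (- om (snd y) (fst z)) * d * e)
          = tpow (- om (snd x + snd y) (fst z)) * (tpow (- om (snd x) (fst y)) * c * d) * e"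
        by (simp only: ac_simps)
      then show ?case
        by (simp only: qt_mult_single add.assoc fst_add snd_add)
    qed (simp_all add: qt_mult_add_right)
  qed (simp_all add: qt_mult_add_right qt_mult_add_left)
qed (simp_all add: qt_mult_add_left)

end

section \<open>Leading monomials with respect to an additive grading\<close>

definition munit :: "laurent \<Rightarrow> bool" where
  "munit u \<longleftrightarrow> (\<exists>e. u = tpow e \<or> u = - tpow e)"

lemma munit_tpow [simp]: "munit (tpow e)"
  by (auto simp: munit_def)

lemma munit_one [simp]: "munit 1"
  by (metis munit_tpow tpow_0)

lemma munit_uminus [simp]: "munit (- u) \<longleftrightarrow> munit u"
  by (auto simp: munit_def) (metis minus_minus)+

lemma munit_mult: "munit u \<Longrightarrow> munit v \<Longrightarrow> munit (u * v)"
  by (auto simp: munit_def tpow_mult)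

lemma munit_nonzero: "munit u \<Longrightarrow> u \<noteq> 0"
  by (auto simp: munit_def)

lemma munit_inverse:
  assumes "munit u"
  obtains v where "munit v" "u * v = 1" "v * u = 1"
proof -
  from assms obtain e where "u = tpow e \<or> u = - tpow e" by (auto simp: munit_def)
  then show thesis
    using that[of "tpow (- e)"] that[of "- tpow (- e)"] by auto
qed

definition addf :: "('a::ab_group_add \<Rightarrow> int) \<Rightarrow> bool" where
  "addf \<psi> \<longleftrightarrow> (\<forall>x y. \<psi> (x + y) = \<psi> x + \<psi> y)"

lemma addf_add: "addf \<psi> \<Longrightarrow> \<psi> (x + y) = \<psi> x + \<psi> y"
  by (simp add: addf_def)

lemma addf_0: "addf \<psi> \<Longrightarrow> \<psi> 0 = 0"
  using addf_add[of \<psi> 0 0] by simp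

lemma addf_uminus: "addf \<psi> \<Longrightarrow> \<psi> (- x) = - \<psi> x"
  using addf_add[of \<psi> x "- x"] by (simp add: addf_0)

lemma addf_diff: "addf \<psi> \<Longrightarrow> \<psi> (x - y) = \<psi> x - \<psi> y"
  using addf_add[of \<psi> x "- y"] by (simp add: addf_uminus)

definition domin :: "('k \<Rightarrow> int) \<Rightarrow> int \<Rightarrow> ('k \<Rightarrow>\<^sub>0 laurent) \<Rightarrow> bool" where
  "domin \<psi> d f \<longleftrightarrow> (\<forall>k\<in>Poly_Mapping.keys f. \<psi> k < d)"

lemma domin_add: "domin \<psi> d f \<Longrightarrow> domin \<psi> d g \<Longrightarrow> domin \<psi> d (f + g)"
  using keys_add[of f g] by (auto simp: domin_def)

lemma domin_uminus: "domin \<psi> d (- f) \<longleftrightarrow> domin \<psi> d f"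
  by (simp add: domin_def)

lemma domin_diff: "domin \<psi> d f \<Longrightarrow> domin \<psi> d g \<Longrightarrow> domin \<psi> d (f - g)"
  using domin_add[of \<psi> d f "- g"] by (simp add: domin_uminus)

lemma domin_zero [simp]: "domin \<psi> d 0"
  by (simp add: domin_def)

text \<open>A single monomial on the highest level, with a coefficient that is a unit of Z[t, 1/t].
  This makes leading terms multiplicative and divisible even though \<open>\<psi>\<close> does not
  order the monomials totally.\<close>

definition topmon :: "('k \<Rightarrow> int) \<Rightarrow> ('k \<Rightarrow>\<^sub>0 laurent) \<Rightarrow> 'k \<Rightarrow> bool" where
  "topmon \<psi> f k \<longleftrightarrow> (\<exists>u. munit u \<and> domin \<psi> (\<psi> k) (f - Poly_Mapping.single k u))"

lemma topmonI: "munit u \<Longrightarrow> domin \<psi> (\<psi> k) (f - Poly_Mapping.single k u) \<Longrightarrow> topmon \<psi> f k"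
  by (auto simp: topmon_def)

lemma topmon_single: "munit u \<Longrightarrow> topmon \<psi> (Poly_Mapping.single k u) k"
  by (rule topmonI) auto

lemma topmon_lookup: "topmon \<psi> f k \<Longrightarrow> munit (Poly_Mapping.lookup f k)"
  unfolding topmon_def domin_def
  by (metis eq_iff_diff_eq_0 in_keys_iff less_irrefl lookup_minus lookup_single_eq)

lemma topmon_lookup_zero:
  assumes "topmon \<psi> f k" "\<psi> k' \<ge> \<psi> k" "k' \<noteq> k"
  shows "Poly_Mapping.lookup f k' = 0"
proof -
  from assms obtain u where "domin \<psi> (\<psi> k) (f - Poly_Mapping.single k u)" by (auto simp: topmon_def)
  with assms(2) have "k' \<notin> Poly_Mapping.keys (f - Poly_Mapping.single k u)"
    by (force simp: domin_def)
  with assms(3) show ?thesis by (simp add: in_keys_iff lookup_minus lookup_single when_def)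
qed

lemma topmon_keys_le: "topmon \<psi> f k \<Longrightarrow> k' \<in> Poly_Mapping.keys f \<Longrightarrow> \<psi> k' \<le> \<psi> k"
  using topmon_lookup_zero[of \<psi> f k k'] by (cases "k' = k") (force simp: in_keys_iff)+

lemma topmon_iff:
  "topmon \<psi> f k \<longleftrightarrow> munit (Poly_Mapping.lookup f k) \<and>
     (\<forall>k'\<in>Poly_Mapping.keys f. k' \<noteq> k \<longrightarrow> \<psi> k' < \<psi> k)"
proof
  assume *: "munit (Poly_Mapping.lookup f k) \<and> (\<forall>k'\<in>Poly_Mapping.keys f. k' \<noteq> k \<longrightarrow> \<psi> k' < \<psi> k)"
  then have "domin \<psi> (\<psi> k) (f - Poly_Mapping.single k (Poly_Mapping.lookup f k))"
    by (auto simp: domin_def in_keys_iff lookup_minus lookup_single when_def split: if_splits)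
  with * show "topmon \<psi> f k" by (auto simp: topmon_def)
next
  assume "topmon \<psi> f k"
  then show "munit (Poly_Mapping.lookup f k) \<and> (\<forall>k'\<in>Poly_Mapping.keys f. k' \<noteq> k \<longrightarrow> \<psi> k' < \<psi> k)"
    using topmon_lookup topmon_lookup_zero by (metis in_keys_iff not_le)
qed

lemma topmon_add_lower: "topmon \<psi> f k \<Longrightarrow> domin \<psi> (\<psi> k) g \<Longrightarrow> topmon \<psi> (f + g) k"
  unfolding topmon_def using domin_add[of \<psi> "\<psi> k"]
  by (metis add_diff_eq add.commute diff_add_eq)

lemma topmon_uminus: "topmon \<psi> (- f) k \<longleftrightarrow> topmon \<psi> f k"
  by (simp add: topmon_iff)

lemma topmon_domin: "topmon \<psi> f k \<Longrightarrow> \<psi> k < d \<Longrightarrow> domin \<psi> d f"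
  using topmon_keys_le unfolding domin_def by (meson le_less_trans)

context torus
begin

sublocale T: ring_1 "1 :: 'r qt" tmult "(+)" 0 "(-)" uminus
proof (unfold_locales, goal_cases)
  case (1 a b c)
  show ?case by (rule qt_mult_assoc)
next
  case (2 a)
  show ?case
  proof (induction a rule: qt_additive_induct)
    case (1 x c)
    have "Poly_Mapping.single 0 1 \<star> Poly_Mapping.single x c = Poly_Mapping.single x c"
      by (simp only: qt_mult_single) (simp add: tpow_0)
    then show ?case by simp
  qed (simp add: qt_mult_add_right)
next
  case (3 a)
  show ?case
  proof (induction a rule: qt_additive_induct)
    case (1 x c)
    have "Poly_Mapping.single x c \<star> Poly_Mapping.single 0 1 = Poly_Mapping.single x c"
      by (simp only: qt_mult_single) (simp add: tpow_0)
    then show ?case by simp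
  qed (simp add: qt_mult_add_left)
qed (simp_all add: qt_mult_add_left qt_mult_add_right)

abbreviation tpower :: "'r qt \<Rightarrow> nat \<Rightarrow> 'r qt" (infixr "\<up>" 80) where
  "f \<up> n \<equiv> T.power f n"

abbreviation tt :: "int \<Rightarrow> 'r qt" where
  "tt e \<equiv> qt_scalar (tpow e)"

lemma lookup_qt_scalar_mult [simp]:
  "Poly_Mapping.lookup (qt_scalar c \<star> f) k = c * Poly_Mapping.lookup f k"
proof (induction f rule: qt_additive_induct)
  case (1 x d)
  then show ?case by (simp add: qt_scalar_def qt_mult_single tpow_0 lookup_single when_def)
qed (simp add: qt_mult_add_right lookup_add algebra_simps)

lemma qt_scalar_central: "f \<star> qt_scalar c = qt_scalar c \<star> f"
proof (induction f rule: qt_additive_induct)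
  case (1 x d)
  then show ?case by (simp add: qt_scalar_def qt_mult_single tpow_0 mult.commute)
qed (simp add: qt_mult_add_left qt_mult_add_right)

lemma qt_scalar_left_commute: "f \<star> (qt_scalar c \<star> g) = qt_scalar c \<star> (f \<star> g)"
  by (metis qt_scalar_central T.mult_assoc)

lemma qt_scalar_mult: "qt_scalar c \<star> qt_scalar d = qt_scalar (c * d)"
  by (simp add: qt_scalar_def qt_mult_single tpow_0)

lemma tt_mult: "tt a \<star> tt b = tt (a + b)"
  by (simp add: qt_scalar_mult tpow_mult)

lemma tt_mult': "tt a \<star> (tt b \<star> f) = tt (a + b) \<star> f"
  by (simp add: tt_mult T.mult_assoc[symmetric])

lemma tt_0 [simp]: "tt 0 = 1"
  by (simp add: qt_scalar_def tpow_0)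

lemma qt_scalar_1: "qt_scalar 1 = 1"
  by (simp add: qt_scalar_def)

lemma tt_cancel [simp]: "tt a \<star> f = tt a \<star> g \<longleftrightarrow> f = g"
  using tt_mult'[of "- a" a] by (metis T.mult_1_left add.left_inverse tt_0)

lemma tt_eq_iff: "tt a \<star> f = g \<longleftrightarrow> f = tt (- a) \<star> g"
proof -
  have "tt (- a) \<star> (tt a \<star> f) = f" by (simp add: tt_mult')
  then show ?thesis by (metis tt_cancel)
qed

definition qcomm :: "int \<Rightarrow> 'r qt \<Rightarrow> 'r qt \<Rightarrow> bool" where
  "qcomm e f g \<longleftrightarrow> f \<star> g = tt e \<star> (g \<star> f)"

lemma qcommD: "qcomm e f g \<Longrightarrow> f \<star> g = tt e \<star> (g \<star> f)"
  by (simp add: qcomm_def)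

lemma qcommD': "qcomm e f g \<Longrightarrow> f \<star> (g \<star> h) = tt e \<star> (g \<star> (f \<star> h))"
  by (metis qcomm_def T.mult_assoc)

lemma qcomm_sym: "qcomm e f g \<Longrightarrow> qcomm (- e) g f"
  by (simp add: qcomm_def tt_mult')

lemma qcomm_one [simp]: "qcomm 0 f 1" "qcomm 0 1 f"
  by (simp_all add: qcomm_def)

lemma qcomm_mult_right:
  "qcomm e f g \<Longrightarrow> qcomm e' f g' \<Longrightarrow> qcomm (e + e') f (g \<star> g')"
  unfolding qcomm_def
  by (metis T.mult_assoc qt_scalar_left_commute tt_mult')

lemma qcomm_mult_left:
  "qcomm e f g \<Longrightarrow> qcomm e' f' g \<Longrightarrow> qcomm (e + e') (f \<star> f') g"
  using qcomm_sym[OF qcomm_mult_right[OF qcomm_sym qcomm_sym, of e f g e' f']] by (simp add: add.commute)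

lemma qcomm_power_right: "qcomm e f g \<Longrightarrow> qcomm (int n * e) f (g \<up> n)"
  by (induction n) (simp_all add: qcomm_mult_right algebra_simps)

lemma qcomm_power_left: "qcomm e f g \<Longrightarrow> qcomm (int n * e) (f \<up> n) g"
  by (induction n) (simp_all add: qcomm_mult_left algebra_simps)

lemma qcomm_diff_right: "qcomm e f g \<Longrightarrow> qcomm e f g' \<Longrightarrow> qcomm e f (g - g')"
  by (simp add: qcomm_def T.left_diff_distrib T.right_diff_distrib)

lemma qcomm_diff_left: "qcomm e f g \<Longrightarrow> qcomm e f' g \<Longrightarrow> qcomm e (f - f') g"
  by (simp add: qcomm_def T.left_diff_distrib T.right_diff_distrib)

lemma qcomm_scalar_right: "qcomm e f g \<Longrightarrow> qcomm e f (qt_scalar c \<star> g)"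
  using qcomm_mult_right[of 0 f "qt_scalar c" e g] by (simp add: qcomm_def qt_scalar_central)

lemma qcomm_scalar_left: "qcomm e f g \<Longrightarrow> qcomm e (qt_scalar c \<star> f) g"
  using qcomm_mult_left[of 0 "qt_scalar c" g e f] by (simp add: qcomm_def qt_scalar_central)

definition lprod :: "('i \<Rightarrow> 'r qt) \<Rightarrow> 'i list \<Rightarrow> 'r qt" where
  "lprod f xs = foldr (\<lambda>x acc. f x \<star> acc) xs 1"

lemma lprod_simps [simp]: "lprod f [] = 1" "lprod f (x # xs) = f x \<star> lprod f xs"
  by (simp_all add: lprod_def)

lemma lprod_cong: "(\<And>x. x \<in> set xs \<Longrightarrow> f x = g x) \<Longrightarrow> lprod f xs = lprod g xs"
  by (induction xs) auto

lemma qcomm_lprod_left: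
  "(\<And>x. x \<in> set xs \<Longrightarrow> qcomm (e x) (f x) g) \<Longrightarrow> qcomm (sum_list (map e xs)) (lprod f xs) g"
  by (induction xs) (simp_all add: qcomm_mult_left)

lemma qcomm_lprod_right:
  "(\<And>x. x \<in> set xs \<Longrightarrow> qcomm (e x) g (f x)) \<Longrightarrow> qcomm (sum_list (map e xs)) g (lprod f xs)"
  by (induction xs) (simp_all add: qcomm_mult_right)

lemma lprod_mult:
  assumes "\<And>x y. x \<in> set xs \<Longrightarrow> y \<in> set xs \<Longrightarrow> qcomm 0 (f x) (g y)"
  shows "lprod (\<lambda>x. f x \<star> g x) xs = lprod f xs \<star> lprod g xs"
  using assms
proof (induction xs)
  case (Cons x xs)
  have "qcomm (sum_list (map (\<lambda>_. 0) xs)) (lprod f xs) (g x)"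
    by (rule qcomm_lprod_left) (use Cons.prems in auto)
  then have "lprod f xs \<star> (g x \<star> h) = g x \<star> (lprod f xs \<star> h)" for h
    using qcommD'[of 0 "lprod f xs" "g x"] by (simp add: sum_list_0)
  then show ?case using Cons by (simp add: T.mult_assoc)
qed simp

lemma lookup_qt_mult:
  "Poly_Mapping.lookup (f \<star> g) z = (\<Sum>x\<in>Poly_Mapping.keys f.
     tpow (- om (snd x) (fst (z - x))) * Poly_Mapping.lookup f x * Poly_Mapping.lookup g (z - x))"
proof -
  have "Poly_Mapping.lookup (Poly_Mapping.single x c \<star> g) z
      = tpow (- om (snd x) (fst (z - x))) * c * Poly_Mapping.lookup g (z - x)" for x c
  proof (induction g rule: qt_additive_induct)
    case (1 y d)
    then show ?case by (auto simp: qt_mult_single lookup_single when_def)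
  qed (simp add: qt_mult_add_right lookup_add algebra_simps)
  moreover have "f \<star> g = (\<Sum>x\<in>Poly_Mapping.keys f. Poly_Mapping.single x (Poly_Mapping.lookup f x)) \<star> g"
    by (rule arg_cong[of _ _ "\<lambda>h. h \<star> g"], rule poly_mapping_eqI)
      (simp add: lookup_sum lookup_single when_def in_keys_iff)
  ultimately show ?thesis by (simp add: qt_mult_sum_left lookup_sum)
qed

lemma lookup_qt_mult':
  "Poly_Mapping.lookup (f \<star> g) z = (\<Sum>y\<in>Poly_Mapping.keys g.
     tpow (- om (snd (z - y)) (fst y)) * Poly_Mapping.lookup f (z - y) * Poly_Mapping.lookup g y)"
proof -
  have "Poly_Mapping.lookup (f \<star> Poly_Mapping.single y d) z
      = tpow (- om (snd (z - y)) (fst y)) * Poly_Mapping.lookup f (z - y) * d" for y d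
  proof (induction f rule: qt_additive_induct)
    case (1 x c)
    then show ?case by (auto simp: qt_mult_single lookup_single when_def)
  qed (simp add: qt_mult_add_left lookup_add algebra_simps)
  moreover have "f \<star> g = f \<star> (\<Sum>x\<in>Poly_Mapping.keys g. Poly_Mapping.single x (Poly_Mapping.lookup g x))"
    by (rule arg_cong[of _ _ "\<lambda>h. f \<star> h"], rule poly_mapping_eqI)
      (simp add: lookup_sum lookup_single when_def in_keys_iff)
  ultimately show ?thesis by (simp add: qt_mult_sum_right lookup_sum)
qed

lemma keys_qt_mult:
  assumes "z \<in> Poly_Mapping.keys (f \<star> g)"
  obtains x y where "x \<in> Poly_Mapping.keys f" "y \<in> Poly_Mapping.keys g" "z = x + y"
proof -
  from assms have "(\<Sum>x\<in>Poly_Mapping.keys f. tpow (- om (snd x) (fst (z - x))) *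
      Poly_Mapping.lookup f x * Poly_Mapping.lookup g (z - x)) \<noteq> 0"
    by (simp add: in_keys_iff lookup_qt_mult)
  then obtain x where "x \<in> Poly_Mapping.keys f" "tpow (- om (snd x) (fst (z - x))) *
      Poly_Mapping.lookup f x * Poly_Mapping.lookup g (z - x) \<noteq> 0"
    by (meson sum.neutral)
  then have "z - x \<in> Poly_Mapping.keys g" by (auto simp: in_keys_iff)
  with \<open>x \<in> _\<close> show thesis using that[of x "z - x"] by simp
qed

lemma domin_mult:
  assumes "addf \<psi>" "domin \<psi> d f" "\<And>k. k \<in> Poly_Mapping.keys g \<Longrightarrow> \<psi> k \<le> d'"
  shows "domin \<psi> (d + d') (f \<star> g)"
  unfolding domin_def
proof
  fix z assume "z \<in> Poly_Mapping.keys (f \<star> g)"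
  then obtain x y where "x \<in> Poly_Mapping.keys f" "y \<in> Poly_Mapping.keys g" "z = x + y"
    by (rule keys_qt_mult)
  with assms show "\<psi> z < d + d'"
    by (simp add: domin_def addf_add add_less_le_mono)
qed

lemma domin_mult':
  assumes "addf \<psi>" "domin \<psi> d g" "\<And>k. k \<in> Poly_Mapping.keys f \<Longrightarrow> \<psi> k \<le> d'"
  shows "domin \<psi> (d' + d) (f \<star> g)"
  unfolding domin_def
proof
  fix z assume "z \<in> Poly_Mapping.keys (f \<star> g)"
  then obtain x y where "x \<in> Poly_Mapping.keys f" "y \<in> Poly_Mapping.keys g" "z = x + y"
    by (rule keys_qt_mult)
  with assms show "\<psi> z < d' + d"
    by (simp add: domin_def addf_add add_le_less_mono)
qed

lemma domin_scalar: "domin \<psi> d f \<Longrightarrow> domin \<psi> d (qt_scalar c \<star> f)"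
  by (auto simp: domin_def in_keys_iff)

lemma topmon_mult:
  assumes "addf \<psi>" "topmon \<psi> f k" "topmon \<psi> g k'"
  shows "topmon \<psi> (f \<star> g) (k + k')"
proof -
  from assms obtain u v where u: "munit u" "domin \<psi> (\<psi> k) (f - Poly_Mapping.single k u)"
    and v: "munit v" "domin \<psi> (\<psi> k') (g - Poly_Mapping.single k' v)"
    unfolding topmon_def by blast
  let ?u = "Poly_Mapping.single k u" and ?v = "Poly_Mapping.single k' v"
  have "domin \<psi> (\<psi> k + \<psi> k') ((f - ?u) \<star> g)"
    using assms(1) u(2) topmon_keys_le[OF assms(3)] by (rule domin_mult)
  moreover have "domin \<psi> (\<psi> k + \<psi> k') (?u \<star> (g - ?v))"
    using assms(1) v(2) by (rule domin_mult') (simp split: if_splits)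
  moreover have "f \<star> g - ?u \<star> ?v = (f - ?u) \<star> g + ?u \<star> (g - ?v)"
    by (simp add: T.left_diff_distrib T.right_diff_distrib)
  ultimately have "domin \<psi> (\<psi> (k + k')) (f \<star> g - ?u \<star> ?v)"
    using assms(1) by (simp add: domin_add addf_add)
  moreover have "?u \<star> ?v = Poly_Mapping.single (k + k') (tpow (- om (snd k) (fst k')) * u * v)"
    by (simp add: qt_mult_single)
  ultimately show ?thesis
    using u(1) v(1) by (intro topmonI) (auto intro!: munit_mult)
qed

lemma topmon_tt: "addf \<psi> \<Longrightarrow> topmon \<psi> f k \<Longrightarrow> topmon \<psi> (tt e \<star> f) k"
  using topmon_mult[of \<psi> "tt e" 0 f k] topmon_single[of "tpow e" \<psi> 0] by (simp add: qt_scalar_def)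

lemma topmon_one: "topmon \<psi> (1 :: 'r qt) 0"
  using topmon_single[of 1 \<psi> "0 :: (int ^ 'r) \<times> (int ^ 'r)"] by simp

lemma topmon_lprod:
  "addf \<psi> \<Longrightarrow> (\<And>x. x \<in> set xs \<Longrightarrow> topmon \<psi> (f x) (k x)) \<Longrightarrow> topmon \<psi> (lprod f xs) (sum_list (map k xs))"
  by (induction xs) (auto simp: topmon_one intro: topmon_mult)

text \<open>Let \<open>k1\<close> be an exponent of \<open>f\<close> on its highest level. At
  \<open>k1 + k\<close> only the leading term of \<open>g\<close> meets it, so nothing cancels there
  and the level of \<open>f\<close> can be read off the product.\<close>

lemma domin_cancel_right:
  assumes "addf \<psi>" "topmon \<psi> g k" "domin \<psi> (d + \<psi> k) (f \<star> g)"
  shows "domin \<psi> d f"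
proof (rule ccontr)
  assume "\<not> domin \<psi> d f"
  then obtain k0 where k0: "k0 \<in> Poly_Mapping.keys f" "\<psi> k0 \<ge> d" by (force simp: domin_def)
  define M where "M = Max (\<psi> ` Poly_Mapping.keys f)"
  have "M \<in> \<psi> ` Poly_Mapping.keys f" unfolding M_def using k0 by (intro Max_in) auto
  then obtain k1 where k1: "k1 \<in> Poly_Mapping.keys f" "\<psi> k1 = M" by auto
  have le: "\<psi> x \<le> M" if "x \<in> Poly_Mapping.keys f" for x
    unfolding M_def using that by simp
  have "Poly_Mapping.lookup (f \<star> g) (k1 + k) = (\<Sum>x\<in>Poly_Mapping.keys f.
     tpow (- om (snd x) (fst (k1 + k - x))) * Poly_Mapping.lookup f x * Poly_Mapping.lookup g (k1 + k - x))"
    by (rule lookup_qt_mult)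
  also have "\<dots> = (\<Sum>x\<in>{k1}. tpow (- om (snd x) (fst (k1 + k - x))) * Poly_Mapping.lookup f x *
      Poly_Mapping.lookup g (k1 + k - x))"
  proof (rule sum.mono_neutral_right)
    show "\<forall>x\<in>Poly_Mapping.keys f - {k1}. tpow (- om (snd x) (fst (k1 + k - x))) *
        Poly_Mapping.lookup f x * Poly_Mapping.lookup g (k1 + k - x) = 0"
    proof
      fix x assume x: "x \<in> Poly_Mapping.keys f - {k1}"
      have "Poly_Mapping.lookup g (k1 + k - x) = 0"
        by (rule topmon_lookup_zero[OF assms(2)])
          (use x le k1 assms(1) in \<open>auto simp: addf_diff addf_add\<close>)
      then show "tpow (- om (snd x) (fst (k1 + k - x))) *
        Poly_Mapping.lookup f x * Poly_Mapping.lookup g (k1 + k - x) = 0" by simp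
    qed
  qed (use k1 in auto)
  also have "\<dots> \<noteq> 0"
    using k1 munit_nonzero[OF topmon_lookup[OF assms(2)]] by (simp add: in_keys_iff)
  finally have "k1 + k \<in> Poly_Mapping.keys (f \<star> g)" by (simp add: in_keys_iff)
  then have "\<psi> (k1 + k) < d + \<psi> k" using assms(3) by (simp add: domin_def)
  then show False using k0 le[OF k0(1)] k1 assms(1) by (simp add: addf_add)
qed

lemma domin_cancel_left:
  assumes "addf \<psi>" "topmon \<psi> g k" "domin \<psi> (d + \<psi> k) (g \<star> f)"
  shows "domin \<psi> d f"
proof (rule ccontr)
  assume "\<not> domin \<psi> d f"
  then obtain k0 where k0: "k0 \<in> Poly_Mapping.keys f" "\<psi> k0 \<ge> d" by (force simp: domin_def)
  define M where "M = Max (\<psi> ` Poly_Mapping.keys f)"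
  have "M \<in> \<psi> ` Poly_Mapping.keys f" unfolding M_def using k0 by (intro Max_in) auto
  then obtain k1 where k1: "k1 \<in> Poly_Mapping.keys f" "\<psi> k1 = M" by auto
  have le: "\<psi> x \<le> M" if "x \<in> Poly_Mapping.keys f" for x
    unfolding M_def using that by simp
  have "Poly_Mapping.lookup (g \<star> f) (k + k1) = (\<Sum>x\<in>Poly_Mapping.keys f.
     tpow (- om (snd (k + k1 - x)) (fst x)) * Poly_Mapping.lookup g (k + k1 - x) * Poly_Mapping.lookup f x)"
    by (rule lookup_qt_mult')
  also have "\<dots> = (\<Sum>x\<in>{k1}. tpow (- om (snd (k + k1 - x)) (fst x)) * Poly_Mapping.lookup g (k + k1 - x) *
      Poly_Mapping.lookup f x)"
  proof (rule sum.mono_neutral_right)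
    show "\<forall>x\<in>Poly_Mapping.keys f - {k1}. tpow (- om (snd (k + k1 - x)) (fst x)) *
        Poly_Mapping.lookup g (k + k1 - x) * Poly_Mapping.lookup f x = 0"
    proof
      fix x assume x: "x \<in> Poly_Mapping.keys f - {k1}"
      have "Poly_Mapping.lookup g (k + k1 - x) = 0"
        by (rule topmon_lookup_zero[OF assms(2)])
          (use x le k1 assms(1) in \<open>auto simp: addf_diff addf_add\<close>)
      then show "tpow (- om (snd (k + k1 - x)) (fst x)) *
        Poly_Mapping.lookup g (k + k1 - x) * Poly_Mapping.lookup f x = 0" by simp
    qed
  qed (use k1 in auto)
  also have "\<dots> \<noteq> 0"
    using k1 munit_nonzero[OF topmon_lookup[OF assms(2)]] by (simp add: in_keys_iff)
  finally have "k + k1 \<in> Poly_Mapping.keys (g \<star> f)" by (simp add: in_keys_iff)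
  then have "\<psi> (k + k1) < d + \<psi> k" using assms(3) by (simp add: domin_def)
  then show False using k0 le[OF k0(1)] k1 assms(1) by (simp add: addf_add)
qed

lemma topmon_cancel_right_eq:
  assumes "addf \<psi>" "topmon \<psi> g k" "f \<star> g = f' \<star> g"
  shows "f = f'"
proof -
  have 0: "(f - f') \<star> g = 0" using assms(3) by (simp add: T.left_diff_distrib)
  have "domin \<psi> d (f - f')" for d
    by (rule domin_cancel_right[OF assms(1,2)]) (simp add: 0)
  then have "k' \<notin> Poly_Mapping.keys (f - f')" for k'
    using less_irrefl unfolding domin_def by blast
  then have "Poly_Mapping.keys (f - f') = {}" by blast
  then show ?thesis by simp
qed

lemma single_munit_inverse:
  assumes "munit u"
  obtains v where "munit v"
    "Poly_Mapping.single k u \<star> Poly_Mapping.single (- k) v = 1"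
    "Poly_Mapping.single (- k) v \<star> Poly_Mapping.single k u = 1"
proof -
  obtain w where w: "munit w" "u * w = 1" "w * u = 1" using munit_inverse[OF assms] .
  define E where "E = om (snd k) (fst k)"
  have "tpow E * u * (tpow (- E) * w) = (tpow E * tpow (- E)) * (u * w)"
    "tpow E * (tpow (- E) * w) * u = (tpow E * tpow (- E)) * (u * w)"
    by (simp_all only: ac_simps)
  then have 1: "tpow E * u * (tpow (- E) * w) = 1" "tpow E * (tpow (- E) * w) * u = 1"
    using w(2) by simp_all
  show thesis
  proof (rule that[of "tpow (- E) * w"])
    show "munit (tpow (- E) * w)" using w by (simp add: munit_mult)
    show "Poly_Mapping.single k u \<star> Poly_Mapping.single (- k) (tpow (- E) * w) = 1"
      by (simp only: qt_mult_single) (simp add: E_def[symmetric] 1)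
    show "Poly_Mapping.single (- k) (tpow (- E) * w) \<star> Poly_Mapping.single k u = 1"
      by (simp only: qt_mult_single) (simp add: E_def[symmetric] 1)
  qed
qed

text \<open>\<open>L\<close> may have several monomials on the highest level \<open>e\<close>. This
  generality serves the one step of the recursion at which its two terms tie, besides the division
  of leading monomials.\<close>

lemma domin_divide_right:
  assumes "addf \<psi>" "topmon \<psi> g k" "domin \<psi> e (f \<star> g - L)" "\<And>x. x \<in> Poly_Mapping.keys L \<Longrightarrow> \<psi> x \<le> e"
  obtains v where "munit v" "domin \<psi> (e - \<psi> k) (f - L \<star> Poly_Mapping.single (- k) v)"
proof -
  obtain u where u: "munit u" "domin \<psi> (\<psi> k) (g - Poly_Mapping.single k u)"
    using assms(2) unfolding topmon_def by blast
  obtain v where v: "munit v" "Poly_Mapping.single (- k) v \<star> Poly_Mapping.single k u = 1"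
    using single_munit_inverse[OF u(1)] by metis
  let ?v = "Poly_Mapping.single (- k) v" and ?u = "Poly_Mapping.single k u"
  have "domin \<psi> (\<psi> (- k) + \<psi> k) (?v \<star> (g - ?u))"
    using assms(1) u(2) by (rule domin_mult') (simp split: if_splits)
  then have "domin \<psi> (e + 0) (L \<star> (?v \<star> (g - ?u)))"
    using assms(1,4) by (intro domin_mult') (simp_all add: addf_uminus)
  moreover have "L \<star> (?v \<star> (g - ?u)) = L \<star> ?v \<star> g - L"
    by (simp add: T.right_diff_distrib v T.mult_assoc)
  ultimately have "domin \<psi> e (L \<star> ?v \<star> g - L)" by simp
  from domin_diff[OF assms(3) this]
  have "domin \<psi> (e - \<psi> k + \<psi> k) ((f - L \<star> ?v) \<star> g)"
    by (simp add: T.left_diff_distrib)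
  from domin_cancel_right[OF assms(1,2) this] v(1) show thesis by (rule that[rotated])
qed

lemma topmon_divide_right:
  assumes "addf \<psi>" "topmon \<psi> g k" "topmon \<psi> (f \<star> g) k'"
  shows "topmon \<psi> f (k' - k)"
proof -
  obtain u where u: "munit u" "domin \<psi> (\<psi> k') (f \<star> g - Poly_Mapping.single k' u)"
    using assms(3) unfolding topmon_def by blast
  obtain v where v: "munit v" "domin \<psi> (\<psi> k' - \<psi> k) (f - Poly_Mapping.single k' u \<star> Poly_Mapping.single (- k) v)"
    using domin_divide_right[OF assms(1,2) u(2)] by (metis empty_iff keys_single order_refl singletonD)
  show ?thesis
    using v u(1) assms(1)
    by (intro topmonI[of "tpow (- om (snd k') (fst (- k))) * u * v"])
      (auto simp: qt_mult_single addf_diff intro!: munit_mult simp del: fst_uminus)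
qed

lemma topmon_divide_left:
  assumes "addf \<psi>" "topmon \<psi> g k" "topmon \<psi> (g \<star> f) k'"
  shows "topmon \<psi> f (k' - k)"
proof -
  obtain u where u: "munit u" "domin \<psi> (\<psi> k') (g \<star> f - Poly_Mapping.single k' u)"
    using assms(3) unfolding topmon_def by blast
  obtain w where w: "munit w" "domin \<psi> (\<psi> k) (g - Poly_Mapping.single k w)"
    using assms(2) unfolding topmon_def by blast
  obtain v where v: "munit v" "Poly_Mapping.single k w \<star> Poly_Mapping.single (- k) v = 1"
    using single_munit_inverse[OF w(1)] by metis
  let ?v = "Poly_Mapping.single (- k) v" and ?w = "Poly_Mapping.single k w"
    and ?L = "Poly_Mapping.single k' u"
  have "domin \<psi> (\<psi> k + \<psi> (- k)) ((g - ?w) \<star> ?v)"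
    using assms(1) w(2) by (rule domin_mult) (simp split: if_splits)
  then have "domin \<psi> (0 + \<psi> k') ((g - ?w) \<star> ?v \<star> ?L)"
    using assms(1) by (intro domin_mult) (simp_all add: addf_uminus split: if_splits)
  moreover have "(g - ?w) \<star> ?v \<star> ?L = g \<star> (?v \<star> ?L) - ?L"
    by (simp add: T.left_diff_distrib v T.mult_assoc)
  ultimately have "domin \<psi> (\<psi> k') (g \<star> (?v \<star> ?L) - ?L)" by simp
  from domin_diff[OF u(2) this] have "domin \<psi> (\<psi> k' - \<psi> k + \<psi> k) (g \<star> (f - ?v \<star> ?L))"
    by (simp add: T.right_diff_distrib)
  from domin_cancel_left[OF assms(1,2) this] u(1) v(1) assms(1) show ?thesis
    by (intro topmonI[of "tpow (- om (snd (- k)) (fst k')) * v * u"])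
      (auto simp: qt_mult_single addf_diff intro!: munit_mult simp del: snd_uminus)
qed

end

subsection \<open>The Cartan matrix\<close>

lemma det_of_int: "det (\<chi> i j. of_int (M $ i $ j) :: 'a::comm_ring_1 ^ 'n ^ 'n) = of_int (det M)"
  by (simp add: det_def)

locale cartan = torus C for C :: "'r::finite sqmat" +
  assumes cartan: "simply_laced_cartan_matrix C"
begin

abbreviation d :: int where "d \<equiv> det C"

lemma C_diag [simp]: "C $ \<alpha> $ \<alpha> = 2"
  using cartan by (simp add: simply_laced_cartan_matrix_def)

lemma C_off: "\<alpha> \<noteq> \<beta> \<Longrightarrow> C $ \<alpha> $ \<beta> = 0 \<or> C $ \<alpha> $ \<beta> = - 1"
  using cartan by (auto simp: simply_laced_cartan_matrix_def)

lemma C_sym: "C $ \<alpha> $ \<beta> = C $ \<beta> $ \<alpha>"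
proof -
  have "transpose C = C" using cartan by (simp add: simply_laced_cartan_matrix_def)
  then have "transpose C $ \<alpha> $ \<beta> = C $ \<alpha> $ \<beta>" by simp
  then show ?thesis by (simp add: transpose_def)
qed

lemma C_pos_real:
  assumes "x \<noteq> (0 :: real ^ 'r)"
  shows "0 < (\<Sum>\<alpha>\<in>UNIV. \<Sum>\<beta>\<in>UNIV. of_int (C $ \<alpha> $ \<beta>) * x $ \<alpha> * x $ \<beta>)"
  using cartan assms by (simp add: simply_laced_cartan_matrix_def)

lemma C_connected:
  assumes "S \<noteq> {}" "S \<noteq> UNIV"
  obtains \<alpha> \<beta> where "\<alpha> \<in> S" "\<beta> \<notin> S" "C $ \<alpha> $ \<beta> \<noteq> 0"
  using cartan assms unfolding simply_laced_cartan_matrix_def by (metis ComplD)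

definition Adj :: "int ^ 'r ^ 'r" where
  "Adj = (\<chi> \<alpha> \<beta>. if \<alpha> = \<beta> then 0 else - C $ \<alpha> $ \<beta>)"

lemma Adj_nonneg [simp]: "0 \<le> Adj $ \<alpha> $ \<beta>"
  using C_off[of \<alpha> \<beta>] by (auto simp: Adj_def)

lemma C_Adj: "C $ \<alpha> $ \<beta> = (if \<alpha> = \<beta> then 2 else 0) - Adj $ \<alpha> $ \<beta>"
  by (simp add: Adj_def)

lemma Adj_sym: "Adj $ \<alpha> $ \<beta> = Adj $ \<beta> $ \<alpha>"
  using C_sym by (simp add: Adj_def)

lemma Adj_diag [simp]: "Adj $ \<alpha> $ \<alpha> = 0"
  by (simp add: Adj_def)

lemma sum_C: "(\<Sum>\<beta>\<in>UNIV. C $ \<alpha> $ \<beta> * x \<beta>) = 2 * x \<alpha> - (\<Sum>\<beta>\<in>UNIV. Adj $ \<alpha> $ \<beta> * x \<beta>)"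
  for x :: "'r \<Rightarrow> int"
  by (simp add: C_Adj left_diff_distrib sum_subtractf if_distrib[of "\<lambda>z. z * _"] cong: if_cong)

definition Creal :: "real ^ 'r ^ 'r" where "Creal = (\<chi> i j. of_int (C $ i $ j))"

text \<open>A convex combination of the identity and C has a quadratic form that is positive off 0,
  hence a trivial kernel. The intermediate value theorem then gives \<open>d\<close> the sign of the
  determinant of the identity.\<close>

lemma det_convex_nonzero:
  assumes s: "0 \<le> s" "s \<le> (1::real)"
  shows "det ((1 - s) *\<^sub>R mat 1 + s *\<^sub>R Creal) \<noteq> 0"
proof -
  let ?M = "(1 - s) *\<^sub>R mat 1 + s *\<^sub>R Creal"
  have "x = 0" if "?M *v x = 0" for x :: "real ^ 'r"
  proof (rule ccontr)
    assume x: "x \<noteq> 0"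
    have "(Creal *v x) \<bullet> x = (\<Sum>\<alpha>\<in>UNIV. \<Sum>\<beta>\<in>UNIV. of_int (C $ \<alpha> $ \<beta>) * x $ \<alpha> * x $ \<beta>)"
      by (simp add: inner_vec_def matrix_vector_mult_def Creal_def sum_distrib_left sum_distrib_right algebra_simps)
    with C_pos_real[OF x] have C0: "0 < (Creal *v x) \<bullet> x" by simp
    have "(?M *v x) \<bullet> x = (1 - s) * (x \<bullet> x) + s * ((Creal *v x) \<bullet> x)"
      by (simp add: matrix_vector_mult_add_rdistrib scaleR_matrix_vector_assoc[symmetric] inner_add_left)
    also have "\<dots> > 0"
    proof (cases "s = 0")
      case False
      with s C0 show ?thesis by (intro add_nonneg_pos) simp_all
    qed (use x in simp)
    finally show False using that by simp
  qed
  then have "\<exists>B. B ** ?M = mat 1" by (simp add: matrix_left_invertible_ker)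
  then show ?thesis by (simp add: invertible_det_nz[symmetric] invertible_left_inverse)
qed

lemma det_Creal: "det Creal = of_int d"
  unfolding Creal_def by (rule det_of_int)

lemma d_pos: "0 < d"
proof (rule ccontr)
  assume "\<not> 0 < d"
  then have "det Creal \<le> 0" by (simp add: det_Creal)
  define g where "g s = det ((1 - s) *\<^sub>R mat 1 + s *\<^sub>R Creal)" for s :: real
  have g: "g 1 \<le> 0" "0 \<le> g 0"
    using \<open>det Creal \<le> 0\<close> by (simp_all add: g_def)
  moreover have "continuous_on {0..1} g"
    unfolding g_def det_def by (intro continuous_intros)
  ultimately obtain s where "0 \<le> s" "s \<le> 1" "g s = 0"
    using IVT2'[of g 1 0 0] by auto
  then show False using det_convex_nonzero[of s] by (simp add: g_def)
qed

text \<open>By Cramer's rule the entries of \<open>d\<close> times the inverse of C are determinants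
  of integer matrices, so the floor in \<open>lam\<close> changes nothing.\<close>

lemma lam_rat:
  "(of_int (lam C \<alpha> \<beta>) :: rat) = of_int d * matrix_inv (\<chi> i j. of_int (C $ i $ j)) $ \<alpha> $ \<beta>"
  and inv_rat: "(\<chi> i j. of_int (C $ i $ j) :: rat ^ 'r ^ 'r) ** matrix_inv (\<chi> i j. of_int (C $ i $ j)) = mat 1"
proof -
  let ?M = "\<chi> i j. of_int (C $ i $ j) :: rat ^ 'r ^ 'r"
  have dM: "det ?M = of_int d" by (rule det_of_int)
  then have nz: "det ?M \<noteq> 0" using d_pos by simp
  then have "invertible ?M" by (simp add: invertible_det_nz)
  then have "?M ** matrix_inv ?M = mat 1 \<and> matrix_inv ?M ** ?M = mat 1"
    unfolding matrix_inv_def invertible_def by (rule someI_ex)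
  then show 1: "?M ** matrix_inv ?M = mat 1" by simp
  define e where "e = (axis \<beta> 1 :: rat ^ 'r)"
  have col: "?M *v (column \<beta> (matrix_inv ?M)) = e"
  proof -
    have "(?M *v (column \<beta> (matrix_inv ?M))) $ i = (?M ** matrix_inv ?M) $ i $ \<beta>" for i
      by (simp add: matrix_vector_mult_def matrix_matrix_mult_def column_def)
    then show ?thesis by (simp add: vec_eq_iff 1 mat_def e_def axis_def)
  qed
  then have "column \<beta> (matrix_inv ?M) = (\<chi> k. det (\<chi> i j. if j = k then e $ i else ?M $ i $ j) / det ?M)"
    using cramer[OF nz] by blast
  then have "of_int d * matrix_inv ?M $ \<alpha> $ \<beta> = det (\<chi> i j. if j = \<alpha> then e $ i else ?M $ i $ j)"
    using nz dM by (simp add: column_def vec_eq_iff)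
  also have "\<dots> = det (\<chi> i j. of_int ((\<chi> i j. if j = \<alpha> then (axis \<beta> 1 :: int ^ 'r) $ i else C $ i $ j) $ i $ j))"
    by (rule arg_cong[of _ _ det]) (simp add: vec_eq_iff e_def axis_def)
  also have "\<dots> = of_int (det (\<chi> i j. if j = \<alpha> then (axis \<beta> 1 :: int ^ 'r) $ i else C $ i $ j))"
    by (rule det_of_int)
  finally have eq: "of_int d * matrix_inv ?M $ \<alpha> $ \<beta> = of_int (det (\<chi> i j. if j = \<alpha> then (axis \<beta> 1 :: int ^ 'r) $ i else C $ i $ j))" .
  show "(of_int (lam C \<alpha> \<beta>) :: rat) = of_int d * matrix_inv ?M $ \<alpha> $ \<beta>"
    by (simp only: lam_def eq floor_of_int)
qed

lemma C_lam: "(\<Sum>\<beta>\<in>UNIV. C $ \<alpha> $ \<beta> * lam C \<beta> \<gamma>) = (if \<alpha> = \<gamma> then d else 0)"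
proof -
  let ?M = "\<chi> i j. of_int (C $ i $ j) :: rat ^ 'r ^ 'r"
  have "(of_int (\<Sum>\<beta>\<in>UNIV. C $ \<alpha> $ \<beta> * lam C \<beta> \<gamma>) :: rat)
      = of_int d * (?M ** matrix_inv ?M) $ \<alpha> $ \<gamma>"
    by (simp add: lam_rat matrix_matrix_mult_def sum_distrib_left algebra_simps)
  also have "\<dots> = of_int (if \<alpha> = \<gamma> then d else 0)"
    by (simp add: inv_rat mat_def)
  finally show ?thesis by (simp only: of_int_eq_iff)
qed

lemma C_inj:
  assumes "\<And>\<alpha>. (\<Sum>\<beta>\<in>UNIV. C $ \<alpha> $ \<beta> * x \<beta>) = 0"
  shows "x \<beta> = (0::int)"
proof (rule ccontr)
  assume nz: "x \<beta> \<noteq> 0"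
  let ?x = "\<chi> \<alpha>. of_int (x \<alpha>) :: real ^ 'r"
  have "?x \<noteq> 0" using nz by (auto simp: vec_eq_iff)
  then have "0 < (\<Sum>\<alpha>\<in>UNIV. \<Sum>\<beta>\<in>UNIV. of_int (C $ \<alpha> $ \<beta>) * ?x $ \<alpha> * ?x $ \<beta>)"
    by (rule C_pos_real)
  also have "\<dots> = of_int (\<Sum>\<alpha>\<in>UNIV. x \<alpha> * (\<Sum>\<beta>\<in>UNIV. C $ \<alpha> $ \<beta> * x \<beta>))"
    by (simp add: sum_distrib_left algebra_simps)
  finally show False by (simp add: assms)
qed

lemma lam_sym: "lam C \<alpha> \<beta> = lam C \<beta> \<alpha>"
proof -
  have "(\<Sum>\<gamma>\<in>UNIV. \<Sum>\<delta>\<in>UNIV. lam C \<gamma> \<alpha> * (C $ \<gamma> $ \<delta> * lam C \<delta> \<beta>)) = d * lam C \<beta> \<alpha>"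
    by (simp add: sum_distrib_left[symmetric] C_lam if_distrib[of "(*) _"] cong: if_cong)
  moreover have "(\<Sum>\<gamma>\<in>UNIV. \<Sum>\<delta>\<in>UNIV. lam C \<gamma> \<alpha> * (C $ \<gamma> $ \<delta> * lam C \<delta> \<beta>))
      = (\<Sum>\<delta>\<in>UNIV. (\<Sum>\<gamma>\<in>UNIV. C $ \<delta> $ \<gamma> * lam C \<gamma> \<alpha>) * lam C \<delta> \<beta>)"
  proof -
    have eq: "lam C \<gamma> \<alpha> * (C $ \<gamma> $ \<delta> * lam C \<delta> \<beta>) = (C $ \<delta> $ \<gamma> * lam C \<gamma> \<alpha>) * lam C \<delta> \<beta>" for \<gamma> \<delta>
      by (subst C_sym) (simp only: ac_simps)
    show ?thesis unfolding sum_distrib_right by (subst sum.swap) (simp only: eq)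
  qed
  moreover have "\<dots> = d * lam C \<alpha> \<beta>"
    by (simp add: C_lam if_distrib[of "\<lambda>z. z * _"] cong: if_cong)
  ultimately show ?thesis using d_pos by simp
qed

lemma lam_C: "(\<Sum>\<beta>\<in>UNIV. lam C \<gamma> \<beta> * C $ \<beta> $ \<alpha>) = (if \<alpha> = \<gamma> then d else 0)"
proof -
  have "lam C \<gamma> \<beta> * C $ \<beta> $ \<alpha> = C $ \<alpha> $ \<beta> * lam C \<beta> \<gamma>" for \<beta>
    by (subst lam_sym, subst C_sym) (rule mult.commute)
  then show ?thesis by (simp add: C_lam)
qed

text \<open>Up to the factor \<open>d\<close>, the coordinates of the Weyl vector in the simple
  roots. The cyclic vector has eigenvalue \<open>tpow (- rho \<alpha>)\<close> under
  \<open>Q \<alpha> 0\<close>.\<close>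

definition rho :: "'r \<Rightarrow> int" where "rho \<alpha> = (\<Sum>\<beta>\<in>UNIV. lam C \<alpha> \<beta>)"

lemma C_rho: "(\<Sum>\<beta>\<in>UNIV. C $ \<alpha> $ \<beta> * rho \<beta>) = d"
  unfolding rho_def sum_distrib_left by (subst sum.swap) (simp add: C_lam)

lemma Adj_rho: "(\<Sum>\<beta>\<in>UNIV. Adj $ \<alpha> $ \<beta> * rho \<beta>) = 2 * rho \<alpha> - d"
  using C_rho[of \<alpha>] by (simp add: sum_C)

text \<open>Let m and p be the negative and positive parts of \<open>rho\<close>. Pairing m with C
  rho gives a value that is at least 0; but m.Cp is at most 0, the supports being disjoint, and m.Cm
  > 0 unless m = 0. Strictness comes from \<open>2 * rho \<alpha> = d +\<close> a nonnegative sum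
  over neighbours.\<close>

lemma rho_pos: "0 < rho \<alpha>"
proof -
  define m where "m \<beta> = max 0 (- rho \<beta>)" for \<beta>
  define p where "p \<beta> = max 0 (rho \<beta>)" for \<beta>
  have rp: "rho \<beta> = p \<beta> - m \<beta>" "0 \<le> m \<beta>" "0 \<le> p \<beta>" "m \<beta> * p \<beta> = 0" for \<beta>
    by (auto simp: p_def m_def max_def)
  have "m \<alpha> = 0" for \<alpha>
  proof (rule ccontr)
    assume "m \<alpha> \<noteq> 0"
    let ?x = "\<chi> \<alpha>. of_int (m \<alpha>) :: real ^ 'r"
    have "?x \<noteq> 0" using \<open>m \<alpha> \<noteq> 0\<close> by (auto simp: vec_eq_iff)
    from C_pos_real[OF this] have "0 < (of_int (\<Sum>\<alpha>\<in>UNIV. m \<alpha> * (\<Sum>\<beta>\<in>UNIV. C $ \<alpha> $ \<beta> * m \<beta>)) :: real)"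
      by (simp add: sum_distrib_left algebra_simps)
    then have 1: "0 < (\<Sum>\<alpha>\<in>UNIV. m \<alpha> * (\<Sum>\<beta>\<in>UNIV. C $ \<alpha> $ \<beta> * m \<beta>))" by (simp only: of_int_0_less_iff)
    have "0 \<le> (\<Sum>\<alpha>\<in>UNIV. m \<alpha> * d)" using rp d_pos by (intro sum_nonneg) simp
    also have "\<dots> = (\<Sum>\<alpha>\<in>UNIV. m \<alpha> * (\<Sum>\<beta>\<in>UNIV. C $ \<alpha> $ \<beta> * p \<beta>)) -
       (\<Sum>\<alpha>\<in>UNIV. m \<alpha> * (\<Sum>\<beta>\<in>UNIV. C $ \<alpha> $ \<beta> * m \<beta>))"
    proof -
      have dd: "d = (\<Sum>\<beta>\<in>UNIV. C $ \<alpha> $ \<beta> * p \<beta>) - (\<Sum>\<beta>\<in>UNIV. C $ \<alpha> $ \<beta> * m \<beta>)" for \<alpha>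
        using C_rho[of \<alpha>] by (simp only: rp(1) right_diff_distrib sum_subtractf)
      have "m \<alpha> * d = m \<alpha> * (\<Sum>\<beta>\<in>UNIV. C $ \<alpha> $ \<beta> * p \<beta>) - m \<alpha> * (\<Sum>\<beta>\<in>UNIV. C $ \<alpha> $ \<beta> * m \<beta>)" for \<alpha>
        by (subst dd[of \<alpha>]) (rule right_diff_distrib)
      then show ?thesis by (simp only: sum_subtractf)
    qed
    also have "(\<Sum>\<alpha>\<in>UNIV. m \<alpha> * (\<Sum>\<beta>\<in>UNIV. C $ \<alpha> $ \<beta> * p \<beta>)) \<le> 0"
    proof (intro sum_nonpos)
      fix \<alpha>
      have "m \<alpha> * (\<Sum>\<beta>\<in>UNIV. C $ \<alpha> $ \<beta> * p \<beta>) = - (m \<alpha> * (\<Sum>\<beta>\<in>UNIV. Adj $ \<alpha> $ \<beta> * p \<beta>))"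
        using rp(4)[of \<alpha>] by (simp add: sum_C right_diff_distrib)
      also have "\<dots> \<le> 0" using rp by (simp add: sum_nonneg)
      finally show "m \<alpha> * (\<Sum>\<beta>\<in>UNIV. C $ \<alpha> $ \<beta> * p \<beta>) \<le> 0" .
    qed
    finally show False using 1 by simp
  qed
  then have nn: "0 \<le> rho \<beta>" for \<beta> using rp by simp
  then have "0 \<le> (\<Sum>\<beta>\<in>UNIV. Adj $ \<alpha> $ \<beta> * rho \<beta>)" by (intro sum_nonneg) simp
  then show ?thesis using Adj_rho[of \<alpha>] d_pos by simp
qed

definition phi :: "int ^ 'r \<Rightarrow> int" where
  "phi c = (\<Sum>\<alpha>\<in>UNIV. rho \<alpha> * c $ \<alpha>)"

lemma om_sym: "om a b = om b a"
proof -
  have eq: "a $ \<beta> * lam C \<beta> \<alpha> * b $ \<alpha> = b $ \<alpha> * lam C \<alpha> \<beta> * a $ \<beta>" for \<alpha> \<beta>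
    by (subst lam_sym) (simp only: ac_simps)
  show ?thesis unfolding om_def by (subst sum.swap) (simp only: eq)
qed

lemma phi_om: "phi c = om c (\<chi> _. 1)" "phi c = om (\<chi> _. 1) c"
proof -
  show "phi c = om c (\<chi> _. 1)"
    by (simp add: phi_def rho_def om_def sum_distrib_left mult.commute)
  then show "phi c = om (\<chi> _. 1) c" by (simp add: om_sym)
qed

lemma addf_phi: "addf phi"
  by (simp add: addf_def phi_def algebra_simps sum.distrib)

lemma sum_axis: "(\<Sum>\<beta>\<in>UNIV. f \<beta> * axis \<alpha> k $ \<beta>) = f \<alpha> * (k::int)"
  by (simp add: axis_def if_distrib[of "(*) _"] cong: if_cong)

lemma phi_axis [simp]: "phi (axis \<alpha> k) = rho \<alpha> * k"
  by (simp add: phi_def sum_axis)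

lemma om_axis: "om a (axis \<alpha> k) = (\<Sum>\<beta>\<in>UNIV. a $ \<beta> * lam C \<beta> \<alpha>) * k"
  by (simp add: om_def sum_axis sum_distrib_right)

lemma om_axis_axis [simp]: "om (axis \<alpha> k) (axis \<beta> l) = k * lam C \<alpha> \<beta> * l"
proof -
  have "(\<Sum>\<gamma>\<in>UNIV. axis \<alpha> k $ \<gamma> * lam C \<gamma> \<beta>) = (\<Sum>\<gamma>\<in>UNIV. lam C \<gamma> \<beta> * axis \<alpha> k $ \<gamma>)"
    by (simp add: mult.commute)
  then show ?thesis by (simp add: om_axis sum_axis mult.commute)
qed

definition nbr :: "'r \<Rightarrow> int ^ 'r" where "nbr \<alpha> = (\<chi> \<beta>. Adj $ \<alpha> $ \<beta>)"

text \<open>\<open>axis \<alpha> 2 - nbr \<alpha>\<close> is row \<alpha> of C, so pairing through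
  \<open>lam\<close> returns \<open>d\<close> times one coordinate. It is also the difference of the
  x-exponents of the two terms of the recursion at index 0, whose combination therefore detects the
  coordinate \<alpha>.\<close>

lemma om_root: "om (axis \<alpha> 2 - nbr \<alpha>) c = d * c $ \<alpha>"
proof -
  have "om (axis \<alpha> 2 - nbr \<alpha>) c = (\<Sum>\<gamma>\<in>UNIV. \<Sum>\<beta>\<in>UNIV. C $ \<alpha> $ \<gamma> * lam C \<gamma> \<beta> * c $ \<beta>)"
    unfolding om_def by (intro sum.cong refl) (simp add: nbr_def axis_def C_Adj)
  also have "\<dots> = (\<Sum>\<beta>\<in>UNIV. (\<Sum>\<gamma>\<in>UNIV. C $ \<alpha> $ \<gamma> * lam C \<gamma> \<beta>) * c $ \<beta>)"
    by (subst sum.swap) (simp add: sum_distrib_right)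
  also have "\<dots> = d * c $ \<alpha>"
    by (simp add: C_lam if_distrib[of "\<lambda>z. z * _"] cong: if_cong)
  finally show ?thesis .
qed

definition bump :: "'r \<Rightarrow> nat \<Rightarrow> int \<Rightarrow> ('r \<Rightarrow> nat \<Rightarrow> int) \<Rightarrow> ('r \<Rightarrow> nat \<Rightarrow> int)" where
  "bump \<alpha> i x n = (\<lambda>\<beta> j. n \<beta> j + (if \<beta> = \<alpha> \<and> j = i then x else 0))"

definition bumpnbr :: "'r \<Rightarrow> nat \<Rightarrow> ('r \<Rightarrow> nat \<Rightarrow> int) \<Rightarrow> ('r \<Rightarrow> nat \<Rightarrow> int)" where
  "bumpnbr \<alpha> i n = (\<lambda>\<beta> j. n \<beta> j + (if j = i then Adj $ \<alpha> $ \<beta> else 0))"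

subsection \<open>Half periods of the linearized system\<close>

definition ip :: "int ^ 'r \<Rightarrow> int ^ 'r \<Rightarrow> int" where
  "ip x y = (\<Sum>\<alpha>\<in>UNIV. x $ \<alpha> * y $ \<alpha>)"

definition aip :: "int ^ 'r \<Rightarrow> int ^ 'r \<Rightarrow> int" where
  "aip x y = (\<Sum>\<alpha>\<in>UNIV. \<Sum>\<beta>\<in>UNIV. Adj $ \<alpha> $ \<beta> * (x $ \<alpha> * y $ \<beta>))"

lemma ip_linear: "ip (x + y) z = ip x z + ip y z" "ip x (y + z) = ip x y + ip x z"
  "ip (x - y) z = ip x z - ip y z" "ip x (y - z) = ip x y - ip x z"
  by (simp_all add: ip_def algebra_simps sum.distrib sum_subtractf)

lemma aip_linear: "aip (x + y) z = aip x z + aip y z" "aip x (y + z) = aip x y + aip x z"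
  "aip (x - y) z = aip x z - aip y z" "aip x (y - z) = aip x y - aip x z"
  by (simp_all add: aip_def algebra_simps sum.distrib sum_subtractf)

lemma ip_sym: "ip x y = ip y x"
  by (simp add: ip_def mult.commute)

lemma aip_sym: "aip x y = aip y x"
proof -
  have eq: "Adj $ \<beta> $ \<alpha> * (x $ \<beta> * y $ \<alpha>) = Adj $ \<alpha> $ \<beta> * (y $ \<alpha> * x $ \<beta>)" for \<alpha> \<beta>
    by (subst Adj_sym) (simp only: ac_simps)
  show ?thesis unfolding aip_def by (subst sum.swap) (simp only: eq)
qed

lemma aip_mono: "(\<And>\<alpha> \<beta>. x $ \<alpha> * y $ \<beta> \<le> x' $ \<alpha> * y' $ \<beta>) \<Longrightarrow> aip x y \<le> aip x' y'"
  unfolding aip_def by (intro sum_mono mult_left_mono) auto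

lemma aip_less:
  assumes "x \<noteq> 0"
  shows "aip x x < 2 * ip x x"
proof -
  let ?x = "\<chi> \<alpha>. of_int (x $ \<alpha>) :: real ^ 'r"
  have "?x \<noteq> 0" using assms by (auto simp: vec_eq_iff)
  then have "0 < (\<Sum>\<alpha>\<in>UNIV. \<Sum>\<beta>\<in>UNIV. of_int (C $ \<alpha> $ \<beta>) * ?x $ \<alpha> * ?x $ \<beta>)"
    by (rule C_pos_real)
  also have "\<dots> = of_int (\<Sum>\<alpha>\<in>UNIV. x $ \<alpha> * (\<Sum>\<beta>\<in>UNIV. C $ \<alpha> $ \<beta> * x $ \<beta>))"
    by (simp add: sum_distrib_left algebra_simps)
  finally have "0 < (\<Sum>\<alpha>\<in>UNIV. x $ \<alpha> * (\<Sum>\<beta>\<in>UNIV. C $ \<alpha> $ \<beta> * x $ \<beta>))"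
    by (simp only: of_int_0_less_iff)
  also have "\<dots> = 2 * ip x x - aip x x"
    unfolding sum_C ip_def aip_def
    by (simp add: right_diff_distrib sum_subtractf sum_distrib_left mult.left_commute)
  finally show ?thesis by simp
qed

lemma aip_le: "aip x x \<le> 2 * ip x x"
  using aip_less[of x] by (cases "x = 0") (auto simp: aip_def ip_def)

text \<open>The Tits form of the bipartite double of the diagram: two copies of the nodes, with
  edges only between the copies. It is constant along the linear recursion that defines
  \<open>Zm\<close>.\<close>

definition qform2 :: "int ^ 'r \<Rightarrow> int ^ 'r \<Rightarrow> int" where
  "qform2 x y = ip x x + ip y y - aip x y"

text \<open>Passing to absolute values p, r only increases the mixed term, and 4
  \<open>aip p r\<close> is the difference of the values of \<open>Adj\<close> at p + r and at p -
  r. The first is below 2 |p + r|^2 by positivity of C; the second is at least -2 |p - r|^2, by the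
  same bound applied to absolute values, since \<open>Adj\<close> has nonnegative entries.\<close>

lemma qform2_pos:
  assumes "x \<noteq> 0 \<or> y \<noteq> 0"
  shows "1 \<le> qform2 x y"
proof -
  define p where "p = (\<chi> \<alpha>. \<bar>x $ \<alpha>\<bar>)"
  define r where "r = (\<chi> \<alpha>. \<bar>y $ \<alpha>\<bar>)"
  define s where "s = (\<chi> \<alpha>. \<bar>(p - r) $ \<alpha>\<bar>)"
  have "x $ \<alpha> * y $ \<beta> \<le> p $ \<alpha> * r $ \<beta>" for \<alpha> \<beta>
    by (simp add: p_def r_def flip: abs_mult)
  then have 1: "aip x y \<le> aip p r" by (rule aip_mono)
  have 2: "ip p p = ip x x" "ip r r = ip y y" "ip s s = ip (p - r) (p - r)"
    by (simp_all add: ip_def p_def r_def s_def)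
  have "p + r \<noteq> 0"
  proof
    assume "p + r = 0"
    then have "\<bar>x $ \<alpha>\<bar> + \<bar>y $ \<alpha>\<bar> = 0" for \<alpha> by (simp add: p_def r_def vec_eq_iff)
    then have "x $ \<alpha> = 0 \<and> y $ \<alpha> = 0" for \<alpha>
      by (smt (verit) abs_ge_zero)
    then have "x = 0 \<and> y = 0" by (simp add: vec_eq_iff)
    with assms show False by simp
  qed
  then have 3: "aip (p + r) (p + r) < 2 * ip (p + r) (p + r)" by (rule aip_less)
  have "(- (p - r)) $ \<alpha> * (p - r) $ \<beta> \<le> s $ \<alpha> * s $ \<beta>" for \<alpha> \<beta>
  proof -
    have "(- (p - r)) $ \<alpha> * (p - r) $ \<beta> = - ((p - r) $ \<alpha> * (p - r) $ \<beta>)"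
      by (simp add: algebra_simps)
    also have "\<dots> \<le> \<bar>(p - r) $ \<alpha> * (p - r) $ \<beta>\<bar>" by (rule abs_ge_minus_self)
    also have "\<dots> = s $ \<alpha> * s $ \<beta>" by (simp only: s_def vec_lambda_beta abs_mult)
    finally show ?thesis .
  qed
  then have "aip (- (p - r)) (p - r) \<le> aip s s" by (intro aip_mono)
  moreover have "aip (- (p - r)) (p - r) = - aip (p - r) (p - r)"
    using aip_linear(3)[of 0 "p - r" "p - r"] by (simp add: aip_def)
  ultimately have 4: "- aip (p - r) (p - r) \<le> 2 * ip (p - r) (p - r)"
    using aip_le[of s] 2(3) by linarith
  from 3 4 have "4 * aip p r < 4 * ip p p + 4 * ip r r"
    by (simp add: aip_linear ip_linear aip_sym[of r p] ip_sym[of r p])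
  with 1 2 show ?thesis by (simp add: qform2_def)
qed

text \<open>If both the positive part and the negative part were nonzero, each would contribute at
  least 1 to the form, and the cross terms only add to it, so the value would be at least 2. This is
  the sign property of roots.\<close>

lemma sign_coherent:
  assumes "qform2 x y = 1"
  shows "(\<forall>\<alpha>. 0 \<le> x $ \<alpha> \<and> 0 \<le> y $ \<alpha>) \<or> (\<forall>\<alpha>. x $ \<alpha> \<le> 0 \<and> y $ \<alpha> \<le> 0)"
proof (rule ccontr)
  assume nc: "\<not> ?thesis"
  define xp where "xp = (\<chi> \<alpha>. max 0 (x $ \<alpha>))"
  define xm where "xm = (\<chi> \<alpha>. max 0 (- x $ \<alpha>))"
  define yp where "yp = (\<chi> \<alpha>. max 0 (y $ \<alpha>))"
  define ym where "ym = (\<chi> \<alpha>. max 0 (- y $ \<alpha>))"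
  have xy: "x = xp - xm" "y = yp - ym"
    by (auto simp: vec_eq_iff xp_def xm_def yp_def ym_def max_def)
  have ortho: "ip xp xm = 0" "ip yp ym = 0"
    unfolding ip_def by (rule sum.neutral, simp add: xp_def xm_def yp_def ym_def max_def)+
  have nn: "0 \<le> aip xp ym" "0 \<le> aip xm yp"
    unfolding aip_def by (intro sum_nonneg mult_nonneg_nonneg; simp add: xp_def xm_def yp_def ym_def)+
  have "qform2 xp yp + qform2 xm ym \<le> qform2 x y"
    unfolding qform2_def xy using ortho nn
    by (simp add: ip_linear aip_linear ip_sym[of xm xp] ip_sym[of ym yp])
  moreover have "1 \<le> qform2 xp yp"
  proof (rule qform2_pos, rule ccontr)
    assume "\<not> (xp \<noteq> 0 \<or> yp \<noteq> 0)"
    then have "\<forall>\<alpha>. x $ \<alpha> \<le> 0 \<and> y $ \<alpha> \<le> 0"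
      by (simp add: xp_def yp_def vec_eq_iff) (metis max.cobounded2)
    with nc show False by blast
  qed
  moreover have "1 \<le> qform2 xm ym"
  proof (rule qform2_pos, rule ccontr)
    assume "\<not> (xm \<noteq> 0 \<or> ym \<noteq> 0)"
    then have "\<forall>\<alpha>. 0 \<le> x $ \<alpha> \<and> 0 \<le> y $ \<alpha>"
      by (simp add: xm_def ym_def vec_eq_iff) (metis max.cobounded2 neg_le_0_iff_le)
    with nc show False by blast
  qed
  ultimately show False using assms by linarith
qed

text \<open>Chebyshev polynomials of the second kind in \<open>Adj\<close>, of degree one less than
  the index. Their rows are the exponents of the lowest terms of the Q-system as long as the product
  over neighbours dominates there.\<close>

fun Zm :: "nat \<Rightarrow> int ^ 'r ^ 'r" where
  "Zm 0 = 0"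
| "Zm (Suc 0) = mat 1"
| "Zm (Suc (Suc m)) = Adj ** Zm (Suc m) - Zm m"

lemma matrix_diff_ldistrib: "A ** (B - B') = A ** B - A ** (B' :: int ^ 'r ^ 'r)"
  by (simp add: matrix_matrix_mult_def vec_eq_iff right_diff_distrib sum_subtractf)

lemma matrix_diff_rdistrib: "(B - B') ** A = B ** A - B' ** (A :: int ^ 'r ^ 'r)"
  by (simp add: matrix_matrix_mult_def vec_eq_iff left_diff_distrib sum_subtractf)

lemma Zm_comm: "Adj ** Zm m = Zm m ** Adj"
proof (induction m rule: Zm.induct)
  case (3 m)
  then show ?case
    by (simp add: matrix_diff_ldistrib matrix_diff_rdistrib) (metis matrix_mul_assoc)
next
  case 1
  show ?case by (simp add: matrix_matrix_mult_def vec_eq_iff)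
next
  case 2
  show ?case by simp
qed

lemma transpose_Zm: "transpose (Zm m) = Zm m"
proof (induction m rule: Zm.induct)
  case (3 m)
  have "transpose Adj = Adj" by (simp add: transpose_def vec_eq_iff Adj_sym)
  have "transpose (Zm (Suc (Suc m))) = transpose (Adj ** Zm (Suc m)) - transpose (Zm m)"
    by (simp add: transpose_def vec_eq_iff)
  also have "\<dots> = Zm (Suc m) ** Adj - Zm m"
    using 3 \<open>transpose Adj = Adj\<close> by (simp add: matrix_transpose_mul)
  finally show ?case by (simp add: Zm_comm)
qed (simp_all add: transpose_def vec_eq_iff mat_def)

lemma Zm_sym: "Zm m $ \<alpha> $ \<gamma> = Zm m $ \<gamma> $ \<alpha>"
proof -
  have "transpose (Zm m) $ \<alpha> $ \<gamma> = Zm m $ \<alpha> $ \<gamma>" by (simp add: transpose_Zm)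
  then show ?thesis by (simp add: transpose_def)
qed

lemma Zm_row: "Zm (Suc (Suc m)) $ \<alpha> = (\<Sum>\<beta>\<in>UNIV. Adj $ \<alpha> $ \<beta> *s Zm (Suc m) $ \<beta>) - Zm m $ \<alpha>"
  by (simp add: vec_eq_iff matrix_matrix_mult_def)

lemma Zm_row': "Zm (Suc (Suc m)) $ \<gamma> $ \<alpha> = (\<Sum>\<beta>\<in>UNIV. Adj $ \<alpha> $ \<beta> * Zm (Suc m) $ \<gamma> $ \<beta>) - Zm m $ \<gamma> $ \<alpha>"
proof -
  have "(Adj ** Zm (Suc m)) $ \<gamma> $ \<alpha> = (Zm (Suc m) ** Adj) $ \<gamma> $ \<alpha>"
    by (subst Zm_comm) (rule refl)
  also have "\<dots> = (\<Sum>\<beta>\<in>UNIV. Adj $ \<alpha> $ \<beta> * Zm (Suc m) $ \<gamma> $ \<beta>)"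
    by (simp add: matrix_matrix_mult_def Adj_sym[of \<alpha>] mult.commute)
  finally show ?thesis by simp
qed

text \<open>The recursion turns \<open>aip x u\<close>, for u the middle one of three consecutive
  rows, into the sum of \<open>ip x\<close> at the two outer rows. Taking x to be either outer row
  shows that the form is conserved.\<close>

lemma qform2_Zm: "qform2 (Zm m $ \<gamma>) (Zm (Suc m) $ \<gamma>) = 1"
proof (induction m)
  case 0
  show ?case
    by (simp add: qform2_def ip_def aip_def mat_def if_distrib[of "\<lambda>z. z * _"] cong: if_cong)
next
  case (Suc m)
  let ?u = "\<lambda>m. Zm m $ \<gamma>"
  have "aip x (?u (Suc m)) = ip x (?u (Suc (Suc m))) + ip x (?u m)" for x
  proof -
    have "aip x (?u (Suc m)) = (\<Sum>\<alpha>\<in>UNIV. x $ \<alpha> * (\<Sum>\<beta>\<in>UNIV. Adj $ \<alpha> $ \<beta> * ?u (Suc m) $ \<beta>))"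
      by (simp add: aip_def sum_distrib_left mult.left_commute)
    also have "\<dots> = (\<Sum>\<alpha>\<in>UNIV. x $ \<alpha> * (?u (Suc (Suc m)) $ \<alpha> + ?u m $ \<alpha>))"
      using Zm_row'[of m \<gamma>] by (simp del: Zm.simps)
    finally show ?thesis by (simp add: ip_def distrib_left sum.distrib del: Zm.simps)
  qed
  from this[of "?u (Suc (Suc m))"] this[of "?u m"] Suc show ?case
    by (simp add: qform2_def aip_sym[of "?u (Suc m)"] ip_sym[of "?u m" "?u (Suc (Suc m))"] del: Zm.simps)
qed

text \<open>Since \<open>Adj\<close> and \<open>Zm m\<close> commute, a zero row \<alpha> makes row
  \<alpha> of their product zero. That row is a nonnegative combination of the rows at the
  neighbours of \<alpha>, so these vanish too, and the diagram is connected.\<close>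

lemma Zm_zero_spread:
  assumes nn: "\<And>\<alpha> \<gamma>. 0 \<le> Zm m $ \<alpha> $ \<gamma>" and z: "Zm m $ \<gamma> = 0"
  shows "Zm m = 0"
proof -
  define S where "S = {\<gamma>. Zm m $ \<gamma> = 0}"
  have "S = UNIV"
  proof (rule ccontr)
    assume "S \<noteq> UNIV"
    moreover have "S \<noteq> {}" using z by (auto simp: S_def)
    ultimately obtain \<alpha> \<beta> where ab: "\<alpha> \<in> S" "\<beta> \<notin> S" "C $ \<alpha> $ \<beta> \<noteq> 0"
      by (meson C_connected)
    then have "\<alpha> \<noteq> \<beta>" by auto
    with ab have A: "Adj $ \<alpha> $ \<beta> > 0" using C_off[of \<alpha> \<beta>] by (auto simp: Adj_def)
    have "Zm m $ \<beta> $ \<delta> = 0" for \<delta>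
    proof -
      have "(Adj ** Zm m) $ \<alpha> $ \<delta> = (\<Sum>\<beta>\<in>UNIV. Zm m $ \<alpha> $ \<beta> * Adj $ \<beta> $ \<delta>)"
        unfolding Zm_comm by (simp add: matrix_matrix_mult_def)
      also have "\<dots> = 0" using ab(1) by (simp add: S_def)
      finally have "(\<Sum>\<beta>\<in>UNIV. Adj $ \<alpha> $ \<beta> * Zm m $ \<beta> $ \<delta>) = 0"
        by (simp add: matrix_matrix_mult_def)
      then have "\<forall>\<beta>\<in>UNIV. Adj $ \<alpha> $ \<beta> * Zm m $ \<beta> $ \<delta> = 0"
        by (subst (asm) sum_nonneg_eq_0_iff) (auto simp: nn)
      then show ?thesis using A by (metis UNIV_I less_irrefl mult_eq_0_iff)
    qed
    with ab(2) show False by (simp add: S_def vec_eq_iff)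
  qed
  then show ?thesis by (auto simp: S_def vec_eq_iff)
qed

text \<open>If all entries stayed nonnegative, \<open>phi\<close> of a fixed row would be a
  nonnegative integer sequence whose second difference is \<open>- d\<close> times the row sum,
  hence at most -1. Such a sequence becomes negative.\<close>

lemma Zm_eventually_negative: "\<exists>m \<alpha> \<gamma>. Zm m $ \<alpha> $ \<gamma> < 0"
proof (rule ccontr)
  assume "\<not> ?thesis"
  then have nn: "0 \<le> Zm m $ \<alpha> $ \<gamma>" for m \<alpha> \<gamma> by (simp add: not_less)
  obtain \<gamma> :: 'r where True by simp
  define f where "f m = phi (Zm m $ \<gamma>)" for m
  define s where "s m = (\<Sum>\<alpha>\<in>UNIV. Zm m $ \<gamma> $ \<alpha>)" for m
  have rec: "f (Suc (Suc m)) = 2 * f (Suc m) - f m - d * s (Suc m)" for m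
  proof -
    have "f (Suc (Suc m)) = (\<Sum>\<alpha>\<in>UNIV. rho \<alpha> * (\<Sum>\<beta>\<in>UNIV. Adj $ \<alpha> $ \<beta> * Zm (Suc m) $ \<gamma> $ \<beta>)) - f m"
      unfolding f_def phi_def Zm_row' by (simp add: right_diff_distrib sum_subtractf)
    also have "(\<Sum>\<alpha>\<in>UNIV. rho \<alpha> * (\<Sum>\<beta>\<in>UNIV. Adj $ \<alpha> $ \<beta> * Zm (Suc m) $ \<gamma> $ \<beta>))
        = (\<Sum>\<beta>\<in>UNIV. (\<Sum>\<alpha>\<in>UNIV. Adj $ \<beta> $ \<alpha> * rho \<alpha>) * Zm (Suc m) $ \<gamma> $ \<beta>)"
    proof -
      have eq: "rho \<alpha> * (Adj $ \<alpha> $ \<beta> * Zm (Suc m) $ \<gamma> $ \<beta>) = Adj $ \<beta> $ \<alpha> * rho \<alpha> * Zm (Suc m) $ \<gamma> $ \<beta>" for \<alpha> \<beta>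
        by (subst Adj_sym) (simp only: ac_simps)
      show ?thesis
        unfolding sum_distrib_left sum_distrib_right eq by (rule sum.swap)
    qed
    also have "\<dots> = 2 * f (Suc m) - d * s (Suc m)"
      unfolding Adj_rho f_def s_def phi_def
      by (simp add: left_diff_distrib sum_subtractf sum_distrib_left mult.assoc del: Zm.simps)
    finally show ?thesis by simp
  qed
  have nz: "Zm (Suc m) $ \<gamma> \<noteq> 0" for m
  proof
    assume z: "Zm (Suc m) $ \<gamma> = 0"
    have "Zm (Suc (Suc m)) $ \<gamma> $ \<alpha> = - Zm m $ \<gamma> $ \<alpha>" for \<alpha>
      unfolding Zm_row' by (simp add: z)
    then have "Zm m $ \<gamma> $ \<alpha> = 0" for \<alpha>
      using nn[of "Suc (Suc m)" \<gamma> \<alpha>] nn[of m \<gamma> \<alpha>] by (simp del: Zm.simps)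
    then have "Zm m $ \<gamma> = 0" by (simp add: vec_eq_iff)
    with z qform2_Zm[of m \<gamma>] show False by (simp add: qform2_def ip_def aip_def)
  qed
  have s1: "1 \<le> s (Suc m)" for m
  proof -
    from nz obtain \<alpha> where "Zm (Suc m) $ \<gamma> $ \<alpha> \<noteq> 0" by (auto simp: vec_eq_iff)
    then have "1 \<le> Zm (Suc m) $ \<gamma> $ \<alpha>" using nn[of "Suc m" \<gamma> \<alpha>] by linarith
    also have "\<dots> \<le> s (Suc m)" unfolding s_def by (rule member_le_sum) (auto simp: nn)
    finally show ?thesis .
  qed
  have slope: "f (Suc m) - f m \<le> f (Suc 0) - f 0 - int m" for m
  proof (induction m)
    case (Suc m)
    have "1 \<le> d * s (Suc m)" using s1[of m] d_pos mult_mono[of 1 d 1 "s (Suc m)"] by simp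
    with Suc rec[of m] show ?case by simp
  qed simp
  have f_nn: "0 \<le> f m" for m
    unfolding f_def phi_def by (intro sum_nonneg mult_nonneg_nonneg) (auto simp: nn rho_pos less_imp_le)
  have up: "f (m + k) \<le> f m - int k" if "m \<ge> nat (f (Suc 0) - f 0 + 1)" for m k
  proof (induction k)
    case (Suc k)
    have "f (Suc (m + k)) - f (m + k) \<le> - 1" using slope[of "m + k"] that by linarith
    with Suc show ?case by simp
  qed simp
  define m0 where "m0 = nat (f (Suc 0) - f 0 + 1)"
  have "f (m0 + nat (f m0 + 1)) \<le> f m0 - int (nat (f m0 + 1))" by (rule up) (simp add: m0_def)
  then show False using f_nn[of m0] f_nn[of "m0 + nat (f m0 + 1)"] by simp
qed

text \<open>\<open>H\<close> plays the role of the Coxeter number and \<open>Zm (H - 1)\<close> is the permutation matrix of the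
  diagram automorphism \<open>- w\<^sub>0\<close>.\<close>

lemma coxeter_period:
  obtains H where "2 \<le> H" "\<And>m \<alpha> \<gamma>. m \<le> H \<Longrightarrow> 0 \<le> Zm m $ \<alpha> $ \<gamma>"
    "\<And>m \<alpha>. 1 \<le> m \<Longrightarrow> m < H \<Longrightarrow> \<exists>\<gamma>. 0 < Zm m $ \<alpha> $ \<gamma>"
    "Zm H = 0" "\<And>\<gamma>. \<exists>\<alpha>. Zm (H - 1) $ \<alpha> = axis \<gamma> 1"
proof -
  define N where "N = (LEAST m. \<exists>\<alpha> \<gamma>. Zm m $ \<alpha> $ \<gamma> < 0)"
  have N: "\<exists>\<alpha> \<gamma>. Zm N $ \<alpha> $ \<gamma> < 0"
    unfolding N_def using Zm_eventually_negative by (rule LeastI_ex)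
  have nn: "0 \<le> Zm m $ \<alpha> $ \<gamma>" if "m < N" for m \<alpha> \<gamma>
    using not_less_Least[of m "\<lambda>m. \<exists>\<alpha> \<gamma>. Zm m $ \<alpha> $ \<gamma> < 0"] that
    unfolding N_def by (force simp: not_less)
  from N obtain \<gamma> \<alpha> where neg: "Zm N $ \<gamma> $ \<alpha> < 0" by auto
  have "N \<noteq> 0" using neg by (intro notI) simp
  moreover have "N \<noteq> 1" using neg by (auto simp: mat_def split: if_splits)
  ultimately obtain H where H: "N = Suc H" "1 \<le> H" by (cases N) auto
  have nn': "0 \<le> Zm m $ \<alpha> $ \<gamma>" if "m \<le> H" for m \<alpha> \<gamma> using nn[of m] that H by simp
  \<comment> \<open>Row \<gamma> of the first matrix with a negative entry is sign coherent with its
    predecessor, which is therefore nonpositive; coming before the first negative index, it is also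
    nonnegative.\<close>
  have "Zm H $ \<gamma> $ \<beta> \<le> 0" for \<beta>
    using sign_coherent[OF qform2_Zm[of H \<gamma>]] neg H by (auto simp: not_le[symmetric] simp del: Zm.simps)
  then have "Zm H $ \<gamma> = 0" using nn'[of H \<gamma>] by (simp add: vec_eq_iff order_antisym)
  from Zm_zero_spread[OF nn' this] have ZH: "Zm H = 0" by simp
  have "Zm 1 $ \<gamma> $ \<gamma> = 1" by (simp add: mat_def)
  with ZH have "H \<noteq> 1" by auto
  with H have H2: "2 \<le> H" by simp
  have pos: "\<exists>\<gamma>. 0 < Zm m $ \<alpha> $ \<gamma>" if m: "1 \<le> m" "m < H" for m \<alpha>
  proof (rule ccontr)
    assume "\<not> ?thesis"
    then have "Zm m $ \<alpha> $ \<gamma> = 0" for \<gamma> using nn'[of m \<alpha> \<gamma>] m by (simp add: not_less order_antisym)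
    then have "Zm m $ \<alpha> = 0" by (simp add: vec_eq_iff)
    from Zm_zero_spread[OF nn' this] m have z: "Zm m = 0" by simp
    obtain k where k: "m = Suc k" using m by (cases m) auto
    have "Zm (Suc m) $ \<alpha> $ \<beta> = - Zm k $ \<alpha> $ \<beta>" for \<beta>
      unfolding k Zm_row' by (simp add: z[unfolded k])
    then have "Zm k $ \<alpha> $ \<beta> = 0" for \<beta>
      using nn'[of "Suc m" \<alpha> \<beta>] nn'[of k \<alpha> \<beta>] m k by (simp del: Zm.simps)
    then have "Zm k $ \<alpha> = 0" by (simp add: vec_eq_iff)
    with z k qform2_Zm[of k \<alpha>] show False by (simp add: qform2_def ip_def aip_def)
  qed
  obtain G where G: "H = Suc G" using H2 by (cases H) auto
  have unit: "\<exists>\<alpha>. Zm G $ \<gamma> = axis \<alpha> 1" for \<gamma>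
  proof -
    \<comment> \<open>As the next matrix is zero, the conserved form is just the squared length, so
      the row is a nonnegative integer vector of length 1.\<close>
    have "ip (Zm G $ \<gamma>) (Zm G $ \<gamma>) = 1"
      using qform2_Zm[of G \<gamma>] ZH G by (simp add: qform2_def ip_def aip_def)
    then have s: "(\<Sum>\<beta>\<in>UNIV. (Zm G $ \<gamma> $ \<beta>)\<^sup>2) = 1" by (simp add: ip_def power2_eq_square)
    then obtain \<alpha> where a: "Zm G $ \<gamma> $ \<alpha> \<noteq> 0" by fastforce
    have "(\<Sum>\<beta>\<in>UNIV. (Zm G $ \<gamma> $ \<beta>)\<^sup>2) = (Zm G $ \<gamma> $ \<alpha>)\<^sup>2 + (\<Sum>\<beta>\<in>UNIV - {\<alpha>}. (Zm G $ \<gamma> $ \<beta>)\<^sup>2)"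
      by (rule sum.remove) auto
    moreover have "1 \<le> (Zm G $ \<gamma> $ \<alpha>)\<^sup>2" using a by (smt (verit) zero_less_power2)
    moreover have "0 \<le> (\<Sum>\<beta>\<in>UNIV - {\<alpha>}. (Zm G $ \<gamma> $ \<beta>)\<^sup>2)" by (simp add: sum_nonneg)
    ultimately have e: "(Zm G $ \<gamma> $ \<alpha>)\<^sup>2 = 1" "(\<Sum>\<beta>\<in>UNIV - {\<alpha>}. (Zm G $ \<gamma> $ \<beta>)\<^sup>2) = 0"
      using s by linarith+
    from e(2) have "\<forall>\<beta>\<in>UNIV - {\<alpha>}. (Zm G $ \<gamma> $ \<beta>)\<^sup>2 = 0"
      by (subst (asm) sum_nonneg_eq_0_iff) auto
    moreover have "Zm G $ \<gamma> $ \<alpha> = 1"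
      using e(1) nn'[of G \<gamma> \<alpha>] G by (auto simp: power2_eq_1_iff)
    ultimately have "Zm G $ \<gamma> = axis \<alpha> 1" by (auto simp: vec_eq_iff axis_def)
    then show ?thesis by blast
  qed
  have "\<exists>\<alpha>. Zm G $ \<alpha> = axis \<gamma> 1" for \<gamma>
  proof -
    obtain \<alpha> where a: "Zm G $ \<gamma> = axis \<alpha> 1" using unit by blast
    obtain \<beta> where b: "Zm G $ \<alpha> = axis \<beta> 1" using unit by blast
    \<comment> \<open>\<open>Zm G\<close> is symmetric, so the permutation of the nodes is an
      involution.\<close>
    have "Zm G $ \<alpha> $ \<gamma> = 1" using a by (simp add: Zm_sym[of G \<alpha>] axis_def)
    then have "\<beta> = \<gamma>" using b by (auto simp: axis_def split: if_splits)
    with b show ?thesis by blast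
  qed
  then show thesis
    using that[OF H2 nn' pos ZH] G by simp
qed

end

subsection \<open>Leading terms and commutation relations of the Q-system\<close>

context torus
begin

lemma ring_qtorus: "ring (qtorus C)"
proof (rule ringI)
  show "abelian_group (qtorus C)"
  proof (rule abelian_groupI)
    fix x assume "x \<in> carrier (qtorus C)"
    show "\<exists>y\<in>carrier (qtorus C). y \<oplus>\<^bsub>qtorus C\<^esub> x = \<zero>\<^bsub>qtorus C\<^esub>"
      by (rule bexI[of _ "- x"]) (simp_all add: qtorus_def)
  qed (simp_all add: qtorus_def algebra_simps)
  show "monoid (qtorus C)"
    by (rule monoidI) (simp_all add: qtorus_def T.mult_assoc)
qed (simp_all add: qtorus_def qt_mult_add_left qt_mult_add_right)

lemma qtorus_simps [simp]:
  "carrier (qtorus C) = UNIV" "monoid.mult (qtorus C) = tmult" "one (qtorus C) = 1"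
  "zero (qtorus C) = 0" "add (qtorus C) = (+)"
  by (simp_all add: qtorus_def)

lemma qtorus_minus [simp]: "f \<ominus>\<^bsub>qtorus C\<^esub> g = f - g"
proof -
  interpret R: ring "qtorus C" by (rule ring_qtorus)
  have "\<ominus>\<^bsub>qtorus C\<^esub> g = - g" by (rule R.minus_equality) simp_all
  then show ?thesis by (simp add: a_minus_def)
qed

lemma qtorus_nat_pow [simp]: "f [^]\<^bsub>qtorus C\<^esub> (n::nat) = f \<up> n"
  by (induction n) (simp_all add: T.power_Suc2 del: T.power_Suc)

lemma list_product_lprod: "list_product (qtorus C) (map f xs) = lprod f xs"
  by (induction xs) (simp_all add: list_product_def)

lemma topmon_power01:
  "addf \<psi> \<Longrightarrow> topmon \<psi> f k \<Longrightarrow> n \<le> 1 \<Longrightarrow> topmon \<psi> (f \<up> n) (if n = 1 then k else 0)"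
  by (cases n) (auto simp: topmon_one)

lemma qcomm_same_power: "qcomm 0 f f"
  by (simp add: qcomm_def)

text \<open>\<open>p\<close>, \<open>q\<close>, \<open>r\<close> stand for three consecutive indices
  and \<open>E\<close> for the right-hand side of the recursion. After multiplication by
  \<open>p\<close> the element \<open>r\<close> is replaced by \<open>E\<close>, which commutes with
  \<open>q\<close>; then \<open>p\<close> is cancelled.\<close>

lemma q_r_qcomm:
  assumes rec: "\<And>\<alpha>. r \<alpha> \<star> p \<alpha> = tt (c \<alpha>) \<star> E \<alpha>"
    and Eq: "\<And>\<alpha> \<beta>. qcomm 0 (E \<alpha>) (q \<beta>)"
    and pq: "\<And>\<alpha> \<beta>. qcomm (l \<alpha> \<beta>) (p \<alpha>) (q \<beta>)"
    and cancel: "\<And>f f' \<alpha>. f \<star> p \<alpha> = f' \<star> p \<alpha> \<Longrightarrow> f = f'"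
  shows "qcomm (l \<beta> \<alpha>) (q \<alpha>) (r \<beta>)"
proof -
  have "(q \<alpha> \<star> r \<beta>) \<star> p \<beta> = q \<alpha> \<star> (tt (c \<beta>) \<star> E \<beta>)"
    by (simp only: T.mult_assoc rec)
  also have "\<dots> = tt (c \<beta>) \<star> (q \<alpha> \<star> E \<beta>)"
    by (rule qt_scalar_left_commute)
  also have "q \<alpha> \<star> E \<beta> = E \<beta> \<star> q \<alpha>"
    using qcommD[OF Eq, of \<beta> \<alpha>] by simp
  also have "tt (c \<beta>) \<star> (E \<beta> \<star> q \<alpha>) = (r \<beta> \<star> p \<beta>) \<star> q \<alpha>"
    by (simp only: T.mult_assoc rec)
  also have "\<dots> = r \<beta> \<star> (tt (l \<beta> \<alpha>) \<star> (q \<alpha> \<star> p \<beta>))"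
    by (simp only: T.mult_assoc qcommD[OF pq])
  also have "\<dots> = (tt (l \<beta> \<alpha>) \<star> (r \<beta> \<star> q \<alpha>)) \<star> p \<beta>"
    by (simp only: T.mult_assoc qt_scalar_left_commute[of "r \<beta>"])
  finally show ?thesis unfolding qcomm_def by (rule cancel)
qed

text \<open>Multiplied by \<open>p \<beta> \<star> p \<alpha>\<close>, either order of the two
  factors collapses to \<open>E \<alpha> \<star> E \<beta>\<close> with a scalar that is symmetric
  in \<alpha> and \<beta>.\<close>

lemma r_r_qcomm:
  assumes rec: "\<And>\<alpha>. r \<alpha> \<star> p \<alpha> = tt (c \<alpha>) \<star> E \<alpha>"
    and Ep: "\<And>\<alpha> \<beta>. \<alpha> \<noteq> \<beta> \<Longrightarrow> qcomm (2 * l \<alpha> \<beta>) (p \<beta>) (E \<alpha>)"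
    and EE: "\<And>\<alpha> \<beta>. qcomm 0 (E \<alpha>) (E \<beta>)"
    and pp: "\<And>\<alpha> \<beta>. qcomm 0 (p \<alpha>) (p \<beta>)"
    and l: "\<And>\<alpha> \<beta>. l \<alpha> \<beta> = l \<beta> \<alpha>"
    and cancel: "\<And>f f' \<alpha>. f \<star> p \<alpha> = f' \<star> p \<alpha> \<Longrightarrow> f = f'"
    and ne: "\<alpha> \<noteq> \<beta>"
  shows "qcomm 0 (r \<alpha>) (r \<beta>)"
proof -
  have two: "r \<alpha> \<star> r \<beta> \<star> p \<beta> \<star> p \<alpha> = tt (c \<beta> - 2 * l \<beta> \<alpha> + c \<alpha>) \<star> (E \<alpha> \<star> E \<beta>)"
    if "\<alpha> \<noteq> \<beta>" for \<alpha> \<beta>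
  proof -
    have "r \<alpha> \<star> r \<beta> \<star> p \<beta> \<star> p \<alpha> = r \<alpha> \<star> (tt (c \<beta>) \<star> (E \<beta> \<star> p \<alpha>))"
      by (simp only: T.mult_assoc[symmetric]) (simp only: T.mult_assoc rec)
    also have "\<dots> = tt (c \<beta>) \<star> (r \<alpha> \<star> (E \<beta> \<star> p \<alpha>))"
      by (rule qt_scalar_left_commute)
    also have "E \<beta> \<star> p \<alpha> = tt (- (2 * l \<beta> \<alpha>)) \<star> (p \<alpha> \<star> E \<beta>)"
      using that by (intro qcommD qcomm_sym Ep) simp
    also have "r \<alpha> \<star> (tt (- (2 * l \<beta> \<alpha>)) \<star> (p \<alpha> \<star> E \<beta>)) = tt (- (2 * l \<beta> \<alpha>)) \<star> (r \<alpha> \<star> p \<alpha> \<star> E \<beta>)"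
      by (simp only: qt_scalar_left_commute[of "r \<alpha>"] T.mult_assoc)
    finally show ?thesis by (simp add: rec tt_mult' T.mult_assoc algebra_simps)
  qed
  have "r \<alpha> \<star> r \<beta> \<star> p \<beta> \<star> p \<alpha> = tt (c \<beta> - 2 * l \<beta> \<alpha> + c \<alpha>) \<star> (E \<beta> \<star> E \<alpha>)"
    using two[OF ne] qcommD[OF EE, of \<alpha> \<beta>] by simp
  also have "\<dots> = r \<beta> \<star> r \<alpha> \<star> p \<alpha> \<star> p \<beta>"
    using two[OF ne[symmetric]] l[of \<alpha> \<beta>] by (simp add: algebra_simps)
  also have "\<dots> = r \<beta> \<star> r \<alpha> \<star> p \<beta> \<star> p \<alpha>"
    using qcommD[OF pp, of \<alpha> \<beta>] by (simp add: T.mult_assoc)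
  finally have "r \<alpha> \<star> r \<beta> = r \<beta> \<star> r \<alpha>" by (blast dest: cancel)
  then show ?thesis by (simp add: qcomm_def)
qed

end

lemma set_indices [simp]: "set indices = UNIV"
  by (simp add: indices_def)

lemma distinct_indices [simp]: "distinct indices"
  by (simp add: indices_def)

lemma sum_list_indices: "sum_list (map f indices) = (\<Sum>\<alpha>\<in>UNIV. f \<alpha>)"
  by (simp add: sum_list_distinct_conv_sum_set)

locale qsys = cartan C for C :: "'r::{finite,linorder} sqmat" +
  fixes Q :: "'r \<Rightarrow> int \<Rightarrow> 'r qt"
  assumes Qsys: "quantum_Q_system C Q"
begin

definition nprod :: "'r \<Rightarrow> int \<Rightarrow> 'r qt" where
  "nprod \<alpha> m = lprod (\<lambda>\<beta>. Q \<beta> m \<up> nat (Adj $ \<alpha> $ \<beta>)) indices"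

lemma Adj_01: "nat (Adj $ \<alpha> $ \<beta>) \<le> 1" "Adj $ \<alpha> $ \<beta> = 0 \<or> Adj $ \<alpha> $ \<beta> = 1"
  using C_off[of \<alpha> \<beta>] by (auto simp: Adj_def)

lemma Q_0: "Q \<alpha> 0 = Poly_Mapping.single (axis \<alpha> 1, 0) 1"
  and Q_1: "Q \<alpha> 1 = Poly_Mapping.single (0, axis \<alpha> 1) 1"
  using Qsys by (simp_all add: quantum_Q_system_def qgen0_def qgen1_def)

lemma Q_rec: "tt (lam C \<alpha> \<alpha>) \<star> (Q \<alpha> (m + 1) \<star> Q \<alpha> (m - 1)) = Q \<alpha> m \<star> Q \<alpha> m - nprod \<alpha> m"
proof -
  have "list_product (qtorus C)
          (map (\<lambda>\<beta>. Q \<beta> m [^]\<^bsub>qtorus C\<^esub> (- (C $ \<alpha> $ \<beta>))) (filter (\<lambda>\<beta>. \<beta> \<noteq> \<alpha>) xs))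
      = lprod (\<lambda>\<beta>. Q \<beta> m \<up> nat (Adj $ \<alpha> $ \<beta>)) xs" for xs
  proof (induction xs)
    case (Cons \<beta> xs)
    have "Q \<beta> m [^]\<^bsub>qtorus C\<^esub> (- (C $ \<alpha> $ \<beta>)) = Q \<beta> m \<up> nat (Adj $ \<alpha> $ \<beta>)" if "\<beta> \<noteq> \<alpha>"
      using C_off[of \<alpha> \<beta>] that by (auto simp: int_pow_def2 Adj_def)
    with Cons show ?case by (simp add: list_product_def)
  qed (simp add: list_product_def)
  then show ?thesis
    using Qsys by (simp add: quantum_Q_system_def nprod_def numeral_2_eq_2)
qed

lemma sum_nbr_key:
  assumes "addf \<psi>"
  shows "\<psi> (\<Sum>\<beta>\<in>UNIV. if Adj $ \<alpha> $ \<beta> = 1 then k \<beta> else 0) = (\<Sum>\<beta>\<in>UNIV. Adj $ \<alpha> $ \<beta> * \<psi> (k \<beta>))"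
proof -
  have "\<psi> (\<Sum>\<beta>\<in>A. if Adj $ \<alpha> $ \<beta> = 1 then k \<beta> else 0) = (\<Sum>\<beta>\<in>A. Adj $ \<alpha> $ \<beta> * \<psi> (k \<beta>))" for A
  proof (induction A rule: infinite_finite_induct)
    case (insert \<beta> A)
    then show ?case using assms Adj_01(2)[of \<alpha> \<beta>] by (auto simp: addf_add addf_0)
  qed (use assms in \<open>simp_all add: addf_0\<close>)
  then show ?thesis .
qed

lemma topmon_nprod:
  assumes "addf \<psi>" "\<And>\<beta>. topmon \<psi> (Q \<beta> m) (k \<beta>)"
  shows "topmon \<psi> (nprod \<alpha> m) (\<Sum>\<beta>\<in>UNIV. if Adj $ \<alpha> $ \<beta> = 1 then k \<beta> else 0)"
proof -
  have "topmon \<psi> (nprod \<alpha> m) (sum_list (map (\<lambda>\<beta>. if nat (Adj $ \<alpha> $ \<beta>) = 1 then k \<beta> else 0) indices))"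
    unfolding nprod_def using assms by (intro topmon_lprod topmon_power01 Adj_01(1))
  moreover have "(nat (Adj $ \<alpha> $ \<beta>) = 1) = (Adj $ \<alpha> $ \<beta> = 1)" for \<beta>
    using Adj_01(2)[of \<alpha> \<beta>] by auto
  ultimately show ?thesis by (simp add: sum_list_indices)
qed

lemma topmon_Q_rhs_square:
  assumes "addf \<psi>" "\<And>\<beta>. topmon \<psi> (Q \<beta> m) (k \<beta>)"
    "(\<Sum>\<beta>\<in>UNIV. Adj $ \<alpha> $ \<beta> * \<psi> (k \<beta>)) < 2 * \<psi> (k \<alpha>)"
  shows "topmon \<psi> (Q \<alpha> (m + 1) \<star> Q \<alpha> (m - 1)) (k \<alpha> + k \<alpha>)"
proof -
  have "domin \<psi> (\<psi> (k \<alpha> + k \<alpha>)) (nprod \<alpha> m)"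
    using assms by (intro topmon_domin[OF topmon_nprod]) (simp_all add: sum_nbr_key addf_add)
  then have "topmon \<psi> (Q \<alpha> m \<star> Q \<alpha> m + (- nprod \<alpha> m)) (k \<alpha> + k \<alpha>)"
    using assms by (intro topmon_add_lower topmon_mult) (simp_all add: domin_uminus)
  then have "topmon \<psi> (tt (- lam C \<alpha> \<alpha>) \<star> (Q \<alpha> m \<star> Q \<alpha> m - nprod \<alpha> m)) (k \<alpha> + k \<alpha>)"
    using assms by (intro topmon_tt) simp_all
  then show ?thesis using Q_rec[of \<alpha> m] by (simp add: tt_eq_iff)
qed

lemma topmon_Q_rhs_nbr:
  assumes "addf \<psi>" "\<And>\<beta>. topmon \<psi> (Q \<beta> m) (k \<beta>)"
    "2 * \<psi> (k \<alpha>) < (\<Sum>\<beta>\<in>UNIV. Adj $ \<alpha> $ \<beta> * \<psi> (k \<beta>))"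
  shows "topmon \<psi> (Q \<alpha> (m + 1) \<star> Q \<alpha> (m - 1)) (\<Sum>\<beta>\<in>UNIV. if Adj $ \<alpha> $ \<beta> = 1 then k \<beta> else 0)"
    (is "topmon _ _ ?S")
proof -
  have "domin \<psi> (\<psi> ?S) (Q \<alpha> m \<star> Q \<alpha> m)"
    using assms by (intro topmon_domin[OF topmon_mult[OF assms(1) assms(2) assms(2)]])
      (simp add: sum_nbr_key addf_add)
  then have "topmon \<psi> (- nprod \<alpha> m + Q \<alpha> m \<star> Q \<alpha> m) ?S"
    using assms by (intro topmon_add_lower) (simp_all add: topmon_uminus topmon_nprod)
  then have "topmon \<psi> (tt (- lam C \<alpha> \<alpha>) \<star> (Q \<alpha> m \<star> Q \<alpha> m - nprod \<alpha> m)) ?S"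
    using assms by (intro topmon_tt) simp_all
  then show ?thesis using Q_rec[of \<alpha> m] by (simp add: tt_eq_iff)
qed

text \<open>Three gradings for three purposes. In total degree \<open>psi1\<close> the square
  dominates at every index, by \<open>2 rho - Adj rho = d\<close>, which yields cancellation. The
  y-degree \<open>psi2\<close> governs invertibility on functions, and its negative
  \<open>psi3\<close> gives access to the lowest terms.\<close>

definition psi1 :: "(int, 'r) vec \<times> (int, 'r) vec \<Rightarrow> int" where "psi1 k = phi (fst k) + phi (snd k)"
definition psi2 :: "(int, 'r) vec \<times> (int, 'r) vec \<Rightarrow> int" where "psi2 k = phi (snd k)"
definition psi3 :: "(int, 'r) vec \<times> (int, 'r) vec \<Rightarrow> int" where "psi3 k = - phi (snd k)"

lemma addf_psi [simp]: "addf psi1" "addf psi2" "addf psi3"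
  using addf_add[OF addf_phi] by (simp_all add: addf_def psi1_def psi2_def psi3_def)

lemma axis_0 [simp]: "axis \<alpha> (0::int) = 0"
  by (simp add: axis_def vec_eq_iff)

definition topkey :: "'r \<Rightarrow> int \<Rightarrow> (int, 'r) vec \<times> (int, 'r) vec" where
  "topkey \<alpha> m = (axis \<alpha> (1 - m), axis \<alpha> m)"

lemma axis_add: "axis \<alpha> a + axis \<alpha> b = axis \<alpha> (a + b)" "axis \<alpha> a - axis \<alpha> b = axis \<alpha> (a - b)"
  "- axis \<alpha> a = axis \<alpha> (- a)" for a :: int
  by (simp_all add: axis_def vec_eq_iff)

lemma topkey_step: "topkey \<alpha> m + topkey \<alpha> m - topkey \<alpha> (m - 1) = topkey \<alpha> (m + 1)"
  "topkey \<alpha> m + topkey \<alpha> m - topkey \<alpha> (m + 1) = topkey \<alpha> (m - 1)"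
  by (simp_all add: topkey_def axis_add)

lemma psi_topkey [simp]: "psi1 (topkey \<alpha> m) = rho \<alpha>" "psi2 (topkey \<alpha> m) = rho \<alpha> * m"
  by (simp_all add: psi1_def psi2_def topkey_def algebra_simps)

lemma topmon_psi1_ladder:
  assumes "\<And>\<beta>. topmon psi1 (Q \<beta> m) (topkey \<beta> m)"
  shows "topmon psi1 (Q \<alpha> (m + 1) \<star> Q \<alpha> (m - 1)) (topkey \<alpha> m + topkey \<alpha> m)"
  using assms d_pos by (intro topmon_Q_rhs_square) (simp_all add: Adj_rho)

lemma topmon_psi1_nat: "topmon psi1 (Q \<alpha> (int m)) (topkey \<alpha> (int m))"
proof (induction m arbitrary: \<alpha> rule: less_induct)
  case (less m)
  consider "m = 0" | "m = 1" | j where "m = Suc (Suc j)"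
    by (metis One_nat_def not0_implies_Suc)
  then show ?case
  proof cases
    case 1
    then show ?thesis by (simp add: Q_0 topkey_def topmon_single)
  next
    case 2
    then show ?thesis by (simp add: Q_1 topkey_def topmon_single)
  next
    case 3
    have "topmon psi1 (Q \<alpha> (int (Suc j) + 1) \<star> Q \<alpha> (int (Suc j) - 1)) (topkey \<alpha> (int (Suc j)) + topkey \<alpha> (int (Suc j)))"
      by (rule topmon_psi1_ladder, rule less.IH) (simp add: 3)
    moreover have "topmon psi1 (Q \<alpha> (int (Suc j) - 1)) (topkey \<alpha> (int (Suc j) - 1))"
      using less.IH[of j \<alpha>] 3 by simp
    ultimately have "topmon psi1 (Q \<alpha> (int (Suc j) + 1)) (topkey \<alpha> (int (Suc j) + 1))"
      using topmon_divide_right[OF addf_psi(1)] topkey_step(1) by metis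
    then show ?thesis by (simp add: 3 add.commute)
  qed
qed

text \<open>Index -1 is included because polynomiality substitutes \<open>Q \<alpha> (- 1)\<close>
  for \<open>Q \<alpha> 0\<close>. It is reached from indices 0 and 1 by division on the
  left.\<close>

lemma topmon_psi1: "- 1 \<le> m \<Longrightarrow> topmon psi1 (Q \<alpha> m) (topkey \<alpha> m)"
proof (cases "m = - 1")
  case True
  have "topmon psi1 (Q \<alpha> (0 + 1) \<star> Q \<alpha> (0 - 1)) (topkey \<alpha> 0 + topkey \<alpha> 0)"
    by (rule topmon_psi1_ladder) (use topmon_psi1_nat[of _ 0] in simp)
  moreover have "topmon psi1 (Q \<alpha> (0 + 1)) (topkey \<alpha> (0 + 1))"
    using topmon_psi1_nat[of \<alpha> 1] by simp
  ultimately have "topmon psi1 (Q \<alpha> (0 - 1)) (topkey \<alpha> (0 - 1))"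
    using topmon_divide_left[OF addf_psi(1)] topkey_step(2) by metis
  with True show ?thesis by simp
next
  case False
  assume "- 1 \<le> m"
  with False topmon_psi1_nat[of \<alpha> "nat m"] show ?thesis by simp
qed

lemma topmon_psi2: "topmon psi2 (Q \<alpha> (int m)) (topkey \<alpha> (int m))"
proof (induction m arbitrary: \<alpha> rule: less_induct)
  case (less m)
  consider "m = 0" | "m = 1" | j where "m = Suc (Suc j)"
    by (metis One_nat_def not0_implies_Suc)
  then show ?case
  proof cases
    case 1
    then show ?thesis by (simp add: Q_0 topkey_def topmon_single)
  next
    case 2
    then show ?thesis by (simp add: Q_1 topkey_def topmon_single)
  next
    case 3
    have "(\<Sum>\<beta>\<in>UNIV. Adj $ \<alpha> $ \<beta> * psi2 (topkey \<beta> (int (Suc j)))) = (2 * rho \<alpha> - d) * int (Suc j)"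
      by (simp add: Adj_rho[symmetric] sum_distrib_right mult.assoc)
    also have "\<dots> < 2 * psi2 (topkey \<alpha> (int (Suc j)))"
    proof -
      have "0 < d * int (Suc j)" using d_pos by (intro mult_pos_pos) simp_all
      then show ?thesis by (simp add: algebra_simps)
    qed
    finally have "topmon psi2 (Q \<alpha> (int (Suc j) + 1) \<star> Q \<alpha> (int (Suc j) - 1)) (topkey \<alpha> (int (Suc j)) + topkey \<alpha> (int (Suc j)))"
      by (intro topmon_Q_rhs_square less.IH) (simp_all add: 3)
    moreover have "topmon psi2 (Q \<alpha> (int (Suc j) - 1)) (topkey \<alpha> (int (Suc j) - 1))"
      using less.IH[of j \<alpha>] 3 by simp
    ultimately have "topmon psi2 (Q \<alpha> (int (Suc j) + 1)) (topkey \<alpha> (int (Suc j) + 1))"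
      using topmon_divide_right[OF addf_psi(2)] topkey_step(1) by metis
    then show ?thesis by (simp add: 3 add.commute)
  qed
qed

lemma Q_cancel_right: "- 1 \<le> m \<Longrightarrow> f \<star> Q \<alpha> m = f' \<star> Q \<alpha> m \<Longrightarrow> f = f'"
  using topmon_cancel_right_eq[OF addf_psi(1) topmon_psi1] .

lemma qcomm_nprod:
  assumes "\<And>\<beta>. qcomm (e \<beta>) f (Q \<beta> m)"
  shows "qcomm (\<Sum>\<beta>\<in>UNIV. Adj $ \<alpha> $ \<beta> * e \<beta>) f (nprod \<alpha> m)"
proof -
  have "qcomm (sum_list (map (\<lambda>\<beta>. int (nat (Adj $ \<alpha> $ \<beta>)) * e \<beta>) indices)) f (nprod \<alpha> m)"
    unfolding nprod_def by (rule qcomm_lprod_right, rule qcomm_power_right, rule assms)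
  then show ?thesis by (simp add: sum_list_indices)
qed

lemma Adj_lam: "(\<Sum>\<beta>\<in>UNIV. Adj $ \<alpha> $ \<beta> * lam C \<beta> \<gamma>) = 2 * lam C \<alpha> \<gamma> - (if \<alpha> = \<gamma> then d else 0)"
  using C_lam[of \<alpha> \<gamma>] by (simp add: sum_C)

lemma qcomm_single: "qcomm (om (snd k') (fst k) - om (snd k) (fst k')) (Poly_Mapping.single k u) (Poly_Mapping.single k' v)"
proof -
  have "tpow (- om (snd k) (fst k')) * u * v =
      tpow (om (snd k') (fst k) - om (snd k) (fst k')) * (tpow (- om (snd k') (fst k)) * v * u)"
    by (simp add: mult.assoc[symmetric] tpow_mult)
  then show ?thesis
    by (simp only: qcomm_def qt_scalar_def qt_mult_single snd_zero om_zero minus_zero tpow_0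
        mult_1_left add_0_left add.commute[of k k'])
qed

text \<open>\<open>f\<close> stands for \<open>Q \<gamma> (m - 1)\<close>. Moving it past the square
  and past the product over neighbours costs the same power of t, except that for \<alpha> =
  \<gamma> the latter is off by \<open>d\<close>, because \<open>Adj\<close> times
  \<open>lam\<close> is 2 \<open>lam\<close> minus \<open>d\<close> times the identity.\<close>

lemma Q_rhs_commute:
  assumes 0: "\<And>\<alpha> \<beta>. qcomm 0 (Q \<alpha> m) (Q \<beta> m)"
    and f: "\<And>\<beta>. qcomm (lam C \<beta> \<gamma>) f (Q \<beta> m)"
  shows "qcomm 0 (Q \<alpha> m \<star> Q \<alpha> m - nprod \<alpha> m) (Q \<beta> m)"
    and "\<alpha> \<noteq> \<gamma> \<Longrightarrow> qcomm (2 * lam C \<alpha> \<gamma>) f (Q \<alpha> m \<star> Q \<alpha> m - nprod \<alpha> m)"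
    and "f \<star> (Q \<alpha> m \<star> Q \<alpha> m - nprod \<alpha> m) =
      (tt (2 * lam C \<alpha> \<gamma>) \<star> (Q \<alpha> m \<star> Q \<alpha> m) -
       tt (2 * lam C \<alpha> \<gamma> - (if \<alpha> = \<gamma> then d else 0)) \<star> nprod \<alpha> m) \<star> f"
proof -
  have "qcomm 0 (nprod \<alpha> m) (Q \<beta> m)"
    using qcomm_sym[OF qcomm_nprod[of "\<lambda>_. 0" "Q \<beta> m" m \<alpha>]] 0 by simp
  moreover have "qcomm 0 (Q \<alpha> m \<star> Q \<alpha> m) (Q \<beta> m)"
    using qcomm_mult_left[OF 0 0] by simp
  ultimately show "qcomm 0 (Q \<alpha> m \<star> Q \<alpha> m - nprod \<alpha> m) (Q \<beta> m)" by (rule qcomm_diff_left[rotated])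
  have 1: "qcomm (2 * lam C \<alpha> \<gamma>) f (Q \<alpha> m \<star> Q \<alpha> m)"
    using qcomm_mult_right[OF f f, of \<alpha> \<alpha>] by simp
  have 2: "qcomm (2 * lam C \<alpha> \<gamma> - (if \<alpha> = \<gamma> then d else 0)) f (nprod \<alpha> m)"
    using qcomm_nprod[OF f, of \<alpha>] by (simp only: Adj_lam)
  show "qcomm (2 * lam C \<alpha> \<gamma>) f (Q \<alpha> m \<star> Q \<alpha> m - nprod \<alpha> m)" if "\<alpha> \<noteq> \<gamma>"
    using 1 2 that by (intro qcomm_diff_right) simp_all
  show "f \<star> (Q \<alpha> m \<star> Q \<alpha> m - nprod \<alpha> m) =
      (tt (2 * lam C \<alpha> \<gamma>) \<star> (Q \<alpha> m \<star> Q \<alpha> m) -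
       tt (2 * lam C \<alpha> \<gamma> - (if \<alpha> = \<gamma> then d else 0)) \<star> nprod \<alpha> m) \<star> f"
    using qcommD[OF 1] qcommD[OF 2] by (simp add: T.right_diff_distrib T.left_diff_distrib T.mult_assoc)
qed

lemma Q_commute_nat:
  "(\<forall>\<alpha> \<beta>. qcomm 0 (Q \<alpha> (int m)) (Q \<beta> (int m))) \<and>
   (\<forall>\<alpha> \<beta>. qcomm 0 (Q \<alpha> (int m + 1)) (Q \<beta> (int m + 1))) \<and>
   (\<forall>\<alpha> \<beta>. qcomm (lam C \<alpha> \<beta>) (Q \<alpha> (int m)) (Q \<beta> (int m + 1)))"
proof (induction m)
  case 0
  have "qcomm 0 (Q \<alpha> 0) (Q \<beta> 0)" "qcomm 0 (Q \<alpha> 1) (Q \<beta> 1)" "qcomm (lam C \<alpha> \<beta>) (Q \<alpha> 0) (Q \<beta> 1)" for \<alpha> \<beta>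
    using qcomm_single[of "(axis \<beta> 1, 0)" "(axis \<alpha> 1, 0)" 1 1]
      qcomm_single[of "(0, axis \<beta> 1)" "(0, axis \<alpha> 1)" 1 1]
      qcomm_single[of "(0, axis \<beta> 1)" "(axis \<alpha> 1, 0)" 1 1]
    by (simp_all add: Q_0 Q_1 lam_sym)
  then show ?case by simp
next
  case (Suc j)
  let ?m = "int (Suc j)"
  let ?q = "\<lambda>\<alpha>. Q \<alpha> ?m" and ?p = "\<lambda>\<alpha>. Q \<alpha> (int j)" and ?r = "\<lambda>\<alpha>. Q \<alpha> (?m + 1)"
  let ?E = "\<lambda>\<alpha>. ?q \<alpha> \<star> ?q \<alpha> - nprod \<alpha> ?m"
  have m1: "int j + 1 = ?m" "?m - 1 = int j" by simp_all
  have q0: "qcomm 0 (?q \<alpha>) (?q \<beta>)" for \<alpha> \<beta> using Suc m1 by metis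
  have p0: "qcomm 0 (?p \<alpha>) (?p \<beta>)" for \<alpha> \<beta> using Suc by metis
  have pq: "qcomm (lam C \<alpha> \<beta>) (?p \<alpha>) (?q \<beta>)" for \<alpha> \<beta> using Suc m1 by metis
  have pq': "qcomm (lam C \<beta> \<gamma>) (?p \<gamma>) (?q \<beta>)" for \<beta> \<gamma> using pq[of \<gamma> \<beta>] by (simp add: lam_sym)
  have rec: "?r \<alpha> \<star> ?p \<alpha> = tt (- lam C \<alpha> \<alpha>) \<star> ?E \<alpha>" for \<alpha>
    using Q_rec[of \<alpha> ?m] unfolding m1 by (rule iffD1[OF tt_eq_iff])
  have Eq: "qcomm 0 (?E \<alpha>) (?q \<beta>)" for \<alpha> \<beta>
    by (rule Q_rhs_commute(1)[OF q0 pq'])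
  have EE: "qcomm 0 (?E \<alpha>) (?E \<beta>)" for \<alpha> \<beta>
    using qcomm_mult_right[OF Eq Eq, of \<alpha> \<beta> \<beta>] qcomm_nprod[of "\<lambda>_. 0" "?E \<alpha>" ?m \<beta>, OF Eq]
    by (intro qcomm_diff_right) simp_all
  have Ep: "qcomm (2 * lam C \<alpha> \<beta>) (?p \<beta>) (?E \<alpha>)" if "\<alpha> \<noteq> \<beta>" for \<alpha> \<beta>
    by (rule Q_rhs_commute(2)[OF q0 pq' that])
  have cancel: "f = f'" if "f \<star> ?p \<alpha> = f' \<star> ?p \<alpha>" for f f' \<alpha>
    by (rule Q_cancel_right[OF _ that]) simp
  have qr: "qcomm (lam C \<alpha> \<beta>) (?q \<alpha>) (?r \<beta>)" for \<alpha> \<beta>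
    unfolding lam_sym[of \<alpha> \<beta>]
  proof (rule q_r_qcomm[where p = ?p and c = "\<lambda>\<alpha>. - lam C \<alpha> \<alpha>" and E = ?E and l = "lam C"])
    show "?r \<alpha> \<star> ?p \<alpha> = tt (- lam C \<alpha> \<alpha>) \<star> ?E \<alpha>" for \<alpha> by (rule rec)
    show "qcomm 0 (?E \<alpha>) (?q \<beta>)" for \<alpha> \<beta> by (rule Eq)
    show "qcomm (lam C \<alpha> \<beta>) (?p \<alpha>) (?q \<beta>)" for \<alpha> \<beta> by (rule pq)
    show "f \<star> ?p \<alpha> = f' \<star> ?p \<alpha> \<Longrightarrow> f = f'" for f f' \<alpha> by (rule cancel)
  qed
  have rr: "qcomm 0 (?r \<alpha>) (?r \<beta>)" for \<alpha> \<beta>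
  proof (cases "\<alpha> = \<beta>")
    case False
    show ?thesis
    proof (rule r_r_qcomm[where p = ?p and c = "\<lambda>\<alpha>. - lam C \<alpha> \<alpha>" and E = ?E and l = "lam C"])
      show "?r \<alpha> \<star> ?p \<alpha> = tt (- lam C \<alpha> \<alpha>) \<star> ?E \<alpha>" for \<alpha> by (rule rec)
      show "qcomm (2 * lam C \<alpha> \<beta>) (?p \<beta>) (?E \<alpha>)" if "\<alpha> \<noteq> \<beta>" for \<alpha> \<beta> using that by (rule Ep)
      show "qcomm 0 (?E \<alpha>) (?E \<beta>)" for \<alpha> \<beta> by (rule EE)
      show "qcomm 0 (?p \<alpha>) (?p \<beta>)" for \<alpha> \<beta> by (rule p0)
      show "lam C \<alpha> \<beta> = lam C \<beta> \<alpha>" for \<alpha> \<beta> by (rule lam_sym)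
      show "f \<star> ?p \<alpha> = f' \<star> ?p \<alpha> \<Longrightarrow> f = f'" for f f' \<alpha> by (rule cancel)
      show "\<alpha> \<noteq> \<beta>" by (rule False)
    qed
  qed (simp add: qcomm_same_power)
  show ?case using q0 rr qr by simp
qed

lemma Q_commute: "0 \<le> m \<Longrightarrow> qcomm 0 (Q \<alpha> m) (Q \<beta> m)"
  using Q_commute_nat[of "nat m"] by simp

lemma Q_qcommute: "0 \<le> m \<Longrightarrow> qcomm (lam C \<alpha> \<beta>) (Q \<alpha> m) (Q \<beta> (m + 1))"
  using Q_commute_nat[of "nat m"] by simp

text \<open>The factors appear here in the order of increasing index, as in the ordered products.
  Reversing them costs the factor \<open>tpow (- d)\<close>, that is q, on the product over
  neighbours; this is where the recursion acquires its q.\<close>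

lemma Q_rec_reversed:
  assumes "1 \<le> m"
  shows "Q \<alpha> (m - 1) \<star> Q \<alpha> (m + 1) = tt (lam C \<alpha> \<alpha>) \<star> (Q \<alpha> m \<star> Q \<alpha> m) - tt (lam C \<alpha> \<alpha> - d) \<star> nprod \<alpha> m"
proof (rule Q_cancel_right[of "m - 1" _ \<alpha>])
  have c: "qcomm (lam C \<beta> \<alpha>) (Q \<alpha> (m - 1)) (Q \<beta> m)" for \<beta>
    using Q_qcommute[of "m - 1" \<alpha> \<beta>] assms by (simp add: lam_sym)
  have c0: "qcomm 0 (Q \<alpha> m) (Q \<beta> m)" for \<alpha> \<beta> using Q_commute assms by simp
  have "Q \<alpha> (m + 1) \<star> Q \<alpha> (m - 1) = tt (- lam C \<alpha> \<alpha>) \<star> (Q \<alpha> m \<star> Q \<alpha> m - nprod \<alpha> m)"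
    using Q_rec[of \<alpha> m] by (rule iffD1[OF tt_eq_iff])
  then have "Q \<alpha> (m - 1) \<star> Q \<alpha> (m + 1) \<star> Q \<alpha> (m - 1)
      = tt (- lam C \<alpha> \<alpha>) \<star> (Q \<alpha> (m - 1) \<star> (Q \<alpha> m \<star> Q \<alpha> m - nprod \<alpha> m))"
    by (simp add: T.mult_assoc qt_scalar_left_commute[of "Q \<alpha> (m - 1)"])
  also have "\<dots> = tt (- lam C \<alpha> \<alpha>) \<star> ((tt (2 * lam C \<alpha> \<alpha>) \<star> (Q \<alpha> m \<star> Q \<alpha> m) -
       tt (2 * lam C \<alpha> \<alpha> - d) \<star> nprod \<alpha> m) \<star> Q \<alpha> (m - 1))"
    using Q_rhs_commute(3)[of m \<alpha> "Q \<alpha> (m - 1)" \<alpha>, OF c0 c] by simp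
  also have "\<dots> = (tt (lam C \<alpha> \<alpha>) \<star> (Q \<alpha> m \<star> Q \<alpha> m) - tt (lam C \<alpha> \<alpha> - d) \<star> nprod \<alpha> m) \<star> Q \<alpha> (m - 1)"
  proof -
    have "tt (- l) \<star> ((tt (2 * l) \<star> P - tt (2 * l - d) \<star> N) \<star> R) = (tt l \<star> P - tt (l - d) \<star> N) \<star> R" for l P N R
    proof -
      have "tt (- l) \<star> (tt (2 * l) \<star> P - tt (2 * l - d) \<star> N) = tt (- l + 2 * l) \<star> P - tt (- l + (2 * l - d)) \<star> N"
        by (simp only: T.right_diff_distrib tt_mult')
      then show ?thesis by (simp add: T.mult_assoc[symmetric])
    qed
    then show ?thesis .
  qed
  finally show "Q \<alpha> (m - 1) \<star> Q \<alpha> (m + 1) \<star> Q \<alpha> (m - 1)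
      = (tt (lam C \<alpha> \<alpha>) \<star> (Q \<alpha> m \<star> Q \<alpha> m) - tt (lam C \<alpha> \<alpha> - d) \<star> nprod \<alpha> m) \<star> Q \<alpha> (m - 1)" .
qed (use assms in simp)

end

subsection \<open>Functions on the weight lattice as a right module\<close>

text \<open>A difference operator removes one exponential, so by induction the sum satisfies
  \<open>S (k + 1) = tpow (e j) * S k\<close>; zeros far to the left then propagate to all
  k.\<close>

lemma exponential_sum_vanishes:
  fixes w :: "'j \<Rightarrow> laurent" and e :: "'j \<Rightarrow> int"
  assumes "finite A" "\<And>k. k \<le> k0 \<Longrightarrow> (\<Sum>j\<in>A. w j * tpow (e j * k)) = 0"
  shows "(\<Sum>j\<in>A. w j * tpow (e j * k)) = 0"
  using assms
proof (induction A arbitrary: w k0 k rule: finite_induct)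
  case (insert j A)
  define S where "S k = (\<Sum>i\<in>insert j A. w i * tpow (e i * k))" for k
  define w' where "w' i = w i * (tpow (e i) - tpow (e j))" for i
  have diff: "S (k + 1) - tpow (e j) * S k = (\<Sum>i\<in>A. w' i * tpow (e i * k))" for k
  proof -
    have "S (k + 1) - tpow (e j) * S k
        = (\<Sum>i\<in>insert j A. w i * tpow (e i * (k + 1)) - tpow (e j) * (w i * tpow (e i * k)))"
      by (simp only: S_def sum_distrib_left sum_subtractf)
    also have "\<dots> = (\<Sum>i\<in>insert j A. w' i * tpow (e i * k))"
    proof (rule sum.cong[OF refl])
      fix i
      have "tpow (e i * (k + 1)) = tpow (e i) * tpow (e i * k)"
        by (simp add: tpow_mult algebra_simps)
      then show "w i * tpow (e i * (k + 1)) - tpow (e j) * (w i * tpow (e i * k)) = w' i * tpow (e i * k)"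
        by (simp add: w'_def algebra_simps)
    qed
    also have "\<dots> = (\<Sum>i\<in>A. w' i * tpow (e i * k))"
      using insert by (simp add: w'_def)
    finally show ?thesis .
  qed
  have "(\<Sum>i\<in>A. w' i * tpow (e i * k)) = 0" for k
  proof (rule insert.IH)
    fix k assume k: "k \<le> k0 - 1"
    have "S (k + 1) = 0" "S k = 0" using insert.prems[of "k + 1"] insert.prems[of k] k by (simp_all only: S_def)
    then show "(\<Sum>i\<in>A. w' i * tpow (e i * k)) = 0" using diff[of k] by simp
  qed
  then have step: "S (k + 1) = tpow (e j) * S k" for k using diff[of k] by simp
  have "S (k0 + int n) = 0" for n
  proof (induction n)
    case 0
    then show ?case using insert.prems[of k0] by (simp only: S_def) simp
  next
    case (Suc n)
    then show ?case using step[of "k0 + int n"] by (simp add: ac_simps)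
  qed
  from this[of "nat (k - k0)"] have "S k = 0"
    using insert.prems[of k] by (cases "k \<le> k0") (simp_all add: S_def)
  then show ?case by (simp only: S_def)
qed simp

context torus
begin

definition onev :: "int ^ 'r" where "onev = (\<chi> _. 1)"

text \<open>The right module of all functions on the weight lattice in which the delta function at \<open>b\<close> plays the role of
  \<open>\<langle>0| y\<^bsup>b\<^esup>\<close>.\<close>

definition ract :: "(int ^ 'r \<Rightarrow> laurent) \<Rightarrow> 'r qt \<Rightarrow> (int ^ 'r \<Rightarrow> laurent)" (infixl "\<triangleleft>" 65) where
  "g \<triangleleft> f = (\<lambda>c. \<Sum>k\<in>Poly_Mapping.keys f.
     Poly_Mapping.lookup f k * tpow (- om (fst k) (c - snd k + onev)) * g (c - snd k))"

definition delta :: "int ^ 'r \<Rightarrow> int ^ 'r \<Rightarrow> laurent" where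
  "delta b c = (if c = b then 1 else 0)"

lemma ract_superset:
  assumes "finite A" "Poly_Mapping.keys f \<subseteq> A"
  shows "(g \<triangleleft> f) c = (\<Sum>k\<in>A. Poly_Mapping.lookup f k * tpow (- om (fst k) (c - snd k + onev)) * g (c - snd k))"
  unfolding ract_def by (rule sum.mono_neutral_left) (use assms in \<open>auto simp: in_keys_iff\<close>)

lemma ract_add_right: "(g \<triangleleft> (f + f')) c = (g \<triangleleft> f) c + (g \<triangleleft> f') c"
proof -
  let ?A = "Poly_Mapping.keys f \<union> Poly_Mapping.keys f'"
  have "Poly_Mapping.keys (f + f') \<subseteq> ?A" by (rule keys_add)
  then show ?thesis
    by (simp add: ract_superset[of ?A] lookup_add distrib_right sum.distrib)
qed

lemma ract_uminus_right: "(g \<triangleleft> (- f)) c = - (g \<triangleleft> f) c"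
  by (simp add: ract_def sum_negf)

lemma ract_diff_right: "(g \<triangleleft> (f - f')) c = (g \<triangleleft> f) c - (g \<triangleleft> f') c"
  using ract_add_right[of g f "- f'"] by (simp add: ract_uminus_right)

lemma ract_0_right [simp]: "g \<triangleleft> 0 = (\<lambda>_. 0)"
  by (simp add: ract_def)

lemma ract_sum_right: "(g \<triangleleft> (\<Sum>i\<in>I. f i)) c = (\<Sum>i\<in>I. (g \<triangleleft> f i) c)"
  by (induction I rule: infinite_finite_induct) (simp_all add: ract_add_right)

lemma ract_single: "(g \<triangleleft> Poly_Mapping.single k u) c = u * tpow (- om (fst k) (c - snd k + onev)) * g (c - snd k)"
  by (subst ract_superset[of "{k}"]) auto

lemma ract_diff_left: "((\<lambda>c. g c - h c) \<triangleleft> f) = (\<lambda>c. (g \<triangleleft> f) c - (h \<triangleleft> f) c)"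
  by (simp add: ract_def right_diff_distrib sum_subtractf)

lemma ract_scale_left: "((\<lambda>c. u * g c) \<triangleleft> f) = (\<lambda>c. u * (g \<triangleleft> f) c)"
  by (simp add: ract_def sum_distrib_left mult.left_commute)

lemma ract_scalar: "g \<triangleleft> qt_scalar u = (\<lambda>c. u * g c)"
  by (rule ext) (simp add: qt_scalar_def ract_single tpow_0)

lemma ract_one [simp]: "g \<triangleleft> 1 = g"
  using ract_scalar[of g 1] by (simp add: qt_scalar_1)

end

context cartan
begin

text \<open>The scalar in the action combines the exchange of x past y with the eigenvalue of x on
  the cyclic vector, the source of \<open>onev\<close>. It matches the power of t in the product of
  the torus because \<open>om\<close> is symmetric.\<close>

lemma ract_mult: "g \<triangleleft> (f \<star> f') = (g \<triangleleft> f) \<triangleleft> f'"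
proof
  fix c
  show "(g \<triangleleft> (f \<star> f')) c = ((g \<triangleleft> f) \<triangleleft> f') c"
  proof (induction f' rule: qt_additive_induct)
    case (1 k' u')
    show ?case
    proof (induction f rule: qt_additive_induct)
      case (1 k u)
      define E where "E = om (fst k) (c - snd k' - snd k + onev)"
      define E' where "E' = om (fst k') (c - snd k' + onev)"
      have "om (fst (k + k')) (c - snd (k + k') + onev) + om (snd k) (fst k') = E + E'"
        using om_sym[of "snd k" "fst k'"]
        by (simp add: E_def E'_def om_add_left om_add_right om_diff_right diff_diff_eq add.commute)
      then have e: "tpow (- om (snd k) (fst k')) * tpow (- om (fst (k + k')) (c - snd (k + k') + onev))
          = tpow (- E') * (tpow (- E) :: laurent)"
        by (simp add: tpow_mult)
      have "(g \<triangleleft> (Poly_Mapping.single k u \<star> Poly_Mapping.single k' u')) c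
        = (tpow (- om (snd k) (fst k')) * tpow (- om (fst (k + k')) (c - snd (k + k') + onev))) * (u * u' * g (c - snd (k + k')))"
        by (simp only: qt_mult_single ract_single ac_simps)
      also have "\<dots> = tpow (- E') * tpow (- E) * (u * u' * g (c - snd k' - snd k))"
        by (simp only: e) (simp add: diff_diff_eq add.commute)
      also have "\<dots> = ((g \<triangleleft> Poly_Mapping.single k u) \<triangleleft> Poly_Mapping.single k' u') c"
        by (simp only: ract_single E_def E'_def ac_simps)
      finally show ?case .
    next
      case (2 f1 f2)
      then show ?case
        by (simp add: qt_mult_add_left ract_add_right) (simp add: ract_single ract_add_right algebra_simps)
    qed
  next
    case (2 f1 f2)
    then show ?case by (simp add: qt_mult_add_right ract_add_right)
  qed
qed

lemma ract_delta: "(delta b \<triangleleft> f) c = (\<Sum>k\<in>{k\<in>Poly_Mapping.keys f. snd k = c - b}.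
    Poly_Mapping.lookup f k * tpow (- om (fst k) (b + onev)))"
proof -
  have "(delta b \<triangleleft> f) c = (\<Sum>k\<in>Poly_Mapping.keys f. if snd k = c - b
      then Poly_Mapping.lookup f k * tpow (- om (fst k) (b + onev)) else 0)"
    unfolding ract_def by (rule sum.cong) (auto simp: delta_def)
  then show ?thesis by (simp add: sum.If_cases Int_def)
qed

lemma ract_expand:
  assumes "finite B" "snd ` Poly_Mapping.keys f \<subseteq> B"
  shows "(g \<triangleleft> f) c = (\<Sum>b\<in>B. g (c - b) * (delta (c - b) \<triangleleft> f) c)"
proof -
  have "(g \<triangleleft> f) c = (\<Sum>b\<in>B. \<Sum>k\<in>{k\<in>Poly_Mapping.keys f. snd k = b}.
     Poly_Mapping.lookup f k * tpow (- om (fst k) (c - snd k + onev)) * g (c - snd k))"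
    unfolding ract_def by (rule sum.group[symmetric]) (use assms in auto)
  also have "\<dots> = (\<Sum>b\<in>B. g (c - b) * (delta (c - b) \<triangleleft> f) c)"
    unfolding ract_delta sum_distrib_left by (intro sum.cong refl) (auto simp: mult.commute)
  finally show ?thesis .
qed

lemma ract_delta_single: "delta b \<triangleleft> Poly_Mapping.single (a, b') u = (\<lambda>c. u * tpow (- om a (b + onev)) * delta (b + b') c)"
  by (rule ext) (auto simp: ract_single delta_def)

definition stab :: "'r \<Rightarrow> 'r qt \<Rightarrow> bool" where
  "stab \<alpha> f \<longleftrightarrow> (\<forall>b c. 0 \<le> b $ \<alpha> \<longrightarrow> c $ \<alpha> < 0 \<longrightarrow> (delta b \<triangleleft> f) c = 0)"

lemma stab_ract:
  assumes "stab \<alpha> f" "\<And>c. c $ \<alpha> < 0 \<Longrightarrow> g c = 0" "c $ \<alpha> < 0"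
  shows "(g \<triangleleft> f) c = 0"
proof -
  have "(g \<triangleleft> f) c = (\<Sum>b\<in>snd ` Poly_Mapping.keys f. g (c - b) * (delta (c - b) \<triangleleft> f) c)"
    by (rule ract_expand) auto
  also have "\<dots> = 0"
  proof (rule sum.neutral, rule ballI)
    fix b
    show "g (c - b) * (delta (c - b) \<triangleleft> f) c = 0"
      using assms unfolding stab_def by (cases "(c - b) $ \<alpha> < 0") (auto simp del: vector_minus_component)
  qed
  finally show ?thesis .
qed

end

context torus
begin

lemma tone_single: "(1 :: 'r qt) = Poly_Mapping.single (0, 0) 1"
  by (simp add: zero_prod_def[symmetric])

lemma lprod_delta:
  assumes "distinct xs"
  shows "lprod (\<lambda>\<beta>. if \<beta> = \<alpha> then f else 1) xs = (if \<alpha> \<in> set xs then f else 1)"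
  using assms by (induction xs) auto

lemma lprod_single_x: "lprod (\<lambda>\<beta>. Poly_Mapping.single (h \<beta>, 0) 1) xs = Poly_Mapping.single (sum_list (map h xs), 0) 1"
  by (induction xs) (simp_all add: tone_single qt_mult_single tpow_0)

lemma single_x_power: "Poly_Mapping.single (a, 0) 1 \<up> n = Poly_Mapping.single (int n *s a, 0) 1"
  by (induction n) (simp_all add: qt_mult_single tpow_0 vector_sadd_rdistrib flip: zero_prod_def)

end

section \<open>The operators with index -1\<close>

context qsys
begin

text \<open>The right-hand side of the recursion at index 0; up to a scalar and one inverse
  y-variable it is \<open>Q \<alpha> (- 1)\<close>.\<close>

definition Eroot :: "'r \<Rightarrow> 'r qt" where
  "Eroot \<alpha> = Poly_Mapping.single (axis \<alpha> 2, 0) 1 - Poly_Mapping.single (nbr \<alpha>, 0) 1"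

lemma nprod_0: "nprod \<alpha> 0 = Poly_Mapping.single (nbr \<alpha>, 0) 1"
proof -
  have "nprod \<alpha> 0 = lprod (\<lambda>\<beta>. Poly_Mapping.single (int (nat (Adj $ \<alpha> $ \<beta>)) *s axis \<beta> 1, 0) 1) indices"
    unfolding nprod_def by (rule lprod_cong) (simp add: Q_0 single_x_power)
  also have "\<dots> = Poly_Mapping.single (\<Sum>\<beta>\<in>UNIV. int (nat (Adj $ \<alpha> $ \<beta>)) *s axis \<beta> 1, 0) 1"
    by (simp only: lprod_single_x sum_list_indices)
  also have "(\<Sum>\<beta>\<in>UNIV. int (nat (Adj $ \<alpha> $ \<beta>)) *s axis \<beta> 1) = nbr \<alpha>"
    by (simp add: vec_eq_iff nbr_def axis_def if_distrib[of "(*) _"] cong: if_cong)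
  finally show ?thesis .
qed

lemma Q_square_0: "Q \<alpha> 0 \<star> Q \<alpha> 0 = Poly_Mapping.single (axis \<alpha> 2, 0) 1"
  by (simp add: Q_0 qt_mult_single tpow_0 axis_add)

lemma Q_1_Q_minus_1: "Q \<alpha> 1 \<star> Q \<alpha> (- 1) = tt (- lam C \<alpha> \<alpha>) \<star> Eroot \<alpha>"
proof -
  have "tt (lam C \<alpha> \<alpha>) \<star> (Q \<alpha> 1 \<star> Q \<alpha> (- 1)) = Eroot \<alpha>"
    using Q_rec[of \<alpha> 0] by (simp add: nprod_0 Q_square_0 Eroot_def)
  then show ?thesis by (rule iffD1[OF tt_eq_iff])
qed

lemma Q_minus_1: "Q \<alpha> (- 1) = tt (- lam C \<alpha> \<alpha>) \<star> (Poly_Mapping.single (0, - axis \<alpha> 1) 1 \<star> Eroot \<alpha>)"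
proof -
  have "Poly_Mapping.single (0, - axis \<alpha> 1) 1 \<star> Q \<alpha> 1 = 1"
    by (simp add: Q_1 qt_mult_single tpow_0 flip: zero_prod_def)
  then have "Q \<alpha> (- 1) = Poly_Mapping.single (0, - axis \<alpha> 1) 1 \<star> (Q \<alpha> 1 \<star> Q \<alpha> (- 1))"
    by (metis T.mult_1_left T.mult_assoc)
  then show ?thesis unfolding Q_1_Q_minus_1 by (simp only: qt_scalar_left_commute)
qed

lemma om_nbr: "om (nbr \<alpha>) b = om (axis \<alpha> 2) b - d * b $ \<alpha>"
  using om_root[of \<alpha> b] by (simp add: om_diff_left)

lemma qcomm_x_Q_minus_1: "qcomm (- om (axis \<alpha> 1) b) (Poly_Mapping.single (b, 0) 1) (Q \<alpha> (- 1))"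
proof -
  have 1: "qcomm (- om (axis \<alpha> 1) b) (Poly_Mapping.single (b, 0) 1) (Poly_Mapping.single (0, - axis \<alpha> 1) 1)"
    using qcomm_single[of "(0, - axis \<alpha> 1)" "(b, 0)" 1 1] by simp
  have 2: "qcomm 0 (Poly_Mapping.single (b, 0) 1) (Eroot \<alpha>)"
    unfolding Eroot_def
    using qcomm_single[of "(axis \<alpha> 2, 0)" "(b, 0)" 1 1] qcomm_single[of "(nbr \<alpha>, 0)" "(b, 0)" 1 1]
    by (intro qcomm_diff_right) simp_all
  show ?thesis
    unfolding Q_minus_1 using qcomm_mult_right[OF 1 2] by (intro qcomm_scalar_right) simp
qed

text \<open>Exchanging the inverse y-variable of either operator with the x-part of the other one
  costs 2 \<open>lam\<close>, with opposite signs in the two cases.\<close>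

lemma Q_minus_1_commute: "qcomm 0 (Q \<alpha> (- 1)) (Q \<beta> (- 1))"
proof (cases "\<alpha> = \<beta>")
  case True
  then show ?thesis by (simp add: qcomm_same_power)
next
  case False
  let ?Y = "\<lambda>\<alpha>. Poly_Mapping.single (0, - axis \<alpha> 1) (1::laurent)"
  have YE: "qcomm (2 * lam C \<alpha> \<beta>) (?Y \<beta>) (Eroot \<alpha>)" if "\<alpha> \<noteq> \<beta>" for \<alpha> \<beta>
  proof -
    have "(axis \<beta> 1 :: (int, 'r) vec) $ \<alpha> = 0" using that by (simp add: axis_def)
    then have "om (axis \<beta> 1) (nbr \<alpha>) = 2 * lam C \<alpha> \<beta>"
      by (subst om_sym) (simp add: om_nbr)
    moreover have "om (axis \<beta> 1) (axis \<alpha> 2) = 2 * lam C \<alpha> \<beta>"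
      by (simp add: lam_sym)
    ultimately show ?thesis
      unfolding Eroot_def
      using qcomm_single[of "(axis \<alpha> 2, 0)" "(0, - axis \<beta> 1)" 1 1]
        qcomm_single[of "(nbr \<alpha>, 0)" "(0, - axis \<beta> 1)" 1 1]
      by (intro qcomm_diff_right) (simp_all del: om_axis_axis)
  qed
  have YY: "qcomm 0 (?Y \<alpha>) (?Y \<beta>)"
    using qcomm_single[of "(0, - axis \<beta> 1)" "(0, - axis \<alpha> 1)" 1 1] by simp
  have EE: "qcomm 0 (Eroot \<alpha>) (Eroot \<beta>)"
    unfolding Eroot_def by (intro qcomm_diff_right qcomm_diff_left)
      (use qcomm_single[of "(_, 0)" "(_, 0)" 1 1] in simp_all)
  have "qcomm (0 + 2 * lam C \<beta> \<alpha>) (?Y \<alpha>) (?Y \<beta> \<star> Eroot \<beta>)"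
    using YY YE[OF False[symmetric]] by (rule qcomm_mult_right)
  moreover have "qcomm (- (2 * lam C \<alpha> \<beta>) + 0) (Eroot \<alpha>) (?Y \<beta> \<star> Eroot \<beta>)"
    using qcomm_sym[OF YE[OF False]] EE by (rule qcomm_mult_right)
  ultimately have "qcomm 0 (?Y \<alpha> \<star> Eroot \<alpha>) (?Y \<beta> \<star> Eroot \<beta>)"
    using qcomm_mult_left[of "0 + 2 * lam C \<beta> \<alpha>" "?Y \<alpha>" "?Y \<beta> \<star> Eroot \<beta>" "- (2 * lam C \<alpha> \<beta>) + 0" "Eroot \<alpha>"]
    by (simp add: lam_sym[of \<beta>])
  then show ?thesis
    unfolding Q_minus_1 by (intro qcomm_scalar_left qcomm_scalar_right)
qed

text \<open>\<open>nat\<close> truncates negative coordinates to exponent 0, hence the condition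
  \<open>nonneg\<close> in what follows.\<close>

definition ypow :: "(int, 'r) vec \<Rightarrow> 'r qt" where
  "ypow a = lprod (\<lambda>\<alpha>. Q \<alpha> (- 1) \<up> nat (a $ \<alpha>)) indices"

definition nonneg :: "(int, 'r) vec \<Rightarrow> bool" where "nonneg a \<longleftrightarrow> (\<forall>\<alpha>. 0 \<le> a $ \<alpha>)"

lemma ypow_add:
  assumes "nonneg a" "nonneg b"
  shows "ypow (a + b) = ypow a \<star> ypow b"
proof -
  have "ypow (a + b) = lprod (\<lambda>\<alpha>. Q \<alpha> (- 1) \<up> nat (a $ \<alpha>) \<star> Q \<alpha> (- 1) \<up> nat (b $ \<alpha>)) indices"
    unfolding ypow_def using assms
    by (intro lprod_cong) (simp add: nonneg_def nat_add_distrib T.power_add)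
  also have "\<dots> = ypow a \<star> ypow b"
    unfolding ypow_def
  proof (rule lprod_mult)
    fix \<alpha> \<beta>
    have "qcomm (int (nat (b $ \<beta>)) * 0) (Q \<alpha> (- 1)) (Q \<beta> (- 1) \<up> nat (b $ \<beta>))"
      by (rule qcomm_power_right, rule Q_minus_1_commute)
    then have "qcomm (int (nat (a $ \<alpha>)) * (int (nat (b $ \<beta>)) * 0)) (Q \<alpha> (- 1) \<up> nat (a $ \<alpha>)) (Q \<beta> (- 1) \<up> nat (b $ \<beta>))"
      by (rule qcomm_power_left)
    then show "qcomm 0 (Q \<alpha> (- 1) \<up> nat (a $ \<alpha>)) (Q \<beta> (- 1) \<up> nat (b $ \<beta>))" by simp
  qed
  finally show ?thesis .
qed

lemma ypow_axis: "ypow (axis \<alpha> 1) = Q \<alpha> (- 1)"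
proof -
  have "ypow (axis \<alpha> 1) = lprod (\<lambda>\<beta>. if \<beta> = \<alpha> then Q \<alpha> (- 1) else 1) indices"
    unfolding ypow_def by (rule lprod_cong) (auto simp: axis_def)
  then show ?thesis by (simp add: lprod_delta)
qed

lemma qcomm_x_ypow:
  assumes "nonneg a"
  shows "qcomm (- om a b) (Poly_Mapping.single (b, 0) 1) (ypow a)"
proof -
  have "qcomm (sum_list (map (\<lambda>\<alpha>. int (nat (a $ \<alpha>)) * (- om (axis \<alpha> 1) b)) indices)) (Poly_Mapping.single (b, 0) 1) (ypow a)"
    unfolding ypow_def by (intro qcomm_lprod_right qcomm_power_right qcomm_x_Q_minus_1)
  moreover have "sum_list (map (\<lambda>\<alpha>. int (nat (a $ \<alpha>)) * (- om (axis \<alpha> 1) b)) indices) = - om a b"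
    using assms by (simp add: nonneg_def sum_list_indices sum_negf om_sym[of _ b] om_axis)
      (simp add: om_sym[of b a], simp add: om_def sum_distrib_left lam_sym mult.assoc mult.left_commute mult.commute)
  ultimately show ?thesis by simp
qed

text \<open>The two x-monomials of \<open>Eroot \<alpha>\<close> act at the lowered point by powers
  of t that differ by \<open>d * c $ \<alpha>\<close>: the shift by \<open>onev\<close> compensates
  the step down. So the lowering stops exactly at coordinate 0.\<close>

lemma delta_Q_minus_1:
  obtains k where "delta c \<triangleleft> Q \<alpha> (- 1) = (\<lambda>v. k * delta (c - axis \<alpha> 1) v)" "k = 0 \<longleftrightarrow> c $ \<alpha> = 0"
proof -
  let ?c = "c - axis \<alpha> 1"
  have 1: "delta c \<triangleleft> Poly_Mapping.single (0, - axis \<alpha> 1) 1 = delta ?c"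
    by (simp add: ract_delta_single tpow_0)
  have 2: "delta ?c \<triangleleft> Eroot \<alpha> = (\<lambda>v. (tpow (- om (axis \<alpha> 2) (?c + onev)) - tpow (- om (nbr \<alpha>) (?c + onev))) * delta ?c v)"
    by (rule ext) (simp add: Eroot_def ract_diff_right ract_delta_single left_diff_distrib)
  have 3: "om (nbr \<alpha>) (?c + onev) = om (axis \<alpha> 2) (?c + onev) - d * c $ \<alpha>"
    unfolding om_nbr by (simp add: onev_def axis_def)
  define k where "k = tpow (- lam C \<alpha> \<alpha>) * (tpow (- om (axis \<alpha> 2) (?c + onev)) - tpow (- om (nbr \<alpha>) (?c + onev)) :: laurent)"
  show thesis
  proof (rule that[of k])
    show "delta c \<triangleleft> Q \<alpha> (- 1) = (\<lambda>v. k * delta ?c v)"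
      unfolding Q_minus_1 ract_mult ract_scalar
      by (simp only: 1 2 ract_scale_left) (simp add: k_def 1 2 ract_scale_left mult.assoc)
    show "k = 0 \<longleftrightarrow> c $ \<alpha> = 0"
      using d_pos unfolding k_def 3 by simp
  qed
qed

lemma delta_Q_minus_1_power:
  "\<exists>k. delta c \<triangleleft> (Q \<alpha> (- 1) \<up> n) = (\<lambda>v. k * delta (c - axis \<alpha> (int n)) v) \<and>
     (c $ \<alpha> < 0 \<longrightarrow> k \<noteq> 0) \<and> (0 \<le> c $ \<alpha> \<longrightarrow> c $ \<alpha> < int n \<longrightarrow> k = 0)"
proof (induction n)
  case 0
  then show ?case by (intro exI[of _ 1]) simp
next
  case (Suc n)
  then obtain k where k: "delta c \<triangleleft> (Q \<alpha> (- 1) \<up> n) = (\<lambda>v. k * delta (c - axis \<alpha> (int n)) v)"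
     "c $ \<alpha> < 0 \<longrightarrow> k \<noteq> 0" "0 \<le> c $ \<alpha> \<longrightarrow> c $ \<alpha> < int n \<longrightarrow> k = 0" by blast
  obtain j where j: "delta (c - axis \<alpha> (int n)) \<triangleleft> Q \<alpha> (- 1) = (\<lambda>v. j * delta (c - axis \<alpha> (int n) - axis \<alpha> 1) v)"
    "j = 0 \<longleftrightarrow> (c - axis \<alpha> (int n)) $ \<alpha> = 0" by (rule delta_Q_minus_1)
  have "c - axis \<alpha> (int n) - axis \<alpha> 1 = c - axis \<alpha> (int (Suc n))"
    by (simp add: diff_diff_eq axis_add add.commute)
  with k(1) j(1) have "delta c \<triangleleft> (Q \<alpha> (- 1) \<up> Suc n) = (\<lambda>v. (k * j) * delta (c - axis \<alpha> (int (Suc n))) v)"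
    by (simp add: T.power_Suc2 ract_mult ract_scale_left mult.assoc del: T.power_Suc)
  moreover have "c $ \<alpha> < 0 \<longrightarrow> k * j \<noteq> 0" "0 \<le> c $ \<alpha> \<longrightarrow> c $ \<alpha> < int (Suc n) \<longrightarrow> k * j = 0"
    using k(2,3) j(2) by (auto simp: axis_def)
  ultimately show ?case by blast
qed

lemma delta_ypow_aux:
  assumes "nonneg a" "distinct xs"
  shows "\<exists>k. delta c \<triangleleft> lprod (\<lambda>\<alpha>. Q \<alpha> (- 1) \<up> nat (a $ \<alpha>)) xs =
       (\<lambda>v. k * delta (c - (\<Sum>\<alpha>\<in>set xs. axis \<alpha> (a $ \<alpha>))) v) \<and>
     ((\<forall>\<alpha>. c $ \<alpha> < 0) \<longrightarrow> k \<noteq> 0) \<and> ((\<exists>\<alpha>\<in>set xs. 0 \<le> c $ \<alpha> \<and> c $ \<alpha> < a $ \<alpha>) \<longrightarrow> k = 0)"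
  using assms(2)
proof (induction xs arbitrary: c)
  case Nil
  then show ?case by (intro exI[of _ 1]) simp
next
  case (Cons \<beta> xs)
  let ?c = "c - axis \<beta> (a $ \<beta>)"
  have a: "int (nat (a $ \<beta>)) = a $ \<beta>" using assms(1) by (simp add: nonneg_def)
  obtain k where k: "delta c \<triangleleft> (Q \<beta> (- 1) \<up> nat (a $ \<beta>)) = (\<lambda>v. k * delta ?c v)"
     "c $ \<beta> < 0 \<longrightarrow> k \<noteq> 0" "0 \<le> c $ \<beta> \<longrightarrow> c $ \<beta> < a $ \<beta> \<longrightarrow> k = 0"
    using delta_Q_minus_1_power[of c \<beta> "nat (a $ \<beta>)"] unfolding a by blast
  obtain j where j: "delta ?c \<triangleleft> lprod (\<lambda>\<alpha>. Q \<alpha> (- 1) \<up> nat (a $ \<alpha>)) xs =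
       (\<lambda>v. j * delta (?c - (\<Sum>\<alpha>\<in>set xs. axis \<alpha> (a $ \<alpha>))) v)"
     "(\<forall>\<alpha>. ?c $ \<alpha> < 0) \<longrightarrow> j \<noteq> 0" "(\<exists>\<alpha>\<in>set xs. 0 \<le> ?c $ \<alpha> \<and> ?c $ \<alpha> < a $ \<alpha>) \<longrightarrow> j = 0"
    using Cons.IH[of ?c] Cons.prems by auto
  have c: "?c $ \<alpha> = (if \<alpha> = \<beta> then c $ \<alpha> - a $ \<alpha> else c $ \<alpha>)" for \<alpha> by (simp add: axis_def)
  have s: "?c - (\<Sum>\<alpha>\<in>set xs. axis \<alpha> (a $ \<alpha>)) = c - (\<Sum>\<alpha>\<in>set (\<beta> # xs). axis \<alpha> (a $ \<alpha>))"
    using Cons.prems by (simp add: diff_diff_eq)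
  have "delta c \<triangleleft> lprod (\<lambda>\<alpha>. Q \<alpha> (- 1) \<up> nat (a $ \<alpha>)) (\<beta> # xs) =
       (\<lambda>v. (k * j) * delta (c - (\<Sum>\<alpha>\<in>set (\<beta> # xs). axis \<alpha> (a $ \<alpha>))) v)"
    unfolding s[symmetric] by (simp add: ract_mult k(1) ract_scale_left j(1) mult.assoc)
  moreover have "(\<forall>\<alpha>. c $ \<alpha> < 0) \<longrightarrow> k * j \<noteq> 0"
  proof
    assume neg: "\<forall>\<alpha>. c $ \<alpha> < 0"
    then have "\<forall>\<alpha>. ?c $ \<alpha> < 0" unfolding c using assms(1) by (auto simp: nonneg_def intro: order.strict_trans2)
    with neg j(2) k(2) show "k * j \<noteq> 0" by simp
  qed
  moreover have "(\<exists>\<alpha>\<in>set (\<beta> # xs). 0 \<le> c $ \<alpha> \<and> c $ \<alpha> < a $ \<alpha>) \<longrightarrow> k * j = 0"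
  proof (intro impI, elim bexE)
    fix \<alpha> assume \<alpha>: "\<alpha> \<in> set (\<beta> # xs)" "0 \<le> c $ \<alpha> \<and> c $ \<alpha> < a $ \<alpha>"
    show "k * j = 0"
    proof (cases "\<alpha> = \<beta>")
      case True
      with \<alpha>(2) k(3) show ?thesis by simp
    next
      case False
      with \<alpha> have "\<exists>\<alpha>\<in>set xs. 0 \<le> ?c $ \<alpha> \<and> ?c $ \<alpha> < a $ \<alpha>"
        unfolding c by (intro bexI[of _ \<alpha>]) auto
      with j(3) show ?thesis by simp
    qed
  qed
  ultimately show ?case by (intro exI[of _ "k * j"] conjI)
qed

text \<open>Stepping down from negative coordinates never meets coordinate 0, so the factor is
  nonzero; a descent from a nonnegative to a negative coordinate does meet it, so the factor is
  0.\<close>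

lemma delta_ypow:
  assumes "nonneg a"
  obtains k where "delta c \<triangleleft> ypow a = (\<lambda>v. k * delta (c - a) v)"
    "(\<forall>\<alpha>. c $ \<alpha> < 0) \<Longrightarrow> k \<noteq> 0" "\<And>\<alpha>. 0 \<le> c $ \<alpha> \<Longrightarrow> c $ \<alpha> < a $ \<alpha> \<Longrightarrow> k = 0"
proof -
  have s: "(\<Sum>\<alpha>\<in>UNIV. axis \<alpha> (a $ \<alpha>)) = a"
    by (simp add: vec_eq_iff axis_def cong: if_cong)
  obtain k where k: "delta c \<triangleleft> ypow a = (\<lambda>v. k * delta (c - (\<Sum>\<alpha>\<in>UNIV. axis \<alpha> (a $ \<alpha>))) v)"
     "(\<forall>\<alpha>. c $ \<alpha> < 0) \<longrightarrow> k \<noteq> 0" "(\<exists>\<alpha>. 0 \<le> c $ \<alpha> \<and> c $ \<alpha> < a $ \<alpha>) \<longrightarrow> k = 0"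
    using delta_ypow_aux[OF assms distinct_indices, of c] unfolding ypow_def set_indices by blast
  show thesis
  proof (rule that)
    show "delta c \<triangleleft> ypow a = (\<lambda>v. k * delta (c - a) v)" using k(1) unfolding s .
    show "k \<noteq> 0" if "\<forall>\<alpha>. c $ \<alpha> < 0" using k(2) that by blast
    show "k = 0" if "0 \<le> c $ \<alpha>" "c $ \<alpha> < a $ \<alpha>" for \<alpha> using k(3) that by blast
  qed
qed

subsection \<open>Polynomiality\<close>

text \<open>The substitution \<open>Q\<^bsub>\<alpha>,0\<^esub> \<mapsto> Q\<^bsub>\<alpha>,-1\<^esub>\<close>, \<open>Q\<^bsub>\<alpha>,1\<^esub> \<mapsto> Q\<^bsub>\<alpha>,0\<^esub>\<close>. It is meaningful (and multiplicative) on the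
  elements without negative powers of the \<open>Q\<^bsub>\<alpha>,0\<^esub>\<close>.\<close>

definition shift_hom :: "'r qt \<Rightarrow> 'r qt" where
  "shift_hom f = (\<Sum>k\<in>Poly_Mapping.keys f. qt_scalar (Poly_Mapping.lookup f k) \<star> (ypow (fst k) \<star> Poly_Mapping.single (snd k, 0) 1))"

definition xbound :: "int \<Rightarrow> 'r qt \<Rightarrow> bool" where
  "xbound N f \<longleftrightarrow> (\<forall>k\<in>Poly_Mapping.keys f. \<forall>\<alpha>. 0 \<le> fst k $ \<alpha> + N)"

definition xs :: "int \<Rightarrow> 'r qt" where "xs N = Poly_Mapping.single (N *s onev, 0) 1"

definition ys :: "int \<Rightarrow> 'r qt" where "ys N = ypow (N *s onev)"

lemma qt_scalar_0 [simp]: "qt_scalar 0 = 0"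
  by (simp add: qt_scalar_def)

lemma qt_scalar_add: "qt_scalar (a + b) = qt_scalar a + qt_scalar b"
  by (simp add: qt_scalar_def single_add)

lemma shift_hom_superset:
  assumes "finite A" "Poly_Mapping.keys f \<subseteq> A"
  shows "shift_hom f = (\<Sum>k\<in>A. qt_scalar (Poly_Mapping.lookup f k) \<star> (ypow (fst k) \<star> Poly_Mapping.single (snd k, 0) 1))"
  unfolding shift_hom_def by (rule sum.mono_neutral_left) (use assms in \<open>auto simp: in_keys_iff\<close>)

lemma shift_hom_add: "shift_hom (f + g) = shift_hom f + shift_hom g"
proof -
  let ?A = "Poly_Mapping.keys f \<union> Poly_Mapping.keys g"
  have "Poly_Mapping.keys (f + g) \<subseteq> ?A" by (rule keys_add)
  then show ?thesis
    by (simp add: shift_hom_superset[of ?A] lookup_add qt_scalar_add qt_mult_add_left sum.distrib)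
qed

lemma shift_hom_0 [simp]: "shift_hom 0 = 0"
  by (simp add: shift_hom_def)

lemma shift_hom_sum: "shift_hom (\<Sum>i\<in>I. f i) = (\<Sum>i\<in>I. shift_hom (f i))"
  by (induction I rule: infinite_finite_induct) (simp_all add: shift_hom_add)

lemma shift_hom_single: "shift_hom (Poly_Mapping.single k u) = qt_scalar u \<star> (ypow (fst k) \<star> Poly_Mapping.single (snd k, 0) 1)"
  by (subst shift_hom_superset[of "{k}"]) auto

lemma shift_hom_scalar: "shift_hom (qt_scalar c \<star> f) = qt_scalar c \<star> shift_hom f"
proof -
  have "Poly_Mapping.keys (qt_scalar c \<star> f) \<subseteq> Poly_Mapping.keys f" by (auto simp: in_keys_iff)
  then have "shift_hom (qt_scalar c \<star> f) = (\<Sum>k\<in>Poly_Mapping.keys f. qt_scalar (Poly_Mapping.lookup (qt_scalar c \<star> f) k) \<star>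
      (ypow (fst k) \<star> Poly_Mapping.single (snd k, 0) 1))"
    by (intro shift_hom_superset) simp_all
  then show ?thesis
    by (simp add: shift_hom_def qt_mult_sum_right qt_scalar_mult flip: T.mult_assoc)
qed

lemma shift_hom_mult_single:
  assumes "nonneg (fst k)" "nonneg (fst k')"
  shows "shift_hom (Poly_Mapping.single k u \<star> Poly_Mapping.single k' u') = shift_hom (Poly_Mapping.single k u) \<star> shift_hom (Poly_Mapping.single k' u')"
proof -
  let ?X = "\<lambda>b. Poly_Mapping.single (b, 0) (1::laurent)"
  have XX: "?X (snd k) \<star> ?X (snd k') = ?X (snd (k + k'))" by (simp add: qt_mult_single tpow_0)
  have "shift_hom (Poly_Mapping.single k u) \<star> shift_hom (Poly_Mapping.single k' u')
     = qt_scalar u \<star> (ypow (fst k) \<star> (?X (snd k) \<star> (qt_scalar u' \<star> (ypow (fst k') \<star> ?X (snd k')))))"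
    by (simp only: shift_hom_single T.mult_assoc)
  also have "\<dots> = qt_scalar (u * u') \<star> (ypow (fst k) \<star> ((?X (snd k) \<star> ypow (fst k')) \<star> ?X (snd k')))"
    by (subst qt_scalar_left_commute[of "?X (snd k)"], subst qt_scalar_left_commute[of "ypow (fst k)"])
      (simp only: T.mult_assoc[symmetric] qt_scalar_mult)
  also have "?X (snd k) \<star> ypow (fst k') = tt (- om (snd k) (fst k')) \<star> (ypow (fst k') \<star> ?X (snd k))"
    using qcommD[OF qcomm_x_ypow[OF assms(2), of "snd k"]] by (simp add: om_sym)
  also have "ypow (fst k) \<star> ((tt (- om (snd k) (fst k')) \<star> (ypow (fst k') \<star> ?X (snd k))) \<star> ?X (snd k'))
     = tt (- om (snd k) (fst k')) \<star> ((ypow (fst k) \<star> ypow (fst k')) \<star> (?X (snd k) \<star> ?X (snd k')))"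
    by (simp only: qt_scalar_left_commute[of "ypow _"] T.mult_assoc)
  also have "ypow (fst k) \<star> ypow (fst k') = ypow (fst (k + k'))"
    by (simp add: ypow_add assms)
  finally have *: "shift_hom (Poly_Mapping.single k u) \<star> shift_hom (Poly_Mapping.single k' u') =
      qt_scalar (u * u') \<star> (tt (- om (snd k) (fst k')) \<star> (ypow (fst (k + k')) \<star> ?X (snd (k + k'))))"
    unfolding XX .
  have "shift_hom (Poly_Mapping.single k u \<star> Poly_Mapping.single k' u') =
      qt_scalar (tpow (- om (snd k) (fst k')) * u * u') \<star> (ypow (fst (k + k')) \<star> ?X (snd (k + k')))"
    by (simp only: qt_mult_single shift_hom_single)
  also have "\<dots> = qt_scalar (u * u') \<star> (tt (- om (snd k) (fst k')) \<star> (ypow (fst (k + k')) \<star> ?X (snd (k + k'))))"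
    by (simp only: T.mult_assoc[symmetric] qt_scalar_mult) (simp only: ac_simps)
  finally show ?thesis by (simp only: *)
qed

lemma qt_sum_single: "f = (\<Sum>k\<in>Poly_Mapping.keys f. Poly_Mapping.single k (Poly_Mapping.lookup f k))" for f :: "'r qt"
  by (rule poly_mapping_eqI) (simp add: lookup_sum lookup_single when_def in_keys_iff)

lemma shift_hom_mult:
  assumes "xbound 0 f" "xbound 0 g"
  shows "shift_hom (f \<star> g) = shift_hom f \<star> shift_hom g"
proof -
  let ?s = "\<lambda>f k. Poly_Mapping.single k (Poly_Mapping.lookup f k)"
  have "shift_hom (f \<star> g) = shift_hom ((\<Sum>k\<in>Poly_Mapping.keys f. ?s f k) \<star> (\<Sum>k\<in>Poly_Mapping.keys g. ?s g k))"
    by (simp only: qt_sum_single[symmetric])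
  also have "\<dots> = (\<Sum>k\<in>Poly_Mapping.keys f. \<Sum>k'\<in>Poly_Mapping.keys g. shift_hom (?s f k \<star> ?s g k'))"
    by (simp only: qt_mult_sum_left qt_mult_sum_right shift_hom_sum) (rule sum.swap)
  also have "\<dots> = (\<Sum>k\<in>Poly_Mapping.keys f. \<Sum>k'\<in>Poly_Mapping.keys g. shift_hom (?s f k) \<star> shift_hom (?s g k'))"
    using assms by (intro sum.cong refl shift_hom_mult_single) (auto simp: xbound_def nonneg_def)
  also have "\<dots> = shift_hom (\<Sum>k\<in>Poly_Mapping.keys f. ?s f k) \<star> shift_hom (\<Sum>k\<in>Poly_Mapping.keys g. ?s g k)"
    by (simp only: qt_mult_sum_left qt_mult_sum_right shift_hom_sum) (rule sum.swap)
  also have "\<dots> = shift_hom f \<star> shift_hom g" by (simp only: qt_sum_single[symmetric])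
  finally show ?thesis .
qed

lemma xs_add: "xs (M + N) = xs M \<star> xs N"
  by (simp add: xs_def qt_mult_single tpow_0 vector_sadd_rdistrib)

lemma xs_0 [simp]: "xs 0 = 1"
  by (simp add: xs_def flip: zero_prod_def)

lemma shift_hom_xs: "shift_hom (xs N) = ys N"
  by (simp add: xs_def shift_hom_single ys_def qt_scalar_1 flip: zero_prod_def)

lemma xbound_xs: "0 \<le> N \<Longrightarrow> xbound 0 (xs N)"
  by (auto simp: xbound_def xs_def onev_def)

lemma xbound_conj: "xbound (M + N) f \<Longrightarrow> xbound 0 (xs M \<star> f \<star> xs N)"
  unfolding xbound_def xs_def by (auto elim!: keys_qt_mult simp: onev_def add.assoc add.left_commute)

lemma xbound_mono: "xbound M f \<Longrightarrow> M \<le> N \<Longrightarrow> xbound N f"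
  unfolding xbound_def by (smt (verit))

lemma xbound_mult:
  assumes "xbound M f" "xbound N g"
  shows "xbound (M + N) (f \<star> g)"
  unfolding xbound_def
proof (intro ballI allI)
  fix z \<alpha> assume "z \<in> Poly_Mapping.keys (f \<star> g)"
  then obtain x y where xy: "x \<in> Poly_Mapping.keys f" "y \<in> Poly_Mapping.keys g" "z = x + y"
    by (rule keys_qt_mult)
  then have "0 \<le> fst x $ \<alpha> + M" "0 \<le> fst y $ \<alpha> + N" using assms by (simp_all add: xbound_def)
  then show "0 \<le> fst z $ \<alpha> + (M + N)" using xy(3) by simp
qed

lemma xbound_add: "xbound M f \<Longrightarrow> xbound M g \<Longrightarrow> xbound M (f + g)"
  unfolding xbound_def using keys_add[of f g] by blast

lemma xbound_exists: "\<exists>N\<ge>0. xbound N f"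
proof -
  define N where "N = (\<Sum>k\<in>Poly_Mapping.keys f. \<Sum>\<alpha>\<in>UNIV. \<bar>fst k $ \<alpha>\<bar>)"
  have "0 \<le> fst k $ \<alpha> + N" if "k \<in> Poly_Mapping.keys f" for k \<alpha>
  proof -
    have "\<bar>fst k $ \<alpha>\<bar> \<le> (\<Sum>\<alpha>\<in>UNIV. \<bar>fst k $ \<alpha>\<bar>)" by (rule member_le_sum) auto
    also have "\<dots> \<le> N" unfolding N_def using that by (intro member_le_sum) (auto intro: sum_nonneg)
    finally show ?thesis by simp
  qed
  moreover have "0 \<le> N" unfolding N_def by (intro sum_nonneg) simp
  ultimately show ?thesis by (auto simp: xbound_def)
qed

text \<open>\<open>Q \<alpha> (- 1)\<close> is not invertible in the torus, so negative powers of
  \<open>Q \<alpha> 0\<close> have no image. They are cleared by a monomial \<open>xs N\<close> on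
  the right, whose image is \<open>ys N\<close>; in effect \<open>f'\<close> is the image of
  \<open>f\<close> in a localization.\<close>

definition shifts_to :: "'r qt \<Rightarrow> 'r qt \<Rightarrow> bool" where
  "shifts_to f f' \<longleftrightarrow> (\<exists>N0\<ge>0. xbound N0 f \<and> (\<forall>N\<ge>N0. shift_hom (f \<star> xs N) = f' \<star> ys N))"

lemma shift_hom_conj:
  assumes "0 \<le> N" "xbound (M - N) g"
  shows "ys N \<star> shift_hom (xs (- N) \<star> g \<star> xs M) = shift_hom (g \<star> xs M)"
proof -
  have "ys N \<star> shift_hom (xs (- N) \<star> g \<star> xs M) = shift_hom (xs N \<star> (xs (- N) \<star> g \<star> xs M))"
    using assms by (simp add: shift_hom_mult xbound_xs xbound_conj shift_hom_xs)
  also have "xs N \<star> (xs (- N) \<star> g \<star> xs M) = g \<star> xs M"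
    using xs_add[of N "- N"] by (simp flip: T.mult_assoc)
  finally show ?thesis .
qed

text \<open>Inserting \<open>xs N \<star> xs (- N)\<close> between the factors puts both of them
  into the domain on which \<open>shift_hom\<close> is multiplicative.\<close>

lemma shift_hom_factor:
  assumes "0 \<le> N" "xbound N f" "xbound (M - N) g"
  shows "shift_hom (f \<star> g \<star> xs M) = shift_hom (f \<star> xs N) \<star> shift_hom (xs (- N) \<star> g \<star> xs M)"
proof -
  have "xbound 0 (f \<star> xs N)" using xbound_conj[of 0 N f] assms by simp
  then have "shift_hom (f \<star> xs N) \<star> shift_hom (xs (- N) \<star> g \<star> xs M) = shift_hom ((f \<star> xs N) \<star> (xs (- N) \<star> g \<star> xs M))"
    using assms by (simp add: shift_hom_mult xbound_conj)
  also have "(f \<star> xs N) \<star> (xs (- N) \<star> g \<star> xs M) = f \<star> ((xs N \<star> xs (- N)) \<star> (g \<star> xs M))"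
    by (simp only: T.mult_assoc)
  also have "\<dots> = f \<star> g \<star> xs M"
    using xs_add[of N "- N"] by (simp add: T.mult_assoc)
  finally show ?thesis by simp
qed

lemma shifts_to_mult:
  assumes "shifts_to f f'" "shifts_to g g'"
  shows "shifts_to (f \<star> g) (f' \<star> g')"
proof -
  obtain N1 where N1: "0 \<le> N1" "xbound N1 f" "\<And>N. N1 \<le> N \<Longrightarrow> shift_hom (f \<star> xs N) = f' \<star> ys N"
    using assms(1) by (auto simp: shifts_to_def)
  obtain N2 where N2: "0 \<le> N2" "xbound N2 g" "\<And>N. N2 \<le> N \<Longrightarrow> shift_hom (g \<star> xs N) = g' \<star> ys N"
    using assms(2) by (auto simp: shifts_to_def)
  have "shift_hom (f \<star> g \<star> xs M) = f' \<star> g' \<star> ys M" if "N1 + N2 \<le> M" for M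
  proof -
    have g: "xbound (M - N1) g" using N2(2) that by (rule_tac xbound_mono) auto
    have "shift_hom (f \<star> g \<star> xs M) = shift_hom (f \<star> xs N1) \<star> shift_hom (xs (- N1) \<star> g \<star> xs M)"
      by (rule shift_hom_factor[OF N1(1,2) g])
    also have "\<dots> = f' \<star> (ys N1 \<star> shift_hom (xs (- N1) \<star> g \<star> xs M))"
      using N1(3)[of N1] by (simp add: T.mult_assoc)
    also have "\<dots> = f' \<star> shift_hom (g \<star> xs M)" by (simp only: shift_hom_conj[OF N1(1) g])
    also have "\<dots> = f' \<star> g' \<star> ys M" using N2(3)[of M] N1(1) that by (simp add: T.mult_assoc)
    finally show ?thesis .
  qed
  then show ?thesis unfolding shifts_to_def using N1 N2 by (intro exI[of _ "N1 + N2"]) (auto intro: xbound_mult)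
qed

lemma shifts_to_add:
  assumes "shifts_to f f'" "shifts_to g g'"
  shows "shifts_to (f + g) (f' + g')"
proof -
  obtain N1 where N1: "0 \<le> N1" "xbound N1 f" "\<And>N. N1 \<le> N \<Longrightarrow> shift_hom (f \<star> xs N) = f' \<star> ys N"
    using assms(1) by (auto simp: shifts_to_def)
  obtain N2 where N2: "0 \<le> N2" "xbound N2 g" "\<And>N. N2 \<le> N \<Longrightarrow> shift_hom (g \<star> xs N) = g' \<star> ys N"
    using assms(2) by (auto simp: shifts_to_def)
  show ?thesis
    unfolding shifts_to_def using N1 N2
    by (intro exI[of _ "N1 + N2"]) (auto simp: qt_mult_add_left shift_hom_add intro!: xbound_add intro: xbound_mono)
qed

lemma shifts_to_scalar: "shifts_to f f' \<Longrightarrow> shifts_to (qt_scalar c \<star> f) (qt_scalar c \<star> f')"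
proof -
  assume "shifts_to f f'"
  then obtain N where N: "0 \<le> N" "xbound N f" "\<And>M. N \<le> M \<Longrightarrow> shift_hom (f \<star> xs M) = f' \<star> ys M"
    by (auto simp: shifts_to_def)
  have "xbound N (qt_scalar c \<star> f)" using N(2) by (auto simp: xbound_def in_keys_iff)
  with N show ?thesis
    unfolding shifts_to_def by (intro exI[of _ N]) (simp add: T.mult_assoc shift_hom_scalar)
qed

lemma shifts_to_diff: "shifts_to f f' \<Longrightarrow> shifts_to g g' \<Longrightarrow> shifts_to (f - g) (f' - g')"
proof -
  have m: "qt_scalar (- 1) \<star> h = - h" for h :: "'r qt"
    by (rule poly_mapping_eqI) simp
  assume "shifts_to f f'" "shifts_to g g'"
  then show ?thesis using shifts_to_add[of f f' "- g" "- g'"] shifts_to_scalar[of g g' "- 1"] by (simp add: m)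
qed

lemma shifts_to_one: "shifts_to 1 1"
proof -
  have "xbound 0 (1 :: 'r qt)" by (simp add: xbound_def)
  then show ?thesis unfolding shifts_to_def by (intro exI[of _ 0]) (simp add: shift_hom_xs)
qed

lemma shifts_to_power: "shifts_to f f' \<Longrightarrow> shifts_to (f \<up> n) (f' \<up> n)"
  by (induction n) (simp_all add: shifts_to_one shifts_to_mult)

lemma shifts_to_lprod: "(\<And>i. i \<in> set l \<Longrightarrow> shifts_to (f i) (f' i)) \<Longrightarrow> shifts_to (lprod f l) (lprod f' l)"
  by (induction l) (simp_all add: shifts_to_one shifts_to_mult)

lemma topmon_power: "addf \<psi> \<Longrightarrow> topmon \<psi> f k \<Longrightarrow> \<exists>k'. topmon \<psi> (f \<up> n) k'"
proof (induction n)
  case 0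
  show ?case by (rule exI[of _ 0]) (simp add: topmon_one)
next
  case (Suc n)
  then obtain k' where "topmon \<psi> (f \<up> n) k'" by blast
  with Suc.prems have "topmon \<psi> (f \<star> f \<up> n) (k + k')" by (intro topmon_mult)
  then show ?case by (simp only: T.power_Suc) (rule exI)
qed

lemma topmon_ypow: "\<exists>k. topmon psi1 (ypow a) k"
proof -
  have "\<forall>\<alpha>. \<exists>k. topmon psi1 (Q \<alpha> (- 1) \<up> nat (a $ \<alpha>)) k"
    using topmon_power[OF addf_psi(1) topmon_psi1] by simp
  then obtain k where k: "\<And>\<alpha>. topmon psi1 (Q \<alpha> (- 1) \<up> nat (a $ \<alpha>)) (k \<alpha>)" by metis
  have "topmon psi1 (ypow a) (sum_list (map k indices))"
    unfolding ypow_def by (rule topmon_lprod[OF addf_psi(1) k])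
  then show ?thesis by blast
qed

text \<open>The image of the conjugated \<open>g\<close> inherits a leading monomial from
  \<open>g'\<close>, so it can be cancelled on the right of the two candidates for the image of
  \<open>f\<close>.\<close>

lemma shifts_to_divide:
  assumes "shifts_to (f \<star> g) (f' \<star> g')" "shifts_to g g'" "topmon psi1 g' k"
  shows "shifts_to f f'"
proof -
  obtain N1 where N1: "0 \<le> N1" "xbound N1 f" using xbound_exists by blast
  obtain N2 where N2: "0 \<le> N2" "xbound N2 g" "\<And>N. N2 \<le> N \<Longrightarrow> shift_hom (g \<star> xs N) = g' \<star> ys N"
    using assms(2) by (auto simp: shifts_to_def)
  obtain N3 where N3: "0 \<le> N3" "\<And>N. N3 \<le> N \<Longrightarrow> shift_hom (f \<star> g \<star> xs N) = f' \<star> g' \<star> ys N"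
    using assms(1) by (auto simp: shifts_to_def)
  have "shift_hom (f \<star> xs N) = f' \<star> ys N" if "N1 \<le> N" for N
  proof -
    define M where "M = N + N2 + N3"
    have N0: "0 \<le> N" and M: "N2 \<le> M" "N3 \<le> M" "N2 \<le> M - N"
      using N1 N2 N3 that by (simp_all add: M_def)
    have f: "xbound N f" using N1(2) that by (rule xbound_mono)
    have g: "xbound (M - N) g" using N2(2) M(3) by (rule xbound_mono)
    define Z where "Z = shift_hom (xs (- N) \<star> g \<star> xs M)"
    have yZ: "ys N \<star> Z = g' \<star> ys M"
      unfolding Z_def using shift_hom_conj[OF N0 g] N2(3)[OF M(1)] by simp
    obtain k1 where k1: "topmon psi1 (ys M) k1" unfolding ys_def using topmon_ypow by blast
    obtain k2 where k2: "topmon psi1 (ys N) k2" unfolding ys_def using topmon_ypow by blast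
    have "topmon psi1 (ys N \<star> Z) (k + k1)" unfolding yZ by (rule topmon_mult[OF addf_psi(1) assms(3) k1])
    from topmon_divide_left[OF addf_psi(1) k2 this] have Z: "topmon psi1 Z (k + k1 - k2)" .
    have "shift_hom (f \<star> xs N) \<star> Z = shift_hom (f \<star> g \<star> xs M)" unfolding Z_def by (rule shift_hom_factor[OF N0 f g, symmetric])
    also have "\<dots> = f' \<star> (g' \<star> ys M)" using N3(2)[OF M(2)] by (simp add: T.mult_assoc)
    also have "\<dots> = f' \<star> ys N \<star> Z" by (simp add: yZ[symmetric] T.mult_assoc)
    finally show ?thesis by (rule topmon_cancel_right_eq[OF addf_psi(1) Z])
  qed
  with N1 show ?thesis by (auto simp: shifts_to_def)
qed

lemma shifts_to_Q_0: "shifts_to (Q \<alpha> 0) (Q \<alpha> (- 1))"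
proof -
  have "shift_hom (Q \<alpha> 0 \<star> xs N) = Q \<alpha> (- 1) \<star> ys N" if "0 \<le> N" for N
  proof -
    have "Q \<alpha> 0 \<star> xs N = Poly_Mapping.single (axis \<alpha> 1 + N *s onev, 0) 1"
      by (simp add: Q_0 xs_def qt_mult_single tpow_0)
    then have "shift_hom (Q \<alpha> 0 \<star> xs N) = ypow (axis \<alpha> 1 + N *s onev)"
      by (simp add: shift_hom_single qt_scalar_1 flip: zero_prod_def)
    also have "\<dots> = ypow (axis \<alpha> 1) \<star> ypow (N *s onev)"
      using that by (intro ypow_add) (auto simp: nonneg_def axis_def onev_def)
    finally show ?thesis by (simp add: ypow_axis ys_def)
  qed
  moreover have "xbound 0 (Q \<alpha> 0)" by (auto simp: xbound_def Q_0 axis_def)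
  ultimately show ?thesis unfolding shifts_to_def by (intro exI[of _ 0]) simp
qed

lemma shifts_to_Q_1: "shifts_to (Q \<alpha> 1) (Q \<alpha> 0)"
proof -
  have "shift_hom (Q \<alpha> 1 \<star> xs N) = Q \<alpha> 0 \<star> ys N" if "0 \<le> N" for N
  proof -
    have "Q \<alpha> 1 \<star> xs N = Poly_Mapping.single (N *s onev, axis \<alpha> 1) (tpow (- om (axis \<alpha> 1) (N *s onev)))"
      by (simp add: Q_1 xs_def qt_mult_single)
    then have "shift_hom (Q \<alpha> 1 \<star> xs N) = tt (- om (axis \<alpha> 1) (N *s onev)) \<star> (ys N \<star> Q \<alpha> 0)"
      by (simp add: shift_hom_single ys_def Q_0)
    also have "\<dots> = Q \<alpha> 0 \<star> ys N"
      using qcommD[OF qcomm_x_ypow[of "N *s onev" "axis \<alpha> 1"]] that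
      by (simp add: ys_def Q_0 nonneg_def onev_def om_sym[of "axis \<alpha> 1"])
    finally show ?thesis .
  qed
  moreover have "xbound 0 (Q \<alpha> 1)" by (auto simp: xbound_def Q_1)
  ultimately show ?thesis unfolding shifts_to_def by (intro exI[of _ 0]) simp
qed

text \<open>The recursion has the same coefficients at every index. Both sides of it are therefore
  matched one index lower, and the factor of smallest index is divided out.\<close>

lemma shifts_to_Q: "shifts_to (Q \<alpha> (int n)) (Q \<alpha> (int n - 1))"
proof (induction n arbitrary: \<alpha> rule: less_induct)
  case (less n)
  consider "n = 0" | "n = 1" | j where "n = Suc (Suc j)"
    by (metis One_nat_def not0_implies_Suc)
  then show ?case
  proof cases
    case 1
    then show ?thesis using shifts_to_Q_0 by simp
  next
    case 2
    then show ?thesis using shifts_to_Q_1 by simp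
  next
    case 3
    have S1: "shifts_to (Q \<beta> (int j + 1)) (Q \<beta> (int j))" for \<beta>
      using less.IH[of "Suc j" \<beta>] 3 by (simp add: add.commute)
    have S0: "shifts_to (Q \<alpha> (int j)) (Q \<alpha> (int j - 1))"
      using less.IH[of j \<alpha>] 3 by simp
    have "shifts_to (Q \<alpha> (int j + 1) \<star> Q \<alpha> (int j + 1) - nprod \<alpha> (int j + 1)) (Q \<alpha> (int j) \<star> Q \<alpha> (int j) - nprod \<alpha> (int j))"
      unfolding nprod_def by (intro shifts_to_diff shifts_to_mult shifts_to_lprod shifts_to_power S1)
    then have "shifts_to (tt (- lam C \<alpha> \<alpha>) \<star> (Q \<alpha> (int j + 1) \<star> Q \<alpha> (int j + 1) - nprod \<alpha> (int j + 1)))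
       (tt (- lam C \<alpha> \<alpha>) \<star> (Q \<alpha> (int j) \<star> Q \<alpha> (int j) - nprod \<alpha> (int j)))"
      by (rule shifts_to_scalar)
    moreover have "Q \<alpha> (int j + 2) \<star> Q \<alpha> (int j) = tt (- lam C \<alpha> \<alpha>) \<star> (Q \<alpha> (int j + 1) \<star> Q \<alpha> (int j + 1) - nprod \<alpha> (int j + 1))"
      using iffD1[OF tt_eq_iff, OF Q_rec[of \<alpha> "int j + 1"]] by (simp add: add.assoc)
    moreover have "Q \<alpha> (int j + 1) \<star> Q \<alpha> (int j - 1) = tt (- lam C \<alpha> \<alpha>) \<star> (Q \<alpha> (int j) \<star> Q \<alpha> (int j) - nprod \<alpha> (int j))"
      by (rule iffD1[OF tt_eq_iff, OF Q_rec[of \<alpha> "int j"]])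
    ultimately have "shifts_to (Q \<alpha> (int j + 2) \<star> Q \<alpha> (int j)) (Q \<alpha> (int j + 1) \<star> Q \<alpha> (int j - 1))" by simp
    from shifts_to_divide[OF this S0 topmon_psi1] have "shifts_to (Q \<alpha> (int j + 2)) (Q \<alpha> (int j + 1))" by simp
    then show ?thesis by (simp add: 3 add.commute)
  qed
qed

text \<open>Follow \<open>f'\<close> by \<open>ys N\<close>. At a point with all coordinates
  negative this acts by a nonzero scalar, so nothing is lost; the composite is the image of
  \<open>f \<star> xs N\<close>, a sum of terms that first apply powers of the
  \<open>Q \<alpha> (- 1)\<close>, none of which can carry \<open>c\<close> below coordinate
  0.\<close>

lemma shifts_to_stab_negative:
  assumes "shifts_to f f'" "0 \<le> c $ \<alpha>" "\<And>\<beta>. (c + b) $ \<beta> < 0"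
  shows "(delta c \<triangleleft> f') (c + b) = 0"
proof -
  obtain N where N: "0 \<le> N" "xbound N f" "shift_hom (f \<star> xs N) = f' \<star> ys N"
    using assms(1) by (auto simp: shifts_to_def)
  let ?n = "N *s onev"
  have nn: "nonneg ?n" using N(1) by (simp add: nonneg_def onev_def)
  define w where "w = c + b - ?n"
  obtain k where k: "delta (c + b) \<triangleleft> ypow ?n = (\<lambda>v. k * delta w v)" "k \<noteq> 0"
    using delta_ypow[OF nn, of "c + b"] assms(3) unfolding w_def by metis
  have "((delta c \<triangleleft> f') \<triangleleft> ypow ?n) w = (delta c \<triangleleft> f') (c + b) * k"
  proof -
    let ?B = "insert (- ?n) (snd ` Poly_Mapping.keys (ypow ?n))"
    have "((delta c \<triangleleft> f') \<triangleleft> ypow ?n) w = (\<Sum>b'\<in>?B. (delta c \<triangleleft> f') (w - b') * (delta (w - b') \<triangleleft> ypow ?n) w)"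
      by (rule ract_expand) auto
    also have "\<dots> = (\<Sum>b'\<in>{- ?n}. (delta c \<triangleleft> f') (w - b') * (delta (w - b') \<triangleleft> ypow ?n) w)"
    proof (rule sum.mono_neutral_right)
      show "\<forall>b'\<in>?B - {- ?n}. (delta c \<triangleleft> f') (w - b') * (delta (w - b') \<triangleleft> ypow ?n) w = 0"
      proof
        fix b' assume b': "b' \<in> ?B - {- ?n}"
        obtain j where "delta (w - b') \<triangleleft> ypow ?n = (\<lambda>v. j * delta (w - b' - ?n) v)"
          using delta_ypow[OF nn, of "w - b'"] by metis
        moreover have "w \<noteq> w - b' - ?n" using b' by (auto simp: algebra_simps eq_neg_iff_add_eq_0)
        ultimately show "(delta c \<triangleleft> f') (w - b') * (delta (w - b') \<triangleleft> ypow ?n) w = 0"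
          by (simp add: delta_def)
      qed
    qed auto
    also have "\<dots> = (delta c \<triangleleft> f') (c + b) * k"
      using k(1) by (simp add: w_def delta_def)
    finally show ?thesis .
  qed
  moreover have "((delta c \<triangleleft> f') \<triangleleft> ypow ?n) w = (delta c \<triangleleft> shift_hom (f \<star> xs N)) w"
    by (simp add: N(3) ys_def ract_mult)
  moreover have "(delta c \<triangleleft> shift_hom (f \<star> xs N)) w = 0"
    unfolding shift_hom_def ract_sum_right
  proof (rule sum.neutral, rule ballI)
    fix q assume q: "q \<in> Poly_Mapping.keys (f \<star> xs N)"
    have a: "nonneg (fst q)"
      using q xbound_conj[of 0 N f] N(2) by (simp add: xbound_def nonneg_def)
    obtain j where j: "delta c \<triangleleft> ypow (fst q) = (\<lambda>v. j * delta (c - fst q) v)"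
      "\<And>\<alpha>. 0 \<le> c $ \<alpha> \<Longrightarrow> c $ \<alpha> < fst q $ \<alpha> \<Longrightarrow> j = 0"
      using delta_ypow[OF a, of c] by metis
    \<comment> \<open>A term reaching \<open>w\<close> would have to lower the coordinate \<alpha>
      from a nonnegative to a negative value, and then its factor \<open>j\<close> is 0.\<close>
    have "j = 0 \<or> w \<noteq> c - fst q"
    proof (rule ccontr)
      assume "\<not> (j = 0 \<or> w \<noteq> c - fst q)"
      then have "fst q $ \<alpha> = N - b $ \<alpha>" "j \<noteq> 0"
        by (auto simp: w_def vec_eq_iff onev_def algebra_simps)
      with j(2)[of \<alpha>] assms(2) assms(3)[of \<alpha>] N(1) show False by simp
    qed
    then show "(delta c \<triangleleft> (qt_scalar (Poly_Mapping.lookup (f \<star> xs N) q) \<star> (ypow (fst q) \<star> Poly_Mapping.single (snd q, 0) 1))) w = 0"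
      unfolding ract_mult ract_scalar ract_scale_left j(1) ract_delta_single by (auto simp: delta_def)
  qed
  ultimately show ?thesis using k(2) by simp
qed

text \<open>Along a coordinate direction \<beta> other than \<alpha> the matrix element from
  \<open>c\<close> to \<open>c + b\<close> is an exponential sum. It vanishes where that coordinate
  is very negative, hence everywhere; the coordinates in \<open>B\<close> are released one after
  another.\<close>

lemma stab_extend:
  assumes "\<And>c. 0 \<le> c $ \<alpha> \<Longrightarrow> (\<And>\<beta>. (c + b) $ \<beta> < 0) \<Longrightarrow> (delta c \<triangleleft> f) (c + b) = 0"
    and "0 \<le> c $ \<alpha>" "(c + b) $ \<alpha> < 0"
  shows "(delta c \<triangleleft> f) (c + b) = 0"
proof -
  have *: "(delta c \<triangleleft> f) (c + b) = 0"
    if "finite B" "\<alpha> \<notin> B" "0 \<le> c $ \<alpha>" "(c + b) $ \<alpha> < 0" "\<And>\<beta>. \<beta> \<notin> B \<Longrightarrow> (c + b) $ \<beta> < 0" for B c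
    using that
  proof (induction B arbitrary: c rule: finite_induct)
    case empty
    then show ?case using assms(1) by blast
  next
    case (insert \<beta> B)
    let ?A = "{k\<in>Poly_Mapping.keys f. snd k = b}"
    define w where "w k = Poly_Mapping.lookup f k * tpow (- om (fst k) (c + onev))" for k
    have eq: "(delta (c + axis \<beta> n) \<triangleleft> f) (c + axis \<beta> n + b) = (\<Sum>k\<in>?A. w k * tpow ((- om (fst k) (axis \<beta> 1)) * n))" for n
    proof -
      have "om (fst k) (axis \<beta> n) = om (fst k) (axis \<beta> 1) * n"
        for k :: "(int, 'r) vec \<times> (int, 'r) vec" by (simp add: om_axis)
      then have "- om (fst k) (c + onev) + (- om (fst k) (axis \<beta> 1)) * n = - om (fst k) (c + axis \<beta> n + onev)"
        for k :: "(int, 'r) vec \<times> (int, 'r) vec"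
        by (simp add: om_add_right)
      then have "w k * tpow ((- om (fst k) (axis \<beta> 1)) * n) =
          Poly_Mapping.lookup f k * tpow (- om (fst k) (c + axis \<beta> n + onev))" for k
        by (simp only: w_def mult.assoc tpow_mult)
      then show ?thesis by (simp add: ract_delta)
    qed
    have "(\<Sum>k\<in>?A. w k * tpow ((- om (fst k) (axis \<beta> 1)) * 0)) = 0"
    proof (rule exponential_sum_vanishes[of ?A "- \<bar>(c + b) $ \<beta>\<bar> - 1" w "\<lambda>k. - om (fst k) (axis \<beta> 1)" 0])
      \<comment> \<open>The bound on \<open>n\<close> makes the coordinate \<beta> of the endpoint
        negative, as the induction hypothesis asks.\<close>
      fix n assume n: "n \<le> - \<bar>(c + b) $ \<beta>\<bar> - 1"
      have "(delta (c + axis \<beta> n) \<triangleleft> f) (c + axis \<beta> n + b) = 0"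
      proof (rule insert.IH)
        show "\<alpha> \<notin> B" "0 \<le> (c + axis \<beta> n) $ \<alpha>" "(c + axis \<beta> n + b) $ \<alpha> < 0"
          using insert.prems by (auto simp: axis_def)
        show "(c + axis \<beta> n + b) $ \<gamma> < 0" if "\<gamma> \<notin> B" for \<gamma>
          using insert.prems(4)[of \<gamma>] that n by (cases "\<gamma> = \<beta>") (auto simp: axis_def)
      qed
      then show "(\<Sum>k\<in>?A. w k * tpow ((- om (fst k) (axis \<beta> 1)) * n)) = 0" by (simp only: eq)
    next
      show "finite ?A" by simp
    qed
    then show ?case unfolding eq[symmetric] by simp
  qed
  show ?thesis
  proof (rule *[of "UNIV - {\<alpha>}"])
    show "(c + b) $ \<beta> < 0" if "\<beta> \<notin> UNIV - {\<alpha>}" for \<beta> using that assms(3) by simp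
  qed (use assms(2,3) in simp_all)
qed

text \<open>\<open>Q \<beta> n\<close> is the image of \<open>Q \<beta> (n + 1)\<close>, so the
  vanishing holds at endpoints with all coordinates negative and then extends.\<close>

lemma stab_Q: "stab \<alpha> (Q \<beta> (int n))"
  unfolding stab_def
proof (intro allI impI)
  fix b c :: "(int, 'r) vec" assume bc: "0 \<le> b $ \<alpha>" "c $ \<alpha> < 0"
  have S: "shifts_to (Q \<beta> (int n + 1)) (Q \<beta> (int n))" using shifts_to_Q[of \<beta> "Suc n"] by (simp add: add.commute)
  have "(delta b \<triangleleft> Q \<beta> (int n)) (b + (c - b)) = 0"
  proof (rule stab_extend[of \<alpha>])
    show "(delta c' \<triangleleft> Q \<beta> (int n)) (c' + (c - b)) = 0"
      if "0 \<le> c' $ \<alpha>" "\<And>\<beta>. (c' + (c - b)) $ \<beta> < 0" for c'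
      by (rule shifts_to_stab_negative[OF S that])
  qed (use bc in simp_all)
  then show "(delta b \<triangleleft> Q \<beta> (int n)) c = 0" by simp
qed

subsection \<open>Integer powers on functions bounded above\<close>

definition bnd :: "int \<Rightarrow> ((int, 'r) vec \<Rightarrow> laurent) \<Rightarrow> bool" where
  "bnd B g \<longleftrightarrow> (\<forall>c. g c \<noteq> 0 \<longrightarrow> phi c \<le> B)"

text \<open>A completion: supports may be infinite in the direction of decreasing
  \<open>phi\<close>, which gives room for inverses of operators with a leading monomial.\<close>

definition PB :: "((int, 'r) vec \<Rightarrow> laurent) set" where "PB = {g. \<exists>B. bnd B g}"

lemma PB_I: "bnd B g \<Longrightarrow> g \<in> PB" by (auto simp: PB_def)

lemma bnd_mono: "bnd B g \<Longrightarrow> B \<le> B' \<Longrightarrow> bnd B' g" by (force simp: bnd_def)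

lemma bnd_zeroD: "bnd B g \<Longrightarrow> B < phi c \<Longrightarrow> g c = 0" by (force simp: bnd_def)

lemma bnd_diff: "bnd B g \<Longrightarrow> bnd B h \<Longrightarrow> bnd B (\<lambda>c. g c - h c)"
  unfolding bnd_def by (metis diff_self)

lemma bnd_add: "bnd B g \<Longrightarrow> bnd B h \<Longrightarrow> bnd B (\<lambda>c. g c + h c)"
  unfolding bnd_def by (metis add_0)

lemma bnd_scale: "bnd B g \<Longrightarrow> bnd B (\<lambda>c. u * g c)"
  by (auto simp: bnd_def)

lemma PB_diff: "g \<in> PB \<Longrightarrow> h \<in> PB \<Longrightarrow> (\<lambda>c. g c - h c) \<in> PB"
proof -
  assume "g \<in> PB" "h \<in> PB"
  then obtain B B' where "bnd B g" "bnd B' h" by (auto simp: PB_def)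
  then have "bnd (max B B') g" "bnd (max B B') h" by (auto elim: bnd_mono)
  from bnd_diff[OF this] show ?thesis by (rule PB_I)
qed

lemma PB_add: "g \<in> PB \<Longrightarrow> h \<in> PB \<Longrightarrow> (\<lambda>c. g c + h c) \<in> PB"
proof -
  assume "g \<in> PB" "h \<in> PB"
  then obtain B B' where "bnd B g" "bnd B' h" by (auto simp: PB_def)
  then have "bnd (max B B') g" "bnd (max B B') h" by (auto elim: bnd_mono)
  from bnd_add[OF this] show ?thesis by (rule PB_I)
qed

lemma PB_scale: "g \<in> PB \<Longrightarrow> (\<lambda>c. u * g c) \<in> PB"
  unfolding PB_def using bnd_scale by blast

lemma bnd_delta: "bnd (phi b) (delta b)"
  by (auto simp: bnd_def delta_def)

lemma PB_delta [simp]: "delta b \<in> PB"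
  using bnd_delta by (rule PB_I)

lemma phi_diff: "phi (a - b) = phi a - phi b"
  by (rule addf_diff[OF addf_phi])

lemma phi_add: "phi (a + b) = phi a + phi b"
  by (rule addf_add[OF addf_phi])

lemma bnd_ract:
  assumes "bnd B g" "\<And>k. k \<in> Poly_Mapping.keys f \<Longrightarrow> psi2 k \<le> e"
  shows "bnd (B + e) (g \<triangleleft> f)"
  unfolding bnd_def
proof (intro allI impI)
  fix c assume "(g \<triangleleft> f) c \<noteq> 0"
  then have "\<exists>k\<in>Poly_Mapping.keys f. g (c - snd k) \<noteq> 0"
    unfolding ract_def using sum.neutral by (metis (no_types, lifting) mult_zero_right)
  then obtain k where k: "k \<in> Poly_Mapping.keys f" "g (c - snd k) \<noteq> 0" by blast
  then have "phi (c - snd k) \<le> B" "phi (snd k) \<le> e"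
    using assms by (auto simp: bnd_def psi2_def)
  then show "phi c \<le> B + e" by (simp add: phi_diff)
qed

lemma ract_cong:
  assumes "\<And>k. k \<in> Poly_Mapping.keys f \<Longrightarrow> g (c - snd k) = g' (c - snd k)"
  shows "(g \<triangleleft> f) c = (g' \<triangleleft> f) c"
  unfolding ract_def by (rule sum.cong) (simp_all add: assms)

lemma PB_ract [simp]: "g \<in> PB \<Longrightarrow> g \<triangleleft> f \<in> PB"
proof -
  assume "g \<in> PB"
  then obtain B where "bnd B g" by (auto simp: PB_def)
  have "psi2 k \<le> (\<Sum>k\<in>Poly_Mapping.keys f. \<bar>psi2 k\<bar>)" if "k \<in> Poly_Mapping.keys f" for k
  proof -
    have "\<bar>psi2 k\<bar> \<le> (\<Sum>k\<in>Poly_Mapping.keys f. \<bar>psi2 k\<bar>)" using that by (intro member_le_sum) auto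
    then show ?thesis by linarith
  qed
  from bnd_ract[OF \<open>bnd B g\<close> this] show ?thesis by (rule PB_I)
qed

text \<open>A function in \<open>PB\<close> that is not zero has a support point of maximal
  \<open>phi\<close>. The leading monomial moves its value to a point which no other monomial of
  \<open>f\<close> can reach from the support.\<close>

lemma ract_topmon_inj_zero:
  assumes "topmon psi2 f k" "g \<in> PB" "g \<triangleleft> f = (\<lambda>_. 0)"
  shows "g = (\<lambda>_. 0)"
proof (rule ccontr)
  assume "g \<noteq> (\<lambda>_. 0)"
  then obtain c0 where c0: "g c0 \<noteq> 0" by auto
  obtain B where B: "bnd B g" using assms(2) by (auto simp: PB_def)
  define P where "P n \<longleftrightarrow> (\<exists>c. g c \<noteq> 0 \<and> nat (B - phi c) = n)" for n
  have "P (nat (B - phi c0))" using c0 by (auto simp: P_def)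
  then have "P (LEAST n. P n)" by (rule LeastI)
  then obtain c where c: "g c \<noteq> 0" "nat (B - phi c) = (LEAST n. P n)" by (auto simp: P_def)
  have max: "phi c' \<le> phi c" if "g c' \<noteq> 0" for c'
  proof -
    have "nat (B - phi c) \<le> nat (B - phi c')"
      unfolding c(2) by (rule Least_le) (use that in \<open>auto simp: P_def\<close>)
    moreover have "phi c' \<le> B" "phi c \<le> B" using that c B by (auto simp: bnd_def)
    ultimately show ?thesis by linarith
  qed
  let ?c = "c + snd k"
  have "(g \<triangleleft> f) ?c = (\<Sum>q\<in>Poly_Mapping.keys f. Poly_Mapping.lookup f q * tpow (- om (fst q) (?c - snd q + onev)) * g (?c - snd q))"
    by (simp add: ract_def)
  also have "\<dots> = (\<Sum>q\<in>{k}. Poly_Mapping.lookup f q * tpow (- om (fst q) (?c - snd q + onev)) * g (?c - snd q))"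
  proof (rule sum.mono_neutral_right)
    show "{k} \<subseteq> Poly_Mapping.keys f"
      using munit_nonzero[OF topmon_lookup[OF assms(1)]] by (simp add: in_keys_iff)
    show "\<forall>q\<in>Poly_Mapping.keys f - {k}. Poly_Mapping.lookup f q * tpow (- om (fst q) (?c - snd q + onev)) * g (?c - snd q) = 0"
    proof
      fix q assume q: "q \<in> Poly_Mapping.keys f - {k}"
      then have "psi2 q < psi2 k" using assms(1) by (auto simp: topmon_iff)
      then have "phi c < phi (?c - snd q)" by (simp add: psi2_def phi_diff phi_add)
      then have "g (?c - snd q) = 0" using max[of "?c - snd q"] by linarith
      then show "Poly_Mapping.lookup f q * tpow (- om (fst q) (?c - snd q + onev)) * g (?c - snd q) = 0" by simp
    qed
  qed simp
  also have "\<dots> \<noteq> 0" using c(1) munit_nonzero[OF topmon_lookup[OF assms(1)]] by simp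
  finally show False using assms(3) by simp
qed

lemma ract_topmon_inj:
  assumes "topmon psi2 f k" "g \<in> PB" "g' \<in> PB" "g \<triangleleft> f = g' \<triangleleft> f"
  shows "g = g'"
proof -
  have "(\<lambda>c. g c - g' c) \<triangleleft> f = (\<lambda>_. 0)" unfolding ract_diff_left assms(4) by simp
  from ract_topmon_inj_zero[OF assms(1) PB_diff[OF assms(2,3)] this] show ?thesis
    by (metis eq_iff_diff_eq_0 ext)
qed

text \<open>The inverse is the Neumann series of the leading monomial.\<close>

lemma ract_topmon_surj:
  assumes f: "topmon psi2 f k" and h: "bnd B h"
  obtains g where "bnd (B - psi2 k) g" "g \<triangleleft> f = h"
proof -
  obtain u where u: "munit u" "domin psi2 (psi2 k) (f - Poly_Mapping.single k u)"
    using f by (auto simp: topmon_def)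
  define U where "U = Poly_Mapping.single k u"
  define R where "R = f - U"
  obtain v where v: "munit v" "Poly_Mapping.single k u \<star> Poly_Mapping.single (- k) v = 1"
     "Poly_Mapping.single (- k) v \<star> Poly_Mapping.single k u = 1"
    by (rule single_munit_inverse[OF u(1)])
  define V where "V = Poly_Mapping.single (- k) v"
  have UV: "U \<star> V = 1" "V \<star> U = 1" using v by (simp_all add: U_def V_def)
  define e where "e = psi2 k"
  have R: "psi2 q \<le> e - 1" if "q \<in> Poly_Mapping.keys R" for q
    using u(2) that by (auto simp: domin_def R_def U_def e_def)
  have V: "psi2 q \<le> - e" if "q \<in> Poly_Mapping.keys V" for q
    using that addf_uminus[OF addf_psi(2)] by (auto simp: V_def e_def split: if_splits)
  define G where "G g = (\<lambda>c. h c - (g \<triangleleft> R) c) \<triangleleft> V" for g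
  have G_diff: "(\<lambda>c. G g c - G g' c) = (\<lambda>c. - 1 * ((\<lambda>c. (g c - g' c)) \<triangleleft> R) c) \<triangleleft> V" for g g'
  proof -
    have "(\<lambda>c. G g c - G g' c) = (\<lambda>c. (h c - (g \<triangleleft> R) c) - (h c - (g' \<triangleleft> R) c)) \<triangleleft> V"
      by (simp only: G_def ract_diff_left[of "\<lambda>c. h c - (g \<triangleleft> R) c" "\<lambda>c. h c - (g' \<triangleleft> R) c" V])
    also have "(\<lambda>c. (h c - (g \<triangleleft> R) c) - (h c - (g' \<triangleleft> R) c)) = (\<lambda>c. - 1 * ((\<lambda>c. (g c - g' c)) \<triangleleft> R) c)"
      by (simp add: ract_diff_left)
    finally show ?thesis .
  qed
  define s where "s n = (G ^^ n) (\<lambda>_. 0)" for n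
  have s_Suc: "s (Suc n) = G (s n)" for n by (simp add: s_def)
  have s_bnd: "bnd (B - e) (s n)" for n
  proof (induction n)
    case 0
    then show ?case by (simp add: s_def bnd_def)
  next
    case (Suc n)
    have "bnd (B - e + (e - 1)) (s n \<triangleleft> R)" using Suc R by (rule bnd_ract)
    then have "bnd B (\<lambda>c. h c - (s n \<triangleleft> R) c)" by (intro bnd_diff h) (rule bnd_mono, auto)
    from bnd_ract[OF this V] show ?case by (simp add: s_Suc G_def)
  qed
  \<comment> \<open>Each iteration lowers the support of the difference by one step of
    \<open>phi\<close>, so the iterates become stationary at every point.\<close>
  have s_step: "bnd (B - e - int n) (\<lambda>c. s (Suc n) c - s n c)" for n
  proof (induction n)
    case 0
    then show ?case using s_bnd[of 1] by (simp add: s_def)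
  next
    case (Suc n)
    have "bnd (B - e - int n + (e - 1)) ((\<lambda>c. s (Suc n) c - s n c) \<triangleleft> R)" using Suc R by (rule bnd_ract)
    from bnd_ract[OF bnd_scale[OF this, of "- 1"] V]
    show ?case unfolding s_Suc[of "Suc n"] s_Suc[of n, symmetric] by (subst (2) s_Suc) (simp add: G_diff algebra_simps)
  qed
  have stable: "s (n + j) c = s n c" if "B - e - int n < phi c" for n j c
  proof (induction j)
    case (Suc j)
    have "s (Suc (n + j)) c - s (n + j) c = 0"
      using bnd_zeroD[OF s_step[of "n + j"], of c] that by simp
    with Suc show ?case by simp
  qed simp
  define g where "g c = s (nat (B - e - phi c + 1)) c" for c
  have g: "g c = s n c" if "B - e - int n < phi c" for n c
  proof -
    let ?m = "nat (B - e - phi c + 1)"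
    have "?m \<le> n" using that by linarith
    then obtain j where "n = ?m + j" by (metis le_add_diff_inverse)
    moreover have "B - e - int ?m < phi c" by linarith
    ultimately show ?thesis using stable[of ?m c j] by (simp add: g_def)
  qed
  have fix_g: "g = G g"
  proof
    fix c
    \<comment> \<open>So large that \<open>s n\<close> already agrees with \<open>g\<close> at every
      point which enters the value of \<open>G\<close> at \<open>c\<close>: the second summand
      covers the displacements by \<open>V\<close> and \<open>R\<close>.\<close>
    define n where "n = nat (B - e - phi c + 1) + nat (\<Sum>q\<in>Poly_Mapping.keys V. \<Sum>q'\<in>Poly_Mapping.keys R. \<bar>psi2 q\<bar> + \<bar>psi2 q'\<bar>)"
    have "g c = s (Suc n) c" by (rule g) (simp add: n_def)
    also have "\<dots> = ((\<lambda>c. h c - (s n \<triangleleft> R) c) \<triangleleft> V) c" by (simp add: s_Suc G_def)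
    also have "\<dots> = ((\<lambda>c. h c - (g \<triangleleft> R) c) \<triangleleft> V) c"
    proof (rule ract_cong)
      fix q assume q: "q \<in> Poly_Mapping.keys V"
      have "(s n \<triangleleft> R) (c - snd q) = (g \<triangleleft> R) (c - snd q)"
      proof (rule ract_cong)
        fix q' assume q': "q' \<in> Poly_Mapping.keys R"
        have "\<bar>psi2 q\<bar> + \<bar>psi2 q'\<bar> \<le> (\<Sum>q'\<in>Poly_Mapping.keys R. \<bar>psi2 q\<bar> + \<bar>psi2 q'\<bar>)"
          using q' by (intro member_le_sum) auto
        also have "\<dots> \<le> (\<Sum>q\<in>Poly_Mapping.keys V. \<Sum>q'\<in>Poly_Mapping.keys R. \<bar>psi2 q\<bar> + \<bar>psi2 q'\<bar>)"
          using q by (intro member_le_sum) (auto intro!: sum_nonneg)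
        finally have "B - e - int n < phi (c - snd q - snd q')"
          by (simp add: n_def phi_diff psi2_def) linarith
        then show "s n (c - snd q - snd q') = g (c - snd q - snd q')" by (rule g[symmetric])
      qed
      then show "h (c - snd q) - (s n \<triangleleft> R) (c - snd q) = h (c - snd q) - (g \<triangleleft> R) (c - snd q)" by simp
    qed
    finally show "g c = G g c" by (simp add: G_def)
  qed
  have "g \<triangleleft> U = (\<lambda>c. h c - (g \<triangleleft> R) c)"
    by (subst fix_g) (simp add: G_def ract_mult[symmetric] UV)
  moreover have "g \<triangleleft> f = (\<lambda>c. (g \<triangleleft> U) c + (g \<triangleleft> R) c)"
    by (rule ext) (simp add: R_def ract_diff_right)
  ultimately have "g \<triangleleft> f = h" by simp
  moreover have "bnd (B - e) g"
    using s_bnd unfolding bnd_def g_def by blast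
  ultimately show thesis using that by (simp add: e_def)
qed

text \<open>For negative \<open>n\<close> this is the inverse on \<open>PB\<close>, where existence
  and uniqueness hold; nothing is claimed for other functions.\<close>

definition rpow :: "'r qt \<Rightarrow> int \<Rightarrow> ((int, 'r) vec \<Rightarrow> laurent) \<Rightarrow> ((int, 'r) vec \<Rightarrow> laurent)" where
  "rpow f n g = (if 0 \<le> n then g \<triangleleft> (f \<up> nat n) else (THE h. h \<in> PB \<and> h \<triangleleft> (f \<up> nat (- n)) = g))"

definition tmon :: "'r qt \<Rightarrow> bool" where "tmon f \<longleftrightarrow> (\<exists>k. topmon psi2 f k)"

lemma tmon_power: "tmon f \<Longrightarrow> tmon (f \<up> n)"
  unfolding tmon_def using topmon_power[OF addf_psi(2)] by blast

lemma tmon_inj: "tmon f \<Longrightarrow> g \<in> PB \<Longrightarrow> g' \<in> PB \<Longrightarrow> g \<triangleleft> f = g' \<triangleleft> f \<Longrightarrow> g = g'"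
  unfolding tmon_def using ract_topmon_inj by blast

lemma rpow_neg:
  assumes "tmon f" "g \<in> PB"
  shows "rpow f (- int n) g \<in> PB \<and> rpow f (- int n) g \<triangleleft> (f \<up> n) = g"
proof (cases "n = 0")
  case False
  obtain k where k: "topmon psi2 (f \<up> n) k" using tmon_power[OF assms(1), of n] by (auto simp: tmon_def)
  obtain B where "bnd B g" using assms(2) by (auto simp: PB_def)
  from ract_topmon_surj[OF k this] obtain h where h: "h \<in> PB" "h \<triangleleft> (f \<up> n) = g" using PB_I by metis
  have "(THE h. h \<in> PB \<and> h \<triangleleft> (f \<up> n) = g) = h"
    using h tmon_inj[OF tmon_power[OF assms(1), of n]] by (intro the_equality) auto
  with h False show ?thesis by (simp add: rpow_def)
qed (use assms in \<open>simp add: rpow_def\<close>)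

lemma rpow_PB [simp]:
  assumes "tmon f" "g \<in> PB"
  shows "rpow f n g \<in> PB"
  using rpow_neg[OF assms, of "nat (- n)"] assms by (cases "0 \<le> n") (simp_all add: rpow_def)

lemma rpow_0 [simp]: "rpow f 0 g = g"
  by (simp add: rpow_def)

lemma rpow_plus1:
  assumes "tmon f" "g \<in> PB"
  shows "rpow f (n + 1) g = rpow f n g \<triangleleft> f"
proof (cases "0 \<le> n")
  case True
  then show ?thesis by (simp add: rpow_def nat_add_distrib T.power_Suc2 ract_mult del: T.power_Suc)
next
  case False
  define m where "m = nat (- n - 1)"
  have n: "n = - int (Suc m)" "n + 1 = - int m" using False by (simp_all add: m_def)
  have 1: "(rpow f n g \<triangleleft> f) \<triangleleft> (f \<up> m) = g"
    using rpow_neg[OF assms, of "Suc m"] by (simp add: n(1) ract_mult)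
  have 2: "rpow f (n + 1) g \<triangleleft> (f \<up> m) = g"
    using rpow_neg[OF assms, of m] by (simp add: n(2))
  show ?thesis
    by (rule tmon_inj[OF tmon_power[OF assms(1), of m]]) (use assms 1 2 in auto)
qed

lemma rpow_minus1:
  assumes "tmon f" "g \<in> PB"
  shows "rpow f (n - 1) g \<triangleleft> f = rpow f n g"
  using rpow_plus1[OF assms, of "n - 1"] by simp

lemma rpow_add_nat:
  assumes "tmon f" "g \<in> PB"
  shows "rpow f (n + int m) g = rpow f n g \<triangleleft> (f \<up> m)"
proof (induction m)
  case (Suc m)
  have "rpow f (n + int (Suc m)) g = rpow f (n + int m + 1) g" by (simp add: algebra_simps)
  also have "\<dots> = rpow f n g \<triangleleft> (f \<up> m) \<triangleleft> f" using Suc by (simp only: rpow_plus1[OF assms])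
  also have "\<dots> = rpow f n g \<triangleleft> (f \<up> Suc m)" by (simp only: ract_mult[symmetric] T.power_Suc2)
  finally show ?case .
qed simp

lemma int_induct_both:
  assumes "P (0::int)" "\<And>n. P n \<Longrightarrow> P (n + 1)" "\<And>n. P n \<Longrightarrow> P (n - 1)"
  shows "P n"
  by (rule int_induct[of P 0 n]) (use assms in auto)

lemma rpow_scale:
  assumes f: "tmon f" and g: "g \<in> PB"
  shows "rpow f n (\<lambda>c. u * g c) = (\<lambda>c. u * rpow f n g c)"
proof (induction n rule: int_induct_both)
  case (2 n)
  then show ?case by (simp add: rpow_plus1 f g PB_scale ract_scale_left)
next
  case (3 n)
  show ?case
  proof (rule tmon_inj[OF f])
    show "rpow f (n - 1) (\<lambda>c. u * g c) \<triangleleft> f = (\<lambda>c. u * rpow f (n - 1) g c) \<triangleleft> f"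
      using 3 by (simp add: rpow_minus1 f g PB_scale ract_scale_left)
  qed (simp_all add: f g PB_scale)
qed simp

lemma rpow_diff:
  assumes f: "tmon f" and g: "g \<in> PB" and h: "h \<in> PB"
  shows "rpow f n (\<lambda>c. g c - h c) = (\<lambda>c. rpow f n g c - rpow f n h c)"
proof (induction n rule: int_induct_both)
  case (2 n)
  then show ?case by (simp add: rpow_plus1 f g h PB_diff ract_diff_left)
next
  case (3 n)
  show ?case
  proof (rule tmon_inj[OF f])
    show "rpow f (n - 1) (\<lambda>c. g c - h c) \<triangleleft> f = (\<lambda>c. rpow f (n - 1) g c - rpow f (n - 1) h c) \<triangleleft> f"
      using 3 by (simp add: rpow_minus1 f g h PB_diff ract_diff_left)
  qed (simp_all add: f g h PB_diff)
qed simp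

lemma rpow_qcomm:
  assumes f: "tmon f" and g: "g \<in> PB" and q: "qcomm e f f'"
  shows "rpow f n g \<triangleleft> f' = (\<lambda>c. tpow (e * n) * rpow f n (g \<triangleleft> f') c)"
proof -
  have swap: "h \<triangleleft> f \<triangleleft> f' = (\<lambda>c. tpow e * (h \<triangleleft> f' \<triangleleft> f) c)" for h
  proof -
    have "h \<triangleleft> f \<triangleleft> f' = h \<triangleleft> (tt e \<star> (f' \<star> f))" using q by (simp only: ract_mult[symmetric] qcomm_def)
    then show ?thesis by (simp add: ract_mult ract_scalar ract_scale_left)
  qed
  show ?thesis
  proof (induction n rule: int_induct_both)
    case 1
    then show ?case by (simp add: tpow_0)
  next
    case (2 n)
    have "rpow f (n + 1) g \<triangleleft> f' = (\<lambda>c. tpow e * (rpow f n g \<triangleleft> f' \<triangleleft> f) c)"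
      by (simp add: rpow_plus1 f g swap)
    also have "\<dots> = (\<lambda>c. tpow e * (tpow (e * n) * rpow f (n + 1) (g \<triangleleft> f') c))"
      by (simp add: 2 ract_scale_left rpow_plus1 f g)
    finally show ?case by (simp add: mult.assoc[symmetric] tpow_mult algebra_simps)
  next
    case (3 n)
    show ?case
    proof (rule tmon_inj[OF f])
      have "(\<lambda>c. tpow e * (rpow f (n - 1) g \<triangleleft> f' \<triangleleft> f) c) = rpow f n g \<triangleleft> f'"
        unfolding swap[symmetric] by (simp add: rpow_minus1 f g)
      also have "\<dots> = (\<lambda>c. tpow (e * n) * rpow f n (g \<triangleleft> f') c)" by (rule 3)
      finally have eq: "tpow e * (rpow f (n - 1) g \<triangleleft> f' \<triangleleft> f) c = tpow (e * n) * rpow f n (g \<triangleleft> f') c" for c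
        by (rule fun_cong)
      have "(rpow f (n - 1) g \<triangleleft> f' \<triangleleft> f) c = tpow (e * (n - 1)) * rpow f n (g \<triangleleft> f') c" for c
      proof -
        have "tpow (- e) * (tpow e * (rpow f (n - 1) g \<triangleleft> f' \<triangleleft> f) c) = tpow (- e) * (tpow (e * n) * rpow f n (g \<triangleleft> f') c)"
          by (simp only: eq)
        then show ?thesis by (simp add: mult.assoc[symmetric] tpow_mult tpow_0 algebra_simps)
      qed
      then show "rpow f (n - 1) g \<triangleleft> f' \<triangleleft> f = (\<lambda>c. tpow (e * (n - 1)) * rpow f (n - 1) (g \<triangleleft> f') c) \<triangleleft> f"
        by (simp add: ract_scale_left rpow_minus1 f g fun_eq_iff)
    qed (simp_all add: f g PB_scale)
  qed
qed

lemma bnd_rpow: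
  assumes f: "topmon psi2 f k" and g: "bnd B g"
  shows "bnd (B + psi2 k * n) (rpow f n g)"
proof -
  have t: "tmon f" "g \<in> PB" using f g unfolding tmon_def by (blast intro: PB_I)+
  show ?thesis
  proof (induction n rule: int_induct_both)
    case (2 n)
    have "bnd (B + psi2 k * n + psi2 k) (rpow f n g \<triangleleft> f)"
      using 2 by (rule bnd_ract) (rule topmon_keys_le[OF f])
    then have "bnd (B + psi2 k * (n + 1)) (rpow f n g \<triangleleft> f)" by (simp add: algebra_simps)
    then show ?case by (simp only: rpow_plus1[OF t])
  next
    case (3 n)
    obtain h where h: "bnd (B + psi2 k * n - psi2 k) h" "h \<triangleleft> f = rpow f n g"
      using ract_topmon_surj[OF f 3] by metis
    have "h = rpow f (n - 1) g"
      by (rule tmon_inj[OF t(1)]) (use h t in \<open>auto simp: rpow_minus1 intro: PB_I\<close>)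
    with h(1) show ?case by (simp add: algebra_simps)
  qed (simp add: g)
qed

lemma tmon_Q [simp]: "tmon (Q \<alpha> (int i))"
  unfolding tmon_def using topmon_psi2 by blast

fun level :: "nat \<Rightarrow> ('r \<Rightarrow> int) \<Rightarrow> 'r list \<Rightarrow> ((int, 'r) vec \<Rightarrow> laurent) \<Rightarrow> ((int, 'r) vec \<Rightarrow> laurent)" where
  "level i \<nu> [] g = g"
| "level i \<nu> (\<beta> # l) g = level i \<nu> l (rpow (Q \<beta> (int i)) (\<nu> \<beta>) g)"

lemma level_PB [simp]: "g \<in> PB \<Longrightarrow> level i \<nu> l g \<in> PB"
  by (induction l arbitrary: g) simp_all

lemma level_scale: "g \<in> PB \<Longrightarrow> level i \<nu> l (\<lambda>c. u * g c) = (\<lambda>c. u * level i \<nu> l g c)"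
  by (induction l arbitrary: g) (simp_all add: rpow_scale)

lemma level_diff: "g \<in> PB \<Longrightarrow> h \<in> PB \<Longrightarrow> level i \<nu> l (\<lambda>c. g c - h c) = (\<lambda>c. level i \<nu> l g c - level i \<nu> l h c)"
  by (induction l arbitrary: g h) (simp_all add: rpow_diff)

lemma level_qcomm:
  assumes "g \<in> PB" "\<And>\<beta>. \<beta> \<in> set l \<Longrightarrow> qcomm (e \<beta>) (Q \<beta> (int i)) f'"
  shows "level i \<nu> l g \<triangleleft> f' = (\<lambda>c. tpow (\<Sum>\<beta>\<leftarrow>l. e \<beta> * \<nu> \<beta>) * level i \<nu> l (g \<triangleleft> f') c)"
  using assms
proof (induction l arbitrary: g)
  case Nil
  then show ?case by (simp add: tpow_0)
next
  case (Cons \<beta> l)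
  have 1: "rpow (Q \<beta> (int i)) (\<nu> \<beta>) g \<triangleleft> f' = (\<lambda>c. tpow (e \<beta> * \<nu> \<beta>) * rpow (Q \<beta> (int i)) (\<nu> \<beta>) (g \<triangleleft> f') c)"
    by (rule rpow_qcomm) (use Cons.prems in auto)
  show ?case
    using Cons by (simp add: 1 level_scale mult.assoc[symmetric] tpow_mult add.commute)
qed

lemma level_add_nat:
  assumes "g \<in> PB" "distinct l"
  shows "level i (\<lambda>\<beta>. \<nu> \<beta> + int (\<mu> \<beta>)) l g = level i \<nu> l g \<triangleleft> lprod (\<lambda>\<beta>. Q \<beta> (int i) \<up> \<mu> \<beta>) l"
  using assms
proof (induction l arbitrary: g)
  case (Cons \<beta> l)
  let ?g = "rpow (Q \<beta> (int i)) (\<nu> \<beta>) g"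
  have "level i \<nu> l ?g \<triangleleft> (Q \<beta> (int i) \<up> \<mu> \<beta>) = (\<lambda>c. tpow (\<Sum>\<gamma>\<leftarrow>l. 0 * \<nu> \<gamma>) * level i \<nu> l (?g \<triangleleft> (Q \<beta> (int i) \<up> \<mu> \<beta>)) c)"
  proof (rule level_qcomm)
    show "qcomm 0 (Q \<gamma> (int i)) (Q \<beta> (int i) \<up> \<mu> \<beta>)" for \<gamma>
      using qcomm_power_right[OF Q_commute[of "int i" \<gamma> \<beta>]] by simp
  qed (use Cons.prems in simp)
  then have 1: "level i \<nu> l (?g \<triangleleft> (Q \<beta> (int i) \<up> \<mu> \<beta>)) = level i \<nu> l ?g \<triangleleft> (Q \<beta> (int i) \<up> \<mu> \<beta>)"
    by (simp add: sum_list_0 tpow_0)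
  show ?case
    using Cons by (simp add: rpow_add_nat 1 ract_mult)
qed simp

text \<open>\<open>vac n k\<close> is \<open>\<langle>0| \<Prod>\<^sub>i\<^sub>\<le>\<^sub>k \<Prod>\<^sub>\<alpha> Q\<^bsub>\<alpha>,i\<^esub>\<^bsup>n(\<alpha>,i)\<^esup>\<close> with integer exponents.\<close>

fun vac :: "('r \<Rightarrow> nat \<Rightarrow> int) \<Rightarrow> nat \<Rightarrow> ((int, 'r) vec \<Rightarrow> laurent)" where
  "vac n 0 = delta 0"
| "vac n (Suc k) = level (Suc k) (\<lambda>\<alpha>. n \<alpha> (Suc k)) indices (vac n k)"

lemma vac_PB [simp]: "vac n k \<in> PB"
  by (induction k) simp_all

lemma vac_cong: "(\<And>\<alpha> i. 1 \<le> i \<Longrightarrow> i \<le> k \<Longrightarrow> n \<alpha> i = n' \<alpha> i) \<Longrightarrow> vac n k = vac n' k"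
proof (induction k)
  case (Suc k)
  then have "vac n k = vac n' k" by simp
  moreover have "(\<lambda>\<alpha>. n \<alpha> (Suc k)) = (\<lambda>\<alpha>. n' \<alpha> (Suc k))" using Suc.prems by auto
  ultimately show ?case by simp
qed simp

lemma vac_Suc_add:
  assumes "\<And>\<beta>. n' \<beta> (Suc k) = n \<beta> (Suc k) + int (\<mu> \<beta>)" "\<And>\<beta> i. i \<le> k \<Longrightarrow> n' \<beta> i = n \<beta> i"
  shows "vac n' (Suc k) = vac n (Suc k) \<triangleleft> lprod (\<lambda>\<beta>. Q \<beta> (int (Suc k)) \<up> \<mu> \<beta>) indices"
proof -
  have "vac n' k = vac n k" by (rule vac_cong) (use assms in auto)
  then show ?thesis using level_add_nat[of "vac n k" indices "Suc k" "\<lambda>\<alpha>. n \<alpha> (Suc k)" \<mu>] assms(1) by simp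
qed

lemma lprod_Q_delta: "lprod (\<lambda>\<beta>. Q \<beta> m \<up> (if \<beta> = \<alpha> then x else 0)) indices = Q \<alpha> m \<up> x"
proof -
  have "lprod (\<lambda>\<beta>. Q \<beta> m \<up> (if \<beta> = \<alpha> then x else 0)) indices = lprod (\<lambda>\<beta>. if \<beta> = \<alpha> then Q \<alpha> m \<up> x else 1) indices"
    by (rule lprod_cong) auto
  then show ?thesis by (simp add: lprod_delta)
qed

lemma vac_bump_top: "vac (bump \<alpha> (Suc k) (int x) n) (Suc k) = vac n (Suc k) \<triangleleft> (Q \<alpha> (int (Suc k)) \<up> x)"
  by (subst vac_Suc_add[of _ _ n "\<lambda>\<beta>. if \<beta> = \<alpha> then x else 0"]) (auto simp: bump_def lprod_Q_delta)

lemma vac_bumpnbr_top: "vac (bumpnbr \<alpha> (Suc k) n) (Suc k) = vac n (Suc k) \<triangleleft> nprod \<alpha> (int (Suc k))"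
  by (subst vac_Suc_add[of _ _ n "\<lambda>\<beta>. nat (Adj $ \<alpha> $ \<beta>)"]) (auto simp: bumpnbr_def nprod_def)

lemma delta_Q_0: "delta 0 \<triangleleft> Q \<alpha> 0 = (\<lambda>c. tpow (- rho \<alpha>) * delta 0 c)"
proof -
  have "om (axis \<alpha> 1) onev = rho \<alpha>"
    using phi_om(1)[of "axis \<alpha> 1"] by (simp add: onev_def)
  then show ?thesis by (simp add: Q_0 ract_delta_single)
qed

text \<open>\<open>Q \<alpha> (i - 1)\<close> moves left past all factors of level \<open>i\<close>
  at the cost of a power of t and joins level \<open>i - 1\<close>. For \<open>i = 1\<close> it is
  \<open>Q \<alpha> 0\<close>, which acts on the vacuum by a scalar instead.\<close>

lemma vac_lower:
  assumes "1 \<le> i"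
  shows "vac n i \<triangleleft> Q \<alpha> (int i - 1) = (\<lambda>c. tpow (- (\<Sum>\<beta>\<in>UNIV. lam C \<alpha> \<beta> * n \<beta> i) - (if i = 1 then rho \<alpha> else 0)) *
     vac (if i = 1 then n else bump \<alpha> (i - 1) 1 n) i c)"
proof -
  obtain k where k: "i = Suc k" using assms by (cases i) auto
  have q: "qcomm (- lam C \<alpha> \<beta>) (Q \<beta> (int (Suc k))) (Q \<alpha> (int k))" for \<beta>
    using qcomm_sym[OF Q_qcommute[of "int k" \<alpha> \<beta>]] by (simp add: add.commute)
  have "vac n (Suc k) \<triangleleft> Q \<alpha> (int k) = (\<lambda>c. tpow (\<Sum>\<beta>\<leftarrow>indices. - lam C \<alpha> \<beta> * n \<beta> (Suc k)) *
     level (Suc k) (\<lambda>\<alpha>. n \<alpha> (Suc k)) indices (vac n k \<triangleleft> Q \<alpha> (int k)) c)"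
    unfolding vac.simps(2) by (rule level_qcomm) (use q in simp_all)
  also have "(\<Sum>\<beta>\<leftarrow>indices. - lam C \<alpha> \<beta> * n \<beta> (Suc k)) = - (\<Sum>\<beta>\<in>UNIV. lam C \<alpha> \<beta> * n \<beta> i)"
    by (simp add: sum_list_indices sum_negf k)
  finally have 1: "vac n i \<triangleleft> Q \<alpha> (int i - 1) = (\<lambda>c. tpow (- (\<Sum>\<beta>\<in>UNIV. lam C \<alpha> \<beta> * n \<beta> i)) *
     level (Suc k) (\<lambda>\<alpha>. n \<alpha> (Suc k)) indices (vac n k \<triangleleft> Q \<alpha> (int k)) c)"
    by (simp add: k)
  show ?thesis
  proof (cases "k = 0")
    case True
    then show ?thesis
      unfolding 1 by (simp add: k delta_Q_0 level_scale mult.assoc[symmetric] tpow_mult)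
  next
    case False
    then obtain j where j: "k = Suc j" by (cases k) auto
    have "vac (bump \<alpha> k 1 n) k = vac n k \<triangleleft> Q \<alpha> (int k)"
      using vac_bump_top[of \<alpha> j 1 n] by (simp add: j)
    moreover have "(\<lambda>\<beta>. bump \<alpha> k 1 n \<beta> (Suc k)) = (\<lambda>\<beta>. n \<beta> (Suc k))" by (simp add: bump_def)
    ultimately show ?thesis unfolding 1 using False by (simp add: k)
  qed
qed

text \<open>The extra factor of level \<open>i - 1\<close> is brought to the right of level
  \<open>i\<close> and the one of level \<open>i + 1\<close> to the left of its level, so that they
  become adjacent; the reversed recursion then replaces them by the square and the product over
  neighbours.\<close>

lemma vac_Q_system_local:
  assumes "1 \<le> i"
  shows "vac (bump \<alpha> (Suc i) 1 (if i = 1 then n else bump \<alpha> (i - 1) 1 n)) (Suc i) =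
    (\<lambda>c. tpow ((\<Sum>\<beta>\<in>UNIV. lam C \<alpha> \<beta> * n \<beta> i) + (if i = 1 then rho \<alpha> else 0) + lam C \<alpha> \<alpha>) *
      (vac (bump \<alpha> i 2 n) (Suc i) c - tpow (- d) * vac (bumpnbr \<alpha> i n) (Suc i) c))"
proof -
  let ?n' = "if i = 1 then n else bump \<alpha> (i - 1) 1 n"
  define s where "s = (\<Sum>\<beta>\<in>UNIV. lam C \<alpha> \<beta> * n \<beta> i) + (if i = 1 then rho \<alpha> else 0)"
  define W where "W = level (Suc i) (\<lambda>\<alpha>. n \<alpha> (Suc i)) indices"
  have W_of: "vac n'' (Suc i) = W (vac n'' i)" if "\<And>\<beta>. n'' \<beta> (Suc i) = n \<beta> (Suc i)" for n''
    by (simp add: W_def that)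
  have low: "vac ?n' i = (\<lambda>c. tpow s * (vac n i \<triangleleft> Q \<alpha> (int i - 1)) c)"
    unfolding vac_lower[OF assms] s_def by (simp add: mult.assoc[symmetric] tpow_mult tpow_0)
  have "vac (bump \<alpha> (Suc i) 1 ?n') (Suc i) = vac ?n' (Suc i) \<triangleleft> Q \<alpha> (int (Suc i))"
    using vac_bump_top[of \<alpha> i 1 ?n'] by simp
  also have "\<dots> = W (vac ?n' i) \<triangleleft> Q \<alpha> (int (Suc i))"
    by (subst W_of) (auto simp: bump_def)
  also have "\<dots> = W (vac ?n' i \<triangleleft> Q \<alpha> (int (Suc i)))"
  proof -
    have "W (vac ?n' i) \<triangleleft> Q \<alpha> (int (Suc i)) = (\<lambda>c. tpow (\<Sum>\<beta>\<leftarrow>indices. 0 * n \<beta> (Suc i)) * W (vac ?n' i \<triangleleft> Q \<alpha> (int (Suc i))) c)"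
      unfolding W_def by (rule level_qcomm) (simp_all add: Q_commute)
    then show ?thesis by (simp add: sum_list_0 tpow_0)
  qed
  also have "vac ?n' i \<triangleleft> Q \<alpha> (int (Suc i)) = (\<lambda>c. tpow s * (vac n i \<triangleleft> (Q \<alpha> (int i - 1) \<star> Q \<alpha> (int i + 1))) c)"
    unfolding low ract_scale_left ract_mult by (simp add: add.commute)
  also have "\<dots> = (\<lambda>c. tpow (s + lam C \<alpha> \<alpha>) * ((vac n i \<triangleleft> (Q \<alpha> (int i) \<star> Q \<alpha> (int i))) c - tpow (- d) * (vac n i \<triangleleft> nprod \<alpha> (int i)) c))"
  proof -
    have "vac n i \<triangleleft> (Q \<alpha> (int i - 1) \<star> Q \<alpha> (int i + 1)) =
      (\<lambda>c. tpow (lam C \<alpha> \<alpha>) * (vac n i \<triangleleft> (Q \<alpha> (int i) \<star> Q \<alpha> (int i))) c - tpow (lam C \<alpha> \<alpha> - d) * (vac n i \<triangleleft> nprod \<alpha> (int i)) c)"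
      using assms by (subst Q_rec_reversed) (simp_all add: fun_eq_iff ract_diff_right ract_mult[of _ "tt _"] ract_scalar ract_scale_left)
    moreover have "tpow (lam C \<alpha> \<alpha> - d) = tpow (lam C \<alpha> \<alpha>) * (tpow (- d) :: laurent)" by (simp add: tpow_mult)
    ultimately show ?thesis by (simp add: tpow_mult[symmetric] algebra_simps)
  qed
  also have "W \<dots> = (\<lambda>c. tpow (s + lam C \<alpha> \<alpha>) * (W (vac n i \<triangleleft> (Q \<alpha> (int i) \<star> Q \<alpha> (int i))) c - tpow (- d) * W (vac n i \<triangleleft> nprod \<alpha> (int i)) c))"
    unfolding W_def by (simp add: level_scale level_diff PB_diff PB_scale)
  also have "W (vac n i \<triangleleft> (Q \<alpha> (int i) \<star> Q \<alpha> (int i))) = vac (bump \<alpha> i 2 n) (Suc i)"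
  proof -
    obtain k where k: "i = Suc k" using assms by (cases i) auto
    have "vac (bump \<alpha> i 2 n) i = vac n i \<triangleleft> (Q \<alpha> (int i) \<star> Q \<alpha> (int i))"
      using vac_bump_top[of \<alpha> k 2 n] by (simp add: k numeral_2_eq_2)
    then show ?thesis by (subst W_of) (auto simp: bump_def)
  qed
  also have "W (vac n i \<triangleleft> nprod \<alpha> (int i)) = vac (bumpnbr \<alpha> i n) (Suc i)"
  proof -
    obtain k where k: "i = Suc k" using assms by (cases i) auto
    have "vac (bumpnbr \<alpha> i n) i = vac n i \<triangleleft> nprod \<alpha> (int i)"
      using vac_bumpnbr_top[of \<alpha> k n] by (simp add: k)
    then show ?thesis by (subst W_of) (auto simp: bumpnbr_def)
  qed
  finally show ?thesis by (simp add: s_def)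
qed

lemma vac_Q_system:
  assumes "1 \<le> i" "i < K"
  shows "vac (bump \<alpha> (Suc i) 1 (if i = 1 then n else bump \<alpha> (i - 1) 1 n)) K =
    (\<lambda>c. tpow ((\<Sum>\<beta>\<in>UNIV. lam C \<alpha> \<beta> * n \<beta> i) + (if i = 1 then rho \<alpha> else 0) + lam C \<alpha> \<alpha>) *
      (vac (bump \<alpha> i 2 n) K c - tpow (- d) * vac (bumpnbr \<alpha> i n) K c))"
  using assms(2)
proof (induction K)
  case (Suc K)
  show ?case
  proof (cases "i = K")
    case True
    then show ?thesis using vac_Q_system_local[OF assms(1)] by simp
  next
    case False
    then have iK: "i < K" using Suc.prems by simp
    have l: "(\<lambda>\<beta>. bump \<alpha> (Suc i) 1 (if i = 1 then n else bump \<alpha> (i - 1) 1 n) \<beta> (Suc K)) = (\<lambda>\<beta>. n \<beta> (Suc K))"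
       "(\<lambda>\<beta>. bump \<alpha> i 2 n \<beta> (Suc K)) = (\<lambda>\<beta>. n \<beta> (Suc K))" "(\<lambda>\<beta>. bumpnbr \<alpha> i n \<beta> (Suc K)) = (\<lambda>\<beta>. n \<beta> (Suc K))"
      using iK by (auto simp: bump_def bumpnbr_def fun_eq_iff)
    show ?thesis
      unfolding vac.simps(2) l Suc.IH[OF iK] by (simp add: level_scale level_diff PB_diff PB_scale)
  qed
qed simp

text \<open>For a negative power, take the part of the preimage on negative \<alpha>-coordinates and
  in it a support point of maximal \<open>phi\<close>. The leading monomial does not move the
  coordinate \<alpha>, so its image there survives, at a point where the given function
  vanishes.\<close>

lemma rpow_stab:
  assumes f: "topmon psi2 f k" "stab \<alpha> f" and k: "snd k $ \<alpha> = 0 \<or> 0 \<le> n"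
    and g: "g \<in> PB" "\<And>c. c $ \<alpha> < 0 \<Longrightarrow> g c = 0" and c: "c $ \<alpha> < 0"
  shows "rpow f n g c = 0"
proof (cases "0 \<le> n")
  case True
  have "\<forall>c. c $ \<alpha> < 0 \<longrightarrow> (g \<triangleleft> (f \<up> m)) c = 0" for m
  proof (induction m)
    case (Suc m)
    then show ?case
      using stab_ract[OF f(2), of "g \<triangleleft> (f \<up> m)"] by (simp add: T.power_Suc2 ract_mult del: T.power_Suc)
  qed (simp add: g)
  with True c show ?thesis by (simp add: rpow_def)
next
  case False
  have t: "tmon f" using f unfolding tmon_def by blast
  have down: "\<forall>c. c $ \<alpha> < 0 \<longrightarrow> h c = 0" if h: "h \<in> PB" "\<forall>c. c $ \<alpha> < 0 \<longrightarrow> (h \<triangleleft> f) c = 0" for h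
  proof -
    define h' where "h' c = (if c $ \<alpha> < 0 then h c else 0)" for c
    have h'PB: "h' \<in> PB" using h(1) unfolding PB_def bnd_def h'_def by auto
    show ?thesis
    proof (rule ccontr)
      assume "\<not> ?thesis"
      then obtain c0 where "c0 $ \<alpha> < 0" "h c0 \<noteq> 0" by blast
      then have c0: "h' c0 \<noteq> 0" by (simp add: h'_def)
      obtain B where B: "bnd B h'" using h'PB by (auto simp: PB_def)
      define P where "P n \<longleftrightarrow> (\<exists>c. h' c \<noteq> 0 \<and> nat (B - phi c) = n)" for n
      have "P (nat (B - phi c0))" using c0 by (auto simp: P_def)
      then have "P (LEAST n. P n)" by (rule LeastI)
      then obtain c where c: "h' c \<noteq> 0" "nat (B - phi c) = (LEAST n. P n)" by (auto simp: P_def)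
      have max: "phi c' \<le> phi c" if "h' c' \<noteq> 0" for c'
      proof -
        have "nat (B - phi c) \<le> nat (B - phi c')"
          unfolding c(2) by (rule Least_le) (use that in \<open>auto simp: P_def\<close>)
        moreover have "phi c' \<le> B" "phi c \<le> B" using that c B by (auto simp: bnd_def)
        ultimately show ?thesis by linarith
      qed
      let ?c = "c + snd k"
      have cneg: "c $ \<alpha> < 0" using c(1) by (auto simp: h'_def split: if_splits)
      then have "?c $ \<alpha> < 0" using k False by simp
      then have "(h \<triangleleft> f) ?c = 0" using h(2) by blast
      moreover have "(h \<triangleleft> f) ?c = (h' \<triangleleft> f) ?c + ((\<lambda>c. h c - h' c) \<triangleleft> f) ?c"
        by (simp add: ract_diff_left)
      moreover have "((\<lambda>c. h c - h' c) \<triangleleft> f) ?c = 0"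
        by (rule stab_ract[OF f(2)]) (use \<open>?c $ \<alpha> < 0\<close> in \<open>auto simp: h'_def\<close>)
      ultimately have z: "(h' \<triangleleft> f) ?c = 0" by simp
      have "(h' \<triangleleft> f) ?c = (\<Sum>q\<in>Poly_Mapping.keys f. Poly_Mapping.lookup f q * tpow (- om (fst q) (?c - snd q + onev)) * h' (?c - snd q))"
        by (simp add: ract_def)
      also have "\<dots> = (\<Sum>q\<in>{k}. Poly_Mapping.lookup f q * tpow (- om (fst q) (?c - snd q + onev)) * h' (?c - snd q))"
      proof (rule sum.mono_neutral_right)
        show "{k} \<subseteq> Poly_Mapping.keys f"
          using munit_nonzero[OF topmon_lookup[OF f(1)]] by (simp add: in_keys_iff)
        show "\<forall>q\<in>Poly_Mapping.keys f - {k}. Poly_Mapping.lookup f q * tpow (- om (fst q) (?c - snd q + onev)) * h' (?c - snd q) = 0"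
        proof
          fix q assume q: "q \<in> Poly_Mapping.keys f - {k}"
          then have "psi2 q < psi2 k" using f(1) by (auto simp: topmon_iff)
          then have "phi c < phi (?c - snd q)" by (simp add: psi2_def phi_diff phi_add)
          then have "h' (?c - snd q) = 0" using max[of "?c - snd q"] by linarith
          then show "Poly_Mapping.lookup f q * tpow (- om (fst q) (?c - snd q + onev)) * h' (?c - snd q) = 0" by simp
        qed
      qed simp
      also have "\<dots> \<noteq> 0" using c(1) munit_nonzero[OF topmon_lookup[OF f(1)]] by simp
      finally show False using z by simp
    qed
  qed
  have "\<forall>c. c $ \<alpha> < 0 \<longrightarrow> rpow f (- int m) g c = 0" for m
  proof (induction m)
    case (Suc m)
    have "- int (Suc m) = - int m - 1" by simp
    then have e: "rpow f (- int (Suc m)) g \<triangleleft> f = rpow f (- int m) g"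
      using rpow_minus1[OF t g(1), of "- int m"] by (simp only:)
    show ?case by (rule down) (use Suc e t g in simp_all)
  qed (simp add: g)
  from this[of "nat (- n)"] c False show ?thesis by simp
qed

text \<open>Only row \<alpha> of \<open>n\<close> is constrained: for \<beta> other than \<alpha>
  the leading y-monomial of \<open>Q \<beta> i\<close> does not contain the variable of \<alpha>, so
  negative powers preserve the support condition as well.\<close>

lemma vac_stab:
  assumes "\<And>i. 1 \<le> i \<Longrightarrow> i \<le> K \<Longrightarrow> 0 \<le> n \<alpha> i" "c $ \<alpha> < 0"
  shows "vac n K c = 0"
  using assms
proof (induction K arbitrary: c)
  case 0
  then show ?case by (auto simp: delta_def)
next
  case (Suc K)
  have "level (Suc K) (\<lambda>\<alpha>. n \<alpha> (Suc K)) l g c = 0" if "g \<in> PB" "\<And>c. c $ \<alpha> < 0 \<Longrightarrow> g c = 0" "c $ \<alpha> < 0" for l g c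
    using that
  proof (induction l arbitrary: g)
    case (Cons \<beta> l)
    have "rpow (Q \<beta> (int (Suc K))) (n \<beta> (Suc K)) g c = 0" if "c $ \<alpha> < 0" for c
    proof (rule rpow_stab[OF topmon_psi2 stab_Q])
      show "snd (topkey \<beta> (int (Suc K))) $ \<alpha> = 0 \<or> 0 \<le> n \<beta> (Suc K)"
        using Suc.prems(1)[of "Suc K"] by (cases "\<beta> = \<alpha>") (auto simp: topkey_def axis_def)
    qed (use Cons.prems that in auto)
    then show ?case
      unfolding level.simps using Cons.prems(1,3) by (intro Cons.IH rpow_PB[OF tmon_Q])
  qed simp
  then show ?case using Suc by simp
qed

lemma vac_bnd: "bnd (\<Sum>i=1..K. \<Sum>\<alpha>\<in>UNIV. rho \<alpha> * (int i * n \<alpha> i)) (vac n K)"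
proof (induction K)
  case 0
  have "bnd (phi 0) (delta 0)" by (rule bnd_delta)
  then show ?case by (simp add: addf_0[OF addf_phi])
next
  case (Suc K)
  have "bnd (B + (\<Sum>\<alpha>\<leftarrow>l. rho \<alpha> * (int (Suc K) * n \<alpha> (Suc K)))) (level (Suc K) (\<lambda>\<alpha>. n \<alpha> (Suc K)) l g)" if "bnd B g" for B l g
    using that
  proof (induction l arbitrary: B g)
    case (Cons \<beta> l)
    from bnd_rpow[OF topmon_psi2 Cons.prems, of \<beta> "Suc K" "n \<beta> (Suc K)"]
    have "bnd (B + rho \<beta> * (int (Suc K) * n \<beta> (Suc K))) (rpow (Q \<beta> (int (Suc K))) (n \<beta> (Suc K)) g)"
      by (simp add: mult.assoc)
    from Cons.IH[OF this] show ?case by (simp add: add.assoc)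
  qed simp
  from this[OF Suc, of indices] show ?case by (simp add: sum_list_indices)
qed

lemma rpow_Q_1: "rpow (Q \<alpha> 1) n (delta b) = delta (b + axis \<alpha> n)"
proof (induction n rule: int_induct_both)
  case (2 n)
  have "rpow (Q \<alpha> 1) (n + 1) (delta b) = delta (b + axis \<alpha> n) \<triangleleft> Q \<alpha> 1"
    using rpow_plus1[OF tmon_Q[of \<alpha> 1], of "delta b" n] 2 by simp
  then show ?case by (simp add: Q_1 ract_delta_single tpow_0 add.assoc axis_add)
next
  case (3 n)
  have t: "tmon (Q \<alpha> 1)" using tmon_Q[of \<alpha> 1] by simp
  have "delta (b + axis \<alpha> (n - 1)) \<triangleleft> Q \<alpha> 1 = delta (b + axis \<alpha> n)"
    by (simp add: Q_1 ract_delta_single tpow_0 add.assoc axis_add)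
  then show ?case
    by (intro tmon_inj[OF t, of "rpow (Q \<alpha> 1) (n - 1) (delta b)"]) (simp_all add: t rpow_minus1 3)
qed simp

lemma vac_level_1:
  assumes "\<And>\<alpha> i. 2 \<le> i \<Longrightarrow> n \<alpha> i = 0" "1 \<le> K"
  shows "vac n K = delta (\<chi> \<alpha>. n \<alpha> 1)"
  using assms(2)
proof (induction K)
  case (Suc K)
  show ?case
  proof (cases "K = 0")
    case True
    have "level (Suc 0) (\<lambda>\<alpha>. n \<alpha> 1) l (delta b) = delta (b + (\<Sum>\<alpha>\<leftarrow>l. axis \<alpha> (n \<alpha> 1)))" for l b
    proof (induction l arbitrary: b)
      case (Cons \<beta> l)
      then show ?case using rpow_Q_1[of \<beta> "n \<beta> 1" b] by (simp add: add.assoc)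
    qed simp
    moreover have "(\<Sum>\<alpha>\<in>UNIV. axis \<alpha> (n \<alpha> 1)) = (\<chi> \<alpha>. n \<alpha> 1)"
      by (simp add: vec_eq_iff axis_def cong: if_cong)
    ultimately show ?thesis using True by (simp add: sum_list_indices)
  next
    case False
    have "level (Suc K) (\<lambda>\<alpha>. 0) l g = g" for l g by (induction l) simp_all
    with False Suc assms(1)[of "Suc K"] show ?thesis by simp
  qed
qed simp

lemma Q_product_Suc: "Q_product C Q (Suc k) n = Q_product C Q k n \<star> lprod (\<lambda>\<alpha>. Q \<alpha> (int (Suc k)) \<up> n \<alpha> (Suc k)) indices"
proof -
  have app: "list_product (qtorus C) (l @ l') = list_product (qtorus C) l \<star> list_product (qtorus C) l'" for l l'
    by (induction l) (simp_all add: list_product_def T.mult_assoc)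
  show ?thesis
    unfolding Q_product_def
    by (simp add: app list_product_lprod flip: upt_Suc_append)
qed

lemma vac_nat: "vac (\<lambda>\<alpha> i. int (n \<alpha> i)) k = delta 0 \<triangleleft> Q_product C Q k n"
proof (induction k)
  case 0
  then show ?case by (simp add: Q_product_def list_product_def)
next
  case (Suc k)
  have "vac (\<lambda>\<alpha> i. int (n \<alpha> i)) (Suc k) = level (Suc k) (\<lambda>\<beta>. 0 + int (n \<beta> (Suc k))) indices (vac (\<lambda>\<alpha> i. int (n \<alpha> i)) k)" by simp
  also have "\<dots> = level (Suc k) (\<lambda>\<beta>. 0) indices (vac (\<lambda>\<alpha> i. int (n \<alpha> i)) k) \<triangleleft> lprod (\<lambda>\<beta>. Q \<beta> (int (Suc k)) \<up> n \<beta> (Suc k)) indices"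
    by (rule level_add_nat) simp_all
  also have "level (Suc k) (\<lambda>\<beta>. 0) l g = g" for l g by (induction l) simp_all
  finally show ?case by (simp add: Suc Q_product_Suc ract_mult)
qed

end

subsection \<open>Fermionic sums without the restriction to nonnegative p\<close>

lemma lookup_emb: "Poly_Mapping.lookup (emb f) (of_int e) = Poly_Mapping.lookup f e"
proof -
  have "Poly_Mapping.lookup (emb f) (of_int e) =
      (\<Sum>k\<in>Poly_Mapping.keys f. Poly_Mapping.lookup f k when k = e)"
    by (simp add: emb_def lookup_sum lookup_single)
  then show ?thesis by (simp add: when_def in_keys_iff)
qed

lemma emb_inj: "emb f = emb g \<Longrightarrow> f = g"
  by (rule poly_mapping_eqI) (metis lookup_emb)

lemma emb_superset:
  assumes "finite A" "Poly_Mapping.keys f \<subseteq> A"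
  shows "emb f = (\<Sum>e\<in>A. Poly_Mapping.single (of_int e) (Poly_Mapping.lookup f e))"
  unfolding emb_def by (rule sum.mono_neutral_left) (use assms in \<open>auto simp: in_keys_iff\<close>)

lemma emb_single: "emb (Poly_Mapping.single e c) = Poly_Mapping.single (of_int e) c"
  by (subst emb_superset[of "{e}"]) auto

lemma emb_tpow [simp]: "emb (tpow e) = tpow (of_int e)"
  by (simp add: tpow_def emb_single)

lemma emb_0 [simp]: "emb 0 = 0"
  by (simp add: emb_def)

lemma emb_1 [simp]: "emb 1 = 1"
  using emb_tpow[of 0] by (simp add: tpow_0)

lemma emb_add: "emb (f + g) = emb f + emb g"
proof -
  let ?A = "Poly_Mapping.keys f \<union> Poly_Mapping.keys g"
  have "Poly_Mapping.keys (f + g) \<subseteq> ?A" by (rule keys_add)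
  then show ?thesis
    by (simp add: emb_superset[of ?A] lookup_add single_add sum.distrib)
qed

lemma emb_uminus: "emb (- f) = - emb f"
  using emb_add[of f "- f"] by (simp add: eq_neg_iff_add_eq_0 add.commute)

lemma emb_diff: "emb (f - g) = emb f - emb g"
  using emb_add[of f "- g"] by (simp add: emb_uminus)

lemma emb_sum: "emb (sum f A) = (\<Sum>x\<in>A. emb (f x))"
  by (induction A rule: infinite_finite_induct) (simp_all add: emb_add)

lemma laurent_sum_single: "(\<Sum>e\<in>Poly_Mapping.keys f. Poly_Mapping.single e (Poly_Mapping.lookup f e)) = f"
  for f :: laurent
  by (rule poly_mapping_eqI) (simp add: lookup_sum lookup_single when_def in_keys_iff)

lemma emb_mult: "emb (f * g) = emb f * emb g"
proof -
  have "f * g = (\<Sum>e\<in>Poly_Mapping.keys f. Poly_Mapping.single e (Poly_Mapping.lookup f e)) *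
      (\<Sum>e\<in>Poly_Mapping.keys g. Poly_Mapping.single e (Poly_Mapping.lookup g e))"
    by (simp only: laurent_sum_single)
  also have "emb \<dots> = emb f * emb g"
    by (simp add: emb_def[of f] emb_def[of g] sum_product emb_sum mult_single emb_single)
  finally show ?thesis .
qed

section \<open>The modified q-binomial coefficients\<close>

context cartan
begin

abbreviation qp :: "rat \<Rightarrow> puiseux" where "qp \<equiv> qpow C"

lemma qp_mult: "qp x * qp y = qp (x + y)"
  by (simp add: qpow_def tpow_mult algebra_simps)

lemma qp_0 [simp]: "qp 0 = 1"
  by (simp add: qpow_def tpow_0)

text \<open>The \<open>q\<close>-binomial coefficients with the convention \<open>qbin m (- 1) = 0\<close> for \<open>m > 0\<close>, which makes Pascal's
  rule hold for all integers \<open>p\<close>; for negative \<open>p\<close> this differs from \<^const>\<open>qbinom\<close>.\<close>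

fun qbin :: "nat \<Rightarrow> int \<Rightarrow> puiseux" where
  "qbin 0 p = 1"
| "qbin (Suc m) p = (if 0 \<le> p then \<Sum>j\<in>{0..p}. qp (of_nat (Suc m) * of_int (p - j)) * qbin m j
     else - (\<Sum>j\<in>{p+1..-1}. qp (of_nat (Suc m) * of_int (p - j)) * qbin m j))"

lemma qbin_minus_1: "qbin m (- 1) = (if m = 0 then 1 else 0)"
  by (cases m) simp_all

lemma qbin_pascal: "qbin (Suc m) p = qp (of_nat (Suc m)) * qbin (Suc m) (p - 1) + qbin m p"
proof -
  let ?M = "of_nat (Suc m) :: rat"
  have shift: "(\<Sum>j\<in>A. qp (?M * of_int (p - j)) * qbin m j) = qp ?M * (\<Sum>j\<in>A. qp (?M * of_int (p - 1 - j)) * qbin m j)" for A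
    unfolding sum_distrib_left mult.assoc[symmetric] qp_mult by (simp add: algebra_simps)
  have inv: "qp ?M * (qp (- ?M) * x) = x" for x
    by (simp only: mult.assoc[symmetric] qp_mult) simp
  consider "0 < p" | "p = 0" | "p < 0" by linarith
  then show ?thesis
  proof cases
    case 1
    then have "{0..p} = insert p {0..p - 1}" by auto
    with 1 show ?thesis
      by (simp add: shift distrib_left inv del: of_nat_Suc of_int_diff)
  next
    case 2
    then show ?thesis by simp
  next
    case 3
    then have "{p - 1 + 1..- 1} = insert p {p + 1..- 1}" by auto
    with 3 show ?thesis
      by (simp add: shift right_diff_distrib inv del: of_nat_Suc of_int_diff)
  qed
qed

declare qbin.simps(2) [simp del]

lemma qbin_pascal': "0 < m \<Longrightarrow> qp (of_nat m) * qbin m (p - 1) = qbin m p - qbin (m - 1) p"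
  using qbin_pascal[of "m - 1" p] by (cases m) (simp_all add: algebra_simps)

lemma qbin_0: "qbin m 0 = 1"
  by (induction m) (simp_all add: qbin.simps(2))

text \<open>The Pascal rule adapted to generating functions in m. It follows from the defining one
  by induction on p and, inside, on m.\<close>

lemma qbin_pascal_upper: "qbin (Suc m) (int p) = qbin (Suc m) (int p - 1) + qp (of_nat p) * qbin m (int p)"
proof (induction p arbitrary: m)
  case 0
  then show ?case by (simp add: qbin_minus_1 qbin_0)
next
  case (Suc p)
  note IH = Suc.IH
  let ?P = "int p"
  have P: "int (Suc p) = ?P + 1" "?P + 1 - 1 = ?P" by simp_all
  show ?case unfolding P
  proof (induction m)
    case 0
    let ?X = "qbin (Suc 0)"
    have "?X (?P + 1) = qp 1 * ?X ?P + 1" "?X ?P = qp 1 * ?X (?P - 1) + 1"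
      using qbin_pascal[of 0 "?P + 1"] qbin_pascal[of 0 ?P] by simp_all
    moreover have "qp 1 * ?X ?P = qp 1 * ?X (?P - 1) + qp (of_nat (Suc p))"
      using IH[of 0] by (simp add: distrib_left qp_mult)
    ultimately show ?case by simp
  next
    case (Suc m)
    let ?X = "qbin (Suc (Suc m))" and ?g = "qbin (Suc m)"
    have 1: "?X (?P + 1) = qp (of_nat (Suc (Suc m))) * ?X ?P + ?g (?P + 1)"
      "?X ?P = qp (of_nat (Suc (Suc m))) * ?X (?P - 1) + ?g ?P"
      "?g (?P + 1) = qp (of_nat (Suc m)) * ?g ?P + qbin m (?P + 1)"
      using qbin_pascal[of "Suc m" "?P + 1"] qbin_pascal[of "Suc m" ?P] qbin_pascal[of m "?P + 1"]
      by (simp_all only: P)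
    have 2: "qp (of_nat (Suc (Suc m))) * ?X ?P = qp (of_nat (Suc (Suc m))) * ?X (?P - 1) + qp (of_nat (Suc p)) * (qp (of_nat (Suc m)) * ?g ?P)"
      unfolding IH[of "Suc m"] by (simp only: distrib_left qp_mult mult.assoc[symmetric] of_nat_add[symmetric]) (simp add: add.commute)
    have "?X (?P + 1) = ?X ?P + (qp (of_nat (Suc p)) * (qp (of_nat (Suc m)) * ?g ?P) + qp (of_nat (Suc p)) * qbin m (?P + 1))"
      unfolding 1(1) 2 Suc by (subst 1(2)) simp
    also have "\<dots> = ?X ?P + qp (of_nat (Suc p)) * ?g (?P + 1)"
      by (simp only: 1(3) distrib_left)
    finally show ?case .
  qed
qed

text \<open>By the second Pascal rule the generating series at p, multiplied by 1 - q^p x, is the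
  one at p - 1; at -1 it equals 1. Hence it is inverse to the product that defines
  \<open>qbinom\<close>.\<close>

lemma qbin_eq_qbinom:
  assumes "0 \<le> p"
  shows "qbin m p = qbinom C m p"
proof -
  define G where "G b = Abs_fps (\<lambda>m. qbin m b)" for b
  let ?F = "\<lambda>b::int. \<Prod>i\<in>{0..b}. 1 - fps_const (qp (of_int i)) * fps_X"
  have step: "G (int b) * (1 - fps_const (qp (of_nat b)) * fps_X) = G (int b - 1)" for b
  proof (rule fps_ext)
    fix a
    show "fps_nth (G (int b) * (1 - fps_const (qp (of_nat b)) * fps_X)) a = fps_nth (G (int b - 1)) a"
    proof (cases a)
      case (Suc a)
      then show ?thesis
        using qbin_pascal_upper[of a b]
        by (simp add: G_def right_diff_distrib mult.assoc[symmetric] mult.commute[of "Abs_fps _" "fps_const _"])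
    qed (simp add: G_def right_diff_distrib mult.assoc[symmetric])
  qed
  have "G (int b) * ?F (int b) = 1" for b
  proof (induction b)
    case 0
    have "G (- 1) = 1" by (rule fps_ext) (simp add: G_def qbin_minus_1)
    then show ?case using step[of 0] by simp
  next
    case (Suc b)
    have "{0..int (Suc b)} = insert (int (Suc b)) {0..int b}" by auto
    then have "G (int (Suc b)) * ?F (int (Suc b)) =
        G (int (Suc b)) * (1 - fps_const (qp (of_nat (Suc b))) * fps_X) * ?F (int b)"
      by (simp add: mult.assoc)
    also have "\<dots> = 1" unfolding step using Suc by simp
    finally show ?case .
  qed
  from this[of "nat p"] have 1: "G p * ?F p = 1" using assms by simp
  have "fps_nth (?F p) 0 = 1"
  proof -
    have "fps_nth (\<Prod>i\<in>A. 1 - fps_const (qp (of_int i)) * fps_X) 0 = 1" for A :: "int set"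
      by (induction A rule: infinite_finite_induct) simp_all
    then show ?thesis .
  qed
  then have "fps_left_inverse (?F p) 1 * ?F p = 1" by (intro fps_left_inverse) simp
  moreover have "L = G p" if "L * ?F p = 1" for L
  proof -
    have "L = (L * ?F p) * G p" using 1 by (simp only: mult.assoc mult.commute[of "?F p"] mult_1_right)
    then show ?thesis by (simp only: that mult_1_left)
  qed
  ultimately have "fps_left_inverse (?F p) 1 = G p" by blast
  then show ?thesis using assms by (simp add: qbinom_def G_def)
qed

section \<open>Bilinear forms on integer exponent arrays and the summands of the fermionic
  sum\<close>

definition AI :: "nat \<Rightarrow> ('r \<Rightarrow> nat \<Rightarrow> int) \<Rightarrow> 'r \<Rightarrow> nat \<Rightarrow> int" where
  "AI K x \<alpha> i = (\<Sum>j=1..K. int (min i j) * x \<alpha> j)"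

definition IP :: "nat \<Rightarrow> ('r \<Rightarrow> nat \<Rightarrow> int) \<Rightarrow> ('r \<Rightarrow> nat \<Rightarrow> int) \<Rightarrow> int" where
  "IP K x y = (\<Sum>\<alpha>\<in>UNIV. \<Sum>i=1..K. x \<alpha> i * AI K y \<alpha> i)"

definition mix :: "('r \<Rightarrow> 'r \<Rightarrow> int) \<Rightarrow> ('r \<Rightarrow> nat \<Rightarrow> int) \<Rightarrow> 'r \<Rightarrow> nat \<Rightarrow> int" where
  "mix c x \<alpha> i = (\<Sum>\<beta>\<in>UNIV. c \<alpha> \<beta> * x \<beta> i)"

definition eb :: "'r \<Rightarrow> nat \<Rightarrow> 'r \<Rightarrow> nat \<Rightarrow> int" where
  "eb \<alpha> i \<beta> j = (if \<beta> = \<alpha> \<and> j = i then 1 else 0)"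

abbreviation Cm :: "('r \<Rightarrow> nat \<Rightarrow> int) \<Rightarrow> 'r \<Rightarrow> nat \<Rightarrow> int" where "Cm \<equiv> mix (\<lambda>\<alpha> \<beta>. C $ \<alpha> $ \<beta>)"

lemma AI_linear:
  "AI K (\<lambda>\<alpha> i. x \<alpha> i + y \<alpha> i) \<alpha> i = AI K x \<alpha> i + AI K y \<alpha> i"
  "AI K (\<lambda>\<alpha> i. x \<alpha> i - y \<alpha> i) \<alpha> i = AI K x \<alpha> i - AI K y \<alpha> i"
  "AI K (\<lambda>\<alpha> i. c * x \<alpha> i) \<alpha> i = c * AI K x \<alpha> i"
  by (simp_all add: AI_def distrib_left right_diff_distrib sum.distrib sum_subtractf sum_distrib_left mult.left_commute)

lemma AI_mix: "AI K (mix c x) \<alpha> i = (\<Sum>\<beta>\<in>UNIV. c \<alpha> \<beta> * AI K x \<beta> i)"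
proof -
  have "AI K (mix c x) \<alpha> i = (\<Sum>j=1..K. \<Sum>\<beta>\<in>UNIV. c \<alpha> \<beta> * (int (min i j) * x \<beta> j))"
    by (simp add: AI_def mix_def sum_distrib_left mult.left_commute)
  then show ?thesis by (subst (asm) sum.swap) (simp add: AI_def sum_distrib_left)
qed

lemma mix_linear:
  "mix c (\<lambda>\<alpha> i. x \<alpha> i + y \<alpha> i) \<alpha> i = mix c x \<alpha> i + mix c y \<alpha> i"
  "mix c (\<lambda>\<alpha> i. x \<alpha> i - y \<alpha> i) \<alpha> i = mix c x \<alpha> i - mix c y \<alpha> i"
  by (simp_all add: mix_def distrib_left right_diff_distrib sum.distrib sum_subtractf)

lemma IP_linear:
  "IP K (\<lambda>\<alpha> i. x \<alpha> i + x' \<alpha> i) y = IP K x y + IP K x' y"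
  "IP K (\<lambda>\<alpha> i. x \<alpha> i - x' \<alpha> i) y = IP K x y - IP K x' y"
  "IP K (\<lambda>\<alpha> i. c * x \<alpha> i) y = c * IP K x y"
  "IP K x (\<lambda>\<alpha> i. y \<alpha> i + y' \<alpha> i) = IP K x y + IP K x y'"
  "IP K x (\<lambda>\<alpha> i. y \<alpha> i - y' \<alpha> i) = IP K x y - IP K x y'"
  "IP K x (\<lambda>\<alpha> i. c * y \<alpha> i) = c * IP K x y"
  by (simp_all add: IP_def AI_linear algebra_simps sum.distrib sum_subtractf sum_distrib_left)

lemma IP_sym: "IP K x y = IP K y x"
proof -
  have "(\<Sum>i=1..K. x \<alpha> i * AI K y \<alpha> i) = (\<Sum>i=1..K. y \<alpha> i * AI K x \<alpha> i)" for \<alpha>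
    unfolding AI_def sum_distrib_left
    by (subst sum.swap) (simp add: min.commute mult.assoc mult.commute mult.left_commute)
  then show ?thesis by (simp add: IP_def)
qed

lemma IP_mix:
  assumes "\<And>\<alpha> \<beta>. c \<alpha> \<beta> = c \<beta> \<alpha>"
  shows "IP K (mix c x) y = IP K x (mix c y)"
proof -
  have "IP K (mix c x) y = (\<Sum>i=1..K. \<Sum>\<alpha>\<in>UNIV. \<Sum>\<beta>\<in>UNIV. c \<alpha> \<beta> * x \<beta> i * AI K y \<alpha> i)"
    unfolding IP_def mix_def by (subst sum.swap) (simp add: sum_distrib_right)
  also have "\<dots> = (\<Sum>i=1..K. \<Sum>\<beta>\<in>UNIV. \<Sum>\<alpha>\<in>UNIV. c \<alpha> \<beta> * x \<beta> i * AI K y \<alpha> i)"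
    by (intro sum.cong refl sum.swap)
  also have "\<dots> = IP K x (mix c y)"
    unfolding IP_def AI_mix
    by (subst (3) sum.swap) (simp add: sum_distrib_left mult.assoc mult.left_commute assms[of _ "_ :: 'r"])
  finally show ?thesis .
qed

lemma AI_eb: "AI K (eb \<alpha> i) \<beta> j = (if \<beta> = \<alpha> \<and> i \<in> {1..K} then int (min j i) else 0)"
  by (auto simp: AI_def eb_def if_distrib[of "(*) _"] intro!: sum.neutral cong: if_cong)

lemma IP_eb: "i \<in> {1..K} \<Longrightarrow> IP K (eb \<alpha> i) y = AI K y \<alpha> i"
proof -
  assume i: "i \<in> {1..K}"
  have "IP K (eb \<alpha> i) y = (\<Sum>\<beta>\<in>UNIV. if \<beta> = \<alpha> then AI K y \<alpha> i else 0)"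
    unfolding IP_def eb_def
    by (intro sum.cong refl) (use i in \<open>auto simp: if_distrib[of "\<lambda>z. z * _"] cong: if_cong\<close>)
  then show ?thesis by simp
qed

lemma mix_eb: "mix c (eb \<alpha> i) \<beta> j = (if j = i then c \<beta> \<alpha> else 0)"
  by (simp add: mix_def eb_def if_distrib[of "(*) _"] cong: if_cong)

definition pI :: "nat \<Rightarrow> ('r \<Rightarrow> nat \<Rightarrow> nat) \<Rightarrow> ('r \<Rightarrow> nat \<Rightarrow> int) \<Rightarrow> 'r \<Rightarrow> nat \<Rightarrow> int" where
  "pI K m n \<alpha> i = AI K n \<alpha> i - (\<Sum>\<beta>\<in>UNIV. C $ \<alpha> $ \<beta> * AI K (\<lambda>\<beta> j. int (m \<beta> j)) \<beta> i)"

lemma pI_mix: "pI K m n \<alpha> i = AI K (\<lambda>\<beta> j. n \<beta> j - Cm (\<lambda>\<beta> j. int (m \<beta> j)) \<beta> j) \<alpha> i"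
  by (simp add: pI_def AI_linear AI_mix)

definition QI :: "nat \<Rightarrow> ('r \<Rightarrow> nat \<Rightarrow> nat) \<Rightarrow> ('r \<Rightarrow> nat \<Rightarrow> int) \<Rightarrow> rat" where
  "QI K m n = - (1/2) * of_int (\<Sum>\<alpha>\<in>UNIV. \<Sum>i=1..K. int (m \<alpha> i) * (pI K m n \<alpha> i + AI K n \<alpha> i))"

lemma QI_IP: "QI K m n = - (1/2) * of_int (IP K (\<lambda>\<alpha> i. int (m \<alpha> i)) (\<lambda>\<alpha> i. 2 * n \<alpha> i - Cm (\<lambda>\<alpha> i. int (m \<alpha> i)) \<alpha> i))"
  by (simp add: QI_def IP_def AI_linear AI_mix pI_def)

definition Nset :: "nat \<Rightarrow> ('r \<Rightarrow> int) \<Rightarrow> ('r \<Rightarrow> nat \<Rightarrow> int) \<Rightarrow> ('r \<Rightarrow> nat \<Rightarrow> nat) set" where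
  "Nset K l n = {m. (\<forall>\<alpha> i. i \<notin> {1..K} \<longrightarrow> m \<alpha> i = 0) \<and> (\<forall>\<alpha>. pI K m n \<alpha> K = l \<alpha>)}"

definition gprod :: "nat \<Rightarrow> ('r \<Rightarrow> nat \<Rightarrow> nat) \<Rightarrow> ('r \<Rightarrow> nat \<Rightarrow> int) \<Rightarrow> puiseux" where
  "gprod K m n = (\<Prod>x\<in>UNIV \<times> {1..K}. qbin (m (fst x) (snd x)) (pI K m n (fst x) (snd x)))"

definition nterm :: "nat \<Rightarrow> ('r \<Rightarrow> nat \<Rightarrow> int) \<Rightarrow> ('r \<Rightarrow> nat \<Rightarrow> nat) \<Rightarrow> puiseux" where
  "nterm K n m = qp (QI K m n) * gprod K m n"

text \<open>The sum over all \<open>m\<close>, without the restriction to \<open>p \<ge> 0\<close>.\<close>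

definition Nsum :: "nat \<Rightarrow> ('r \<Rightarrow> int) \<Rightarrow> ('r \<Rightarrow> nat \<Rightarrow> int) \<Rightarrow> puiseux" where
  "Nsum K l n = (\<Sum>m\<in>Nset K l n. nterm K n m)"

text \<open>C is injective, so the condition at level \<open>K\<close> fixes the sums of i
  m(\<alpha>,i) over i, and these bound all entries.\<close>

lemma finite_Nset: "finite (Nset K l n)"
proof (cases "Nset K l n = {}")
  case False
  then obtain m0 where m0: "m0 \<in> Nset K l n" by blast
  define M where "M m \<alpha> = AI K (\<lambda>\<beta> j. int (m \<beta> j)) \<alpha> K" for m :: "'r \<Rightarrow> nat \<Rightarrow> nat" and \<alpha>
  have MM: "M m \<alpha> = M m0 \<alpha>" if "m \<in> Nset K l n" for m \<alpha>
  proof -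
    have "(\<Sum>\<beta>\<in>UNIV. C $ \<alpha> $ \<beta> * M m \<beta>) = (\<Sum>\<beta>\<in>UNIV. C $ \<alpha> $ \<beta> * M m0 \<beta>)" for \<alpha>
    proof -
      have "pI K m n \<alpha> K = pI K m0 n \<alpha> K" using that m0 by (simp add: Nset_def)
      then show ?thesis by (simp add: pI_def M_def)
    qed
    then have "M m \<alpha> - M m0 \<alpha> = 0"
      by (intro C_inj[of "\<lambda>\<alpha>. M m \<alpha> - M m0 \<alpha>"]) (simp only: right_diff_distrib sum_subtractf)
    then show ?thesis by simp
  qed
  have le: "int (m \<alpha> i) \<le> M m \<alpha>" if "i \<in> {1..K}" for m \<alpha> i
  proof -
    have "int (m \<alpha> i) \<le> int (min K i) * int (m \<alpha> i)" using that by (cases "m \<alpha> i") auto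
    also have "\<dots> \<le> M m \<alpha>" unfolding M_def AI_def by (rule member_le_sum) (use that in auto)
    finally show ?thesis .
  qed
  define B where "B = nat (\<Sum>\<alpha>\<in>UNIV. M m0 \<alpha>)"
  have B: "m \<alpha> i \<le> B" if "m \<in> Nset K l n" "i \<in> {1..K}" for m \<alpha> i
  proof -
    have "int (m \<alpha> i) \<le> M m0 \<alpha>" using le[OF that(2)] MM[OF that(1)] by metis
    also have "\<dots> \<le> (\<Sum>\<alpha>\<in>UNIV. M m0 \<alpha>)"
      by (rule member_le_sum) (auto simp: M_def AI_def intro!: sum_nonneg)
    finally show ?thesis by (simp add: B_def)
  qed
  let ?S = "{f :: 'r \<times> nat \<Rightarrow> nat. \<forall>x. (x \<in> UNIV \<times> {1..K} \<longrightarrow> f x \<in> {..B}) \<and> (x \<notin> UNIV \<times> {1..K} \<longrightarrow> f x = (0::nat))}"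
  have S: "finite ?S" by (intro finite_set_of_finite_funs finite_cartesian_product) simp_all
  have "Nset K l n \<subseteq> curry ` ?S"
  proof
    fix m assume m: "m \<in> Nset K l n"
    have "case_prod m \<in> ?S" using m B[OF m] by (auto simp: Nset_def)
    then have "curry (case_prod m) \<in> curry ` ?S" by (rule imageI)
    then show "m \<in> curry ` ?S" by (simp only: curry_case_prod)
  qed
  from finite_subset[OF this finite_imageI[OF S]] show ?thesis .
qed simp

lemma bump_eb: "bump \<alpha> i x n = (\<lambda>\<beta> j. n \<beta> j + x * eb \<alpha> i \<beta> j)"
  by (auto simp: bump_def eb_def fun_eq_iff)

lemma bumpnbr_eb: "bumpnbr \<alpha> i n = (\<lambda>\<beta> j. n \<beta> j + (2 * eb \<alpha> i \<beta> j - Cm (eb \<alpha> i) \<beta> j))"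
  by (auto simp: bumpnbr_def mix_eb fun_eq_iff C_Adj eb_def Adj_sym)

text \<open>The exponents of the term with two different levels in the Q-system relation. Level 0 is
  omitted since \<open>Q \<alpha> 0\<close> acts on the vacuum by a scalar.\<close>

definition nup :: "'r \<Rightarrow> nat \<Rightarrow> ('r \<Rightarrow> nat \<Rightarrow> int) \<Rightarrow> 'r \<Rightarrow> nat \<Rightarrow> int" where
  "nup \<alpha> i n = bump \<alpha> (Suc i) 1 (if i = 1 then n else bump \<alpha> (i - 1) 1 n)"

lemma AI_bump: "AI K (bump \<alpha> i x n) \<beta> j = AI K n \<beta> j + (if \<beta> = \<alpha> \<and> i \<in> {1..K} then x * int (min j i) else 0)"
  by (simp add: bump_eb AI_linear AI_eb)

text \<open>The matrix min(i,j) inverts the negative discrete second difference. Hence exchanging 2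
  at level \<open>i\<close> for 1 at each of the two adjacent levels changes the image only at
  \<open>i\<close>, by -1.\<close>

lemma AI_nup:
  assumes "1 \<le> i" "i < K" "j \<le> K"
  shows "AI K (nup \<alpha> i n) \<beta> j = AI K (bump \<alpha> i 2 n) \<beta> j - (if \<beta> = \<alpha> \<and> j = i then 1 else 0)"
  using assms by (cases "j < i"; cases "j = i") (auto simp: nup_def AI_bump min_def)

lemma nup_IP:
  assumes "1 \<le> i" "i < K"
  shows "IP K x (nup \<alpha> i n) = IP K x (bump \<alpha> i 2 n) - x \<alpha> i"
proof -
  have "IP K x (nup \<alpha> i n) = (\<Sum>\<beta>\<in>UNIV. \<Sum>j=1..K. x \<beta> j * AI K (bump \<alpha> i 2 n) \<beta> j - (if \<beta> = \<alpha> then if j = i then x \<beta> j else 0 else 0))"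
    unfolding IP_def by (intro sum.cong refl) (use assms in \<open>auto simp: AI_nup right_diff_distrib\<close>)
  also have "\<dots> = IP K x (bump \<alpha> i 2 n) - (\<Sum>\<beta>\<in>UNIV. if \<beta> = \<alpha> then \<Sum>j=1..K. if j = i then x \<beta> j else 0 else 0)"
    unfolding IP_def sum_subtractf by (intro arg_cong2[of _ _ _ _ "(-)"] refl sum.cong) simp
  also have "\<dots> = IP K x (bump \<alpha> i 2 n) - x \<alpha> i" using assms by simp
  finally show ?thesis .
qed

definition minc :: "'r \<Rightarrow> nat \<Rightarrow> ('r \<Rightarrow> nat \<Rightarrow> nat) \<Rightarrow> 'r \<Rightarrow> nat \<Rightarrow> nat" where
  "minc \<alpha> i m \<beta> j = (if \<beta> = \<alpha> \<and> j = i then m \<beta> j + 1 else m \<beta> j)"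

definition mdec :: "'r \<Rightarrow> nat \<Rightarrow> ('r \<Rightarrow> nat \<Rightarrow> nat) \<Rightarrow> 'r \<Rightarrow> nat \<Rightarrow> nat" where
  "mdec \<alpha> i m \<beta> j = (if \<beta> = \<alpha> \<and> j = i then m \<beta> j - 1 else m \<beta> j)"

lemma int_minc: "(\<lambda>\<beta> j. int (minc \<alpha> i m \<beta> j)) = (\<lambda>\<beta> j. int (m \<beta> j) + eb \<alpha> i \<beta> j)"
  by (auto simp: minc_def eb_def fun_eq_iff)

text \<open>One more at (\<alpha>,i) in \<open>m\<close> subtracts column \<alpha> of C, which is
  exactly the difference between adding 2 at (\<alpha>,i) and adding the neighbours.\<close>

lemma pI_minc: "pI K (minc \<alpha> i m) (bump \<alpha> i 2 n) \<beta> j = pI K m (bumpnbr \<alpha> i n) \<beta> j"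
  unfolding pI_mix int_minc by (simp add: bump_eb bumpnbr_eb mix_linear AI_linear)

lemma QI_minc:
  assumes "1 \<le> i" "i \<le> K"
  shows "QI K (minc \<alpha> i m) (bump \<alpha> i 2 n) = QI K m (bumpnbr \<alpha> i n) - of_int (AI K n \<alpha> i + int i)"
proof -
  let ?m = "\<lambda>\<beta> j. int (m \<beta> j)" and ?e = "eb \<alpha> i"
  have "IP K ?m (Cm ?e) = IP K (Cm ?m) ?e"
    by (rule IP_mix[symmetric]) (rule C_sym)
  also have "\<dots> = IP K ?e (Cm ?m)" by (rule IP_sym)
  finally have s: "IP K ?m (Cm ?e) = IP K ?e (Cm ?m)" .
  have ii: "i \<in> {1..K}" using assms by simp
  have e: "IP K ?e n = AI K n \<alpha> i" "IP K ?e ?e = int i" "IP K ?e (Cm ?e) = 2 * int i"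
    using assms
    by (simp_all add: IP_eb[OF ii] AI_eb AI_mix if_distrib[of "(*) _"] cong: if_cong)
  have "IP K (\<lambda>\<beta> j. int (minc \<alpha> i m \<beta> j)) (\<lambda>\<beta> j. 2 * bump \<alpha> i 2 n \<beta> j - Cm (\<lambda>\<beta> j. int (minc \<alpha> i m \<beta> j)) \<beta> j)
     = IP K ?m (\<lambda>\<beta> j. 2 * bumpnbr \<alpha> i n \<beta> j - Cm ?m \<beta> j) + 2 * (AI K n \<alpha> i + int i)"
    unfolding int_minc bump_eb bumpnbr_eb by (simp only: mix_linear IP_linear s e) simp
  then show ?thesis by (simp add: QI_IP field_simps)
qed

lemma QI_nup:
  assumes "1 \<le> i" "i < K"
  shows "QI K m (nup \<alpha> i n) = QI K m (bump \<alpha> i 2 n) + of_nat (m \<alpha> i)"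
  by (simp add: QI_IP IP_linear nup_IP[OF assms] field_simps)

lemma gprod_split:
  assumes "i \<in> {1..K}"
  shows "gprod K m n = qbin (m \<alpha> i) (pI K m n \<alpha> i) *
    (\<Prod>x\<in>UNIV \<times> {1..K} - {(\<alpha>, i)}. qbin (m (fst x) (snd x)) (pI K m n (fst x) (snd x)))"
  unfolding gprod_def using assms by (subst prod.remove[of _ "(\<alpha>, i)"]) auto

text \<open>The relation holds term by term. Passing from the square to adjacent levels lowers p by
  one at (\<alpha>,i) and adds m(\<alpha>,i) to the exponent of q; Pascal's rule splits that factor,
  and its second part is the term with m(\<alpha>,i) lowered by one.\<close>

lemma nterm_Q_system:
  assumes "1 \<le> i" "i < K"
  shows "nterm K (nup \<alpha> i n) m = nterm K (bump \<alpha> i 2 n) m -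
     (if m \<alpha> i = 0 then 0 else qp (- of_int (AI K n \<alpha> i + int i)) * nterm K (bumpnbr \<alpha> i n) (mdec \<alpha> i m))"
proof -
  have i: "i \<in> {1..K}" using assms by simp
  define R where "R = (\<Prod>x\<in>UNIV \<times> {1..K} - {(\<alpha>, i)}. qbin (m (fst x) (snd x)) (pI K m (bump \<alpha> i 2 n) (fst x) (snd x)))"
  define p where "p = pI K m (bump \<alpha> i 2 n) \<alpha> i"
  have 2: "nterm K (bump \<alpha> i 2 n) m = qp (QI K m (bump \<alpha> i 2 n)) * qbin (m \<alpha> i) p * R"
    unfolding nterm_def gprod_split[OF i, of _ _ \<alpha>] R_def p_def by (simp add: mult.assoc)
  have "pI K m (nup \<alpha> i n) \<beta> j = pI K m (bump \<alpha> i 2 n) \<beta> j - (if \<beta> = \<alpha> \<and> j = i then 1 else 0)" if "j \<in> {1..K}" for \<beta> j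
    unfolding pI_def using that by (simp add: AI_nup[OF assms])
  then have "gprod K m (nup \<alpha> i n) = qbin (m \<alpha> i) (p - 1) * R"
    unfolding gprod_split[OF i, of _ _ \<alpha>] R_def p_def using i by (intro arg_cong2[of _ _ _ _ "(*)"] prod.cong) (auto split: if_splits)
  then have 1: "nterm K (nup \<alpha> i n) m = qp (QI K m (bump \<alpha> i 2 n)) * (qp (of_nat (m \<alpha> i)) * qbin (m \<alpha> i) (p - 1)) * R"
    unfolding nterm_def QI_nup[OF assms] by (simp only: qp_mult[symmetric] mult.assoc)
  show ?thesis
  proof (cases "m \<alpha> i = 0")
    case True
    then show ?thesis unfolding 1 2 by simp
  next
    case False
    have m: "minc \<alpha> i (mdec \<alpha> i m) = m" using False by (auto simp: minc_def mdec_def fun_eq_iff)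
    have "gprod K (mdec \<alpha> i m) (bumpnbr \<alpha> i n) = qbin (m \<alpha> i - 1) p * R"
      unfolding gprod_split[OF i, of _ _ \<alpha>] R_def p_def pI_minc[of K \<alpha> i "mdec \<alpha> i m" n, symmetric] m
      by (intro arg_cong2[of _ _ _ _ "(*)"] prod.cong) (auto simp: mdec_def)
    moreover have "QI K (mdec \<alpha> i m) (bumpnbr \<alpha> i n) = QI K m (bump \<alpha> i 2 n) + of_int (AI K n \<alpha> i + int i)"
      using QI_minc[of i K \<alpha> "mdec \<alpha> i m" n] assms by (simp add: m)
    ultimately have "qp (- of_int (AI K n \<alpha> i + int i)) * nterm K (bumpnbr \<alpha> i n) (mdec \<alpha> i m) =
       qp (QI K m (bump \<alpha> i 2 n)) * (qbin (m \<alpha> i - 1) p) * R"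
      unfolding nterm_def mult.assoc[symmetric] by (simp add: qp_mult)
    then show ?thesis
      unfolding 1 2 using False by (simp add: qbin_pascal' algebra_simps)
  qed
qed

lemma Nsum_Q_system:
  assumes "1 \<le> i" "i < K"
  shows "Nsum K l (nup \<alpha> i n) = Nsum K l (bump \<alpha> i 2 n) - qp (- of_int (AI K n \<alpha> i + int i)) * Nsum K l (bumpnbr \<alpha> i n)"
proof -
  let ?A = "Nset K l (bump \<alpha> i 2 n)" and ?q = "qp (- of_int (AI K n \<alpha> i + int i))"
  have "Nset K l (nup \<alpha> i n) = ?A"
    using assms by (auto simp: Nset_def pI_def AI_nup[OF assms])
  then have "Nsum K l (nup \<alpha> i n) = Nsum K l (bump \<alpha> i 2 n) -
     (\<Sum>m\<in>?A. if m \<alpha> i = 0 then 0 else ?q * nterm K (bumpnbr \<alpha> i n) (mdec \<alpha> i m))"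
    unfolding Nsum_def by (simp add: nterm_Q_system[OF assms] sum_subtractf)
  also have "(\<Sum>m\<in>?A. if m \<alpha> i = 0 then 0 else ?q * nterm K (bumpnbr \<alpha> i n) (mdec \<alpha> i m)) =
     (\<Sum>m\<in>{m\<in>?A. m \<alpha> i \<noteq> 0}. ?q * nterm K (bumpnbr \<alpha> i n) (mdec \<alpha> i m))"
    by (rule sum.mono_neutral_cong_right) (auto simp: finite_Nset)
  also have "\<dots> = (\<Sum>m\<in>Nset K l (bumpnbr \<alpha> i n). ?q * nterm K (bumpnbr \<alpha> i n) m)"
  proof (rule sum.reindex_bij_witness[of _ "minc \<alpha> i" "mdec \<alpha> i"])
    fix m assume m: "m \<in> {m\<in>?A. m \<alpha> i \<noteq> 0}"
    then show mm: "minc \<alpha> i (mdec \<alpha> i m) = m" by (auto simp: minc_def mdec_def fun_eq_iff)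
    show "mdec \<alpha> i m \<in> Nset K l (bumpnbr \<alpha> i n)"
      using m assms pI_minc[of K \<alpha> i "mdec \<alpha> i m" n, symmetric] by (auto simp: Nset_def mm mdec_def)
  next
    fix m assume m: "m \<in> Nset K l (bumpnbr \<alpha> i n)"
    show "mdec \<alpha> i (minc \<alpha> i m) = m" by (auto simp: minc_def mdec_def fun_eq_iff)
    show "minc \<alpha> i m \<in> {m\<in>?A. m \<alpha> i \<noteq> 0}"
      using m assms by (auto simp: Nset_def pI_minc) (auto simp: minc_def)
  qed simp
  finally show ?thesis by (simp add: Nsum_def sum_distrib_left)
qed

section \<open>Uniqueness of solutions of the Q-system relation, with their initial values\<close>

definition wt :: "nat \<Rightarrow> ('r \<Rightarrow> nat \<Rightarrow> int) \<Rightarrow> int" where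
  "wt K n = (\<Sum>\<alpha>\<in>UNIV. rho \<alpha> * AI K n \<alpha> K)"

lemma wt_nup: "1 \<le> i \<Longrightarrow> i < K \<Longrightarrow> wt K (nup \<alpha> i n) = wt K (bump \<alpha> i 2 n)"
  by (simp add: wt_def AI_nup)

lemma wt_bump: "i \<in> {1..K} \<Longrightarrow> wt K (bump \<alpha> i x n) = wt K n + rho \<alpha> * x * int i"
  by (simp add: wt_def AI_bump distrib_left sum.distrib if_distrib[of "(*) _"] mult.assoc min_absorb2 cong: if_cong)

text \<open>Compared with the square, the product over neighbours loses the weight
  \<open>d * i\<close>; this decrease drives the uniqueness argument.\<close>

lemma wt_bumpnbr: "i \<in> {1..K} \<Longrightarrow> wt K (bumpnbr \<alpha> i n) = wt K n + (2 * rho \<alpha> - d) * int i"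
proof -
  assume i: "i \<in> {1..K}"
  have "AI K (bumpnbr \<alpha> i n) \<beta> K = AI K n \<beta> K + Adj $ \<alpha> $ \<beta> * int i" for \<beta>
    using i unfolding bumpnbr_eb
    by (simp add: AI_linear AI_mix AI_eb if_distrib[of "(*) _"] Adj_def C_sym cong: if_cong)
  then have "wt K (bumpnbr \<alpha> i n) = wt K n + (\<Sum>\<beta>\<in>UNIV. Adj $ \<alpha> $ \<beta> * rho \<beta>) * int i"
    by (simp add: wt_def distrib_left sum.distrib sum_distrib_left mult.assoc mult.left_commute mult.commute)
  then show ?thesis by (simp only: Adj_rho)
qed

text \<open>The \<open>Q\<close>-system relation determines the value at \<open>n\<close> from values with a smaller exponent on the highest
  level and from values of smaller weight.\<close>

lemma Q_system_unique:
  fixes D :: "('r \<Rightarrow> nat \<Rightarrow> int) \<Rightarrow> puiseux"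
  assumes step: "\<And>\<alpha> i n. 1 \<le> i \<Longrightarrow> i < K \<Longrightarrow> \<exists>u. D (nup \<alpha> i n) = D (bump \<alpha> i 2 n) - u * D (bumpnbr \<alpha> i n)"
    and low: "\<And>n. wt K n < B \<Longrightarrow> D n = 0"
    and base: "\<And>n. (\<And>\<alpha> j. 2 \<le> j \<Longrightarrow> n \<alpha> j = 0) \<Longrightarrow> D n = 0"
    and supp: "\<And>\<alpha> j. K < j \<Longrightarrow> n \<alpha> j = 0"
  shows "D n = 0"
proof -
  have "\<forall>n. (\<forall>\<alpha> j. k < j \<longrightarrow> n \<alpha> j = 0) \<longrightarrow> D n = 0" if "k \<le> K" for k
    using that
  proof (induction k)
    case 0
    then show ?case by (auto intro!: base)
  next
    case (Suc k)
    show ?case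
    proof (cases "k = 0")
      case True
      then show ?thesis by (auto intro!: base)
    next
      case False
      define s where "s n = nat (\<Sum>\<beta>\<in>UNIV. \<bar>n \<beta> (Suc k)\<bar>)" for n :: "'r \<Rightarrow> nat \<Rightarrow> int"
      have k: "1 \<le> k" "k < K" "k \<in> {1..K}" using False Suc.prems by auto
      show ?thesis
      proof
        fix n
        show "(\<forall>\<alpha> j. Suc k < j \<longrightarrow> n \<alpha> j = 0) \<longrightarrow> D n = 0"
        \<comment> \<open>Lexicographic induction: first the weight above the cutoff
          \<open>B\<close>, then the total size of the exponents on the highest level.\<close>
        proof (induction n rule: wf_induct_rule[OF wf_measures[of "[\<lambda>n. nat (wt K n - B + 1), s]"]])
          case (1 n)
          note IH = 1
          show ?case
          proof
            assume sup: "\<forall>\<alpha> j. Suc k < j \<longrightarrow> n \<alpha> j = 0"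
            show "D n = 0"
            proof (cases "wt K n < B \<or> (\<forall>\<alpha>. n \<alpha> (Suc k) = 0)")
              case True
              then show ?thesis
              proof
                assume "\<forall>\<alpha>. n \<alpha> (Suc k) = 0"
                then have "\<forall>\<alpha> j. k < j \<longrightarrow> n \<alpha> j = 0" using sup by (metis Suc_lessI)
                then show ?thesis using Suc by simp
              qed (rule low)
            next
              case False
              then obtain \<alpha> where \<alpha>: "n \<alpha> (Suc k) \<noteq> 0" and B: "B \<le> wt K n" by auto
              have less_s: "s n' < s n" if "\<And>\<beta>. \<beta> \<noteq> \<alpha> \<Longrightarrow> n' \<beta> (Suc k) = n \<beta> (Suc k)" "\<bar>n' \<alpha> (Suc k)\<bar> < \<bar>n \<alpha> (Suc k)\<bar>" for n'
              proof -
                have "(\<Sum>\<beta>\<in>UNIV. \<bar>n' \<beta> (Suc k)\<bar>) < (\<Sum>\<beta>\<in>UNIV. \<bar>n \<beta> (Suc k)\<bar>)"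
                proof (rule sum_strict_mono_ex1)
                  show "\<forall>\<beta>\<in>UNIV. \<bar>n' \<beta> (Suc k)\<bar> \<le> \<bar>n \<beta> (Suc k)\<bar>"
                    using that by (metis less_imp_le order_refl)
                qed (use that in auto)
                then show ?thesis unfolding s_def by (subst nat_less_eq_zless) (simp_all add: sum_nonneg)
              qed
              have same: "D n' = 0" if "wt K n' = wt K n" "s n' < s n" "\<forall>\<alpha> j. Suc k < j \<longrightarrow> n' \<alpha> j = 0" for n'
                using IH[of n'] that by simp
              have less: "D n' = 0" if "wt K n' < wt K n" "\<forall>\<alpha> j. Suc k < j \<longrightarrow> n' \<alpha> j = 0" for n'
                using IH[of n'] that B by simp
              show ?thesis
              proof (cases "0 < n \<alpha> (Suc k)")
                case True
                \<comment> \<open>A positive exponent on the highest level: the relation is solved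
                  for the term with adjacent levels, and the square has one factor less
                  there.\<close>
                define n0 where "n0 = bump \<alpha> (Suc k) (- 1) (if k = 1 then n else bump \<alpha> (k - 1) (- 1) n)"
                have n: "nup \<alpha> k n0 = n" using k by (auto simp: nup_def n0_def bump_def fun_eq_iff)
                have w: "wt K n = wt K (bump \<alpha> k 2 n0)" using wt_nup[OF k(1,2), of \<alpha> n0] by (simp only: n)
                have "D (bump \<alpha> k 2 n0) = 0"
                  by (rule same[OF w[symmetric] less_s]) (use True sup k in \<open>auto simp: n0_def bump_def\<close>)
                moreover have "D (bumpnbr \<alpha> k n0) = 0"
                proof (rule less)
                  show "wt K (bumpnbr \<alpha> k n0) < wt K n"
                    using k d_pos unfolding w wt_bump[OF k(3)] wt_bumpnbr[OF k(3)] by (simp add: left_diff_distrib)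
                qed (use sup k in \<open>auto simp: n0_def bump_def bumpnbr_def\<close>)
                ultimately show ?thesis using step[OF k(1,2), of \<alpha> n0] by (simp add: n)
              next
                case False
                \<comment> \<open>A negative exponent on the highest level: the relation is solved
                  for the square, and the term with adjacent levels raises that exponent towards
                  0.\<close>
                define n0 where "n0 = bump \<alpha> k (- 2) n"
                have n: "bump \<alpha> k 2 n0 = n" by (auto simp: n0_def bump_def fun_eq_iff)
                have w: "wt K n = wt K (nup \<alpha> k n0)" using wt_nup[OF k(1,2), of \<alpha> n0] by (simp only: n)
                have "D (nup \<alpha> k n0) = 0"
                  by (rule same[OF w[symmetric] less_s]) (use False \<alpha> sup k in \<open>auto simp: n0_def nup_def bump_def\<close>)
                moreover have "D (bumpnbr \<alpha> k n0) = 0"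
                proof (rule less)
                  show "wt K (bumpnbr \<alpha> k n0) < wt K n"
                    using k d_pos unfolding n[symmetric] wt_bump[OF k(3)] wt_bumpnbr[OF k(3)] by (simp add: left_diff_distrib)
                qed (use sup k in \<open>auto simp: n0_def bump_def bumpnbr_def\<close>)
                ultimately show ?thesis using step[OF k(1,2), of \<alpha> n0] by (auto simp: n)
              qed
            qed
          qed
        qed
      qed
    qed
  qed
  from this[of K] supp show ?thesis by blast
qed

text \<open>Pairing the condition p = -1 at level \<open>K\<close> with \<open>rho\<close> gives
  \<open>wt K n\<close> plus the sum of \<open>rho\<close> as \<open>d\<close> times a sum of
  nonnegative integers, so for smaller weight there is no summand.\<close>

lemma Nsum_low:
  assumes "wt K n < - (\<Sum>\<alpha>\<in>UNIV. rho \<alpha>)"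
  shows "Nsum K (\<lambda>_. - 1) n = 0"
proof -
  have "Nset K (\<lambda>_. - 1) n = {}"
  proof (rule ccontr)
    assume "\<not> ?thesis"
    then obtain m where m: "m \<in> Nset K (\<lambda>_. - 1) n" by blast
    define M where "M \<beta> = AI K (\<lambda>\<beta> j. int (m \<beta> j)) \<beta> K" for \<beta>
    have eq: "AI K n \<alpha> K + 1 = (\<Sum>\<beta>\<in>UNIV. C $ \<alpha> $ \<beta> * M \<beta>)" for \<alpha>
    proof -
      have "pI K m n \<alpha> K = - 1" using m by (simp add: Nset_def)
      then show ?thesis by (simp add: pI_def M_def)
    qed
    have "wt K n + (\<Sum>\<alpha>\<in>UNIV. rho \<alpha>) = (\<Sum>\<alpha>\<in>UNIV. rho \<alpha> * (AI K n \<alpha> K + 1))"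
      by (simp add: wt_def distrib_left sum.distrib)
    also have "\<dots> = (\<Sum>\<beta>\<in>UNIV. (\<Sum>\<alpha>\<in>UNIV. C $ \<beta> $ \<alpha> * rho \<alpha>) * M \<beta>)"
      unfolding eq sum_distrib_left sum_distrib_right
      by (subst sum.swap) (intro sum.cong refl, subst C_sym, simp add: mult.assoc mult.left_commute)
    also have "\<dots> = d * (\<Sum>\<beta>\<in>UNIV. M \<beta>)" by (simp add: C_rho sum_distrib_left)
    also have "\<dots> \<ge> 0" using d_pos by (intro mult_nonneg_nonneg sum_nonneg) (auto simp: M_def AI_def intro!: sum_nonneg)
    finally show False using assms by simp
  qed
  then show ?thesis by (simp add: Nsum_def)
qed

lemma gprod_eq_0:
  assumes "i \<in> {1..K}" "pI K m n \<alpha> i = - 1" "m \<alpha> i \<noteq> 0"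
  shows "gprod K m n = 0"
  using assms by (subst gprod_split[of i _ _ _ \<alpha>]) (simp_all add: qbin_minus_1)

text \<open>Downward induction on the levels: if \<open>m\<close> vanishes above level k, then p
  takes the same value -1 at k as at \<open>K\<close>, and the q-binomial kills every term with a
  nonzero entry of \<open>m\<close> at k. Only m = 0 is left.\<close>

lemma Nsum_level_1:
  assumes n: "\<And>\<alpha> j. 2 \<le> j \<Longrightarrow> n \<alpha> j = 0" and K: "1 \<le> K"
  shows "Nsum K (\<lambda>_. - 1) n = (if \<forall>\<alpha>. n \<alpha> 1 = - 1 then 1 else 0)"
proof -
  have AI_n: "AI K n \<alpha> i = n \<alpha> 1" if "1 \<le> i" for \<alpha> i
  proof -
    have "AI K n \<alpha> i = (\<Sum>j\<in>{1}. int (min i j) * n \<alpha> j)"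
      unfolding AI_def by (rule sum.mono_neutral_right) (use K n in auto)
    then show ?thesis using that by (simp add: min_def)
  qed
  have m0: "m = (\<lambda>_ _. 0)" if m: "m \<in> Nset K (\<lambda>_. - 1) n" and nz: "nterm K n m \<noteq> 0" for m
  proof -
    have "\<forall>\<alpha> j. K - i < j \<longrightarrow> m \<alpha> j = 0" if "i \<le> K" for i
      using that
    proof (induction i)
      case 0
      then show ?case using m by (auto simp: Nset_def)
    next
      case (Suc i)
      define k where "k = K - i"
      have k: "1 \<le> k" "k \<le> K" "K - Suc i = k - 1" using Suc.prems by (auto simp: k_def)
      have hi: "m \<alpha> j = 0" if "k < j" for \<alpha> j using Suc that by (simp add: k_def)
      have "AI K (\<lambda>\<beta> j. int (m \<beta> j)) \<beta> k = AI K (\<lambda>\<beta> j. int (m \<beta> j)) \<beta> K" for \<beta>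
        unfolding AI_def by (intro sum.cong refl) (use hi in \<open>auto simp: min_def\<close>)
      then have p: "pI K m n \<alpha> k = - 1" for \<alpha>
        using m k by (simp add: Nset_def pI_def AI_n)
      have "m \<alpha> k = 0" for \<alpha>
        using gprod_eq_0[of k K m n \<alpha>] p k nz by (auto simp: nterm_def)
      then show ?case using hi k by (metis Suc_pred' less_Suc_eq_le less_eq_Suc_le linorder_neqE_nat not_less One_nat_def)
    qed
    from this[of K] have "m \<alpha> j = 0" if "0 < j" for \<alpha> j using that by simp
    moreover have "m \<alpha> 0 = 0" for \<alpha> using m by (simp add: Nset_def)
    ultimately show ?thesis by (metis (no_types) ext neq0_conv)
  qed
  have AI0: "AI K (\<lambda>_ _. 0) \<alpha> i = 0" for \<alpha> i by (simp add: AI_def)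
  have 0: "(\<lambda>_ _. 0) \<in> Nset K (\<lambda>_. - 1) n \<longleftrightarrow> (\<forall>\<alpha>. n \<alpha> 1 = - 1)"
    using K by (simp add: Nset_def pI_def AI_n AI0)
  have "Nsum K (\<lambda>_. - 1) n = (\<Sum>m\<in>Nset K (\<lambda>_. - 1) n. if m = (\<lambda>_ _. 0) then nterm K n (\<lambda>_ _. 0) else 0)"
    unfolding Nsum_def by (intro sum.cong refl) (use m0 in auto)
  also have "\<dots> = (if \<forall>\<alpha>. n \<alpha> 1 = - 1 then nterm K n (\<lambda>_ _. 0) else 0)"
    by (simp add: finite_Nset 0)
  also have "nterm K n (\<lambda>_ _. 0) = 1" by (simp add: nterm_def QI_def gprod_def)
  finally show ?thesis .
qed

end

subsection \<open>Fermionic sums as matrix elements\<close>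

context qsys
begin

lemma wt_sum: "wt K n = (\<Sum>i=1..K. \<Sum>\<alpha>\<in>UNIV. rho \<alpha> * (int i * n \<alpha> i))"
  unfolding wt_def AI_def sum_distrib_left by (subst sum.swap) (simp add: min_absorb2)

definition Lv :: "nat \<Rightarrow> ('r \<Rightarrow> nat \<Rightarrow> int) \<Rightarrow> int" where
  "Lv K n = (\<Sum>\<alpha>\<in>UNIV. \<Sum>i=1..K. rho \<alpha> * n \<alpha> i)"

abbreviation Lm :: "('r \<Rightarrow> nat \<Rightarrow> int) \<Rightarrow> 'r \<Rightarrow> nat \<Rightarrow> int" where "Lm \<equiv> mix (lam C)"

definition G2 :: "nat \<Rightarrow> ('r \<Rightarrow> nat \<Rightarrow> int) \<Rightarrow> int" where
  "G2 K n = IP K n (Lm n)"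

text \<open>The linear and quadratic parts absorb the powers of t in the relation for
  \<open>vac\<close>; the constant makes the value at the base point, -1 on level 1 and 0 elsewhere,
  equal to 1. The exponent is half-integral, hence rational.\<close>

definition vac_exp :: "nat \<Rightarrow> ('r \<Rightarrow> nat \<Rightarrow> int) \<Rightarrow> rat" where
  "vac_exp K n = (1/2) * of_int (\<Sum>\<alpha>\<in>UNIV. rho \<alpha>) + of_int (Lv K n) + (1/2) * of_int (G2 K n)"

lemma Lv_bump: "Lv K (bump \<alpha> i x n) = Lv K n + (if i \<in> {1..K} then rho \<alpha> * x else 0)"
proof -
  have "Lv K (bump \<alpha> i x n) = Lv K n + (\<Sum>\<beta>\<in>UNIV. if \<beta> = \<alpha> then \<Sum>j=1..K. if j = i then rho \<alpha> * x else 0 else 0)"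
    unfolding Lv_def sum.distrib[symmetric]
    by (intro sum.cong refl) (auto simp: bump_def distrib_left sum.distrib if_distrib[of "(*) _"] cong: if_cong)
  then show ?thesis by simp
qed

lemma Lv_bumpnbr: "i \<in> {1..K} \<Longrightarrow> Lv K (bumpnbr \<alpha> i n) = Lv K n + 2 * rho \<alpha> - d"
proof -
  assume i: "i \<in> {1..K}"
  have "Lv K (bumpnbr \<alpha> i n) = Lv K n + (\<Sum>\<beta>\<in>UNIV. Adj $ \<alpha> $ \<beta> * rho \<beta>)"
    unfolding Lv_def sum.distrib[symmetric] using i
    by (intro sum.cong refl) (simp add: bumpnbr_def distrib_left sum.distrib if_distrib[of "(*) _"] mult.commute cong: if_cong)
  then show ?thesis by (simp add: Adj_rho)
qed

lemma IP_Lm_sym: "IP K x (Lm y) = IP K y (Lm x)"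
proof -
  have "IP K x (Lm y) = IP K (Lm x) y" by (rule IP_mix[symmetric]) (rule lam_sym)
  then show ?thesis by (simp only: IP_sym[of K y])
qed

lemma G2_nup:
  assumes "1 \<le> i" "i < K"
  shows "G2 K (nup \<alpha> i n) = G2 K (bump \<alpha> i 2 n) - 2 * (\<Sum>\<beta>\<in>UNIV. lam C \<alpha> \<beta> * n \<beta> i) - 2 * lam C \<alpha> \<alpha>"
proof -
  let ?n1 = "nup \<alpha> i n" and ?n2 = "bump \<alpha> i 2 n"
  have 1: "IP K x ?n1 = IP K x ?n2 - x \<alpha> i" for x by (rule nup_IP[OF assms])
  have "G2 K ?n1 = IP K (Lm ?n1) ?n2 - Lm ?n1 \<alpha> i"
    unfolding G2_def by (subst IP_sym, subst 1) simp
  also have "IP K (Lm ?n1) ?n2 = IP K ?n2 (Lm ?n1)" by (rule IP_sym)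
  also have "\<dots> = IP K (Lm ?n2) ?n1" unfolding IP_Lm_sym[of K ?n2] by (rule IP_sym)
  also have "\<dots> = IP K (Lm ?n2) ?n2 - Lm ?n2 \<alpha> i" by (rule 1)
  also have "IP K (Lm ?n2) ?n2 = G2 K ?n2" unfolding G2_def by (rule IP_sym)
  also have "Lm ?n2 \<alpha> i = (\<Sum>\<beta>\<in>UNIV. lam C \<alpha> \<beta> * n \<beta> i) + 2 * lam C \<alpha> \<alpha>"
    by (simp add: mix_def bump_def distrib_left sum.distrib if_distrib[of "(*) _"] cong: if_cong)
  also have "Lm ?n1 \<alpha> i = (\<Sum>\<beta>\<in>UNIV. lam C \<alpha> \<beta> * n \<beta> i)"
    using assms by (cases i) (auto simp: mix_def nup_def bump_def)
  finally show ?thesis by simp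
qed

text \<open>The two arrays differ by the image of a unit array under C, and \<open>lam\<close> turns
  this image into \<open>d\<close> times the unit array; so the change of the form only involves
  \<open>AI\<close> at (\<alpha>,i).\<close>

lemma G2_bumpnbr:
  assumes "i \<in> {1..K}"
  shows "G2 K (bump \<alpha> i 2 n) = G2 K (bumpnbr \<alpha> i n) + 2 * d * (AI K n \<alpha> i + int i)"
proof -
  let ?e = "eb \<alpha> i" and ?n2 = "bump \<alpha> i 2 n"
  let ?g = "Cm ?e"
  have Lg: "Lm ?g \<beta> j = d * ?e \<beta> j" for \<beta> j
    by (subst mix_def) (cases "j = i", auto simp: mix_eb eb_def lam_C)
  have n3: "bumpnbr \<alpha> i n = (\<lambda>\<beta> j. ?n2 \<beta> j - ?g \<beta> j)"
    by (simp add: bumpnbr_eb bump_eb fun_eq_iff)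
  have Lgf: "Lm ?g = (\<lambda>\<beta> j. d * ?e \<beta> j)" by (intro ext) (rule Lg)
  have x: "IP K x (Lm ?g) = d * AI K x \<alpha> i" for x
    unfolding Lgf IP_linear IP_sym[of K x] IP_eb[OF assms] ..
  have Ln3: "Lm (\<lambda>\<beta> j. ?n2 \<beta> j - ?g \<beta> j) = (\<lambda>\<beta> j. Lm ?n2 \<beta> j - Lm ?g \<beta> j)"
    by (intro ext) (rule mix_linear)
  have "G2 K (bumpnbr \<alpha> i n) = G2 K ?n2 - 2 * (d * AI K ?n2 \<alpha> i) + d * AI K ?g \<alpha> i"
    unfolding n3 G2_def Ln3 IP_linear IP_Lm_sym[of K ?g ?n2] x by simp
  moreover have "AI K ?n2 \<alpha> i = AI K n \<alpha> i + 2 * int i" using assms by (simp add: AI_bump)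
  moreover have "AI K ?g \<alpha> i = 2 * int i"
    using assms by (simp add: AI_mix AI_eb if_distrib[of "(*) _"] cong: if_cong)
  ultimately show ?thesis by (simp add: algebra_simps)
qed

definition vac_coeff :: "nat \<Rightarrow> ('r \<Rightarrow> nat \<Rightarrow> int) \<Rightarrow> puiseux" where
  "vac_coeff K n = tpow (vac_exp K n) * emb (vac n K (- onev))"

text \<open>The factor \<open>tpow (- d)\<close> of the reversed recursion is cancelled by the
  change of \<open>Lv\<close>, and the change of \<open>G2\<close> supplies the power of q found for
  the fermionic sums.\<close>

lemma vac_coeff_Q_system:
  assumes "1 \<le> i" "i < K"
  shows "vac_coeff K (nup \<alpha> i n) = vac_coeff K (bump \<alpha> i 2 n) - qp (- of_int (AI K n \<alpha> i + int i)) * vac_coeff K (bumpnbr \<alpha> i n)"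
proof -
  have i: "i \<in> {1..K}" using assms by simp
  define s where "s = (\<Sum>\<beta>\<in>UNIV. lam C \<alpha> \<beta> * n \<beta> i) + (if i = 1 then rho \<alpha> else 0) + lam C \<alpha> \<alpha>"
  have "Lv K (nup \<alpha> i n) = Lv K (bump \<alpha> i 2 n) - (if i = 1 then rho \<alpha> else 0)"
    using assms by (auto simp: nup_def Lv_bump)
  then have e1: "vac_exp K (nup \<alpha> i n) + of_int s = vac_exp K (bump \<alpha> i 2 n)"
    by (simp add: vac_exp_def G2_nup[OF assms] s_def field_simps)
  have "Lv K (bump \<alpha> i 2 n) = Lv K (bumpnbr \<alpha> i n) + d"
    using i by (simp only: Lv_bumpnbr[OF i]) (simp add: Lv_bump)
  then have e2: "vac_exp K (bump \<alpha> i 2 n) - of_int d = - of_int d * (- of_int (AI K n \<alpha> i + int i)) + vac_exp K (bumpnbr \<alpha> i n)"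
    by (simp add: vac_exp_def G2_bumpnbr[OF i] field_simps)
  have "vac_coeff K (nup \<alpha> i n) = tpow (vac_exp K (nup \<alpha> i n)) * (tpow (of_int s) * (emb (vac (bump \<alpha> i 2 n) K (- onev)) -
      tpow (- of_int d) * emb (vac (bumpnbr \<alpha> i n) K (- onev))))"
    unfolding vac_coeff_def nup_def vac_Q_system[OF assms] s_def[symmetric] by (simp add: emb_mult emb_diff)
  also have "\<dots> = tpow (vac_exp K (bump \<alpha> i 2 n)) * (emb (vac (bump \<alpha> i 2 n) K (- onev)) -
      tpow (- of_int d) * emb (vac (bumpnbr \<alpha> i n) K (- onev)))"
    by (simp only: mult.assoc[symmetric] tpow_mult e1)
  also have "\<dots> = tpow (vac_exp K (bump \<alpha> i 2 n)) * emb (vac (bump \<alpha> i 2 n) K (- onev)) -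
      tpow (vac_exp K (bump \<alpha> i 2 n) - of_int d) * emb (vac (bumpnbr \<alpha> i n) K (- onev))"
    by (simp add: right_diff_distrib mult.assoc[symmetric] tpow_mult)
  also have "\<dots> = vac_coeff K (bump \<alpha> i 2 n) - qp (- of_int (AI K n \<alpha> i + int i)) * vac_coeff K (bumpnbr \<alpha> i n)"
    unfolding e2 by (simp add: vac_coeff_def qpow_def mult.assoc[symmetric] tpow_mult)
  finally show ?thesis .
qed

lemma vac_coeff_level_1:
  assumes n: "\<And>\<alpha> j. 2 \<le> j \<Longrightarrow> n \<alpha> j = 0" and K: "1 \<le> K"
  shows "vac_coeff K n = (if \<forall>\<alpha>. n \<alpha> 1 = - 1 then 1 else 0)"
proof (cases "\<forall>\<alpha>. n \<alpha> 1 = - 1")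
  case True
  have one: "(\<Sum>j=1..K. f j * n \<alpha> j) = - f 1" for f :: "nat \<Rightarrow> int" and \<alpha>
  proof -
    have "(\<Sum>j=1..K. f j * n \<alpha> j) = (\<Sum>j\<in>{1}. f j * n \<alpha> j)"
      by (rule sum.mono_neutral_right) (use K n in auto)
    then show ?thesis using True by simp
  qed
  have "Lv K n = - (\<Sum>\<alpha>\<in>UNIV. rho \<alpha>)" unfolding Lv_def one by (simp add: sum_negf)
  moreover have "G2 K n = (\<Sum>\<alpha>\<in>UNIV. rho \<alpha>)"
  proof -
    have "AI K n \<beta> 1 = - 1" for \<beta> unfolding AI_def one by simp
    then have "AI K (Lm n) \<alpha> 1 = - rho \<alpha>" for \<alpha> by (simp add: AI_mix rho_def sum_negf)
    then show ?thesis unfolding G2_def IP_def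
      using one[of "\<lambda>i. AI K (Lm n) _ i"] by (simp add: mult.commute)
  qed
  ultimately have "vac_exp K n = 0" by (simp add: vac_exp_def)
  moreover have "vac n K (- onev) = 1"
    using vac_level_1[OF n K] True by (simp add: delta_def onev_def vec_eq_iff)
  ultimately show ?thesis using True by (simp add: vac_coeff_def tpow_0)
next
  case False
  then have "vac n K (- onev) = 0"
    using vac_level_1[OF n K] by (simp add: delta_def onev_def vec_eq_iff) metis
  then show ?thesis using False by (simp add: vac_coeff_def)
qed

lemma vac_coeff_low:
  assumes "wt K n < - (\<Sum>\<alpha>\<in>UNIV. rho \<alpha>)"
  shows "vac_coeff K n = 0"
proof -
  have "phi (- onev) = - (\<Sum>\<alpha>\<in>UNIV. rho \<alpha>)" by (simp add: phi_def onev_def sum_negf)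
  then have "vac n K (- onev) = 0"
    using bnd_zeroD[OF vac_bnd[where K = K and n = n], folded wt_sum] assms by simp
  then show ?thesis by (simp add: vac_coeff_def)
qed

text \<open>Both sides satisfy the same relation, vanish for the same small weights and agree on
  arrays living on level 1, so uniqueness applies to their difference.\<close>

lemma Nsum_eq_vac_coeff:
  assumes "1 \<le> K" "\<And>\<alpha> j. K < j \<Longrightarrow> n \<alpha> j = 0"
  shows "Nsum K (\<lambda>_. - 1) n = vac_coeff K n"
proof -
  have "Nsum K (\<lambda>_. - 1) n - vac_coeff K n = 0"
  proof (rule Q_system_unique[where D = "\<lambda>n. Nsum K (\<lambda>_. - 1) n - vac_coeff K n" and B = "- (\<Sum>\<alpha>\<in>UNIV. rho \<alpha>)"])
    fix \<alpha> i n assume "1 \<le> i" "i < K"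
    then show "\<exists>u. Nsum K (\<lambda>_. - 1) (nup \<alpha> i n) - vac_coeff K (nup \<alpha> i n) =
       Nsum K (\<lambda>_. - 1) (bump \<alpha> i 2 n) - vac_coeff K (bump \<alpha> i 2 n) - u * (Nsum K (\<lambda>_. - 1) (bumpnbr \<alpha> i n) - vac_coeff K (bumpnbr \<alpha> i n))"
      by (intro exI[of _ "qp (- of_int (AI K n \<alpha> i + int i))"]) (simp add: Nsum_Q_system vac_coeff_Q_system algebra_simps)
  qed (use assms in \<open>simp_all add: Nsum_low vac_coeff_low Nsum_level_1 vac_coeff_level_1\<close>)
  then show ?thesis by simp
qed

lemma AI_top: "AI (Suc K) x \<alpha> i = AI K x \<alpha> i + int (min i (Suc K)) * x \<alpha> (Suc K)"
  by (simp add: AI_def)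

lemma AI_above: "K \<le> i \<Longrightarrow> AI K x \<alpha> i = AI K x \<alpha> K"
  unfolding AI_def by (intro sum.cong refl) (auto simp: min_def)

lemma AI_cong: "(\<And>j. 1 \<le> j \<Longrightarrow> j \<le> K \<Longrightarrow> x \<alpha> j = y \<alpha> j) \<Longrightarrow> AI K x \<alpha> i = AI K y \<alpha> i"
  unfolding AI_def by (intro sum.cong refl) auto

text \<open>The exponents \<open>l + 1\<close> and \<open>- (l + 1)\<close> on two adjacent levels
  leave \<open>AI\<close> unchanged up to level \<open>K\<close> and lower it by
  \<open>l + 1\<close> on level \<open>K + 1\<close>. A condition p = \<open>l\<close> thus turns
  into p = -1 one level higher.\<close>

definition sft :: "nat \<Rightarrow> ('r \<Rightarrow> int) \<Rightarrow> ('r \<Rightarrow> nat \<Rightarrow> int) \<Rightarrow> 'r \<Rightarrow> nat \<Rightarrow> int" where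
  "sft K l n \<alpha> i = (if i = K then n \<alpha> i + (l \<alpha> + 1) else if i = Suc K then - (l \<alpha> + 1) else n \<alpha> i)"

lemma AI_sft:
  assumes "1 \<le> K"
  shows "AI (Suc K) (sft K l n) \<alpha> i = AI K n \<alpha> i - (if i \<le> K then 0 else l \<alpha> + 1)"
proof -
  obtain k where k: "K = Suc k" using assms by (cases K) auto
  have "AI k (sft K l n) \<alpha> i = AI k n \<alpha> i" by (rule AI_cong) (simp add: sft_def k)
  then show ?thesis by (auto simp: AI_top k sft_def algebra_simps min_def not_le le_Suc_eq)
qed

lemma nterm_top_zero:
  assumes "m \<in> Nset (Suc K) l' n'" "\<And>\<alpha>. m \<alpha> (Suc K) = 0" "\<And>\<alpha> i. i \<le> K \<Longrightarrow> AI (Suc K) n' \<alpha> i = AI K n \<alpha> i"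
  shows "nterm (Suc K) n' m = nterm K n m"
proof -
  have p: "pI (Suc K) m n' \<alpha> i = pI K m n \<alpha> i" if "i \<le> K" for \<alpha> i
    using that assms by (simp add: pI_def AI_top)
  have "gprod (Suc K) m n' = gprod K m n"
    unfolding gprod_def by (rule prod.mono_neutral_cong_right) (auto simp: le_Suc_eq assms(2) p)
  moreover have "QI (Suc K) m n' = QI K m n" by (simp add: QI_def p assms(2,3))
  ultimately show ?thesis by (simp add: nterm_def)
qed

text \<open>At level \<open>K + 1\<close> all p are -1, so only terms with vanishing m there
  survive, and these are the terms of the original sum.\<close>

lemma Nsum_shift:
  assumes K: "1 \<le> K"
  shows "Nsum K l n = Nsum (Suc K) (\<lambda>_. - 1) (sft K l n)"
proof -
  let ?n = "sft K l n"
  have A: "AI (Suc K) ?n \<alpha> i = AI K n \<alpha> i" if "i \<le> K" for \<alpha> i using that by (simp add: AI_sft[OF K])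
  have eq: "{m \<in> Nset (Suc K) (\<lambda>_. - 1) ?n. \<forall>\<alpha>. m \<alpha> (Suc K) = 0} = Nset K l n"
  proof -
    have "(m \<in> Nset (Suc K) (\<lambda>_. - 1) ?n) = (m \<in> Nset K l n)" if m: "\<forall>\<alpha>. m \<alpha> (Suc K) = 0" for m
    proof -
      have "pI (Suc K) m ?n \<alpha> (Suc K) = pI K m n \<alpha> K - (l \<alpha> + 1)" for \<alpha>
        using m by (simp add: pI_def AI_sft[OF K] AI_top[of K "\<lambda>\<beta> j. int (m \<beta> j)"] AI_above[of K "Suc K"])
      moreover have "(\<forall>\<alpha> i. i \<notin> {1..Suc K} \<longrightarrow> m \<alpha> i = 0) \<longleftrightarrow> (\<forall>\<alpha> i. i \<notin> {1..K} \<longrightarrow> m \<alpha> i = 0)"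
        using m by (auto simp: not_le le_Suc_eq)
      ultimately show ?thesis by (simp add: Nset_def)
    qed
    moreover have "\<forall>\<alpha>. m \<alpha> (Suc K) = 0" if "m \<in> Nset K l n" for m using that by (simp add: Nset_def)
    ultimately show ?thesis by blast
  qed
  have "Nsum (Suc K) (\<lambda>_. - 1) ?n = (\<Sum>m\<in>Nset K l n. nterm K n m)"
    unfolding Nsum_def
  proof (rule sum.mono_neutral_cong_right)
    show "Nset K l n \<subseteq> Nset (Suc K) (\<lambda>_. - 1) ?n" using eq by blast
    show "\<forall>m\<in>Nset (Suc K) (\<lambda>_. - 1) ?n - Nset K l n. nterm (Suc K) ?n m = 0"
    proof
      fix m assume m: "m \<in> Nset (Suc K) (\<lambda>_. - 1) ?n - Nset K l n"
      then obtain \<alpha> where "m \<alpha> (Suc K) \<noteq> 0" using eq by blast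
      then show "nterm (Suc K) ?n m = 0"
        using m gprod_eq_0[of "Suc K" "Suc K" m ?n \<alpha>] by (simp add: nterm_def Nset_def)
    qed
  next
    fix m assume "m \<in> Nset K l n"
    then have "m \<in> Nset (Suc K) (\<lambda>_. - 1) ?n" "\<And>\<alpha>. m \<alpha> (Suc K) = 0" using eq by blast+
    then show "nterm (Suc K) ?n m = nterm K n m" using A by (rule nterm_top_zero)
  qed (rule finite_Nset)
  then show ?thesis by (simp add: Nsum_def)
qed

lemma Nsum_vac_coeff:
  assumes "1 \<le> K" "\<And>\<alpha> j. K < j \<Longrightarrow> n \<alpha> j = 0"
  shows "Nsum K l n = vac_coeff (Suc K) (sft K l n)"
  unfolding Nsum_shift[OF assms(1)] by (rule Nsum_eq_vac_coeff) (use assms in \<open>auto simp: sft_def\<close>)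

text \<open>After the shift, row \<alpha> carries \<open>n \<alpha> K + l \<alpha> + 1\<close> and
  \<open>- (l \<alpha> + 1)\<close> on the two highest levels, both nonnegative by assumption. By
  polynomiality the coefficient at the negative point \<open>- onev\<close> vanishes.\<close>

lemma Nsum_negative:
  assumes "1 \<le> K" "\<And>\<alpha> j. K < j \<Longrightarrow> n \<alpha> j = 0" "l \<alpha> < 0" "- l \<alpha> \<le> n \<alpha> K" "\<And>i. 1 \<le> i \<Longrightarrow> i < K \<Longrightarrow> 0 \<le> n \<alpha> i"
  shows "Nsum K l n = 0"
proof -
  have "vac (sft K l n) (Suc K) (- onev) = 0"
    by (rule vac_stab[of _ _ \<alpha>]) (use assms in \<open>auto simp: sft_def onev_def le_Suc_eq\<close>)
  then show ?thesis by (simp add: Nsum_vac_coeff[OF assms(1,2)] vac_coeff_def)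
qed

subsection \<open>Restoring the restriction to nonnegative p\<close>

text \<open>The flag lets the peeling of a level be proved once for the restricted and the
  unrestricted sum.\<close>

definition Nset_restr :: "bool \<Rightarrow> nat \<Rightarrow> ('r \<Rightarrow> int) \<Rightarrow> ('r \<Rightarrow> nat \<Rightarrow> int) \<Rightarrow> ('r \<Rightarrow> nat \<Rightarrow> nat) set" where
  "Nset_restr b K l n = {m \<in> Nset K l n. b \<longrightarrow> (\<forall>\<alpha>. \<forall>i\<in>{1..K}. 0 \<le> pI K m n \<alpha> i)}"

definition Nsum_restr :: "bool \<Rightarrow> nat \<Rightarrow> ('r \<Rightarrow> int) \<Rightarrow> ('r \<Rightarrow> nat \<Rightarrow> int) \<Rightarrow> puiseux" where
  "Nsum_restr b K l n = (\<Sum>m\<in>Nset_restr b K l n. nterm K n m)"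

lemma Nsum_restr_False: "Nsum_restr False K l n = Nsum K l n"
  by (simp add: Nsum_restr_def Nset_restr_def Nsum_def)

text \<open>The difference of p between levels \<open>K + 1\<close> and \<open>K\<close> when
  \<open>v\<close> is the highest level of m.\<close>

definition tops :: "nat \<Rightarrow> ('r \<Rightarrow> nat \<Rightarrow> int) \<Rightarrow> ('r \<Rightarrow> nat) \<Rightarrow> 'r \<Rightarrow> int" where
  "tops K n v \<alpha> = n \<alpha> (Suc K) - (\<Sum>\<beta>\<in>UNIV. C $ \<alpha> $ \<beta> * int (v \<beta>))"

text \<open>The highest level folded into level \<open>K\<close>. For i up to \<open>K\<close> both
  levels have the same coefficient i in p, so p stays the same there.\<close>

definition low :: "nat \<Rightarrow> ('r \<Rightarrow> nat \<Rightarrow> int) \<Rightarrow> ('r \<Rightarrow> nat) \<Rightarrow> 'r \<Rightarrow> nat \<Rightarrow> int" where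
  "low K n v \<alpha> i = (if i < K then n \<alpha> i else if i = K then n \<alpha> i + tops K n v \<alpha> else 0)"

definition mtop :: "nat \<Rightarrow> ('r \<Rightarrow> nat \<Rightarrow> nat) \<Rightarrow> ('r \<Rightarrow> nat) \<Rightarrow> 'r \<Rightarrow> nat \<Rightarrow> nat" where
  "mtop K m v \<alpha> i = (if i = Suc K then v \<alpha> else m \<alpha> i)"

lemma AI_low: "1 \<le> K \<Longrightarrow> AI K (low K n v) \<alpha> i = AI K n \<alpha> i + int (min i K) * tops K n v \<alpha>"
proof -
  assume "1 \<le> K"
  then obtain k where k: "K = Suc k" by (cases K) auto
  have "AI k (low K n v) \<alpha> i = AI k n \<alpha> i" by (rule AI_cong) (simp add: low_def k)
  then show ?thesis by (simp add: AI_top k low_def algebra_simps)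
qed

lemma AI_join: "AI (Suc K) (\<lambda>\<beta> j. int (mtop K m v \<beta> j)) \<alpha> i = AI K (\<lambda>\<beta> j. int (m \<beta> j)) \<alpha> i + int (min i (Suc K)) * int (v \<alpha>)"
proof -
  have "AI K (\<lambda>\<beta> j. int (mtop K m v \<beta> j)) \<alpha> i = AI K (\<lambda>\<beta> j. int (m \<beta> j)) \<alpha> i"
    by (rule AI_cong) (simp add: mtop_def)
  then show ?thesis by (simp add: AI_top mtop_def)
qed

lemma pI_join:
  assumes "1 \<le> K"
  shows "i \<le> K \<Longrightarrow> pI (Suc K) (mtop K m v) n \<alpha> i = pI K m (low K n v) \<alpha> i"
    and "pI (Suc K) (mtop K m v) n \<alpha> (Suc K) = pI K m (low K n v) \<alpha> K + tops K n v \<alpha>"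
  using assms
  by (simp_all add: pI_def AI_join AI_low AI_top[of K n] AI_above[of K "Suc K"] tops_def
      algebra_simps sum.distrib sum_distrib_left)

text \<open>All that depends on the highest level \<open>v\<close> in a term. The cross terms
  between \<open>v\<close> and the lower levels of m are included, for they are determined by
  \<open>l\<close>, \<open>n\<close> and \<open>v\<close>.\<close>

definition peel :: "nat \<Rightarrow> ('r \<Rightarrow> int) \<Rightarrow> ('r \<Rightarrow> nat \<Rightarrow> int) \<Rightarrow> ('r \<Rightarrow> nat) \<Rightarrow> puiseux" where
  "peel K l n v = qp (- (1/2) * of_int (\<Sum>\<alpha>\<in>UNIV. int (v \<alpha>) *
       (AI K (low K n v) \<alpha> K - (l \<alpha> - tops K n v \<alpha>) + (l \<alpha> + AI (Suc K) n \<alpha> (Suc K))))) *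
     (\<Prod>\<alpha>\<in>UNIV. qbin (v \<alpha>) (l \<alpha>))"

lemma nterm_join:
  assumes K: "1 \<le> K" and m: "m \<in> Nset K (\<lambda>\<alpha>. l \<alpha> - tops K n v \<alpha>) (low K n v)"
  shows "nterm (Suc K) n (mtop K m v) = peel K l n v * nterm K (low K n v) m"
proof -
  let ?n = "low K n v" and ?s = "tops K n v" and ?m = "\<lambda>\<beta> j. int (m \<beta> j)"
  have pK: "pI K m ?n \<alpha> K = l \<alpha> - ?s \<alpha>" for \<alpha> using m by (simp add: Nset_def)
  have top: "pI (Suc K) (mtop K m v) n \<alpha> (Suc K) = l \<alpha>" for \<alpha> by (simp add: pI_join[OF K] pK)
  have An: "AI (Suc K) n \<alpha> i = AI K ?n \<alpha> i + int i * (\<Sum>\<beta>\<in>UNIV. C $ \<alpha> $ \<beta> * int (v \<beta>))" if "i \<le> K" for \<alpha> i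
    using that by (simp add: AI_top AI_low[OF K] tops_def algebra_simps)
  \<comment> \<open>The cross terms involve m only through the sums of i m(\<alpha>,i), which the
    condition at level \<open>K\<close> expresses by \<open>l\<close> and \<open>n\<close>.\<close>
  have M: "(\<Sum>\<alpha>\<in>UNIV. \<Sum>i=1..K. int (m \<alpha> i) * (int i * (\<Sum>\<beta>\<in>UNIV. C $ \<alpha> $ \<beta> * int (v \<beta>))))
     = (\<Sum>\<alpha>\<in>UNIV. int (v \<alpha>) * (AI K ?n \<alpha> K - (l \<alpha> - ?s \<alpha>)))"
  proof -
    have "(\<Sum>i=1..K. int (m \<alpha> i) * (int i * x)) = AI K ?m \<alpha> K * x" for \<alpha> x
      unfolding AI_def sum_distrib_right by (intro sum.cong refl) (simp add: min_def)
    then have "(\<Sum>\<alpha>\<in>UNIV. \<Sum>i=1..K. int (m \<alpha> i) * (int i * (\<Sum>\<beta>\<in>UNIV. C $ \<alpha> $ \<beta> * int (v \<beta>))))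
      = (\<Sum>\<alpha>\<in>UNIV. AI K ?m \<alpha> K * (\<Sum>\<beta>\<in>UNIV. C $ \<alpha> $ \<beta> * int (v \<beta>)))" by simp
    also have "\<dots> = (\<Sum>\<beta>\<in>UNIV. int (v \<beta>) * (\<Sum>\<alpha>\<in>UNIV. C $ \<beta> $ \<alpha> * AI K ?m \<alpha> K))"
      unfolding sum_distrib_left by (subst sum.swap, intro sum.cong refl, subst C_sym) simp
    also have "\<dots> = (\<Sum>\<beta>\<in>UNIV. int (v \<beta>) * (AI K ?n \<beta> K - (l \<beta> - ?s \<beta>)))"
      by (simp add: pK[symmetric] pI_def)
    finally show ?thesis .
  qed
  have Q: "QI (Suc K) (mtop K m v) n = QI K m ?n - (1/2) * of_int (\<Sum>\<alpha>\<in>UNIV. int (v \<alpha>) *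
       (AI K ?n \<alpha> K - (l \<alpha> - ?s \<alpha>) + (l \<alpha> + AI (Suc K) n \<alpha> (Suc K))))"
  proof -
    have "(\<Sum>i=1..Suc K. int (mtop K m v \<alpha> i) * (pI (Suc K) (mtop K m v) n \<alpha> i + AI (Suc K) n \<alpha> i)) =
       (\<Sum>i=1..K. int (m \<alpha> i) * (pI K m ?n \<alpha> i + AI K ?n \<alpha> i)) +
       (\<Sum>i=1..K. int (m \<alpha> i) * (int i * (\<Sum>\<beta>\<in>UNIV. C $ \<alpha> $ \<beta> * int (v \<beta>)))) +
       int (v \<alpha>) * (l \<alpha> + AI (Suc K) n \<alpha> (Suc K))" for \<alpha>
    proof -
      have "(\<Sum>i=1..K. int (mtop K m v \<alpha> i) * (pI (Suc K) (mtop K m v) n \<alpha> i + AI (Suc K) n \<alpha> i)) =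
        (\<Sum>i=1..K. int (m \<alpha> i) * (pI K m ?n \<alpha> i + AI K ?n \<alpha> i) + int (m \<alpha> i) * (int i * (\<Sum>\<beta>\<in>UNIV. C $ \<alpha> $ \<beta> * int (v \<beta>))))"
        by (intro sum.cong refl) (simp add: pI_join[OF K] An mtop_def distrib_left)
      then show ?thesis by (simp add: top sum.distrib) (simp add: mtop_def)
    qed
    then have "(\<Sum>\<alpha>\<in>UNIV. \<Sum>i=1..Suc K. int (mtop K m v \<alpha> i) * (pI (Suc K) (mtop K m v) n \<alpha> i + AI (Suc K) n \<alpha> i)) =
      (\<Sum>\<alpha>\<in>UNIV. \<Sum>i=1..K. int (m \<alpha> i) * (pI K m ?n \<alpha> i + AI K ?n \<alpha> i)) +
      (\<Sum>\<alpha>\<in>UNIV. int (v \<alpha>) * (AI K ?n \<alpha> K - (l \<alpha> - ?s \<alpha>) + (l \<alpha> + AI (Suc K) n \<alpha> (Suc K))))"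
      by (simp only: sum.distrib M distrib_left[of "int _" "AI K ?n _ K - (l _ - ?s _)"])
    then show ?thesis unfolding QI_def by (simp add: field_simps)
  qed
  have "gprod (Suc K) (mtop K m v) n = gprod K m ?n * (\<Prod>\<alpha>\<in>UNIV. qbin (v \<alpha>) (l \<alpha>))"
  proof -
    have "gprod K m n = (\<Prod>\<alpha>\<in>UNIV. \<Prod>i=1..K. qbin (m \<alpha> i) (pI K m n \<alpha> i))" for K m n
      unfolding gprod_def by (simp add: prod.cartesian_product case_prod_beta)
    then show ?thesis
      by (simp add: top prod.distrib[symmetric] pI_join[OF K]) (intro prod.cong refl arg_cong2[of _ _ _ _ "(*)"]; simp add: mtop_def pK)
  qed
  then show ?thesis
    unfolding nterm_def Q peel_def by (simp add: qp_mult[symmetric] mult.assoc mult.left_commute mult.commute[of "gprod _ _ _"] diff_conv_add_uminus del: add_uminus_conv_diff)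
qed

text \<open>On the highest level p equals \<open>l\<close>, which is nonnegative, so the restriction
  there is automatic and the same decomposition holds with and without it.\<close>

lemma Nsum_restr_peel:
  assumes K: "1 \<le> K" and l: "\<And>\<alpha>. 0 \<le> l \<alpha>"
  shows "Nsum_restr b (Suc K) l n = (\<Sum>v\<in>(\<lambda>m \<alpha>. m \<alpha> (Suc K)) ` Nset (Suc K) l n.
     peel K l n v * Nsum_restr b K (\<lambda>\<alpha>. l \<alpha> - tops K n v \<alpha>) (low K n v))"
proof -
  let ?V = "(\<lambda>m \<alpha>. m \<alpha> (Suc K)) ` Nset (Suc K) l n"
  let ?N = "\<lambda>v. Nset_restr b K (\<lambda>\<alpha>. l \<alpha> - tops K n v \<alpha>) (low K n v)"
  let ?lo = "\<lambda>m \<alpha> i. if i = Suc K then 0 else m \<alpha> i"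
  have fin: "finite ?V" "finite (?N v)" for v
    by (auto simp: finite_Nset Nset_restr_def)
  have iff: "mtop K m v \<in> Nset_restr b (Suc K) l n \<longleftrightarrow> m \<in> ?N v" if "\<And>\<alpha>. m \<alpha> (Suc K) = 0" for m v
  proof -
    have "(\<forall>\<alpha> i. i \<notin> {1..Suc K} \<longrightarrow> mtop K m v \<alpha> i = 0) \<longleftrightarrow> (\<forall>\<alpha> i. i \<notin> {1..K} \<longrightarrow> m \<alpha> i = 0)"
      using that by (auto simp: mtop_def le_Suc_eq) (metis that)
    moreover have "pI (Suc K) (mtop K m v) n \<alpha> (Suc K) = l \<alpha> \<longleftrightarrow> pI K m (low K n v) \<alpha> K = l \<alpha> - tops K n v \<alpha>" for \<alpha>
      by (auto simp: pI_join[OF K])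
    moreover have "(\<forall>\<alpha>. \<forall>i\<in>{1..Suc K}. 0 \<le> pI (Suc K) (mtop K m v) n \<alpha> i) \<longleftrightarrow> (\<forall>\<alpha>. \<forall>i\<in>{1..K}. 0 \<le> pI K m (low K n v) \<alpha> i)"
       if "\<forall>\<alpha>. pI (Suc K) (mtop K m v) n \<alpha> (Suc K) = l \<alpha>"
    proof -
      have "{1..Suc K} = insert (Suc K) {1..K}" by auto
      moreover have "pI (Suc K) (mtop K m v) n \<alpha> i = pI K m (low K n v) \<alpha> i" if "i \<in> {1..K}" for \<alpha> i
        using that by (simp add: pI_join(1)[OF K])
      ultimately show ?thesis using l by (simp only: ball_simps that) simp
    qed
    ultimately show ?thesis unfolding Nset_restr_def Nset_def by auto
  qed
  have "(\<Sum>v\<in>?V. peel K l n v * Nsum_restr b K (\<lambda>\<alpha>. l \<alpha> - tops K n v \<alpha>) (low K n v)) =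
    (\<Sum>v\<in>?V. \<Sum>m\<in>?N v. nterm (Suc K) n (mtop K m v))"
    unfolding Nsum_restr_def sum_distrib_left
    by (intro sum.cong refl nterm_join[OF K, symmetric]) (simp add: Nset_restr_def)
  also have "\<dots> = (\<Sum>(v, m)\<in>Sigma ?V ?N. nterm (Suc K) n (mtop K m v))"
    using fin by (subst sum.Sigma) auto
  also have "\<dots> = (\<Sum>m\<in>Nset_restr b (Suc K) l n. nterm (Suc K) n m)"
  proof (rule sum.reindex_bij_witness[of _ "\<lambda>m. (\<lambda>\<alpha>. m \<alpha> (Suc K), ?lo m)" "\<lambda>(v, m). mtop K m v"])
    fix m assume m: "m \<in> Nset_restr b (Suc K) l n"
    have j: "mtop K (?lo m) (\<lambda>\<alpha>. m \<alpha> (Suc K)) = m" by (auto simp: mtop_def fun_eq_iff)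
    then show "(case (\<lambda>\<alpha>. m \<alpha> (Suc K), ?lo m) of (v, m) \<Rightarrow> mtop K m v) = m" by simp
    show "(\<lambda>\<alpha>. m \<alpha> (Suc K), ?lo m) \<in> Sigma ?V ?N"
      using m iff[of "?lo m" "\<lambda>\<alpha>. m \<alpha> (Suc K)"] unfolding j by (auto simp: Nset_restr_def)
  next
    fix x assume x: "x \<in> Sigma ?V ?N"
    obtain v m where vm: "x = (v, m)" by (cases x)
    with x have m: "m \<in> ?N v" by simp
    then have m0: "m \<alpha> (Suc K) = 0" for \<alpha> by (simp add: Nset_restr_def Nset_def)
    then have "?lo (mtop K m v) = m" "(\<lambda>\<alpha>. mtop K m v \<alpha> (Suc K)) = v" by (auto simp: mtop_def fun_eq_iff)
    then show "(\<lambda>\<alpha>. (case x of (v, m) \<Rightarrow> mtop K m v) \<alpha> (Suc K), ?lo (case x of (v, m) \<Rightarrow> mtop K m v)) = x"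
      unfolding vm prod.case by simp
    show "(case x of (v, m) \<Rightarrow> mtop K m v) \<in> Nset_restr b (Suc K) l n" using iff[of m v] m m0 by (simp add: vm)
  qed (auto simp: case_prod_beta)
  finally show ?thesis by (simp add: Nsum_restr_def)
qed

text \<open>The terms in which some \<open>p\<close> is negative cancel: peeling off the highest level leaves sums with a negative
  \<open>l\<close>, which vanish.\<close>

lemma Nsum_restr_eq_Nsum:
  assumes "1 \<le> K" "\<And>\<alpha>. 0 \<le> l \<alpha>" "\<And>\<alpha> i. 1 \<le> i \<Longrightarrow> i < K \<Longrightarrow> 0 \<le> n \<alpha> i"
  shows "Nsum_restr True K l n = Nsum K l n"
  using assms
proof (induction K arbitrary: l n rule: dec_induct)
  case base
  then have "Nset_restr True 1 l n = Nset_restr False 1 l n" by (auto simp: Nset_restr_def Nset_def)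
  then show ?case unfolding Nsum_restr_False[symmetric] Nsum_restr_def by simp
next
  case (step K)
  show ?case
    unfolding Nsum_restr_False[symmetric] Nsum_restr_peel[OF step.hyps(1) step.prems(1)]
  proof (intro sum.cong refl arg_cong2[of _ _ _ _ "(*)"])
    fix v
    let ?l = "\<lambda>\<alpha>. l \<alpha> - tops K n v \<alpha>"
    show "Nsum_restr True K ?l (low K n v) = Nsum_restr False K ?l (low K n v)"
    proof (cases "\<forall>\<alpha>. 0 \<le> ?l \<alpha>")
      case True
      then show ?thesis
        unfolding Nsum_restr_False by (intro step.IH) (use step.prems in \<open>auto simp: low_def\<close>)
    next
      case False
      then obtain \<alpha> where \<alpha>: "?l \<alpha> < 0" by (auto simp: not_le)
      have "Nset_restr True K ?l (low K n v) = {}"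
      proof -
        have False if "m \<in> Nset_restr True K ?l (low K n v)" for m
        proof -
          have "pI K m (low K n v) \<alpha> K = ?l \<alpha>" using that by (simp add: Nset_restr_def Nset_def)
          moreover have "0 \<le> pI K m (low K n v) \<alpha> K" using that step.hyps(1) by (simp add: Nset_restr_def)
          ultimately show False using \<alpha> by simp
        qed
        then show ?thesis by blast
      qed
      \<comment> \<open>This makes the folded exponent \<open>n \<alpha> K + tops\<close> at least
        \<open>tops - l \<alpha>\<close>, the bound under which the unrestricted sum with negative
        value vanishes.\<close>
      moreover have nK: "- l \<alpha> \<le> n \<alpha> K" using step.hyps(1) step.prems(1)[of \<alpha>] step.prems(2)[of K \<alpha>] by simp
      have "Nsum K ?l (low K n v) = 0"
        by (rule Nsum_negative[of _ _ _ \<alpha>])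
          (use \<alpha> step.hyps(1) step.prems(1)[of \<alpha>] step.prems(2)[of _ \<alpha>] nK in \<open>auto simp: low_def\<close>)
      ultimately show ?thesis by (simp add: Nsum_restr_def[of True] Nsum_restr_False)
    qed
  qed
qed

lemma MsumK_eq_Nsum:
  assumes "1 \<le> K"
  shows "MsumK C K l n = Nsum K (\<lambda>\<alpha>. int (l \<alpha>)) (\<lambda>\<alpha> i. int (n \<alpha> i))"
proof -
  let ?l = "\<lambda>\<alpha>. int (l \<alpha>)" and ?n = "\<lambda>\<alpha> i. int (n \<alpha> i)"
  have An: "An K m \<alpha> i = AI K (\<lambda>\<alpha> i. int (m \<alpha> i)) \<alpha> i" for m \<alpha> i
    by (simp add: An_def AI_def)
  have p: "pvec C K m n \<alpha> i = pI K m ?n \<alpha> i" for m \<alpha> i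
    by (simp add: pvec_def pI_def An)
  have "Mset C K l n = Nset_restr True K ?l ?n"
    by (auto simp: Mset_def Nset_restr_def Nset_def p)
  moreover have "qpow C (Qform C K m n) * (\<Prod>\<alpha>\<in>UNIV. \<Prod>i=1..K. qbinom C (m \<alpha> i) (pvec C K m n \<alpha> i)) = nterm K ?n m"
    if "m \<in> Nset_restr True K ?l ?n" for m
  proof -
    have "(\<Prod>\<alpha>\<in>UNIV. \<Prod>i=1..K. qbinom C (m \<alpha> i) (pvec C K m n \<alpha> i)) = (\<Prod>\<alpha>\<in>UNIV. \<Prod>i=1..K. qbin (m \<alpha> i) (pI K m ?n \<alpha> i))"
      using that by (intro prod.cong refl) (simp add: p Nset_restr_def qbin_eq_qbinom)
    also have "\<dots> = gprod K m ?n"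
      unfolding gprod_def by (simp add: prod.cartesian_product case_prod_beta)
    finally show ?thesis by (simp add: nterm_def Qform_def QI_def p An)
  qed
  ultimately have "MsumK C K l n = Nsum_restr True K ?l ?n" by (simp add: MsumK_def Nsum_restr_def)
  also have "\<dots> = Nsum K ?l ?n" by (rule Nsum_restr_eq_Nsum[OF assms]) simp_all
  finally show ?thesis .
qed

text \<open>A nonzero entry on level \<open>K + 1\<close> contributes at least \<open>K + 1\<close>
  to the sums of i m(\<alpha>,i). Pairing the condition on the highest level with \<open>rho\<close>
  bounds their total by \<open>wt K n\<close>, which is smaller.\<close>

lemma Nset_restr_stable:
  assumes n: "\<And>\<alpha> i. K < i \<Longrightarrow> n \<alpha> i = 0" and l: "\<And>\<alpha>. 0 \<le> l \<alpha>" and W: "wt K n < int (Suc K)" and K: "1 \<le> K"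
  shows "Nset_restr True (Suc K) l n = Nset_restr True K l n"
proof -
  have An: "AI (Suc K) n \<alpha> i = AI K n \<alpha> i" for \<alpha> i by (simp add: AI_top n)
  have top: "m \<alpha> (Suc K) = 0" if m: "m \<in> Nset_restr True (Suc K) l n" for m \<alpha>
  proof (rule ccontr)
    assume "m \<alpha> (Suc K) \<noteq> 0"
    define M where "M \<beta> = AI (Suc K) (\<lambda>\<beta> j. int (m \<beta> j)) \<beta> (Suc K)" for \<beta>
    have M0: "0 \<le> M \<beta>" for \<beta> unfolding M_def AI_def by (rule sum_nonneg) simp
    have eq: "AI K n \<alpha> K - l \<alpha> = (\<Sum>\<beta>\<in>UNIV. C $ \<alpha> $ \<beta> * M \<beta>)" for \<alpha>
    proof -
      have "pI (Suc K) m n \<alpha> (Suc K) = l \<alpha>" using m by (simp add: Nset_restr_def Nset_def)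
      then show ?thesis by (simp add: pI_def M_def An AI_above[of K "Suc K"])
    qed
    have "int (Suc K) \<le> int (min (Suc K) (Suc K)) * int (m \<alpha> (Suc K))" using \<open>m \<alpha> (Suc K) \<noteq> 0\<close> by (cases "m \<alpha> (Suc K)") auto
    also have "\<dots> \<le> M \<alpha>" unfolding M_def AI_def by (rule member_le_sum) auto
    also have "\<dots> \<le> (\<Sum>\<beta>\<in>UNIV. M \<beta>)" by (rule member_le_sum) (auto simp: M0)
    also have "\<dots> \<le> d * (\<Sum>\<beta>\<in>UNIV. M \<beta>)"
      using mult_right_mono[of 1 d "\<Sum>\<beta>\<in>UNIV. M \<beta>"] d_pos M0 by (simp add: sum_nonneg)
    also have "\<dots> = (\<Sum>\<beta>\<in>UNIV. (\<Sum>\<alpha>\<in>UNIV. C $ \<beta> $ \<alpha> * rho \<alpha>) * M \<beta>)" by (simp add: C_rho sum_distrib_left)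
    also have "\<dots> = (\<Sum>\<alpha>\<in>UNIV. rho \<alpha> * (AI K n \<alpha> K - l \<alpha>))"
      unfolding eq sum_distrib_left sum_distrib_right
      by (subst sum.swap) (intro sum.cong refl, subst C_sym, simp add: mult.assoc mult.left_commute)
    also have "\<dots> \<le> wt K n"
      unfolding wt_def using rho_pos l by (intro sum_mono mult_left_mono) (auto simp: less_imp_le)
    finally show False using W by simp
  qed
  have "m \<in> Nset_restr True (Suc K) l n \<longleftrightarrow> m \<in> Nset_restr True K l n" if m: "\<And>\<alpha>. m \<alpha> (Suc K) = 0" for m
  proof -
    have p: "pI (Suc K) m n \<alpha> i = pI K m n \<alpha> i" for \<alpha> i by (simp add: pI_def An AI_top[of K "\<lambda>\<beta> j. int (m \<beta> j)"] m)
    have pt: "pI K m n \<alpha> (Suc K) = pI K m n \<alpha> K" for \<alpha> by (simp add: pI_def AI_above[of K "Suc K"])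
    have "{1..Suc K} = insert (Suc K) {1..K}" by auto
    then have "(\<forall>i\<in>{1..Suc K}. 0 \<le> pI K m n \<alpha> i) \<longleftrightarrow> (\<forall>i\<in>{1..K}. 0 \<le> pI K m n \<alpha> i)" for \<alpha>
      using K by (auto simp: pt)
    moreover have "(\<forall>\<alpha> i. i \<notin> {1..Suc K} \<longrightarrow> m \<alpha> i = 0) \<longleftrightarrow> (\<forall>\<alpha> i. i \<notin> {1..K} \<longrightarrow> m \<alpha> i = 0)"
      using m by (auto simp: le_Suc_eq)
    ultimately show ?thesis unfolding Nset_restr_def Nset_def mem_Collect_eq p pt by simp
  qed
  moreover have "m \<alpha> (Suc K) = 0" if "m \<in> Nset_restr True K l n" for m \<alpha>
    using that by (simp add: Nset_restr_def Nset_def)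
  ultimately show ?thesis using top by blast
qed

lemma Msum_eq:
  assumes n: "\<And>\<alpha> i. k < i \<Longrightarrow> n \<alpha> i = 0"
  obtains K0 where "\<And>K. K0 \<le> K \<Longrightarrow> Msum C l n = Nsum K (\<lambda>\<alpha>. int (l \<alpha>)) (\<lambda>\<alpha> i. int (n \<alpha> i))"
proof -
  let ?l = "\<lambda>\<alpha>. int (l \<alpha>)" and ?n = "\<lambda>\<alpha> i. int (n \<alpha> i)"
  have AIk: "AI K ?n \<alpha> K = AI k ?n \<alpha> k" if "k \<le> K" for K \<alpha>
  proof -
    have "AI K ?n \<alpha> K = (\<Sum>j=1..k. int (min K j) * ?n \<alpha> j)"
      unfolding AI_def by (rule sum.mono_neutral_right) (use that n in auto)
    also have "\<dots> = AI k ?n \<alpha> k" unfolding AI_def using that by (intro sum.cong refl) (auto simp: min_def)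
    finally show ?thesis .
  qed
  have wtk: "wt K ?n = wt k ?n" if "k \<le> K" for K using AIk[OF that] by (simp add: wt_def)
  define K0 where "K0 = 1 + k + nat (wt k ?n)"
  have step: "Nsum (Suc K) ?l ?n = Nsum K ?l ?n" if K: "K0 \<le> K" for K
  proof -
    have K': "1 \<le> K" "k \<le> K" "wt K ?n < int (Suc K)" using K wtk[of K] by (auto simp: K0_def)
    have Nset_restr: "Nset_restr True (Suc K) ?l ?n = Nset_restr True K ?l ?n"
      by (rule Nset_restr_stable) (use K' n in auto)
    have "Nsum_restr True (Suc K) ?l ?n = Nsum_restr True K ?l ?n"
      unfolding Nsum_restr_def Nset_restr
    proof (intro sum.cong refl nterm_top_zero[where l' = ?l])
      fix m assume m: "m \<in> Nset_restr True K ?l ?n"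
      then have "m \<in> Nset_restr True (Suc K) ?l ?n" by (simp only: Nset_restr)
      then show "m \<in> Nset (Suc K) ?l ?n" by (simp add: Nset_restr_def)
      show "m \<alpha> (Suc K) = 0" for \<alpha> using m by (simp add: Nset_def Nset_restr_def)
    next
      show "AI (Suc K) ?n \<alpha> i = AI K ?n \<alpha> i" for \<alpha> i using n[of "Suc K"] K' by (simp add: AI_top)
    qed
    then show ?thesis using K' by (simp add: Nsum_restr_eq_Nsum)
  qed
  have const: "Nsum K ?l ?n = Nsum K0 ?l ?n" if "K0 \<le> K" for K
    using that by (induction K rule: dec_induct) (simp_all add: step)
  have cyc: "\<forall>\<^sub>F K in sequentially. MsumK C K l n = Nsum K0 ?l ?n"
    unfolding eventually_sequentially
  proof (intro exI[of _ K0] allI impI)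
    fix K assume "K0 \<le> K"
    with const[of K] show "MsumK C K l n = Nsum K0 ?l ?n" using MsumK_eq_Nsum[of K l n] by (simp add: K0_def)
  qed
  have "Msum C l n = Nsum K0 ?l ?n"
    unfolding Msum_def
  proof (rule the_equality)
    fix M assume "\<forall>\<^sub>F K in sequentially. MsumK C K l n = M"
    with cyc have "\<forall>\<^sub>F K in sequentially. M = Nsum K0 ?l ?n" by eventually_elim simp
    then show "M = Nsum K0 ?l ?n" by simp
  qed (rule cyc)
  then show thesis using that const by metis
qed

text \<open>The two extra levels of \<open>sft\<close> applied to a vector, followed by the
  coefficient at \<open>- onev\<close>. As a linear functional on \<open>PB\<close> it sees only the
  vector and not the product that produced it.\<close>

definition Phi :: "('r \<Rightarrow> nat) \<Rightarrow> nat \<Rightarrow> ((int, 'r) vec \<Rightarrow> laurent) \<Rightarrow> laurent" where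
  "Phi l K g = level (Suc K) (\<lambda>\<alpha>. - (int (l \<alpha>) + 1)) indices (level K (\<lambda>\<alpha>. int (l \<alpha>) + 1) indices g) (- onev)"

lemma Phi_diff: "g \<in> PB \<Longrightarrow> h \<in> PB \<Longrightarrow> Phi l K (\<lambda>c. g c - h c) = Phi l K g - Phi l K h"
  by (simp add: Phi_def level_diff)

lemma Phi_scale: "g \<in> PB \<Longrightarrow> Phi l K (\<lambda>c. u * g c) = u * Phi l K g"
  by (simp add: Phi_def level_scale)

lemma level_zero: "level i (\<lambda>_. 0) ls g = g"
  by (induction ls arbitrary: g) simp_all

lemma vac_above:
  assumes "\<And>\<alpha> i. k < i \<Longrightarrow> n \<alpha> i = 0" "k \<le> K"
  shows "vac n K = vac n k"
  using assms(2) by (induction K rule: dec_induct) (simp_all add: assms(1) level_zero)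

lemma vac_sft:
  assumes "\<And>\<alpha> i. k < i \<Longrightarrow> n \<alpha> i = 0" "k < K"
  shows "vac (sft K (\<lambda>\<alpha>. int (l \<alpha>)) n) (Suc K) (- onev) = Phi l K (vac n k)"
proof -
  obtain j where j: "K = Suc j" "k \<le> j" using assms(2) by (cases K) auto
  have "vac (sft K (\<lambda>\<alpha>. int (l \<alpha>)) n) j = vac n j"
    by (rule vac_cong) (simp add: sft_def j)
  then have "vac (sft K (\<lambda>\<alpha>. int (l \<alpha>)) n) j = vac n k" using vac_above[of k n j] assms(1) j(2) by simp
  then show ?thesis using assms by (simp add: j Phi_def sft_def)
qed

definition cl :: "('r \<Rightarrow> nat) \<Rightarrow> rat" where
  "cl l = (1/2) * of_int (\<Sum>\<alpha>\<in>UNIV. rho \<alpha>) +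
     (1/2) * of_int (\<Sum>\<alpha>\<in>UNIV. \<Sum>\<beta>\<in>UNIV. (int (l \<alpha>) + 1) * lam C \<alpha> \<beta> * (int (l \<beta>) + 1))"

text \<open>The extra levels add up to zero and do not change \<open>AI\<close> on the levels of
  \<open>n\<close>, so the exponent has no cross terms between \<open>l\<close> and
  \<open>n\<close>. This is what makes the factor of proportionality depend on \<open>l\<close>
  alone.\<close>

lemma vac_exp_sft:
  assumes "\<And>\<alpha> i. k < i \<Longrightarrow> n \<alpha> i = 0" "k < K"
  shows "vac_exp (Suc K) (sft K (\<lambda>\<alpha>. int (l \<alpha>)) n) = cl l + of_int (Lv k n) + (1/2) * of_int (G2 k n)"
proof -
  let ?n = "sft K (\<lambda>\<alpha>. int (l \<alpha>)) n" and ?l = "\<lambda>\<alpha>. int (l \<alpha>) + 1"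
  have split: "(\<Sum>i=1..Suc K. ?n \<alpha> i * f i) = (\<Sum>i=1..k. n \<alpha> i * f i) + ?l \<alpha> * (f K - f (Suc K))" for f :: "nat \<Rightarrow> int" and \<alpha>
  proof -
    obtain j where j: "K = Suc j" "k \<le> j" using assms(2) by (cases K) auto
    have "(\<Sum>i=1..j. ?n \<alpha> i * f i) = (\<Sum>i=1..j. n \<alpha> i * f i)" by (rule sum.cong) (simp_all add: sft_def j)
    also have "\<dots> = (\<Sum>i=1..k. n \<alpha> i * f i)"
      by (rule sum.mono_neutral_right) (use j assms(1) in auto)
    finally show ?thesis using assms j by (simp add: sft_def algebra_simps)
  qed
  have L: "Lv (Suc K) ?n = Lv k n"
    unfolding Lv_def using split[of _ "\<lambda>i. rho _"] by (simp add: mult.commute)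
  have "G2 (Suc K) ?n = (\<Sum>\<alpha>\<in>UNIV. (\<Sum>i=1..k. n \<alpha> i * AI (Suc K) (Lm ?n) \<alpha> i) + ?l \<alpha> * (AI (Suc K) (Lm ?n) \<alpha> K - AI (Suc K) (Lm ?n) \<alpha> (Suc K)))"
    unfolding G2_def IP_def by (intro sum.cong refl split)
  also have "\<dots> = (\<Sum>\<alpha>\<in>UNIV. (\<Sum>i=1..k. n \<alpha> i * AI k (Lm n) \<alpha> i) + ?l \<alpha> * (\<Sum>\<beta>\<in>UNIV. lam C \<alpha> \<beta> * ?l \<beta>))"
  proof (intro sum.cong refl arg_cong2[of _ _ _ _ "(+)"] arg_cong2[of _ _ _ _ "(*)"])
    fix \<alpha> i assume i: "i \<in> {1..k}"
    have "AI K n \<beta> i = AI k n \<beta> i" for \<beta>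
      unfolding AI_def by (rule sum.mono_neutral_right) (use assms in auto)
    then show "AI (Suc K) (Lm ?n) \<alpha> i = AI k (Lm n) \<alpha> i"
      using i assms(2) by (simp add: AI_mix AI_sft)
  next
    fix \<alpha>
    show "AI (Suc K) (Lm ?n) \<alpha> K - AI (Suc K) (Lm ?n) \<alpha> (Suc K) = (\<Sum>\<beta>\<in>UNIV. lam C \<alpha> \<beta> * ?l \<beta>)"
      using assms(2) by (simp add: AI_mix AI_sft AI_above[of K "Suc K"] sum_subtractf[symmetric] algebra_simps)
  qed
  also have "\<dots> = G2 k n + (\<Sum>\<alpha>\<in>UNIV. \<Sum>\<beta>\<in>UNIV. ?l \<alpha> * lam C \<alpha> \<beta> * ?l \<beta>)"
    by (simp add: G2_def IP_def sum.distrib sum_distrib_left mult.assoc)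
  finally show ?thesis by (simp add: vac_exp_def L cl_def field_simps)
qed

lemma Msum_Phi:
  assumes n: "\<And>\<alpha> i. k < i \<Longrightarrow> n \<alpha> i = 0"
  obtains K0 where "\<And>K. K0 \<le> K \<Longrightarrow> Msum C l n =
    tpow (cl l + of_int (Lv k (\<lambda>\<alpha> i. int (n \<alpha> i))) + (1/2) * of_int (G2 k (\<lambda>\<alpha> i. int (n \<alpha> i)))) *
    emb (Phi l K (delta 0 \<triangleleft> Q_product C Q k n))"
proof -
  let ?n = "\<lambda>\<alpha> i. int (n \<alpha> i)"
  obtain K0 where K0: "\<And>K. K0 \<le> K \<Longrightarrow> Msum C l n = Nsum K (\<lambda>\<alpha>. int (l \<alpha>)) ?n"
    using Msum_eq[of k n l] n by blast
  show thesis
  proof (rule that[of "max K0 (Suc k)"])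
    fix K assume K: "max K0 (Suc k) \<le> K"
    have "Msum C l n = Nsum K (\<lambda>\<alpha>. int (l \<alpha>)) ?n" using K0 K by simp
    also have "\<dots> = vac_coeff (Suc K) (sft K (\<lambda>\<alpha>. int (l \<alpha>)) ?n)" by (rule Nsum_vac_coeff) (use K n in auto)
    also have "\<dots> = tpow (cl l + of_int (Lv k ?n) + (1/2) * of_int (G2 k ?n)) * emb (Phi l K (vac ?n k))"
      unfolding vac_coeff_def using K n by (simp add: vac_exp_sft[of k] vac_sft[of k] del: vac.simps)
    finally show "Msum C l n = tpow (cl l + of_int (Lv k ?n) + (1/2) * of_int (G2 k ?n)) * emb (Phi l K (delta 0 \<triangleleft> Q_product C Q k n))"
      by (simp only: vac_nat)
  qed
qed

subsection \<open>Lowest terms of the Q-system\<close>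

text \<open>The exponents of the monomials of \<open>Q \<alpha> m\<close> of lowest degree in \<open>y\<close>.\<close>

fun lowkey :: "'r \<Rightarrow> nat \<Rightarrow> (int, 'r) vec \<times> (int, 'r) vec" where
  "lowkey \<alpha> 0 = (axis \<alpha> 1, 0)"
| "lowkey \<alpha> (Suc m) = (- Zm m $ \<alpha>, Zm (Suc m) $ \<alpha>)"

lemma mat_row: "(mat 1 :: ((int, 'r) vec, 'r) vec) $ \<alpha> = axis \<alpha> 1"
  by (simp add: vec_eq_iff mat_def axis_def)

lemma Adj_sum: "(\<Sum>\<beta>\<in>UNIV. if Adj $ \<alpha> $ \<beta> = 1 then v \<beta> else 0) = (\<Sum>\<beta>\<in>UNIV. Adj $ \<alpha> $ \<beta> *s (v \<beta> :: (int, 'r) vec))"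
proof (intro sum.cong refl)
  fix \<beta> show "(if Adj $ \<alpha> $ \<beta> = 1 then v \<beta> else 0) = Adj $ \<alpha> $ \<beta> *s v \<beta>"
    using Adj_01(2)[of \<alpha> \<beta>] by auto
qed

lemma fst_snd_Adj_sum:
  "fst (\<Sum>\<beta>\<in>UNIV. if Adj $ \<alpha> $ \<beta> = 1 then k \<beta> else 0) = (\<Sum>\<beta>\<in>UNIV. Adj $ \<alpha> $ \<beta> *s fst (k \<beta> :: (int, 'r) vec \<times> (int, 'r) vec))"
  "snd (\<Sum>\<beta>\<in>UNIV. if Adj $ \<alpha> $ \<beta> = 1 then k \<beta> else 0) = (\<Sum>\<beta>\<in>UNIV. Adj $ \<alpha> $ \<beta> *s snd (k \<beta>))"
proof -
  have "fst (if b then x else 0) = (if b then fst x else 0)" "snd (if b then x else 0) = (if b then snd x else 0)"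
    for b and x :: "(int, 'r) vec \<times> (int, 'r) vec" by auto
  then show "fst (\<Sum>\<beta>\<in>UNIV. if Adj $ \<alpha> $ \<beta> = 1 then k \<beta> else 0) = (\<Sum>\<beta>\<in>UNIV. Adj $ \<alpha> $ \<beta> *s fst (k \<beta>))"
    "snd (\<Sum>\<beta>\<in>UNIV. if Adj $ \<alpha> $ \<beta> = 1 then k \<beta> else 0) = (\<Sum>\<beta>\<in>UNIV. Adj $ \<alpha> $ \<beta> *s snd (k \<beta>))"
    by (simp_all add: fst_sum snd_sum Adj_sum)
qed

lemma Adj_Zm_row: "(\<Sum>\<beta>\<in>UNIV. Adj $ \<alpha> $ \<beta> *s Zm (Suc m) $ \<beta>) = Zm (Suc (Suc m)) $ \<alpha> + Zm m $ \<alpha>"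
  unfolding Zm_row by simp

lemma Adj_row: "(\<Sum>\<beta>\<in>UNIV. Adj $ \<alpha> $ \<beta> *s axis \<beta> 1) = Adj $ \<alpha>"
  using Adj_Zm_row[of \<alpha> 0] by (simp add: mat_row)

lemma lowkey_step: "(\<Sum>\<beta>\<in>UNIV. if Adj $ \<alpha> $ \<beta> = 1 then lowkey \<beta> (Suc m) else 0) - lowkey \<alpha> m = lowkey \<alpha> (Suc (Suc m))"
proof (cases m)
  case 0
  then show ?thesis
    by (intro prod_eqI) (simp_all add: fst_snd_Adj_sum Adj_row mat_row)
next
  case (Suc j)
  have "(\<Sum>\<beta>\<in>UNIV. Adj $ \<alpha> $ \<beta> *s (- Zm (Suc j) $ \<beta>)) = - (Zm (Suc (Suc j)) $ \<alpha> + Zm j $ \<alpha>)"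
    unfolding Adj_Zm_row[symmetric] by (simp add: vec_eq_iff sum_negf)
  then show ?thesis
    by (intro prod_eqI) (simp_all only: Suc lowkey.simps fst_snd_Adj_sum fst_diff snd_diff fst_conv snd_conv Adj_Zm_row, simp_all)
qed

lemma phi_Zm: "(\<Sum>\<beta>\<in>UNIV. Adj $ \<alpha> $ \<beta> * phi (Zm m $ \<beta>)) = 2 * phi (Zm m $ \<alpha>) - d * (\<Sum>\<gamma>\<in>UNIV. Zm m $ \<alpha> $ \<gamma>)"
proof -
  have "(\<Sum>\<beta>\<in>UNIV. Adj $ \<alpha> $ \<beta> * phi (Zm m $ \<beta>)) = (\<Sum>\<gamma>\<in>UNIV. rho \<gamma> * (Adj ** Zm m) $ \<alpha> $ \<gamma>)"
    unfolding phi_def matrix_matrix_mult_def sum_distrib_left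
    by (subst sum.swap) (simp add: sum_distrib_left mult.left_commute)
  also have "\<dots> = (\<Sum>\<gamma>\<in>UNIV. rho \<gamma> * (Zm m ** Adj) $ \<alpha> $ \<gamma>)" by (simp only: Zm_comm)
  also have "\<dots> = (\<Sum>\<delta>\<in>UNIV. Zm m $ \<alpha> $ \<delta> * (\<Sum>\<gamma>\<in>UNIV. Adj $ \<delta> $ \<gamma> * rho \<gamma>))"
    unfolding matrix_matrix_mult_def by (simp add: sum_distrib_left) (subst sum.swap, simp add: mult.assoc mult.left_commute mult.commute)
  also have "\<dots> = 2 * phi (Zm m $ \<alpha>) - d * (\<Sum>\<gamma>\<in>UNIV. Zm m $ \<alpha> $ \<gamma>)"
    unfolding Adj_rho by (simp add: phi_def right_diff_distrib sum_subtractf sum_distrib_left mult.commute mult.left_commute)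
  finally show ?thesis .
qed

text \<open>Up to index \<open>H\<close> the row sums of \<open>Zm\<close> between the ends are
  positive, so in lowest y-degree the product over neighbours strictly beats the square. The lowest
  exponents then follow the linear recursion.\<close>

lemma topmon_psi3:
  assumes nn: "\<And>m \<alpha> \<gamma>. m \<le> H \<Longrightarrow> 0 \<le> Zm m $ \<alpha> $ \<gamma>"
    and pos: "\<And>m \<alpha>. 1 \<le> m \<Longrightarrow> m < H \<Longrightarrow> \<exists>\<gamma>. 0 < Zm m $ \<alpha> $ \<gamma>"
  shows "m \<le> H \<Longrightarrow> topmon psi3 (Q \<alpha> (int m)) (lowkey \<alpha> m)"
proof (induction m arbitrary: \<alpha> rule: less_induct)
  case (less m)
  consider "m = 0" | "m = 1" | j where "m = Suc (Suc j)"
    by (metis One_nat_def not0_implies_Suc)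
  then show ?case
  proof cases
    case 1
    then show ?thesis by (simp add: Q_0 topmon_single)
  next
    case 2
    then show ?thesis by (simp add: Q_1 topmon_single mat_row)
  next
    case 3
    obtain \<gamma>0 where g: "0 < Zm (Suc j) $ \<alpha> $ \<gamma>0" using pos[of "Suc j" \<alpha>] less.prems 3 by auto
    have "0 < (\<Sum>\<gamma>\<in>UNIV. Zm (Suc j) $ \<alpha> $ \<gamma>)"
      by (rule sum_pos2[of _ \<gamma>0]) (use g nn less.prems 3 in auto)
    then have "2 * psi3 (lowkey \<alpha> (Suc j)) < (\<Sum>\<beta>\<in>UNIV. Adj $ \<alpha> $ \<beta> * psi3 (lowkey \<beta> (Suc j)))"
      using phi_Zm[of \<alpha> "Suc j"] d_pos by (simp add: psi3_def sum_negf)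
    then have "topmon psi3 (Q \<alpha> (int (Suc j) + 1) \<star> Q \<alpha> (int (Suc j) - 1)) (\<Sum>\<beta>\<in>UNIV. if Adj $ \<alpha> $ \<beta> = 1 then lowkey \<beta> (Suc j) else 0)"
      by (intro topmon_Q_rhs_nbr less.IH) (use 3 less.prems in simp_all)
    moreover have "topmon psi3 (Q \<alpha> (int (Suc j) - 1)) (lowkey \<alpha> j)"
      using less.IH[of j \<alpha>] 3 less.prems by simp
    ultimately have "topmon psi3 (Q \<alpha> (int (Suc j) + 1)) (lowkey \<alpha> (Suc (Suc j)))"
      unfolding lowkey_step[symmetric] by (rule topmon_divide_right[OF addf_psi(3), rotated])
    then show ?thesis by (simp add: 3 add.commute)
  qed
qed

text \<open>After half a period of the \<open>Q\<close>-system both terms of the recursion have the same lowest degree, so that the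
  lowest part has two terms; by polynomiality they cancel on weights with \<open>b \<gamma> = 0\<close>.\<close>

lemma lowering:
  obtains \<alpha> m where "1 \<le> m" "\<And>b. b $ \<gamma> \<noteq> 0 \<Longrightarrow> (delta b \<triangleleft> Q \<alpha> (int m)) (b - axis \<gamma> 1) \<noteq> 0"
proof -
  obtain H where H: "2 \<le> H" and nn: "\<And>m \<alpha> \<gamma>. m \<le> H \<Longrightarrow> 0 \<le> Zm m $ \<alpha> $ \<gamma>"
    and pos: "\<And>m \<alpha>. 1 \<le> m \<Longrightarrow> m < H \<Longrightarrow> \<exists>\<gamma>. 0 < Zm m $ \<alpha> $ \<gamma>"
    and Z: "Zm H = 0" and perm: "\<And>\<gamma>. \<exists>\<alpha>. Zm (H - 1) $ \<alpha> = axis \<gamma> 1"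
    using coxeter_period by blast
  obtain h where h: "H = Suc (Suc h)" using H by (metis add_2_eq_Suc le_Suc_ex)
  obtain \<alpha> where \<alpha>: "Zm (Suc h) $ \<alpha> = axis \<gamma> 1" using perm[of \<gamma>] by (auto simp: h)
  have low: "topmon psi3 (Q \<beta> (int m)) (lowkey \<beta> m)" if "m \<le> H" for m \<beta>
    by (rule topmon_psi3[of H]) (use nn pos that in auto)
  define k2 where "k2 = (\<Sum>\<beta>\<in>UNIV. if Adj $ \<alpha> $ \<beta> = 1 then lowkey \<beta> H else 0)"
  define k1 where "k1 = lowkey \<alpha> H + lowkey \<alpha> H"
  have lH: "lowkey \<beta> H = (- Zm (Suc h) $ \<beta>, 0)" for \<beta> using Z by (simp add: h)
  have k1: "k1 = (- axis \<gamma> 2, 0)" by (simp add: k1_def lH \<alpha> axis_add)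
  have k2: "k2 = (- nbr \<gamma>, 0)"
  proof -
    have "(\<Sum>\<beta>\<in>UNIV. Adj $ \<alpha> $ \<beta> *s (- Zm (Suc h) $ \<beta>)) = - (Adj ** Zm (Suc h)) $ \<alpha>"
      by (simp add: vec_eq_iff matrix_matrix_mult_def sum_negf)
    also have "(Adj ** Zm (Suc h)) $ \<alpha> = nbr \<gamma>"
      unfolding Zm_comm by (simp add: vec_eq_iff matrix_matrix_mult_def \<alpha> nbr_def axis_def if_distrib[of "\<lambda>z. z * _"] cong: if_cong)
    finally have "fst k2 = - nbr \<gamma>" by (simp add: k2_def fst_snd_Adj_sum lH)
    moreover have "snd k2 = 0" by (simp add: k2_def fst_snd_Adj_sum lH)
    ultimately show ?thesis by (simp add: prod_eq_iff)
  qed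
  have "topmon psi3 (Q \<alpha> (int H) \<star> Q \<alpha> (int H)) k1"
    unfolding k1_def by (intro topmon_mult low) simp_all
  then obtain u1 where u1: "munit u1" "domin psi3 0 (Q \<alpha> (int H) \<star> Q \<alpha> (int H) - Poly_Mapping.single k1 u1)"
    by (auto simp: topmon_def k1 psi3_def addf_0[OF addf_phi])
  have "topmon psi3 (nprod \<alpha> (int H)) k2"
    unfolding k2_def by (intro topmon_nprod low) simp_all
  then obtain u2 where u2: "munit u2" "domin psi3 0 (nprod \<alpha> (int H) - Poly_Mapping.single k2 u2)"
    by (auto simp: topmon_def k2 psi3_def addf_0[OF addf_phi])
  define s where "s = tt (- lam C \<alpha> \<alpha>)"
  \<comment> \<open>At index \<open>H\<close> the y-parts of all lowest exponents vanish, so the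
    square and the product over neighbours tie in y-degree 0 and both monomials are kept.\<close>
  define L where "L = s \<star> (Poly_Mapping.single k1 u1 - Poly_Mapping.single k2 u2)"
  have "domin psi3 0 (Q \<alpha> (int H + 1) \<star> Q \<alpha> (int H - 1) - L)"
  proof -
    have "Q \<alpha> (int H + 1) \<star> Q \<alpha> (int H - 1) = s \<star> (Q \<alpha> (int H) \<star> Q \<alpha> (int H) - nprod \<alpha> (int H))"
      using Q_rec[of \<alpha> "int H"] unfolding s_def by (rule iffD1[OF tt_eq_iff])
    then have "Q \<alpha> (int H + 1) \<star> Q \<alpha> (int H - 1) - L =
      s \<star> ((Q \<alpha> (int H) \<star> Q \<alpha> (int H) - Poly_Mapping.single k1 u1) - (nprod \<alpha> (int H) - Poly_Mapping.single k2 u2))"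
      by (simp add: L_def T.right_diff_distrib)
    then show ?thesis using u1(2) u2(2) by (simp add: s_def domin_scalar domin_diff)
  qed
  moreover have low1: "topmon psi3 (Q \<alpha> (int H - 1)) (lowkey \<alpha> (Suc h))"
    using low[of "Suc h" \<alpha>] by (simp add: h)
  moreover have "psi3 x \<le> 0" if "x \<in> Poly_Mapping.keys L" for x
  proof -
    have "Poly_Mapping.lookup L x \<noteq> 0" using that by (simp add: in_keys_iff)
    then have "x = k1 \<or> x = k2" by (auto simp: L_def s_def lookup_minus lookup_single when_def split: if_splits)
    then show ?thesis by (auto simp: k1 k2 psi3_def addf_0[OF addf_phi])
  qed
  ultimately obtain v where v: "munit v"
    "domin psi3 (0 - psi3 (lowkey \<alpha> (Suc h))) (Q \<alpha> (int H + 1) - L \<star> Poly_Mapping.single (- lowkey \<alpha> (Suc h)) v)"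
    using domin_divide_right[OF addf_psi(3)] by blast
  define k0 where "k0 = lowkey \<alpha> (Suc h)"
  have k0: "snd k0 = axis \<gamma> 1" by (simp add: k0_def \<alpha>)
  define p1 :: "(int, 'r) vec" where "p1 = fst k1 - fst k0"
  define p2 :: "(int, 'r) vec" where "p2 = fst k2 - fst k0"
  have K: "k1 - k0 = (p1, - axis \<gamma> 1)" "k2 - k0 = (p2, - axis \<gamma> 1)"
    by (simp_all add: prod_eq_iff p1_def p2_def k0) (simp_all add: k1 k2)
  obtain w1 w2 :: laurent where w: "w1 \<noteq> 0" and LL: "L \<star> Poly_Mapping.single (- k0) v =
     Poly_Mapping.single (p1, - axis \<gamma> 1) w1 + Poly_Mapping.single (p2, - axis \<gamma> 1) w2"
  proof
    let ?w = "\<lambda>k u. tpow (- lam C \<alpha> \<alpha>) * (tpow (- om (snd k) (fst (- k0))) * u * v)"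
    show "?w k1 u1 \<noteq> 0" using u1(1) v(1) munit_nonzero by simp
    have "qt_scalar c \<star> Poly_Mapping.single k u = Poly_Mapping.single k (c * u)" for c k u
      by (simp add: qt_scalar_def qt_mult_single tpow_0)
    then show "L \<star> Poly_Mapping.single (- k0) v =
     Poly_Mapping.single (p1, - axis \<gamma> 1) (?w k1 u1) + Poly_Mapping.single (p2, - axis \<gamma> 1) (- ?w k2 u2)"
      unfolding L_def s_def
      by (simp add: T.right_diff_distrib T.left_diff_distrib T.mult_assoc qt_mult_single K single_uminus mult.assoc mult.left_commute)
  qed
  define q where "q = Q \<alpha> (int (Suc H))"
  define lo :: "'r qt" where "lo = Poly_Mapping.single (p1, - axis \<gamma> 1) w1 + Poly_Mapping.single (p2, - axis \<gamma> 1) w2"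
  have rest: "domin psi3 (rho \<gamma>) (q - lo)"
    using v(2) unfolding k0_def[symmetric] LL
    by (simp add: q_def lo_def psi3_def k0 add.commute)
  \<comment> \<open>The remainder \<open>q - lo\<close> lies strictly below the level of the
    y-exponent \<open>- axis \<gamma> 1\<close>, so only the two monomials of \<open>lo\<close>
    contribute.\<close>
  have val: "(delta b \<triangleleft> q) (b - axis \<gamma> 1) = w1 * tpow (- om p1 (b + onev)) + w2 * tpow (- om p2 (b + onev))" for b
  proof -
    have "(delta b \<triangleleft> (q - lo)) (b - axis \<gamma> 1) = 0"
    proof -
      have e: "{k \<in> Poly_Mapping.keys (q - lo). snd k = b - axis \<gamma> 1 - b} = {}"
        using rest by (auto simp: domin_def psi3_def addf_uminus[OF addf_phi])
      show ?thesis unfolding ract_delta e by simp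
    qed
    then have "(delta b \<triangleleft> q) (b - axis \<gamma> 1) = (delta b \<triangleleft> lo) (b - axis \<gamma> 1)"
      by (simp add: ract_diff_right)
    then show ?thesis by (simp add: lo_def ract_add_right ract_delta_single delta_def)
  qed
  have "p2 - p1 = axis \<gamma> 2 - nbr \<gamma>" by (simp add: p1_def p2_def k1 k2)
  then have root: "om p2 c = om p1 c + d * c $ \<gamma>" for c
    using om_root[of \<gamma> c] om_diff_left[of p2 p1 c] by simp
  \<comment> \<open>Polynomiality forbids reaching a negative coordinate from 0, which fixes the
    ratio of the two coefficients.\<close>
  have "(delta 0 \<triangleleft> q) (0 - axis \<gamma> 1) = 0"
    unfolding q_def using stab_Q[of \<gamma> \<alpha> "Suc H"] by (simp add: stab_def)
  then have "w1 * tpow (- om p1 onev) + w2 * tpow (- om p1 onev) * tpow (- d) = 0"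
    unfolding val by (simp add: root onev_def tpow_mult mult.assoc)
  then have "tpow (- om p1 onev) * (w1 + w2 * tpow (- d)) = 0" by (simp add: algebra_simps)
  then have w2: "w1 = - w2 * tpow (- d)" by (simp add: eq_neg_iff_add_eq_0)
  show thesis
  proof (rule that[of "Suc H" \<alpha>])
    fix b :: "(int, 'r) vec" assume b: "b $ \<gamma> \<noteq> 0"
    have "(delta b \<triangleleft> q) (b - axis \<gamma> 1) = w2 * tpow (- om p1 (b + onev)) * (tpow (- d - d * b $ \<gamma>) - tpow (- d))"
      unfolding val root w2 by (simp add: onev_def algebra_simps tpow_mult)
    moreover have "w2 \<noteq> 0" using w w2 by auto
    moreover have "tpow (- d - d * b $ \<gamma>) \<noteq> (tpow (- d) :: laurent)" using b d_pos by simp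
    ultimately show "(delta b \<triangleleft> Q \<alpha> (int (Suc H))) (b - axis \<gamma> 1) \<noteq> 0" unfolding q_def by simp
  qed simp
qed

section \<open>Homogeneous components in y\<close>

abbreviation xm :: "(int, 'r) vec \<Rightarrow> 'r qt" where "xm a \<equiv> Poly_Mapping.single (a, 0) 1"
abbreviation ym :: "(int, 'r) vec \<Rightarrow> 'r qt" where "ym b \<equiv> Poly_Mapping.single (0, b) 1"

definition ypart :: "(int, 'r) vec \<Rightarrow> 'r qt \<Rightarrow> 'r qt" where
  "ypart b f = (\<Sum>k\<in>{k\<in>Poly_Mapping.keys f. snd k = b}. Poly_Mapping.single k (Poly_Mapping.lookup f k))"

lemma lookup_ypart: "Poly_Mapping.lookup (ypart b f) k = (if snd k = b then Poly_Mapping.lookup f k else 0)"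
  by (simp add: ypart_def lookup_sum lookup_single when_def in_keys_iff)

lemma keys_ypart: "Poly_Mapping.keys (ypart b f) = {k\<in>Poly_Mapping.keys f. snd k = b}"
  by (auto simp: in_keys_iff lookup_ypart split: if_splits)

lemma ract_ypart: "(delta 0 \<triangleleft> ypart b f) b = (delta 0 \<triangleleft> f) b"
  unfolding ract_delta by (rule sum.cong) (auto simp: keys_ypart lookup_ypart)

lemma lookup_conj: "Poly_Mapping.lookup (xm a \<star> f \<star> xm (- a)) k = tpow (om (snd k) a) * Poly_Mapping.lookup f k"
proof (induction f rule: qt_additive_induct)
  case (1 x c)
  then show ?case by (simp add: qt_mult_single lookup_single when_def tpow_0) (auto simp: prod_eq_iff)
qed (simp add: qt_mult_add_left qt_mult_add_right lookup_add algebra_simps)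

text \<open>Pairing with row \<alpha> of C reads off \<open>d\<close> times the coordinate \<alpha>,
  so any differing coordinate is detected.\<close>

lemma om_separates:
  assumes "b \<noteq> b'"
  obtains a where "om b a \<noteq> om b' a"
proof -
  from assms obtain \<alpha> where \<alpha>: "b $ \<alpha> \<noteq> b' $ \<alpha>" by (auto simp: vec_eq_iff)
  have "om c (axis \<alpha> 2 - nbr \<alpha>) = d * c $ \<alpha>" for c
    using om_root[of \<alpha> c] by (simp only: om_sym[of c])
  with \<alpha> d_pos show thesis by (intro that[of "axis \<alpha> 2 - nbr \<alpha>"]) simp
qed

text \<open>Conjugation by \<open>x\<close> acts on the \<open>y\<close>-degrees with distinct characters, so its eigencomponents can be
  separated up to a scalar.\<close>

lemma projection:
  assumes X: "\<And>f a e. f \<in> X \<Longrightarrow> xm a \<star> f \<star> xm (- a) - tt e \<star> f \<in> X"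
    and S: "finite S" and f: "f \<in> X" "snd ` Poly_Mapping.keys f \<subseteq> insert b S"
  shows "\<exists>\<kappa>. \<kappa> \<noteq> 0 \<and> qt_scalar \<kappa> \<star> ypart b f \<in> X"
  using S f
proof (induction S arbitrary: f rule: finite_induct)
  case empty
  have "ypart b f = f"
  proof (rule poly_mapping_eqI)
    fix k
    have "k \<notin> Poly_Mapping.keys f \<or> snd k = b" using empty.prems(2) by blast
    then show "Poly_Mapping.lookup (ypart b f) k = Poly_Mapping.lookup f k"
      by (auto simp: lookup_ypart in_keys_iff)
  qed
  then show ?case using empty by (intro exI[of _ 1]) (simp add: qt_scalar_1)
next
  case (insert b1 S)
  show ?case
  proof (cases "b1 = b")
    case True
    then show ?thesis using insert by simp
  next
    case False
    then obtain a where a: "om b a \<noteq> om b1 a" using om_separates by metis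
    define g where "g = xm a \<star> f \<star> xm (- a) - tt (om b1 a) \<star> f"
    have lg: "Poly_Mapping.lookup g k = (tpow (om (snd k) a) - tpow (om b1 a)) * Poly_Mapping.lookup f k" for k
      by (simp add: g_def lookup_minus lookup_conj left_diff_distrib)
    have "Poly_Mapping.keys g \<subseteq> {k\<in>Poly_Mapping.keys f. snd k \<noteq> b1}"
      by (auto simp: in_keys_iff lg)
    then have "snd ` Poly_Mapping.keys g \<subseteq> insert b S" using insert.prems(2) by blast
    moreover have "g \<in> X" unfolding g_def using X insert.prems(1) by blast
    ultimately obtain \<kappa> where \<kappa>: "\<kappa> \<noteq> 0" "qt_scalar \<kappa> \<star> ypart b g \<in> X" using insert.IH by blast
    have "qt_scalar \<kappa> \<star> ypart b g = qt_scalar (\<kappa> * (tpow (om b a) - tpow (om b1 a))) \<star> ypart b f"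
      by (rule poly_mapping_eqI) (simp add: lookup_ypart lg mult.assoc)
    moreover have "\<kappa> * (tpow (om b a) - tpow (om b1 a)) \<noteq> 0" using \<kappa>(1) a by simp
    ultimately show ?thesis using \<kappa>(2) by metis
  qed
qed

lemma ypart_in:
  assumes "\<And>f a e. f \<in> X \<Longrightarrow> xm a \<star> f \<star> xm (- a) - tt e \<star> f \<in> X" "f \<in> X"
  obtains \<kappa> where "\<kappa> \<noteq> 0" "qt_scalar \<kappa> \<star> ypart b f \<in> X"
proof -
  have "\<exists>\<kappa>. \<kappa> \<noteq> 0 \<and> qt_scalar \<kappa> \<star> ypart b f \<in> X"
    by (rule projection[where S = "snd ` Poly_Mapping.keys f"]) (auto simp: assms)
  then show thesis using that by auto
qed

lemma sum_axis_vec: "(\<Sum>\<alpha>\<in>UNIV. axis \<alpha> (b $ \<alpha>)) = (b :: (int, 'r) vec)"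
  by (simp add: vec_eq_iff axis_def cong: if_cong)

lemma vec_nat_induct:
  assumes "P 0" "\<And>\<alpha>. P (axis \<alpha> 1)" "\<And>a b. P a \<Longrightarrow> P b \<Longrightarrow> P (a + b)" "\<And>\<alpha>. 0 \<le> (b :: (int, 'r) vec) $ \<alpha>"
  shows "P b"
proof -
  have 1: "P (axis \<alpha> (int n))" for \<alpha> n
  proof (induction n)
    case (Suc n)
    have "axis \<alpha> 1 + axis \<alpha> (int n) = axis \<alpha> (int (Suc n))" by (simp add: axis_add)
    with assms(3)[OF assms(2)[of \<alpha>] Suc] show ?case by (simp only:)
  qed (simp add: assms(1))
  have "P (\<Sum>\<alpha>\<in>A. axis \<alpha> (b $ \<alpha>))" for A
  proof (induction A rule: infinite_finite_induct)
    case (insert \<alpha> A)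
    have "P (axis \<alpha> (b $ \<alpha>))" using 1[of \<alpha> "nat (b $ \<alpha>)"] assms(4)[of \<alpha>] by simp
    from assms(3)[OF this insert.IH] show ?case by (simp only: sum.insert[OF insert.hyps])
  qed (simp_all add: assms(1))
  from this[of UNIV] show ?thesis by (simp add: sum_axis_vec)
qed

lemma vec_int_induct:
  assumes "P 0" "\<And>\<alpha>. P (axis \<alpha> 1)" "\<And>a b. P a \<Longrightarrow> P b \<Longrightarrow> P (a + b)" "\<And>a. P a \<Longrightarrow> P (- a)"
  shows "P (b :: (int, 'r) vec)"
proof -
  have "P (\<chi> \<alpha>. max 0 (c $ \<alpha>))" for c
    by (rule vec_nat_induct) (use assms in auto)
  from assms(3)[OF this[of b] assms(4)[OF this[of "- b"]]]
  have "P ((\<chi> \<alpha>. max 0 (b $ \<alpha>)) + - (\<chi> \<alpha>. max 0 ((- b) $ \<alpha>)))" .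
  moreover have "(\<chi> \<alpha>. max 0 (b $ \<alpha>)) + - (\<chi> \<alpha>. max 0 ((- b) $ \<alpha>)) = b" by (auto simp: vec_eq_iff max_def)
  ultimately show ?thesis by simp
qed

section \<open>Elements of the algebra generated by the Q-variables\<close>

abbreviation A where "A \<equiv> A_plus C Q"

lemma A_one: "1 \<in> A"
  using generate_ring.one[of "qtorus C"] by (simp add: A_plus_def)

lemma A_add: "f \<in> A \<Longrightarrow> g \<in> A \<Longrightarrow> f + g \<in> A"
  using generate_ring.eng_add[of f "qtorus C" _ g] by (simp add: A_plus_def)

lemma A_mult: "f \<in> A \<Longrightarrow> g \<in> A \<Longrightarrow> f \<star> g \<in> A"
  using generate_ring.eng_mult[of f "qtorus C" _ g] by (simp add: A_plus_def)

lemma A_scalar: "qt_scalar c \<in> A"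
  unfolding A_plus_def by (rule generate_ring.incl) blast

lemma A_Q: "Q \<alpha> (int m) \<in> A"
proof (cases "m = 0")
  case True
  then show ?thesis unfolding A_plus_def by (intro generate_ring.incl) auto
next
  case False
  then have "Q \<alpha> (int m) \<in> {Q \<alpha> m | \<alpha> m. m \<ge> 1}" by (auto intro!: exI[of _ \<alpha>] exI[of _ "int m"])
  then show ?thesis unfolding A_plus_def by (intro generate_ring.incl) blast
qed

lemma A_uminus: "f \<in> A \<Longrightarrow> - f \<in> A"
proof -
  assume "f \<in> A"
  moreover have "- f = qt_scalar (- 1) \<star> f" by (rule poly_mapping_eqI) simp
  ultimately show ?thesis using A_mult A_scalar by metis
qed

lemma A_diff: "f \<in> A \<Longrightarrow> g \<in> A \<Longrightarrow> f - g \<in> A"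
  using A_add[OF _ A_uminus, of f g] by simp

lemma A_zero: "0 \<in> A"
  using A_diff[OF A_one A_one] by simp

lemma A_sum: "(\<And>i. i \<in> I \<Longrightarrow> f i \<in> A) \<Longrightarrow> (\<Sum>i\<in>I. f i) \<in> A"
  by (induction I rule: infinite_finite_induct) (simp_all add: A_zero A_add)

lemma xm_mult: "xm a \<star> xm b = xm (a + b)"
  by (simp add: qt_mult_single tpow_0)

lemma ym_mult: "ym a \<star> ym b = ym (a + b)"
  by (simp add: qt_mult_single tpow_0)

lemma xm_0: "xm 0 = 1" "ym 0 = 1"
  by (simp_all add: zero_prod_def[symmetric])

lemma A_xm: "xm a \<in> A"
proof -
  have inv: "xm (- axis \<alpha> 1) \<in> A" for \<alpha>
  proof -
    interpret R: ring "qtorus C" by (rule ring_qtorus)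
    have "inv\<^bsub>qtorus C\<^esub> (Q \<alpha> 0) = xm (- axis \<alpha> 1)"
      by (rule R.inv_unique'[symmetric]) (simp_all add: Q_0 xm_mult xm_0)
    moreover have "inv\<^bsub>qtorus C\<^esub> (Q \<alpha> 0) \<in> A"
      unfolding A_plus_def by (rule generate_ring.incl) blast
    ultimately show ?thesis by simp
  qed
  have "xm a \<in> A \<and> xm (- a) \<in> A"
  proof (induction a rule: vec_int_induct)
    case 1
    then show ?case by (simp add: xm_0 A_one)
  next
    case (2 \<alpha>)
    then show ?case using inv A_Q[of \<alpha> 0] by (simp add: Q_0)
  next
    case (3 a b)
    then show ?case using A_mult[of "xm a" "xm b"] A_mult[of "xm (- a)" "xm (- b)"] by (simp add: xm_mult add.commute)
  qed auto
  then show ?thesis ..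
qed

lemma A_ym: "(\<And>\<alpha>. 0 \<le> b $ \<alpha>) \<Longrightarrow> ym b \<in> A"
proof (rule vec_nat_induct[of "\<lambda>b. ym b \<in> A"])
  show "ym (axis \<alpha> 1) \<in> A" for \<alpha> using A_Q[of \<alpha> 1] by (simp add: Q_1)
  show "ym (a + b) \<in> A" if "ym a \<in> A" "ym b \<in> A" for a b
    using A_mult[OF that] by (simp add: ym_mult)
qed (simp_all add: xm_0 A_one)

lemma A_Q_product: "Q_product C Q k n \<in> A"
proof -
  have p: "f \<in> A \<Longrightarrow> f \<up> n \<in> A" for f n by (induction n) (simp_all add: A_one A_mult)
  have "lprod f ls \<in> A" if "\<And>x. f x \<in> A" for f and ls :: "'r list"
    using that by (induction ls) (simp_all add: A_one A_mult)
  then show ?thesis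
  proof (induction k)
    case 0
    then show ?case by (simp add: Q_product_def list_product_def A_one)
  next
    case (Suc k)
    show ?case unfolding Q_product_Suc by (intro A_mult Suc.IH Suc.prems p A_Q)
  qed
qed

end

subsection \<open>The annihilator of the cyclic vector\<close>

locale qrep = qsys C Q
  for C :: "'r::{finite,linorder} sqmat" and Q :: "'r \<Rightarrow> int \<Rightarrow> 'r qt" +
  fixes sc :: "laurent \<Rightarrow> 'v \<Rightarrow> 'v::ab_group_add" and act :: "'v \<Rightarrow> 'r qt \<Rightarrow> 'v" and bra :: "('r \<Rightarrow> nat) \<Rightarrow> 'v"
  assumes rep: "cyclic_Q_representation C Q sc act bra"
begin

lemma right_rep: "right_representation C A sc act"
  using rep by (simp add: cyclic_Q_representation_def)

sublocale V: Modules.module sc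
  using right_rep by (simp add: right_representation_def)

definition v0 :: 'v where "v0 = bra (\<lambda>_. 0)"

lemma act_left_add: "a \<in> A \<Longrightarrow> act (v + w) a = act v a + act w a"
  and act_add: "a \<in> A \<Longrightarrow> b \<in> A \<Longrightarrow> act v (a + b) = act v a + act v b"
  and act_mult: "a \<in> A \<Longrightarrow> b \<in> A \<Longrightarrow> act v (a \<star> b) = act (act v a) b"
  and act_scalar: "act v (qt_scalar c) = sc c v"
  and act_one: "act v 1 = v"
  using right_rep by (simp_all add: right_representation_def)

lemma act_zero_left: "a \<in> A \<Longrightarrow> act 0 a = 0"
  using act_left_add[of a 0 0] by simp

lemma act_zero: "act v 0 = 0"
  using act_add[OF A_zero A_zero, of v] by simp

lemma act_uminus: "a \<in> A \<Longrightarrow> act v (- a) = - act v a"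
  using act_add[of a "- a" v] by (simp add: A_uminus act_zero eq_neg_iff_add_eq_0 add.commute)

lemma act_diff: "a \<in> A \<Longrightarrow> b \<in> A \<Longrightarrow> act v (a - b) = act v a - act v b"
  using act_add[of a "- b" v] by (simp add: A_uminus act_uminus)

lemma act_sum: "(\<And>i. i \<in> I \<Longrightarrow> f i \<in> A) \<Longrightarrow> act v (\<Sum>i\<in>I. f i) = (\<Sum>i\<in>I. act v (f i))"
  by (induction I rule: infinite_finite_induct) (simp_all add: act_zero act_add A_sum)

lemma act_scalar_mult: "a \<in> A \<Longrightarrow> act v (qt_scalar c \<star> a) = sc c (act v a)"
  unfolding qt_scalar_central[symmetric] by (simp add: act_mult A_scalar act_scalar)

lemma act_sc: "a \<in> A \<Longrightarrow> act (sc c v) a = sc c (act v a)"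
  using act_mult[OF A_scalar, of a v c] by (simp add: act_scalar act_scalar_mult)

lemma indep: "V.independent (range bra)" and span_bra: "V.span (range bra) = UNIV" and inj_bra: "inj bra"
  using rep by (simp_all add: cyclic_Q_representation_def)

text \<open>The module is free over a domain, so scalars can be cancelled coordinatewise.\<close>

lemma sc_eq_0: "sc c v = 0 \<Longrightarrow> c = 0 \<or> v = 0"
proof -
  assume "sc c v = 0"
  then have "V.representation (range bra) (sc c v) = (\<lambda>b. 0)" by (simp only: V.representation_zero)
  moreover have "V.representation (range bra) (sc c v) = (\<lambda>b. c * V.representation (range bra) v b)"
    by (rule V.representation_scale[OF indep]) (simp add: span_bra)
  ultimately have *: "c * V.representation (range bra) v b = 0" for b by metis
  have "(\<Sum>b | V.representation (range bra) v b \<noteq> 0. sc (V.representation (range bra) v b) b) = v"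
    by (rule V.sum_nonzero_representation_eq[OF indep]) (simp add: span_bra)
  then show ?thesis using * by (cases "c = 0") simp_all
qed

lemma v0_nonzero: "v0 \<noteq> 0"
proof
  assume "v0 = 0"
  then have b: "0 = bra (\<lambda>_. 0)" unfolding v0_def by (rule sym)
  have "0 \<in> range bra" unfolding b by (rule rangeI)
  then have "V.dependent (range bra)" by (rule V.dependent_zero)
  then show False using indep by contradiction
qed

lemma act_xm: "act v0 (xm a) = sc (tpow (- om a onev)) v0"
proof (induction a rule: vec_int_induct)
  case 1
  then show ?case by (simp add: xm_0 act_one tpow_0)
next
  case (2 \<alpha>)
  have "om (axis \<alpha> 1) onev = rho \<alpha>"
    using phi_om(1)[of "axis \<alpha> 1"] by (simp add: onev_def)
  moreover have "act v0 (Q \<alpha> 0) = sc (tpow (- rho \<alpha>)) v0"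
    using rep by (simp add: cyclic_Q_representation_def v0_def rho_def)
  ultimately show ?case by (simp add: Q_0)
next
  case (3 a b)
  have "act v0 (xm (a + b)) = sc (tpow (- om a onev)) (sc (tpow (- om b onev)) v0)"
    using act_mult[OF A_xm A_xm, of v0 a b] 3 by (simp add: xm_mult act_sc A_xm)
  then show ?case by (simp add: tpow_mult om_add_left)
next
  case (4 a)
  have "act (act v0 (xm a)) (xm (- a)) = v0"
    unfolding act_mult[OF A_xm A_xm, symmetric] by (simp add: xm_mult xm_0 act_one)
  then have "sc (tpow (- om a onev)) (act v0 (xm (- a))) = v0" unfolding 4 act_sc[OF A_xm] .
  then have "sc (tpow (om a onev)) (sc (tpow (- om a onev)) (act v0 (xm (- a)))) = sc (tpow (om a onev)) v0"
    by (rule arg_cong)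
  then show ?case by simp
qed

text \<open>The link between the two modules: each x-monomial acts on the cyclic vector by its
  eigenvalue, and the sum of these scalars over one y-degree is exactly what the function module
  records at \<open>b\<close>.\<close>

lemma act_homogeneous:
  assumes "\<And>k. k \<in> Poly_Mapping.keys f \<Longrightarrow> snd k = b" "\<And>\<alpha>. 0 \<le> b $ \<alpha>"
  shows "f \<in> A" "act v0 f = sc ((delta 0 \<triangleleft> f) b) (act v0 (ym b))"
proof -
  have 1: "Poly_Mapping.single (a, b) u = qt_scalar u \<star> (xm a \<star> ym b)" for a u
    by (simp add: qt_scalar_def qt_mult_single tpow_0)
  have 2: "Poly_Mapping.single (a, b) u \<in> A" for a u
    unfolding 1[of a u] using assms(2) by (intro A_mult A_scalar A_xm A_ym)
  have 3: "act v0 (Poly_Mapping.single (a, b) u) = sc ((delta 0 \<triangleleft> Poly_Mapping.single (a, b) u) b) (act v0 (ym b))" for a u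
    unfolding ract_delta_single unfolding 1[of a u]
    using assms(2) by (simp add: act_scalar_mult A_mult A_xm A_ym act_mult act_xm act_sc delta_def)
  have *: "(\<Sum>k\<in>S. Poly_Mapping.single k (Poly_Mapping.lookup f k)) \<in> A \<and>
    act v0 (\<Sum>k\<in>S. Poly_Mapping.single k (Poly_Mapping.lookup f k)) =
      sc ((delta 0 \<triangleleft> (\<Sum>k\<in>S. Poly_Mapping.single k (Poly_Mapping.lookup f k))) b) (act v0 (ym b))"
    if "S \<subseteq> Poly_Mapping.keys f" for S
    using finite_subset[OF that finite_keys] that
  proof (induction S rule: finite_induct)
    case (insert k S)
    then obtain a where k: "k = (a, b)" using assms(1)[of k] by (cases k) auto
    show ?case
      using insert 2[of a] 3[of a] by (simp add: k A_add act_add ract_add_right V.scale_left_distrib)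
  qed (simp add: A_zero act_zero)
  have f: "(\<Sum>k\<in>Poly_Mapping.keys f. Poly_Mapping.single k (Poly_Mapping.lookup f k)) = f"
    by (rule poly_mapping_eqI) (simp add: lookup_sum lookup_single when_def in_keys_iff)
  show "f \<in> A" "act v0 f = sc ((delta 0 \<triangleleft> f) b) (act v0 (ym b))"
    using *[OF order_refl] unfolding f by simp_all
qed

definition Ann :: "'r qt set" where "Ann = {f \<in> A. act v0 f = 0}"

lemma Ann_mult: "f \<in> Ann \<Longrightarrow> g \<in> A \<Longrightarrow> f \<star> g \<in> Ann"
  by (simp add: Ann_def A_mult act_mult act_zero_left)

text \<open>The annihilator is a right ideal and, the cyclic vector being an eigenvector of all
  x-monomials, also stable under left multiplication by them. Hence it is stable under conjugation
  and its homogeneous components can be isolated.\<close>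

lemma Ann_ypart:
  assumes "f \<in> Ann"
  obtains \<kappa> where "\<kappa> \<noteq> 0" "qt_scalar \<kappa> \<star> ypart b f \<in> Ann"
proof (rule ypart_in[of Ann f b])
  fix f a e assume f: "f \<in> Ann"
  have "xm a \<star> f \<in> Ann"
    using f by (simp add: Ann_def A_mult A_xm act_mult act_xm act_sc)
  then have "xm a \<star> f \<star> xm (- a) \<in> Ann" by (rule Ann_mult) (rule A_xm)
  then show "xm a \<star> f \<star> xm (- a) - tt e \<star> f \<in> Ann"
    using f by (simp add: Ann_def A_diff A_mult A_scalar act_diff act_scalar_mult)
qed (use assms that in auto)

lemma delta_ym: "delta 0 \<triangleleft> ym b = delta b"
  by (rule ext) (simp add: ract_delta_single tpow_0)

text \<open>If y^b annihilated the cyclic vector, so would its product with a lowering operator and,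
  up to a nonzero scalar, the component of degree \<open>b - axis \<gamma> 1\<close>. That component
  acts as a nonzero multiple of a smaller y-monomial, against the induction hypothesis.\<close>

lemma act_ym_nonzero: "(\<And>\<alpha>. 0 \<le> b $ \<alpha>) \<Longrightarrow> act v0 (ym b) \<noteq> 0"
proof (induction "nat (\<Sum>\<alpha>\<in>UNIV. b $ \<alpha>)" arbitrary: b rule: less_induct)
  case less
  show ?case
  proof (cases "b = 0")
    case True
    then show ?thesis using v0_nonzero by (simp add: xm_0 act_one)
  next
    case False
    then obtain \<gamma> where "b $ \<gamma> \<noteq> 0" by (auto simp: vec_eq_iff)
    then have \<gamma>: "1 \<le> b $ \<gamma>" using less.prems[of \<gamma>] by simp
    let ?b = "b - axis \<gamma> 1"
    have b: "0 \<le> ?b $ \<alpha>" for \<alpha> using less.prems[of \<alpha>] \<gamma> by (auto simp: axis_def)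
    obtain \<alpha> m where m: "\<And>b. b $ \<gamma> \<noteq> 0 \<Longrightarrow> (delta b \<triangleleft> Q \<alpha> (int m)) (b - axis \<gamma> 1) \<noteq> 0"
      using lowering[of \<gamma>] by metis
    show ?thesis
    proof
      assume "act v0 (ym b) = 0"
      then have "ym b \<in> Ann" using less.prems by (simp add: Ann_def A_ym)
      then have "ym b \<star> Q \<alpha> (int m) \<in> Ann" by (rule Ann_mult) (rule A_Q)
      then obtain \<kappa> where \<kappa>: "\<kappa> \<noteq> 0" "qt_scalar \<kappa> \<star> ypart ?b (ym b \<star> Q \<alpha> (int m)) \<in> Ann" (is "?f \<in> Ann")
        by (rule Ann_ypart[where b = ?b])
      have "(delta 0 \<triangleleft> ?f) ?b = \<kappa> * (delta 0 \<triangleleft> (ym b \<star> Q \<alpha> (int m))) ?b"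
        by (simp add: ract_mult[of _ "qt_scalar _"] ract_scalar ract_scale_left ract_ypart)
      also have "\<dots> = \<kappa> * (delta b \<triangleleft> Q \<alpha> (int m)) ?b" by (simp add: ract_mult delta_ym)
      also have "\<dots> \<noteq> 0" using \<kappa>(1) m \<gamma> by simp
      finally have nz: "(delta 0 \<triangleleft> ?f) ?b \<noteq> 0" .
      have "snd k = ?b" if "k \<in> Poly_Mapping.keys ?f" for k
        using that by (auto simp: in_keys_iff lookup_ypart split: if_splits)
      then have "act v0 ?f = sc ((delta 0 \<triangleleft> ?f) ?b) (act v0 (ym ?b))"
        using b by (rule act_homogeneous(2))
      then have "act v0 (ym ?b) = 0" using \<kappa>(2) nz sc_eq_0 by (auto simp: Ann_def)
      moreover have "act v0 (ym ?b) \<noteq> 0"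
      proof (rule less.hyps)
        have "(\<Sum>\<alpha>\<in>UNIV. ?b $ \<alpha>) = (\<Sum>\<alpha>\<in>UNIV. b $ \<alpha>) - 1" by (simp add: sum_subtractf axis_def)
        moreover have "0 < (\<Sum>\<alpha>\<in>UNIV. b $ \<alpha>)" by (rule sum_pos2[of _ \<gamma>]) (use less.prems \<gamma> in auto)
        ultimately show "nat (\<Sum>\<alpha>\<in>UNIV. ?b $ \<alpha>) < nat (\<Sum>\<alpha>\<in>UNIV. b $ \<alpha>)" by simp
      qed (rule b)
      ultimately show False by simp
    qed
  qed
qed

text \<open>A homogeneous component in the annihilator acts by its value in the function module
  times a nonzero vector, so that value is 0.\<close>

lemma Ann_ract:
  assumes "f \<in> Ann"
  shows "delta 0 \<triangleleft> f = (\<lambda>_. 0)"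
proof
  fix c
  obtain \<kappa> where \<kappa>: "\<kappa> \<noteq> 0" "qt_scalar \<kappa> \<star> ypart c f \<in> Ann" by (rule Ann_ypart[OF assms])
  \<comment> \<open>Multiplication by y^B moves the degree \<open>c\<close> into the nonnegative
    range, where nonvanishing is known.\<close>
  define B :: "(int, 'r) vec" where "B = (\<chi> \<alpha>. \<bar>c $ \<alpha>\<bar>)"
  let ?f = "qt_scalar \<kappa> \<star> ypart c f \<star> ym B"
  have f: "?f \<in> Ann" using \<kappa>(2) by (rule Ann_mult) (rule A_ym, simp add: B_def)
  have b: "0 \<le> (c + B) $ \<alpha>" for \<alpha> by (simp add: B_def)
  have "snd k = c + B" if k: "k \<in> Poly_Mapping.keys ?f" for k
  proof -
    obtain x y where xy: "x \<in> Poly_Mapping.keys (qt_scalar \<kappa> \<star> ypart c f)" "y \<in> Poly_Mapping.keys (ym B)" "k = x + y"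
      using k by (rule keys_qt_mult)
    have "snd x = c" using xy(1) by (auto simp: in_keys_iff lookup_ypart split: if_splits)
    then show ?thesis using xy(2,3) by simp
  qed
  from act_homogeneous(2)[OF this b] f have "sc ((delta 0 \<triangleleft> ?f) (c + B)) (act v0 (ym (c + B))) = 0"
    by (simp add: Ann_def)
  then have "(delta 0 \<triangleleft> ?f) (c + B) = 0" using sc_eq_0 act_ym_nonzero[OF b] by blast
  moreover have "(delta 0 \<triangleleft> ?f) (c + B) = \<kappa> * (delta 0 \<triangleleft> f) c"
    by (simp add: ract_mult ract_scalar ract_scale_left ract_single tpow_0 ract_ypart)
  ultimately show "(delta 0 \<triangleleft> f) c = 0" using \<kappa>(1) by simp
qed

text \<open>Linear relations among vectors of the representation carry over to the function module:
  the assignment from the cyclic vector to \<open>delta 0\<close> is well defined.\<close>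

lemma ract_of_act:
  assumes "a \<in> A" "\<And>i. i \<in> I \<Longrightarrow> f i \<in> A" "act v0 a = (\<Sum>i\<in>I. sc (c i) (act v0 (f i)))"
  shows "delta 0 \<triangleleft> a = (\<lambda>x. \<Sum>i\<in>I. c i * (delta 0 \<triangleleft> f i) x)"
proof -
  let ?b = "\<Sum>i\<in>I. qt_scalar (c i) \<star> f i"
  have b: "?b \<in> A" using assms(2) by (intro A_sum A_mult A_scalar)
  have "act v0 ?b = (\<Sum>i\<in>I. sc (c i) (act v0 (f i)))"
    using assms(2) by (subst act_sum) (simp_all add: A_mult A_scalar act_scalar_mult)
  then have "a - ?b \<in> Ann" using assms(1,3) b by (simp add: Ann_def A_diff act_diff)
  from fun_cong[OF Ann_ract[OF this]] have "(delta 0 \<triangleleft> a) x = (delta 0 \<triangleleft> ?b) x" for x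
    by (simp add: ract_diff_right)
  then show ?thesis
    by (simp add: fun_eq_iff ract_sum_right ract_mult ract_scalar ract_scale_left)
qed

end

section \<open>Triangularity of the equations that define the representation\<close>

context qsys
begin

lemma Phi_0: "Phi l K (\<lambda>_. 0) = 0"
proof -
  have "Phi l K (\<lambda>c. 0 * delta 0 c) = 0 * Phi l K (delta 0)" by (rule Phi_scale) simp
  then show ?thesis by simp
qed

lemma Phi_add: "g \<in> PB \<Longrightarrow> h \<in> PB \<Longrightarrow> Phi l K (\<lambda>c. g c + h c) = Phi l K g + Phi l K h"
  using Phi_diff[of g "\<lambda>c. - 1 * h c" l K] Phi_scale[of h l K "- 1"] PB_scale[of h "- 1"] by simp

lemma PB_sum: "(\<And>i. i \<in> I \<Longrightarrow> g i \<in> PB) \<Longrightarrow> (\<lambda>c. \<Sum>i\<in>I. u i * g i c) \<in> PB"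
proof (induction I rule: infinite_finite_induct)
  case (insert i I)
  then show ?case using PB_add[of "\<lambda>c. u i * g i c" "\<lambda>c. \<Sum>i\<in>I. u i * g i c"] by (simp add: PB_scale)
qed (auto intro!: PB_I[of 0] simp: bnd_def)

lemma Phi_sum: "(\<And>i. i \<in> I \<Longrightarrow> g i \<in> PB) \<Longrightarrow> Phi l K (\<lambda>c. \<Sum>i\<in>I. u i * g i c) = (\<Sum>i\<in>I. u i * Phi l K (g i))"
proof (induction I rule: infinite_finite_induct)
  case (insert i I)
  then show ?case
    using Phi_add[of "\<lambda>c. u i * g i c" "\<lambda>c. \<Sum>i\<in>I. u i * g i c" l K] by (simp add: PB_scale PB_sum Phi_scale)
qed (simp_all add: Phi_0)

abbreviation unit_int :: "('r \<Rightarrow> nat) \<Rightarrow> 'r \<Rightarrow> nat \<Rightarrow> int" where "unit_int m \<equiv> \<lambda>\<alpha> i. int (unit_n m \<alpha> i)"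

lemma unit_n_top: "Max (range m) < i \<Longrightarrow> unit_n m \<alpha> i = 0" for \<alpha> :: 'r
  using Max_ge[of "range m" "m \<alpha>"] by (auto simp: unit_n_def)

lemma AI_unit:
  assumes "Max (range m) \<le> K"
  shows "AI K (unit_int m) \<alpha> i = int (min i (m \<alpha>))"
proof -
  have "m \<alpha> \<le> K" using Max_ge[of "range m" "m \<alpha>"] assms by simp
  moreover have "AI K (unit_int m) \<alpha> i = (\<Sum>j=1..K. if j = m \<alpha> then int (min i j) else 0)"
    unfolding AI_def by (intro sum.cong refl) (auto simp: unit_n_def)
  ultimately show ?thesis by (cases "m \<alpha> = 0") simp_all
qed

lemma Lv_sum: "Lv K n = (\<Sum>\<alpha>\<in>UNIV. \<Sum>\<beta>\<in>UNIV. \<Sum>i=1..K. n \<alpha> i * lam C \<alpha> \<beta>)"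
  unfolding Lv_def rho_def
  by (intro sum.cong refl) (subst sum.swap, simp add: sum_distrib_left sum_distrib_right mult.commute)

lemma G2_sum: "G2 K n = (\<Sum>\<alpha>\<in>UNIV. \<Sum>\<beta>\<in>UNIV. \<Sum>i=1..K. \<Sum>j=1..K. n \<alpha> i * (lam C \<alpha> \<beta> * int (min i j)) * n \<beta> j)"
proof -
  have "(\<Sum>i=1..K. n \<alpha> i * AI K (Lm n) \<alpha> i) = (\<Sum>\<beta>\<in>UNIV. \<Sum>i=1..K. \<Sum>j=1..K. n \<alpha> i * (lam C \<alpha> \<beta> * int (min i j)) * n \<beta> j)" for \<alpha>
    unfolding AI_mix sum_distrib_left by (subst sum.swap) (simp add: AI_def sum_distrib_left mult.assoc)
  then show ?thesis by (simp add: G2_def IP_def)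
qed

lemma G2_unit:
  assumes "Max (range m) \<le> K"
  shows "G2 K (unit_int m) = (\<Sum>\<alpha>\<in>UNIV. \<Sum>\<beta>\<in>UNIV. int (min (m \<alpha>) (m \<beta>)) * lam C \<alpha> \<beta>)"
proof -
  have "(\<Sum>i=1..K. unit_int m \<alpha> i * AI K (Lm (unit_int m)) \<alpha> i) = (\<Sum>\<beta>\<in>UNIV. int (min (m \<alpha>) (m \<beta>)) * lam C \<alpha> \<beta>)" for \<alpha>
  proof -
    have "m \<alpha> \<le> K" using Max_ge[of "range m" "m \<alpha>"] assms by simp
    moreover have "(\<Sum>i=1..K. unit_int m \<alpha> i * AI K (Lm (unit_int m)) \<alpha> i) =
       (\<Sum>i=1..K. if i = m \<alpha> then \<Sum>\<beta>\<in>UNIV. int (min i (m \<beta>)) * lam C \<alpha> \<beta> else 0)"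
      unfolding AI_mix AI_unit[OF assms] by (intro sum.cong refl) (auto simp: unit_n_def mult.commute)
    ultimately show ?thesis by (cases "m \<alpha> = 0") simp_all
  qed
  then show ?thesis by (simp add: G2_def IP_def)
qed

text \<open>Pairing the condition at level \<open>K\<close> with \<open>rho\<close> shows that the
  \<open>rho\<close>-weight drops from m to p by \<open>d\<close> times a sum of nonnegative
  integers. This sum is 0 only for the zero array, and then p = m.\<close>

lemma Nset_unit:
  assumes K: "Max (range m) \<le> K" and mm: "mm \<in> Nset K (\<lambda>\<alpha>. int (p \<alpha>)) (unit_int m)"
  shows "mm = (\<lambda>_ _. 0) \<and> p = m \<or> (\<Sum>\<alpha>\<in>UNIV. rho \<alpha> * int (p \<alpha>)) < (\<Sum>\<alpha>\<in>UNIV. rho \<alpha> * int (m \<alpha>))"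
proof -
  define M where "M \<beta> = AI K (\<lambda>\<beta> j. int (mm \<beta> j)) \<beta> K" for \<beta>
  have M0: "0 \<le> M \<beta>" for \<beta> unfolding M_def AI_def by (rule sum_nonneg) simp
  have mK: "m \<alpha> \<le> K" for \<alpha> using Max_ge[of "range m" "m \<alpha>"] K by simp
  have eq: "int (m \<alpha>) - int (p \<alpha>) = (\<Sum>\<beta>\<in>UNIV. C $ \<alpha> $ \<beta> * M \<beta>)" for \<alpha>
  proof -
    have "pI K mm (unit_int m) \<alpha> K = int (p \<alpha>)" using mm by (simp add: Nset_def)
    then show ?thesis using mK[of \<alpha>] by (simp add: pI_def M_def AI_unit[OF K] min_absorb2)
  qed
  have "(\<Sum>\<alpha>\<in>UNIV. rho \<alpha> * int (m \<alpha>)) - (\<Sum>\<alpha>\<in>UNIV. rho \<alpha> * int (p \<alpha>)) = (\<Sum>\<alpha>\<in>UNIV. rho \<alpha> * (int (m \<alpha>) - int (p \<alpha>)))"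
    by (simp add: right_diff_distrib sum_subtractf)
  also have "\<dots> = (\<Sum>\<beta>\<in>UNIV. (\<Sum>\<alpha>\<in>UNIV. C $ \<beta> $ \<alpha> * rho \<alpha>) * M \<beta>)"
    unfolding eq sum_distrib_left sum_distrib_right
    by (subst sum.swap) (intro sum.cong refl, subst C_sym, simp add: mult.assoc mult.left_commute)
  finally have s: "(\<Sum>\<alpha>\<in>UNIV. rho \<alpha> * int (m \<alpha>)) - (\<Sum>\<alpha>\<in>UNIV. rho \<alpha> * int (p \<alpha>)) = d * (\<Sum>\<beta>\<in>UNIV. M \<beta>)"
    by (simp add: C_rho sum_distrib_left)
  show ?thesis
  proof (cases "\<forall>\<beta>. M \<beta> = 0")
    case True
    have "p = m" using eq True by (simp add: fun_eq_iff)
    moreover have "mm \<beta> j = 0" for \<beta> j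
    proof (cases "j \<in> {1..K}")
      case j: True
      have "(\<Sum>j=1..K. int (min K j) * int (mm \<beta> j)) = 0" using True by (simp add: M_def AI_def)
      then have "\<forall>j\<in>{1..K}. int (min K j) * int (mm \<beta> j) = 0" by (subst (asm) sum_nonneg_eq_0_iff) auto
      then show ?thesis using j by auto
    qed (use mm in \<open>auto simp: Nset_def\<close>)
    ultimately show ?thesis by (simp add: fun_eq_iff)
  next
    case False
    then obtain \<beta> where "M \<beta> \<noteq> 0" by blast
    then have "0 < M \<beta>" using M0[of \<beta>] by linarith
    then have "0 < (\<Sum>\<beta>\<in>UNIV. M \<beta>)" by (intro sum_pos2[of _ \<beta>]) (use M0 in auto)
    then have "0 < d * (\<Sum>\<beta>\<in>UNIV. M \<beta>)" using d_pos by (intro mult_pos_pos)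
    with s show ?thesis by simp
  qed
qed

lemma Msum_unit:
  shows "Msum C m (unit_n m) = 1"
    and "Msum C p (unit_n m) \<noteq> 0 \<Longrightarrow> p = m \<or> (\<Sum>\<alpha>\<in>UNIV. rho \<alpha> * int (p \<alpha>)) < (\<Sum>\<alpha>\<in>UNIV. rho \<alpha> * int (m \<alpha>))"
proof -
  have *: "\<exists>K. Max (range m) \<le> K \<and> Msum C p (unit_n m) = Nsum K (\<lambda>\<alpha>. int (p \<alpha>)) (unit_int m)" for p
  proof -
    obtain K0 where "\<And>K. K0 \<le> K \<Longrightarrow> Msum C p (unit_n m) = Nsum K (\<lambda>\<alpha>. int (p \<alpha>)) (unit_int m)"
      using Msum_eq[of "Max (range m)" "unit_n m" p] unit_n_top by blast
    then show ?thesis by (intro exI[of _ "max K0 (Max (range m))"]) auto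
  qed
  obtain K where K: "Max (range m) \<le> K" "Msum C m (unit_n m) = Nsum K (\<lambda>\<alpha>. int (m \<alpha>)) (unit_int m)" using * by blast
  have mK: "m \<alpha> \<le> K" for \<alpha> using Max_ge[of "range m" "m \<alpha>"] K by simp
  have "AI K (\<lambda>_ _. 0) \<alpha> i = 0" for \<alpha> i by (simp add: AI_def)
  then have "(\<lambda>_ _. 0) \<in> Nset K (\<lambda>\<alpha>. int (m \<alpha>)) (unit_int m)"
    by (simp add: Nset_def pI_def AI_unit[OF K(1)] mK)
  then have "Nset K (\<lambda>\<alpha>. int (m \<alpha>)) (unit_int m) = {\<lambda>_ _. 0}"
    using Nset_unit[OF K(1), of _ m] by blast
  then show "Msum C m (unit_n m) = 1" by (simp add: K(2) Nsum_def nterm_def QI_def gprod_def)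
  show "p = m \<or> (\<Sum>\<alpha>\<in>UNIV. rho \<alpha> * int (p \<alpha>)) < (\<Sum>\<alpha>\<in>UNIV. rho \<alpha> * int (m \<alpha>))"
    if nz: "Msum C p (unit_n m) \<noteq> 0"
  proof -
    obtain K where K: "Max (range m) \<le> K" "Msum C p (unit_n m) = Nsum K (\<lambda>\<alpha>. int (p \<alpha>)) (unit_int m)" using * by blast
    then have "Nset K (\<lambda>\<alpha>. int (p \<alpha>)) (unit_int m) \<noteq> {}" using nz by (auto simp: Nsum_def)
    then show ?thesis using Nset_unit[OF K(1)] by blast
  qed
qed

end

text \<open>The diagonal coefficients are known only as powers of t with rational exponent; lying in
  the image of \<open>emb\<close>, they are units of Z[t, 1/t].\<close>

lemma emb_eq_tpow:
  assumes "emb f = tpow x"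
  obtains e where "f = tpow e"
proof -
  have "f \<noteq> 0" using assms by auto
  then obtain e where e: "Poly_Mapping.lookup f e \<noteq> 0" by (metis poly_mapping_eqI lookup_zero)
  then have "Poly_Mapping.lookup (tpow x :: puiseux) (of_int e) \<noteq> 0"
    using lookup_emb[of f e] assms by simp
  then have "x = of_int e" by (auto simp: tpow_def lookup_single when_def split: if_splits)
  then have "emb f = emb (tpow e)" using assms by simp
  then show thesis using that emb_inj by blast
qed

context qrep
begin

text \<open>The vectors on which the representation is prescribed.\<close>

definition cyc :: "('r \<Rightarrow> nat) \<Rightarrow> 'v" where
  "cyc m = act v0 (Q_product C Q (Max (range m)) (unit_n m))"

lemma ket_cyc: "emb (ket sc bra p (cyc m)) =
  tpow (- of_int (Lv (Max (range m)) (unit_int m)) - (1/2) * of_int ((\<Sum>\<alpha>\<in>UNIV. int (p \<alpha>) * lam C \<alpha> \<alpha>) + G2 (Max (range m)) (unit_int m))) *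
  Msum C p (unit_n m)"
  using rep unfolding Lv_sum G2_unit[OF order_refl]
  by (simp add: cyclic_Q_representation_def cyc_def v0_def Let_def)

lemma bra_expansion:
  "finite {p. ket sc bra p v \<noteq> 0}" "v = (\<Sum>p | ket sc bra p v \<noteq> 0. sc (ket sc bra p v) (bra p))"
proof -
  let ?R = "V.representation (range bra) v"
  have e: "bra ` {p. ket sc bra p v \<noteq> 0} = {b. ?R b \<noteq> 0}"
    using V.representation_ne_zero[of "range bra" v] by (auto simp: ket_def image_iff)
  have inj: "inj_on bra S" for S using inj_bra by (rule inj_on_subset) simp
  have "finite (bra ` {p. ket sc bra p v \<noteq> 0})" unfolding e by (rule V.finite_representation)
  then show "finite {p. ket sc bra p v \<noteq> 0}" by (rule finite_imageD) (rule inj)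
  have "v = (\<Sum>b | ?R b \<noteq> 0. sc (?R b) b)"
    by (rule V.sum_nonzero_representation_eq[OF indep, symmetric]) (simp add: span_bra)
  also have "\<dots> = (\<Sum>p | ket sc bra p v \<noteq> 0. sc (ket sc bra p v) (bra p))"
    unfolding e[symmetric] by (subst sum.reindex[OF inj]) (simp add: ket_def)
  finally show "v = (\<Sum>p | ket sc bra p v \<noteq> 0. sc (ket sc bra p v) (bra p))" .
qed

text \<open>The expansion of \<open>cyc m\<close> has a unit as coefficient of \<open>bra m\<close>,
  and all other basis vectors in it have smaller \<open>rho\<close>-weight, so the system can be
  inverted by induction on this weight.\<close>

lemma bra_in_span: "bra m \<in> V.span (range cyc)"
proof (induction "nat (\<Sum>\<alpha>\<in>UNIV. rho \<alpha> * int (m \<alpha>))" arbitrary: m rule: less_induct)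
  case less
  obtain e where e: "ket sc bra m (cyc m) = tpow e"
    using ket_cyc[of m m] Msum_unit(1)[of m] by (auto elim!: emb_eq_tpow)
  let ?P = "{p. ket sc bra p (cyc m) \<noteq> 0}"
  have "bra p \<in> V.span (range cyc)" if p: "p \<in> ?P - {m}" for p
  proof (rule less.hyps)
    have "emb (ket sc bra p (cyc m)) \<noteq> 0" using p emb_inj[of _ 0] by auto
    then have "Msum C p (unit_n m) \<noteq> 0" using ket_cyc[of p m] by auto
    then have "(\<Sum>\<alpha>\<in>UNIV. rho \<alpha> * int (p \<alpha>)) < (\<Sum>\<alpha>\<in>UNIV. rho \<alpha> * int (m \<alpha>))" using Msum_unit(2) p by blast
    moreover have "0 \<le> (\<Sum>\<alpha>\<in>UNIV. rho \<alpha> * int (p \<alpha>))" using rho_pos by (intro sum_nonneg) (simp add: less_imp_le)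
    ultimately show "nat (\<Sum>\<alpha>\<in>UNIV. rho \<alpha> * int (p \<alpha>)) < nat (\<Sum>\<alpha>\<in>UNIV. rho \<alpha> * int (m \<alpha>))" by simp
  qed
  then have s: "(\<Sum>p\<in>?P - {m}. sc (ket sc bra p (cyc m)) (bra p)) \<in> V.span (range cyc)" (is "?S \<in> _")
    by (intro V.span_sum V.span_scale)
  have "m \<in> ?P" using e by simp
  have "cyc m = (\<Sum>p\<in>?P. sc (ket sc bra p (cyc m)) (bra p))" by (rule bra_expansion(2))
  also have "\<dots> = sc (tpow e) (bra m) + ?S"
    unfolding e[symmetric] by (rule sum.remove[OF bra_expansion(1) \<open>m \<in> ?P\<close>])
  finally have "cyc m - ?S = sc (tpow e) (bra m)" by (simp only: diff_eq_eq)
  moreover have "cyc m - ?S \<in> V.span (range cyc)"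
    by (rule V.span_diff[OF V.span_base s]) (rule rangeI)
  ultimately have "sc (tpow (- e)) (sc (tpow e) (bra m)) \<in> V.span (range cyc)"
    using V.span_scale by (simp only:)
  then show ?case by simp
qed

lemma span_cyc: "V.span (range cyc) = UNIV"
proof -
  have "range bra \<subseteq> V.span (range cyc)" using bra_in_span by blast
  then have "V.span (range bra) \<subseteq> V.span (range cyc)" by (rule V.span_minimal) (rule V.subspace_span)
  then show ?thesis by (simp add: span_bra top.extremum_unique)
qed

definition cl' :: "('r \<Rightarrow> nat) \<Rightarrow> rat" where
  "cl' l = cl l - (1/2) * of_int (\<Sum>\<alpha>\<in>UNIV. int (l \<alpha>) * lam C \<alpha> \<alpha>)"

lemma ket_sum:
  "finite I \<Longrightarrow> ket sc bra l (\<Sum>i\<in>I. sc (c i) (w i)) = (\<Sum>i\<in>I. c i * ket sc bra l (w i))"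
  unfolding ket_def
  by (simp add: V.representation_sum[OF indep] V.representation_scale[OF indep] span_bra)

text \<open>The functional agrees with the coordinate on the vectors \<open>cyc m\<close>, with one
  factor for all m. Since these span, the vector is expanded in them and the expansion is carried to
  the function module. The bound on \<open>K\<close> depends on the finitely many vectors
  involved.\<close>

lemma ket_Phi:
  assumes "a \<in> A"
  obtains K0 where "\<And>K. K0 \<le> K \<Longrightarrow> emb (ket sc bra l (act v0 a)) = tpow (cl' l) * emb (Phi l K (delta 0 \<triangleleft> a))"
proof -
  have base: "\<exists>K0. \<forall>K\<ge>K0. emb (ket sc bra l (cyc m)) =
     tpow (cl' l) * emb (Phi l K (delta 0 \<triangleleft> Q_product C Q (Max (range m)) (unit_n m)))" for m
  proof -
    let ?k = "Max (range m)"
    obtain K0 where K0: "\<And>K. K0 \<le> K \<Longrightarrow> Msum C l (unit_n m) =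
      tpow (cl l + of_int (Lv ?k (unit_int m)) + (1/2) * of_int (G2 ?k (unit_int m))) * emb (Phi l K (delta 0 \<triangleleft> Q_product C Q ?k (unit_n m)))"
      using Msum_Phi[of ?k "unit_n m" l] unit_n_top by blast
    show ?thesis
    proof (intro exI[of _ K0] allI impI)
      fix K assume "K0 \<le> K"
      show "emb (ket sc bra l (cyc m)) = tpow (cl' l) * emb (Phi l K (delta 0 \<triangleleft> Q_product C Q ?k (unit_n m)))"
        unfolding ket_cyc K0[OF \<open>K0 \<le> K\<close>] mult.assoc[symmetric] tpow_mult
        by (simp add: cl'_def field_simps)
    qed
  qed
  have "act v0 a \<in> V.span (range cyc)" by (simp add: span_cyc)
  then obtain t r where t: "finite t" "t \<subseteq> range cyc" "act v0 a = (\<Sum>b\<in>t. sc (r b) b)"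
    unfolding V.span_explicit by blast
  define mm where "mm b = (SOME m. cyc m = b)" for b
  have mm: "cyc (mm b) = b" if "b \<in> t" for b
    unfolding mm_def by (rule someI_ex[of "\<lambda>m. cyc m = b"]) (use that t(2) in \<open>blast elim: rangeE\<close>)
  define f where "f b = Q_product C Q (Max (range (mm b))) (unit_n (mm b))" for b
  have f: "act v0 (f b) = b" if "b \<in> t" for b using mm[OF that] by (simp add: f_def cyc_def)
  have fA: "f b \<in> A" for b unfolding f_def by (rule A_Q_product)
  have ra: "delta 0 \<triangleleft> a = (\<lambda>x. \<Sum>b\<in>t. r b * (delta 0 \<triangleleft> f b) x)"
    by (rule ract_of_act) (simp_all add: assms fA t(3) f)
  have "\<forall>b. \<exists>K0. \<forall>K\<ge>K0. b \<in> t \<longrightarrow> emb (ket sc bra l b) = tpow (cl' l) * emb (Phi l K (delta 0 \<triangleleft> f b))"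
    using base mm unfolding f_def by metis
  then obtain K0 where K0: "\<And>b K. K0 b \<le> K \<Longrightarrow> b \<in> t \<Longrightarrow> emb (ket sc bra l b) = tpow (cl' l) * emb (Phi l K (delta 0 \<triangleleft> f b))"
    by metis
  show thesis
  proof (rule that[of "\<Sum>b\<in>t. K0 b"])
    fix K assume K: "(\<Sum>b\<in>t. K0 b) \<le> K"
    have K0K: "K0 b \<le> K" if "b \<in> t" for b
      using member_le_sum[of b t K0] that t(1) K by simp
    have "emb (ket sc bra l (act v0 a)) = (\<Sum>b\<in>t. emb (r b) * emb (ket sc bra l b))"
      unfolding t(3) ket_sum[OF t(1)] by (simp add: emb_sum emb_mult)
    also have "\<dots> = (\<Sum>b\<in>t. emb (r b) * (tpow (cl' l) * emb (Phi l K (delta 0 \<triangleleft> f b))))"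
      by (intro sum.cong refl) (simp add: K0[OF K0K])
    also have "\<dots> = tpow (cl' l) * emb (\<Sum>b\<in>t. r b * Phi l K (delta 0 \<triangleleft> f b))"
      by (simp add: emb_sum emb_mult sum_distrib_left mult.left_commute)
    also have "(\<Sum>b\<in>t. r b * Phi l K (delta 0 \<triangleleft> f b)) = Phi l K (delta 0 \<triangleleft> a)"
      unfolding ra by (rule Phi_sum[symmetric]) simp
    finally show "emb (ket sc bra l (act v0 a)) = tpow (cl' l) * emb (Phi l K (delta 0 \<triangleleft> a))" .
  qed
qed

text \<open>At a common large \<open>K\<close> the same value of \<open>Phi\<close> occurs in the
  formula for \<open>Msum\<close> and in the one for the coordinate; comparing them leaves only
  powers of t.\<close>

lemma Msum_ket:
  assumes n: "\<And>\<alpha> i. k < i \<Longrightarrow> n \<alpha> i = 0"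
  shows "Msum C l n = tpow (of_int (Lv k (\<lambda>\<alpha> i. int (n \<alpha> i))) +
     (1/2) * of_int ((\<Sum>\<alpha>\<in>UNIV. int (l \<alpha>) * lam C \<alpha> \<alpha>) + G2 k (\<lambda>\<alpha> i. int (n \<alpha> i)))) *
     emb (ket sc bra l (act v0 (Q_product C Q k n)))"
proof -
  obtain K1 where K1: "\<And>K. K1 \<le> K \<Longrightarrow> emb (ket sc bra l (act v0 (Q_product C Q k n))) =
      tpow (cl' l) * emb (Phi l K (delta 0 \<triangleleft> Q_product C Q k n))"
    using ket_Phi[OF A_Q_product] by blast
  obtain K0 where K0: "\<And>K. K0 \<le> K \<Longrightarrow> Msum C l n =
    tpow (cl l + of_int (Lv k (\<lambda>\<alpha> i. int (n \<alpha> i))) + (1/2) * of_int (G2 k (\<lambda>\<alpha> i. int (n \<alpha> i)))) *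
    emb (Phi l K (delta 0 \<triangleleft> Q_product C Q k n))"
    using Msum_Phi[of k n l] n by blast
  show ?thesis
    unfolding K1[OF max.cobounded1[of K1 K0]] K0[OF max.cobounded2[of K0 K1]] mult.assoc[symmetric] tpow_mult
    by (simp add: cl'_def field_simps)
qed

end

theorem theorem5p26:
  fixes C :: "'r::{finite,linorder} sqmat"
    and Q :: "'r \<Rightarrow> int \<Rightarrow> 'r qt"
    and sc :: "laurent \<Rightarrow> 'v \<Rightarrow> 'v::ab_group_add"
    and act :: "'v \<Rightarrow> 'r qt \<Rightarrow> 'v"
    and bra :: "('r \<Rightarrow> nat) \<Rightarrow> 'v"
    and l :: "'r \<Rightarrow> nat" and n :: "'r \<Rightarrow> nat \<Rightarrow> nat" and k :: nat
  assumes "simply_laced_cartan_matrix C"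
    and "quantum_Q_system C Q"
    and "cyclic_Q_representation C Q sc act bra"
    and "\<forall>\<alpha> i. i > k \<longrightarrow> n \<alpha> i = 0"
  shows "Msum C l n =
    qpow C (- (1 / of_int (det C)) * of_int (\<Sum>\<alpha>\<in>UNIV. \<Sum>\<beta>\<in>UNIV. \<Sum>i=1..k. int (n \<alpha> i) * lam C \<alpha> \<beta>)
            - (1 / (2 * of_int (det C))) * of_int ((\<Sum>\<alpha>\<in>UNIV. int (l \<alpha>) * lam C \<alpha> \<alpha>)
                + (\<Sum>\<alpha>\<in>UNIV. \<Sum>\<beta>\<in>UNIV. \<Sum>i=1..k. \<Sum>j=1..k.
                     int (n \<alpha> i) * (lam C \<alpha> \<beta> * int (min i j)) * int (n \<beta> j))))
    * emb (ket sc bra l (act (bra (\<lambda>_. 0)) (Q_product C Q k n)))"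
proof -
  interpret qrep C Q sc act bra
    by unfold_locales (rule assms(1-3))+
  \<comment> \<open>Passing from q to t multiplies exponents by \<open>- d\<close>, which cancels
    the denominators.\<close>
  have d: "- of_int d * (- (1 / of_int d) * x - (1 / (2 * of_int d)) * y) = x + (1/2) * y" for x y :: rat
    using d_pos by (simp add: field_simps)
  show ?thesis
    unfolding qpow_def d
    by (rule Msum_ket[unfolded v0_def Lv_sum G2_sum]) (simp add: assms(4))
qed

end
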